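(* There is a c.c.c. poset such that in its generic extensions $\neg\mathrm{CH}$ holds and there are continuum many (i.e. $2^\omega$ many) distinct proper families of reals of size $\omega_1$.
   Context: A family of reals $\mathfrak{X}\subseteq\mathcal{P}(\mathbb{N})$ is proper if it is arithmetically closed (contains every set arithmetically definable from any of its members) and the poset $\mathfrak{X}/\mathrm{Fin}$ — the infinite members of $\mathfrak{X}$ ordered by almost inclusion ($A\leq B$ iff $A\setminus B$ finite) — is a proper poset in the sense of Shelah. *)

theory Defs
  imports Main
begin

(* Forcing is rendered through standard models: HOL has no universe of sets, so a transitive model
   is given, up to its Mostowski collapse, by a well-founded relation E on a type, "E x y" being
   "x is an element of y".  The notions below are those of set theory as computed inside (UNIV, E):
   the quantifiers over sets range over the type, so a function, bijection, antichain, ... of the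
   model is always an element of the model.  Countability of the model, which guarantees that
   generic filters exist, is not needed to state anything and is not assumed. *)

section \<open>First-order set theory\<close>

datatype fm = FMem nat nat | FEq nat nat | FNeg fm | FConj fm fm | FAll nat fm

fun sat :: "'a set \<Rightarrow> ('a \<Rightarrow> 'a \<Rightarrow> bool) \<Rightarrow> (nat \<Rightarrow> 'a) \<Rightarrow> fm \<Rightarrow> bool" where
  "sat D E s (FMem i j) \<longleftrightarrow> E (s i) (s j)"
| "sat D E s (FEq i j) \<longleftrightarrow> s i = s j"
| "sat D E s (FNeg \<phi>) \<longleftrightarrow> \<not> sat D E s \<phi>"
| "sat D E s (FConj \<phi> \<psi>) \<longleftrightarrow> sat D E s \<phi> \<and> sat D E s \<psi>"
| "sat D E s (FAll i \<phi>) \<longleftrightarrow> (\<forall>x\<in>D. sat D E (s(i := x)) \<phi>)"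

definition elementary_in :: "('a \<Rightarrow> 'a \<Rightarrow> bool) \<Rightarrow> 'a set \<Rightarrow> 'a set \<Rightarrow> bool" where
  "elementary_in E A B \<longleftrightarrow>
     A \<subseteq> B \<and> (\<forall>\<phi> s. range s \<subseteq> A \<longrightarrow> (sat A E s \<phi> \<longleftrightarrow> sat B E s \<phi>))"

definition elts :: "('a \<Rightarrow> 'a \<Rightarrow> bool) \<Rightarrow> 'a \<Rightarrow> 'a set" where
  "elts E x = {y. E y x}"

definition extensional_rel :: "('a \<Rightarrow> 'a \<Rightarrow> bool) \<Rightarrow> bool" where
  "extensional_rel E \<longleftrightarrow> (\<forall>x y. elts E x = elts E y \<longrightarrow> x = y)"

(* Separation and replacement are the first-order schemas; the assignment s supplies the
   parameters. *)
definition ZFC :: "('a \<Rightarrow> 'a \<Rightarrow> bool) \<Rightarrow> bool" where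
  "ZFC E \<longleftrightarrow>
     extensional_rel E \<and>
     (\<forall>x. elts E x \<noteq> {} \<longrightarrow> (\<exists>y\<in>elts E x. elts E y \<inter> elts E x = {})) \<and>
     (\<forall>x y. \<exists>z. elts E z = {x, y}) \<and>
     (\<forall>x. \<exists>u. elts E u = (\<Union>y\<in>elts E x. elts E y)) \<and>
     (\<forall>x. \<exists>p. elts E p = {y. elts E y \<subseteq> elts E x}) \<and>
     (\<exists>w. (\<exists>e\<in>elts E w. elts E e = {}) \<and>
          (\<forall>x\<in>elts E w. \<exists>y\<in>elts E w. elts E y = insert x (elts E x))) \<and>
     (\<forall>\<phi> s a. \<exists>b. elts E b = {x \<in> elts E a. sat UNIV E (s(0 := x)) \<phi>}) \<and>
     (\<forall>\<phi> s a. (\<forall>x\<in>elts E a. \<exists>!y. sat UNIV E (s(0 := x, 1 := y)) \<phi>) \<longrightarrow>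
          (\<exists>b. elts E b = {y. \<exists>x\<in>elts E a. sat UNIV E (s(0 := x, 1 := y)) \<phi>})) \<and>
     (\<forall>a. (\<forall>x\<in>elts E a. elts E x \<noteq> {}) \<and>
          (\<forall>x\<in>elts E a. \<forall>y\<in>elts E a. x \<noteq> y \<longrightarrow> elts E x \<inter> elts E y = {}) \<longrightarrow>
          (\<exists>c. \<forall>x\<in>elts E a. \<exists>!y. y \<in> elts E x \<inter> elts E c))"

section \<open>Cardinals inside a model\<close>

definition is_pair :: "('a \<Rightarrow> 'a \<Rightarrow> bool) \<Rightarrow> 'a \<Rightarrow> 'a \<Rightarrow> 'a \<Rightarrow> bool" where
  "is_pair E a b z \<longleftrightarrow>
     (\<exists>c d. elts E c = {a} \<and> elts E d = {a, b} \<and> elts E z = {c, d})"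

definition rel_of :: "('a \<Rightarrow> 'a \<Rightarrow> bool) \<Rightarrow> 'a \<Rightarrow> ('a \<times> 'a) set" where
  "rel_of E r = {(a, b). \<exists>z\<in>elts E r. is_pair E a b z}"

definition is_fun :: "('a \<Rightarrow> 'a \<Rightarrow> bool) \<Rightarrow> 'a \<Rightarrow> 'a \<Rightarrow> ('a \<Rightarrow> 'a) \<Rightarrow> bool" where
  "is_fun E a f h \<longleftrightarrow> rel_of E f = {(x, h x) | x. x \<in> elts E a}"

definition lepoll_in :: "('a \<Rightarrow> 'a \<Rightarrow> bool) \<Rightarrow> 'a \<Rightarrow> 'a \<Rightarrow> bool" where
  "lepoll_in E a b \<longleftrightarrow>
     (\<exists>f h. is_fun E a f h \<and> inj_on h (elts E a) \<and> h ` elts E a \<subseteq> elts E b)"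

definition eqpoll_in :: "('a \<Rightarrow> 'a \<Rightarrow> bool) \<Rightarrow> 'a \<Rightarrow> 'a \<Rightarrow> bool" where
  "eqpoll_in E a b \<longleftrightarrow> (\<exists>f h. is_fun E a f h \<and> bij_betw h (elts E a) (elts E b))"

definition lesspoll_in :: "('a \<Rightarrow> 'a \<Rightarrow> bool) \<Rightarrow> 'a \<Rightarrow> 'a \<Rightarrow> bool" where
  "lesspoll_in E a b \<longleftrightarrow> lepoll_in E a b \<and> \<not> lepoll_in E b a"

fun is_numeral :: "('a \<Rightarrow> 'a \<Rightarrow> bool) \<Rightarrow> nat \<Rightarrow> 'a \<Rightarrow> bool" where
  "is_numeral E 0 x \<longleftrightarrow> elts E x = {}"
| "is_numeral E (Suc n) x \<longleftrightarrow> (\<exists>y. is_numeral E n y \<and> elts E x = insert y (elts E y))"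

(* A well-founded model of ZFC has no nonstandard natural numbers, so its omega consists of the
   von Neumann numerals of the elements of nat. *)
definition is_omega :: "('a \<Rightarrow> 'a \<Rightarrow> bool) \<Rightarrow> 'a \<Rightarrow> bool" where
  "is_omega E w \<longleftrightarrow> elts E w = {x. \<exists>n. is_numeral E n x}"

definition is_Pow :: "('a \<Rightarrow> 'a \<Rightarrow> bool) \<Rightarrow> 'a \<Rightarrow> 'a \<Rightarrow> bool" where
  "is_Pow E a p \<longleftrightarrow> elts E p = {x. elts E x \<subseteq> elts E a}"

definition is_continuum :: "('a \<Rightarrow> 'a \<Rightarrow> bool) \<Rightarrow> 'a \<Rightarrow> bool" where
  "is_continuum E c \<longleftrightarrow> (\<exists>w. is_omega E w \<and> is_Pow E w c)"

definition countable_in :: "('a \<Rightarrow> 'a \<Rightarrow> bool) \<Rightarrow> 'a \<Rightarrow> bool" where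
  "countable_in E a \<longleftrightarrow> (\<exists>w. is_omega E w \<and> lepoll_in E a w)"

definition transitive_in :: "('a \<Rightarrow> 'a \<Rightarrow> bool) \<Rightarrow> 'a \<Rightarrow> bool" where
  "transitive_in E t \<longleftrightarrow> (\<forall>x\<in>elts E t. elts E x \<subseteq> elts E t)"

definition is_ordinal :: "('a \<Rightarrow> 'a \<Rightarrow> bool) \<Rightarrow> 'a \<Rightarrow> bool" where
  "is_ordinal E a \<longleftrightarrow> transitive_in E a \<and> (\<forall>x\<in>elts E a. transitive_in E x)"

definition is_cardinal :: "('a \<Rightarrow> 'a \<Rightarrow> bool) \<Rightarrow> 'a \<Rightarrow> bool" where
  "is_cardinal E k \<longleftrightarrow> is_ordinal E k \<and> (\<forall>a\<in>elts E k. \<not> eqpoll_in E a k)"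

definition is_omega1 :: "('a \<Rightarrow> 'a \<Rightarrow> bool) \<Rightarrow> 'a \<Rightarrow> bool" where
  "is_omega1 E k \<longleftrightarrow>
     is_ordinal E k \<and> \<not> countable_in E k \<and> (\<forall>a\<in>elts E k. countable_in E a)"

definition size_omega1 :: "('a \<Rightarrow> 'a \<Rightarrow> bool) \<Rightarrow> 'a \<Rightarrow> bool" where
  "size_omega1 E x \<longleftrightarrow> (\<exists>k. is_omega1 E k \<and> eqpoll_in E x k)"

definition CH :: "('a \<Rightarrow> 'a \<Rightarrow> bool) \<Rightarrow> bool" where
  "CH E \<longleftrightarrow> (\<exists>c. is_continuum E c \<and> size_omega1 E c)"

definition uncountable_regular :: "('a \<Rightarrow> 'a \<Rightarrow> bool) \<Rightarrow> 'a \<Rightarrow> bool" where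
  "uncountable_regular E k \<longleftrightarrow>
     is_cardinal E k \<and> \<not> countable_in E k \<and>
     (\<forall>a\<in>elts E k. \<forall>f h. is_fun E a f h \<and> h ` elts E a \<subseteq> elts E k \<longrightarrow>
        (\<exists>b\<in>elts E k. h ` elts E a \<subseteq> elts E b))"

(* H(k): the sets whose transitive closure has size less than k. *)
definition H_of :: "('a \<Rightarrow> 'a \<Rightarrow> bool) \<Rightarrow> 'a \<Rightarrow> 'a set" where
  "H_of E k = {x. \<exists>t. transitive_in E t \<and> elts E x \<subseteq> elts E t \<and> lesspoll_in E t k}"

section \<open>Posets and generic extensions\<close>

(* Smaller conditions are stronger; (p, q) \<in> r means "p \<le> q". *)

definition compatible :: "'a set \<Rightarrow> ('a \<times> 'a) set \<Rightarrow> 'a \<Rightarrow> 'a \<Rightarrow> bool" where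
  "compatible A r p q \<longleftrightarrow> (\<exists>z\<in>A. (z, p) \<in> r \<and> (z, q) \<in> r)"

definition dense_in :: "'a set \<Rightarrow> ('a \<times> 'a) set \<Rightarrow> 'a set \<Rightarrow> bool" where
  "dense_in A r D \<longleftrightarrow> D \<subseteq> A \<and> (\<forall>p\<in>A. \<exists>d\<in>D. (d, p) \<in> r)"

definition is_poset :: "('a \<Rightarrow> 'a \<Rightarrow> bool) \<Rightarrow> 'a \<Rightarrow> 'a \<Rightarrow> bool" where
  "is_poset E P R \<longleftrightarrow> elts E P \<noteq> {} \<and> partial_order_on (elts E P) (rel_of E R)"

definition ccc :: "('a \<Rightarrow> 'a \<Rightarrow> bool) \<Rightarrow> 'a \<Rightarrow> 'a \<Rightarrow> bool" where
  "ccc E P R \<longleftrightarrow>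
     (\<forall>A. elts E A \<subseteq> elts E P \<and>
          (\<forall>p\<in>elts E A. \<forall>q\<in>elts E A. p \<noteq> q \<longrightarrow> \<not> compatible (elts E P) (rel_of E R) p q) \<longrightarrow>
          countable_in E A)"

(* G, a set of conditions in the metatheory, is a filter meeting every dense set of the model. *)
definition generic_filter :: "('a \<Rightarrow> 'a \<Rightarrow> bool) \<Rightarrow> 'a \<Rightarrow> 'a \<Rightarrow> 'a set \<Rightarrow> bool" where
  "generic_filter E P R G \<longleftrightarrow>
     G \<subseteq> elts E P \<and> G \<noteq> {} \<and>
     (\<forall>p\<in>G. \<forall>q\<in>elts E P. (p, q) \<in> rel_of E R \<longrightarrow> q \<in> G) \<and>
     (\<forall>p\<in>G. \<forall>q\<in>G. \<exists>z\<in>G. (z, p) \<in> rel_of E R \<and> (z, q) \<in> rel_of E R) \<and>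
     (\<forall>D. dense_in (elts E P) (rel_of E R) (elts E D) \<longrightarrow> elts E D \<inter> G \<noteq> {})"

(* F is (isomorphic to) the membership relation of the generic extension E[G], the values of all
   names: val t = {val s | (s, p) \<in> t for some p \<in> G}.  Every element of the ground model is
   treated as a name, elements that are not pairs (s, p) with p a condition being ignored.  As E is
   well-founded, these requirements determine F up to isomorphism.  The extension has as many
   elements as the ground model, hence it can be taken on the same type. *)
definition generic_extension ::
  "('a \<Rightarrow> 'a \<Rightarrow> bool) \<Rightarrow> 'a set \<Rightarrow> ('a \<Rightarrow> 'a \<Rightarrow> bool) \<Rightarrow> bool" where
  "generic_extension E G F \<longleftrightarrow>
     extensional_rel F \<and>
     (\<exists>val. surj val \<and> (\<forall>t. elts F (val t) = {val s | s. \<exists>p\<in>G. (s, p) \<in> rel_of E t}))"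

(* Properness in the sense of Shelah: for every regular k > 2^|P| and every countable elementary
   submodel X of H(k) containing the poset, each condition in X has an (X, P)-generic extension q,
   i.e. D \<inter> X is predense below q for all dense D in X. *)
definition proper_poset :: "('a \<Rightarrow> 'a \<Rightarrow> bool) \<Rightarrow> 'a \<Rightarrow> 'a \<Rightarrow> bool" where
  "proper_poset E P R \<longleftrightarrow>
     (\<forall>k X. uncountable_regular E k \<and> (\<exists>pw. is_Pow E P pw \<and> lesspoll_in E pw k) \<and>
        countable_in E X \<and> elementary_in E (elts E X) (H_of E k) \<and> E P X \<and> E R X \<longrightarrow>
        (\<forall>p\<in>elts E P \<inter> elts E X. \<exists>q\<in>elts E P. (q, p) \<in> rel_of E R \<and>
           (\<forall>D\<in>elts E X. dense_in (elts E P) (rel_of E R) (elts E D) \<longrightarrow>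
              (\<forall>z\<in>elts E P. (z, q) \<in> rel_of E R \<longrightarrow>
                 (\<exists>d\<in>elts E D \<inter> elts E X. compatible (elts E P) (rel_of E R) d z)))))"

section \<open>Proper families of reals\<close>

(* Formulas of first-order arithmetic with additional set variables: AIn i j is "x_i \<in> X_j". *)
datatype arith = AEq nat nat | APlus nat nat nat | ATimes nat nat nat | AIn nat nat
  | ANeg arith | AConj arith arith | AAll nat arith

fun arith_sat :: "(nat \<Rightarrow> nat set) \<Rightarrow> (nat \<Rightarrow> nat) \<Rightarrow> arith \<Rightarrow> bool" where
  "arith_sat S e (AEq i j) \<longleftrightarrow> e i = e j"
| "arith_sat S e (APlus i j k) \<longleftrightarrow> e i + e j = e k"
| "arith_sat S e (ATimes i j k) \<longleftrightarrow> e i * e j = e k"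
| "arith_sat S e (AIn i j) \<longleftrightarrow> e i \<in> S j"
| "arith_sat S e (ANeg \<phi>) \<longleftrightarrow> \<not> arith_sat S e \<phi>"
| "arith_sat S e (AConj \<phi> \<psi>) \<longleftrightarrow> arith_sat S e \<phi> \<and> arith_sat S e \<psi>"
| "arith_sat S e (AAll i \<phi>) \<longleftrightarrow> (\<forall>n. arith_sat S (e(i := n)) \<phi>)"

definition real_of :: "('a \<Rightarrow> 'a \<Rightarrow> bool) \<Rightarrow> 'a \<Rightarrow> nat set" where
  "real_of E A = {n. \<exists>x\<in>elts E A. is_numeral E n x}"

definition family_of_reals :: "('a \<Rightarrow> 'a \<Rightarrow> bool) \<Rightarrow> 'a \<Rightarrow> bool" where
  "family_of_reals E Z \<longleftrightarrow> (\<forall>A\<in>elts E Z. \<forall>x\<in>elts E A. \<exists>n. is_numeral E n x)"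

(* Closed under arithmetic definability from finitely many members (a formula mentions only
   finitely many set variables). *)
definition arithmetically_closed :: "('a \<Rightarrow> 'a \<Rightarrow> bool) \<Rightarrow> 'a \<Rightarrow> bool" where
  "arithmetically_closed E Z \<longleftrightarrow>
     (\<forall>\<phi> S e. range S \<subseteq> real_of E ` elts E Z \<longrightarrow>
        {n. arith_sat S (e(0 := n)) \<phi>} \<in> real_of E ` elts E Z)"

definition is_mod_Fin :: "('a \<Rightarrow> 'a \<Rightarrow> bool) \<Rightarrow> 'a \<Rightarrow> 'a \<Rightarrow> 'a \<Rightarrow> bool" where
  "is_mod_Fin E Z P R \<longleftrightarrow>
     elts E P = {A \<in> elts E Z. infinite (real_of E A)} \<and>
     elts E R = {z. \<exists>A\<in>elts E P. \<exists>B\<in>elts E P.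
                   finite (real_of E A - real_of E B) \<and> is_pair E A B z}"

definition proper_family :: "('a \<Rightarrow> 'a \<Rightarrow> bool) \<Rightarrow> 'a \<Rightarrow> bool" where
  "proper_family E Z \<longleftrightarrow>
     family_of_reals E Z \<and> arithmetically_closed E Z \<and>
     (\<exists>P R. is_mod_Fin E Z P R \<and> proper_poset E P R)"

end

(* The poset is P = Fn(L, 2), the finite partial functions from L to 2, where L contains all subsets
   of omega_1 x omega and is closed under countable subsets; it is c.c.c.  For l in L the l-th block
   G_l of the generic filter (the coordinates (l, x)) is generic for P itself.  In the ground model
   fix an increasing chain Y_a (a < omega_1) of countable sets of nice names of reals, each one
   closed under names for the arithmetical operations, and such that for b < a and N in Y_a the
   following are named in Y_a: the Cohen real c_b of the block of coordinates labelled Y_b, and a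
   pseudo-intersection q_b(N) below N that this Cohen real builds from the reals named in Y_b.  The
   family Z_l consists of the values at G_l of all the names in the union of the chain.

   The label Y_a does not occur in the names in Y_a, so c_a splits all the reals named in Y_a.
   Hence Z_l has size omega_1, Z_l and Z_l' differ for l \<noteq> l', and L injects into the continuum,
   which refutes CH because omega_1 still does not cover the subsets of omega_1 x omega.  Indexing
   by the least nice name of each real gives exactly continuum many families.

   Properness: let A_a be the set of infinite reals named in Y_a.  For a dense D there are, by
   c.c.c., club many a such that D restricted to A_a is dense in A_a and computed without the block
   labelled Y_a, so that q_a(N) is almost contained in a member of D that belongs to A_a.  For a
   countable elementary X the trace of X on the poset is some A_a with a in all the clubs that
   belong to X, so q_a(N) is even below some member of D in X, for every dense D in X.

   Truth in the extension is handled without a forcing relation: a predicate is admissible (Frc) if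
   it holds exactly when some condition in G satisfies a relation definable in the ground model.
   By density and definability these predicates are closed under all first-order operations. *)

theory Submission
  imports Defs "HOL-Library.Nat_Bijection" "HOL-Library.Infinite_Set"
begin

section \<open>Definability with parameters\<close>

text \<open>The model is seen from outside only, so every set built in it must come with a
  first-order definition. The calculus \<open>df\<close>, \<open>tm\<close> and its forcing analogue
  \<open>Frc\<close> read these definitions off the shape of HOL terms; in the extension, witnesses
  are values of names supplied mainly by \<open>Fname\<close>.

  The labels are the sets \<open>Yc \<alpha>\<close> themselves rather than the ordinals \<alpha>:
  the closure would turn an occurrence of the label \<open>Yc \<alpha>\<close> in a name in
  \<open>Yc \<alpha>\<close> into \<open>Yc \<alpha>\<close> being an element of itself, against
  foundation. The price is a coordinate set that contains the names built over it, hence the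
  recursion of length \<omega>_1 that produces \<open>L\<close>. In return nice names are elements
  of \<open>L\<close> and can index the families directly.

  The same names are evaluated at all blocks G_l. For this reason the operations on names
  (\<open>isog\<close>) have to be correct for every generic filter on \<open>Fn L\<close> at once.

  The pseudo-intersection is built along an enumeration of \<open>Yc \<alpha>\<close> in which each
  name recurs infinitely often. A finite part of the Cohen real, which has already committed itself
  on finitely many indices, can therefore still propose any given name.\<close>

definition scons :: "'a \<Rightarrow> (nat \<Rightarrow> 'a) \<Rightarrow> nat \<Rightarrow> 'a" (infixr "##" 65) where
  "(x ## s) n = (case n of 0 \<Rightarrow> x | Suc m \<Rightarrow> s m)"

lemma scons_0 [simp]: "(x ## s) 0 = x"
  and scons_Suc [simp]: "(x ## s) (Suc n) = s n"
  by (simp_all add: scons_def)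

lemma scons_range: "x \<in> D \<Longrightarrow> range s \<subseteq> D \<Longrightarrow> range (x ## s) \<subseteq> D"
  by (auto simp: scons_def image_subset_iff split: nat.split)

primrec ren :: "(nat \<Rightarrow> nat) \<Rightarrow> fm \<Rightarrow> fm" where
  "ren f (FMem i j) = FMem (f i) (f j)"
| "ren f (FEq i j) = FEq (f i) (f j)"
| "ren f (FNeg \<phi>) = FNeg (ren f \<phi>)"
| "ren f (FConj \<phi> \<psi>) = FConj (ren f \<phi>) (ren f \<psi>)"
| "ren f (FAll i \<phi>) = FAll (f i) (ren f \<phi>)"

text \<open>Bound variables are renamed by the same map, so injectivity alone rules out
  capture.\<close>

lemma sat_ren: "inj f \<Longrightarrow> sat D E s (ren f \<phi>) = sat D E (\<lambda>n. s (f n)) \<phi>"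
proof (induction \<phi> arbitrary: s)
  case (FAll i \<phi>)
  have "(\<lambda>n. (s(f i := x)) (f n)) = (\<lambda>n. s (f n))(i := x)" for x
    using FAll.prems by (auto simp: fun_eq_iff inj_eq)
  then show ?case using FAll by (simp del: fun_upd_apply)
qed auto

definition mix :: "(nat \<Rightarrow> 'a) \<Rightarrow> (nat \<Rightarrow> 'a) \<Rightarrow> nat \<Rightarrow> 'a" where
  "mix s c n = (if even n then s (n div 2) else c (n div 2))"

(* Even variables of the formula carry the environment, odd ones carry parameters from C. *)
definition df :: "'a set \<Rightarrow> 'a set \<Rightarrow> ('a \<Rightarrow> 'a \<Rightarrow> bool) \<Rightarrow> ((nat \<Rightarrow> 'a) \<Rightarrow> bool) \<Rightarrow> bool" where
  "df C D E Pr \<longleftrightarrow> (\<exists>\<phi> c. range c \<subseteq> C \<and>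
     (\<forall>s. range s \<subseteq> D \<longrightarrow> (Pr s \<longleftrightarrow> sat D E (mix s c) \<phi>)))"

text \<open>An operation is definable through its graph, with the value in variable 0 and the
  environment shifted by one. Closure of \<open>D\<close> is demanded because a term is substituted
  by quantifying over its value in \<open>D\<close>.\<close>

definition tm :: "'a set \<Rightarrow> 'a set \<Rightarrow> ('a \<Rightarrow> 'a \<Rightarrow> bool) \<Rightarrow> ((nat \<Rightarrow> 'a) \<Rightarrow> 'a) \<Rightarrow> bool" where
  "tm C D E t \<longleftrightarrow> (\<forall>s. range s \<subseteq> D \<longrightarrow> t s \<in> D) \<and> df C D E (\<lambda>s. s 0 = t (\<lambda>n. s (Suc n)))"

lemma df_rename:
  assumes "df C D E Pr" "inj f"
  shows "df C D E (\<lambda>s. Pr (\<lambda>n. s (f n)))"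
proof -
  obtain \<phi> c where c: "range c \<subseteq> C" and
    \<phi>: "\<And>s. range s \<subseteq> D \<Longrightarrow> Pr s \<longleftrightarrow> sat D E (mix s c) \<phi>"
    using assms(1) unfolding df_def by blast
  define g where "g n = (if even n then 2 * f (n div 2) else n)" for n
  have "inj g" unfolding inj_def g_def using assms(2)[THEN inj_eq]
    by auto
  moreover have "(\<lambda>n. mix s c (g n)) = mix (\<lambda>n. s (f n)) c" for s
    by (auto simp: mix_def g_def fun_eq_iff)
  ultimately have "Pr (\<lambda>n. s (f n)) \<longleftrightarrow> sat D E (mix s c) (ren g \<phi>)" if "range s \<subseteq> D" for s
    using that \<phi>[of "\<lambda>n. s (f n)"] by (simp add: sat_ren image_subset_iff)
  then show ?thesis unfolding df_def using c by blast
qed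

lemma df_conj:
  assumes "df C D E P" "df C D E Q"
  shows "df C D E (\<lambda>s. P s \<and> Q s)"
proof -
  obtain \<phi> c where c: "range c \<subseteq> C" and
    \<phi>: "\<And>s. range s \<subseteq> D \<Longrightarrow> P s \<longleftrightarrow> sat D E (mix s c) \<phi>"
    using assms(1) unfolding df_def by blast
  obtain \<psi> d where d: "range d \<subseteq> C" and
    \<psi>: "\<And>s. range s \<subseteq> D \<Longrightarrow> Q s \<longleftrightarrow> sat D E (mix s d) \<psi>"
    using assms(2) unfolding df_def by blast
  \<comment> \<open>The two parameter lists share the odd variables: entry k of \<open>c\<close>
    moves to variable 4k + 1 and entry k of \<open>d\<close> to variable 4k + 3.\<close>
  define g where "g n = (if even n then n else 2 * (n - 1) + 1)" for n :: nat
  define h where "h n = (if even n then n else 2 * n + 1)" for n :: nat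
  have inj: "inj g" "inj h" unfolding g_def h_def
    by (rule injI; auto elim!: evenE oddE split: if_splits; presburger)+
  have "(\<lambda>n. mix s (mix c d) (g n)) = mix s c" "(\<lambda>n. mix s (mix c d) (h n)) = mix s d" for s
    by (auto simp: mix_def g_def h_def fun_eq_iff elim!: oddE)
  then have "P s \<and> Q s \<longleftrightarrow> sat D E (mix s (mix c d)) (FConj (ren g \<phi>) (ren h \<psi>))"
    if "range s \<subseteq> D" for s
    using that \<phi>[of s] \<psi>[of s] inj by (simp add: sat_ren)
  moreover have "range (mix c d) \<subseteq> C" using c d by (auto simp: mix_def)
  ultimately show ?thesis unfolding df_def by blast
qed

lemma df_not: "df C D E P \<Longrightarrow> df C D E (\<lambda>s. \<not> P s)"
  unfolding df_def by (metis sat.simps(3))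

lemma df_ball_D:
  assumes "df C D E (\<lambda>s. P (\<lambda>n. s (Suc n)) (s 0))"
  shows "df C D E (\<lambda>s. \<forall>x\<in>D. P s x)"
proof -
  obtain \<phi> c where c: "range c \<subseteq> C" and
    \<phi>: "\<And>s. range s \<subseteq> D \<Longrightarrow> P (\<lambda>n. s (Suc n)) (s 0) \<longleftrightarrow> sat D E (mix s c) \<phi>"
    using assms unfolding df_def by blast
  \<comment> \<open>The variable to be bound leaves environment slot 0 for the odd variable 1; the
    environment moves down one slot and the parameters move up one. The entry \<open>c' 0\<close> is
    a filler, since variable 1 is the bound one.\<close>
  define g where "g n = (if n = 0 then 1 else if even n then n - 2 else n + 2)" for n :: nat
  define c' where "c' n = c (n - 1)" for n :: nat
  have inj: "inj g" unfolding g_def by (rule injI) (auto elim!: evenE oddE split: if_splits; presburger)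
  have eq: "(\<lambda>n. ((mix s c')(Suc 0 := x)) (g n)) = mix (x ## s) c" for s x
  proof
    fix n show "((mix s c')(Suc 0 := x)) (g n) = mix (x ## s) c n"
    proof (cases "even n")
      case True then show ?thesis
        by (cases n) (auto simp: mix_def g_def c'_def elim!: evenE oddE split: nat.split, (metis Suc_diff_Suc Suc_eq_plus1 diff_Suc_1 even_Suc_div_two even_two_times_div_two scons_Suc)?)
    next
      case False then show ?thesis
        by (auto simp: mix_def g_def c'_def elim!: oddE)
    qed
  qed
  have "(\<forall>x\<in>D. P s x) \<longleftrightarrow> sat D E (mix s c') (FAll 1 (ren g \<phi>))" if "range s \<subseteq> D" for s
    using \<phi>[OF scons_range[OF _ that]] inj by (simp add: sat_ren eq del: fun_upd_apply)
  moreover have "range c' \<subseteq> C" using c by (auto simp: c'_def)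
  ultimately show ?thesis unfolding df_def by blast
qed

lemma df_eq_var: "C \<noteq> {} \<Longrightarrow> df C D E (\<lambda>s. s i = s j)"
  unfolding df_def by (rule exI[of _ "FEq (2 * i) (2 * j)"], rule exI[of _ "\<lambda>_. SOME x. x \<in> C"])
    (auto simp: mix_def some_in_eq)

lemma df_mem_var: "C \<noteq> {} \<Longrightarrow> df C D E (\<lambda>s. E (s i) (s j))"
  unfolding df_def by (rule exI[of _ "FMem (2 * i) (2 * j)"], rule exI[of _ "\<lambda>_. SOME x. x \<in> C"])
    (auto simp: mix_def some_in_eq)

lemma df_eq_const: "u \<in> C \<Longrightarrow> df C D E (\<lambda>s. s i = u)"
  unfolding df_def by (rule exI[of _ "FEq (2 * i) 1"], rule exI[of _ "\<lambda>_. u"]) (auto simp: mix_def)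

lemma df_cong: "(\<And>s. range s \<subseteq> D \<Longrightarrow> P s = Q s) \<Longrightarrow> df C D E P \<Longrightarrow> df C D E Q"
  unfolding df_def by (metis (no_types, lifting))

lemma df_disj: "df C D E P \<Longrightarrow> df C D E Q \<Longrightarrow> df C D E (\<lambda>s. P s \<or> Q s)"
  using df_not[OF df_conj[OF df_not df_not]] by simp

lemma df_imp: "df C D E P \<Longrightarrow> df C D E Q \<Longrightarrow> df C D E (\<lambda>s. P s \<longrightarrow> Q s)"
  using df_not[OF df_conj[OF _ df_not]] by simp

lemma df_iff: "df C D E P \<Longrightarrow> df C D E Q \<Longrightarrow> df C D E (\<lambda>s. P s \<longleftrightarrow> Q s)"
  using df_conj[OF df_imp df_imp, of C D E P Q Q P] by (simp add: iff_conv_conj_imp)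

lemma df_bex_D: "df C D E (\<lambda>s. P (\<lambda>n. s (Suc n)) (s 0)) \<Longrightarrow> df C D E (\<lambda>s. \<exists>x\<in>D. P s x)"
  using df_not[OF df_ball_D[OF df_not]] by simp

lemma tm_var: "C \<noteq> {} \<Longrightarrow> tm C D E (\<lambda>s. s i)"
  unfolding tm_def by (auto intro: df_eq_var)

lemma tm_const: "u \<in> C \<Longrightarrow> u \<in> D \<Longrightarrow> tm C D E (\<lambda>s. u)"
  unfolding tm_def by (auto intro: df_eq_const)

lemma tm_rename:
  assumes "tm C D E t" "inj f"
  shows "tm C D E (\<lambda>s. t (\<lambda>n. s (f n)))"
proof -
  let ?g = "\<lambda>n. case n of 0 \<Rightarrow> 0 | Suc m \<Rightarrow> Suc (f m)"
  have "inj ?g" by (rule injI) (auto dest: injD[OF assms(2)] split: nat.splits)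
  from df_rename[OF conjunct2[OF assms(1)[unfolded tm_def]] this] assms(1)
  show ?thesis unfolding tm_def by (simp add: image_subset_iff)
qed

text \<open>Substitution is expressed by a quantifier over the value of the term, which avoids
  substituting into formulas.\<close>

lemma df_sub_step:
  assumes "df C D E (\<lambda>s. P (s 0) (\<lambda>n. s (Suc n)))" "tm C D E t"
  shows "df C D E (\<lambda>s. P (t s) s)"
proof -
  have "df C D E (\<lambda>s. \<exists>x\<in>D. x = t s \<and> P x s)"
    using assms by (intro df_bex_D df_conj) (auto simp: tm_def)
  then show ?thesis by (rule df_cong[rotated]) (use assms(2) in \<open>auto simp: tm_def\<close>)
qed

lemma df_sub1:
  assumes "df C D E (\<lambda>s. P (s 0))" "tm C D E t1"
  shows "df C D E (\<lambda>s. P (t1 s))"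
  using df_sub_step[of C D E "\<lambda>x s. P x", OF _ assms(2)] assms(1) by simp

lemma df_sub2:
  assumes "df C D E (\<lambda>s. P (s 0) (s (Suc 0)))" "tm C D E t1" "tm C D E t2"
  shows "df C D E (\<lambda>s. P (t1 s) (t2 s))"
proof -
  have 1: "df C D E (\<lambda>s. P (s (Suc 0)) (s 0))"
    using df_rename[OF assms(1), of "\<lambda>n. if n = 0 then 1 else if n = 1 then 0 else n"]
    by (simp add: inj_def)
  have 2: "df C D E (\<lambda>s. P (s 0) (t2 (\<lambda>n. s (Suc n))))"
    using df_sub_step[of C D E "\<lambda>x s. P (s 0) x", OF 1 tm_rename[OF assms(3), of Suc]] by simp
  show ?thesis using df_sub_step[of C D E "\<lambda>x s. P x (t2 s)", OF 2 assms(2)] .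
qed

text \<open>The arguments are replaced from the last to the first; in between, the variables are
  permuted so that the next argument stands in variable 0.\<close>

lemma df_sub3:
  assumes "df C D E (\<lambda>s. P (s 0) (s (Suc 0)) (s (Suc (Suc 0))))"
    "tm C D E t1" "tm C D E t2" "tm C D E t3"
  shows "df C D E (\<lambda>s. P (t1 s) (t2 s) (t3 s))"
proof -
  have 1: "df C D E (\<lambda>s. P (s (Suc 0)) (s (Suc (Suc 0))) (s 0))"
    using df_rename[OF assms(1), of "\<lambda>n. if n = 0 then 1 else if n = 1 then 2 else if n = 2 then 0 else n"]
    by (simp add: inj_def numeral_2_eq_2)
  have 2: "df C D E (\<lambda>s. P (s 0) (s (Suc 0)) (t3 (\<lambda>n. s (Suc (Suc n)))))"
    using df_sub_step[of C D E "\<lambda>x s. P (s 0) (s (Suc 0)) x", OF 1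
        tm_rename[OF assms(4), of "\<lambda>n. Suc (Suc n)"]] by (simp add: inj_def)
  have 3: "df C D E (\<lambda>s. P (s (Suc 0)) (s 0) (t3 (\<lambda>n. s (Suc (Suc n)))))"
    using df_rename[OF 2, of "\<lambda>n. if n = 0 then 1 else if n = 1 then 0 else n"]
    by (simp add: inj_def)
  have 4: "df C D E (\<lambda>s. P (s 0) (t2 (\<lambda>n. s (Suc n))) (t3 (\<lambda>n. s (Suc n))))"
    using df_sub_step[of C D E "\<lambda>x s. P (s 0) x (t3 (\<lambda>n. s (Suc n)))", OF 3
        tm_rename[OF assms(3), of Suc]] by simp
  show ?thesis using df_sub_step[of C D E "\<lambda>x s. P x (t2 s) (t3 s)", OF 4 assms(2)] .
qed

lemma df_sub4:
  assumes "df C D E (\<lambda>s. P (s 0) (s (Suc 0)) (s (Suc (Suc 0))) (s (Suc (Suc (Suc 0)))))"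
    "tm C D E t1" "tm C D E t2" "tm C D E t3" "tm C D E t4"
  shows "df C D E (\<lambda>s. P (t1 s) (t2 s) (t3 s) (t4 s))"
proof -
  have 1: "df C D E (\<lambda>s. P (s (Suc 0)) (s (Suc (Suc 0))) (s (Suc (Suc (Suc 0)))) (s 0))"
    using df_rename[OF assms(1), of "\<lambda>n. if n = 0 then 1 else if n = 1 then 2 else if n = 2 then 3
      else if n = 3 then 0 else n"]
    by (simp add: inj_def numeral_2_eq_2 numeral_3_eq_3)
  have 2: "df C D E (\<lambda>s. P (s 0) (s (Suc 0)) (s (Suc (Suc 0))) (t4 (\<lambda>n. s (Suc (Suc (Suc n))))))"
    using df_sub_step[of C D E "\<lambda>x s. P (s 0) (s (Suc 0)) (s (Suc (Suc 0))) x", OF 1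
        tm_rename[OF assms(5), of "\<lambda>n. Suc (Suc (Suc n))"]] by (simp add: inj_def)
  have 3: "df C D E (\<lambda>s. P (s (Suc 0)) (s (Suc (Suc 0))) (s 0) (t4 (\<lambda>n. s (Suc (Suc (Suc n))))))"
    using df_rename[OF 2, of "\<lambda>n. if n = 0 then 1 else if n = 1 then 2 else if n = 2 then 0 else n"]
    by (simp add: inj_def numeral_2_eq_2)
  have 4: "df C D E (\<lambda>s. P (s 0) (s (Suc 0)) (t3 (\<lambda>n. s (Suc (Suc n)))) (t4 (\<lambda>n. s (Suc (Suc n)))))"
    using df_sub_step[of C D E "\<lambda>x s. P (s 0) (s (Suc 0)) x (t4 (\<lambda>n. s (Suc (Suc n))))", OF 3
        tm_rename[OF assms(4), of "\<lambda>n. Suc (Suc n)"]] by (simp add: inj_def)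
  have 5: "df C D E (\<lambda>s. P (s (Suc 0)) (s 0) (t3 (\<lambda>n. s (Suc (Suc n)))) (t4 (\<lambda>n. s (Suc (Suc n)))))"
    using df_rename[OF 4, of "\<lambda>n. if n = 0 then 1 else if n = 1 then 0 else n"]
    by (simp add: inj_def)
  have 6: "df C D E (\<lambda>s. P (s 0) (t2 (\<lambda>n. s (Suc n))) (t3 (\<lambda>n. s (Suc n))) (t4 (\<lambda>n. s (Suc n))))"
    using df_sub_step[of C D E "\<lambda>x s. P (s 0) x (t3 (\<lambda>n. s (Suc n))) (t4 (\<lambda>n. s (Suc n)))", OF 5
        tm_rename[OF assms(3), of Suc]] by simp
  show ?thesis using df_sub_step[of C D E "\<lambda>x s. P x (t2 s) (t3 s) (t4 s)", OF 6 assms(2)] .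
qed

lemma tm_sub1:
  assumes "tm C D E (\<lambda>s. g (s 0))" "tm C D E t1"
  shows "tm C D E (\<lambda>s. g (t1 s))"
proof -
  have "C \<noteq> {}" using assms(1) by (auto simp: tm_def df_def)
  then have "df C D E (\<lambda>s. s 0 = g (t1 (\<lambda>n. s (Suc n))))"
    using assms df_sub2[of C D E "\<lambda>x y. x = g y" "\<lambda>s. s 0" "\<lambda>s. t1 (\<lambda>n. s (Suc n))"]
      tm_var[of C D E 0] tm_rename[of C D E t1 Suc] by (simp add: tm_def)
  moreover have "g (t1 s) \<in> D" if "range s \<subseteq> D" for s
  proof -
    have "range (\<lambda>_::nat. t1 s) \<subseteq> D" using assms(2) that by (auto simp: tm_def)
    then show ?thesis using assms(1) unfolding tm_def by fastforce
  qed
  ultimately show ?thesis unfolding tm_def by blast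
qed

section \<open>Well-founded models of ZFC\<close>

named_theorems dfI

text \<open>Just these two properties, so that the vocabulary applies to the generic extension
  \<open>F\<close> as well as to the ground model.\<close>

locale wfm =
  fixes E :: "'a \<Rightarrow> 'a \<Rightarrow> bool"
  assumes wf: "wfp E" and ext_rel: "extensional_rel E"
begin

abbreviation el :: "'a \<Rightarrow> 'a set" where "el \<equiv> elts E"
abbreviation dfu :: "((nat \<Rightarrow> 'a) \<Rightarrow> bool) \<Rightarrow> bool" where "dfu \<equiv> df UNIV UNIV E"
abbreviation tmu :: "((nat \<Rightarrow> 'a) \<Rightarrow> 'a) \<Rightarrow> bool" where "tmu \<equiv> tm UNIV UNIV E"

definition iss :: "'a set \<Rightarrow> bool" where "iss A \<longleftrightarrow> (\<exists>x. el x = A)"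
definition mk :: "'a set \<Rightarrow> 'a" where "mk A = (SOME x. el x = A)"

lemma ext: "el x = el y \<longleftrightarrow> x = y"
  using ext_rel unfolding extensional_rel_def by blast

lemma el_mk: "iss A \<Longrightarrow> el (mk A) = A"
  unfolding iss_def mk_def by (rule someI_ex)

lemma iss_el [simp]: "iss (el x)"
  by (auto simp: iss_def)

lemma mk_el [simp]: "mk (el x) = x"
  by (metis el_mk ext iss_el)

lemma E_iff: "E x y \<longleftrightarrow> x \<in> el y"
  by (simp add: elts_def)

lemma E_induct [case_names step]: "(\<And>x. (\<And>y. y \<in> el x \<Longrightarrow> P y) \<Longrightarrow> P x) \<Longrightarrow> P x"
  using wfp_induct[OF wf, of P x] by (auto simp: E_iff)

lemma E_min: "x \<in> A \<Longrightarrow> \<exists>y\<in>A. \<forall>z\<in>el y. z \<notin> A"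
  by (induction x rule: E_induct) blast

lemma E_irrefl [simp]: "x \<notin> el x"
  by (induction x rule: E_induct) blast

lemma E_asym: "x \<in> el y \<Longrightarrow> y \<notin> el x"
  by (induction x arbitrary: y rule: E_induct) blast

lemma df_bool [dfI]: "dfu (\<lambda>s. b)"
proof (cases b)
  case True then show ?thesis using df_eq_var[of UNIV UNIV E 0 0] by simp
next
  case False then show ?thesis using df_not[OF df_eq_var[of UNIV UNIV E 0 0]] by simp
qed

lemmas [dfI] = df_conj[of UNIV UNIV E] df_disj[of UNIV UNIV E] df_imp[of UNIV UNIV E]
  df_iff[of UNIV UNIV E] df_not[of UNIV UNIV E]

lemma df_all [dfI]: "dfu (\<lambda>s. P (\<lambda>n. s (Suc n)) (s 0)) \<Longrightarrow> dfu (\<lambda>s. \<forall>x. P s x)"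
  using df_ball_D[of UNIV UNIV E P] by simp

lemma df_ex [dfI]: "dfu (\<lambda>s. P (\<lambda>n. s (Suc n)) (s 0)) \<Longrightarrow> dfu (\<lambda>s. \<exists>x. P s x)"
  using df_bex_D[of UNIV UNIV E P] by simp

lemma tmu_var [dfI]: "tmu (\<lambda>s. s i)"
  by (simp add: tm_var)

lemma tmu_const [dfI]: "tmu (\<lambda>s. u)"
  by (simp add: tm_const)

lemma tmu_def: "tmu t \<longleftrightarrow> dfu (\<lambda>s. s 0 = t (\<lambda>n. s (Suc n)))"
  by (simp add: tm_def)

lemma df_eq [dfI]: "tmu t1 \<Longrightarrow> tmu t2 \<Longrightarrow> dfu (\<lambda>s. t1 s = t2 s)"
  by (rule df_sub2[of _ _ _ "\<lambda>x y. x = y"]) (simp_all add: df_eq_var)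

lemma df_E [dfI]: "tmu t1 \<Longrightarrow> tmu t2 \<Longrightarrow> dfu (\<lambda>s. E (t1 s) (t2 s))"
  by (rule df_sub2[of _ _ _ "\<lambda>x y. E x y"]) (simp_all add: df_mem_var)

lemma df_el [dfI]: "tmu t1 \<Longrightarrow> tmu t2 \<Longrightarrow> dfu (\<lambda>s. t1 s \<in> el (t2 s))"
  using df_E by (simp add: E_iff)

lemma tmu_shift: "tmu t \<Longrightarrow> tmu (\<lambda>s. t (\<lambda>n. s (Suc n)))"
  by (rule tm_rename) auto

lemma df_ball [dfI]: "tmu t \<Longrightarrow> dfu (\<lambda>s. P (\<lambda>n. s (Suc n)) (s 0)) \<Longrightarrow> dfu (\<lambda>s. \<forall>x\<in>el (t s). P s x)"
  unfolding Ball_def by (intro dfI tmu_shift)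

lemma df_bex [dfI]: "tmu t \<Longrightarrow> dfu (\<lambda>s. P (\<lambda>n. s (Suc n)) (s 0)) \<Longrightarrow> dfu (\<lambda>s. \<exists>x\<in>el (t s). P s x)"
  unfolding Bex_def by (intro dfI tmu_shift)

lemma df_subset [dfI]: "tmu t1 \<Longrightarrow> tmu t2 \<Longrightarrow> dfu (\<lambda>s. el (t1 s) \<subseteq> el (t2 s))"
  unfolding subset_eq by (intro dfI tmu_shift)

lemma df_empty [dfI]: "tmu t1 \<Longrightarrow> dfu (\<lambda>s. el (t1 s) = {})"
  unfolding set_eq_iff empty_iff by (intro dfI tmu_shift)

lemmas df_1 = df_sub1[of UNIV UNIV E] and df_2 = df_sub2[of UNIV UNIV E]
  and df_3 = df_sub3[of UNIV UNIV E] and df_4 = df_sub4[of UNIV UNIV E]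

lemma tm_1: "tmu (\<lambda>s. g (s 0)) \<Longrightarrow> tmu t1 \<Longrightarrow> tmu (\<lambda>s. g (t1 s))"
  by (rule tm_sub1)

lemma tm_2:
  "tmu (\<lambda>s. g (s 0) (s (Suc 0))) \<Longrightarrow> tmu t1 \<Longrightarrow> tmu t2 \<Longrightarrow> tmu (\<lambda>s. g (t1 s) (t2 s))"
  unfolding tmu_def[of "\<lambda>s. g (s 0) (s (Suc 0))"] tmu_def[of "\<lambda>s. g (t1 s) (t2 s)"]
  by (rule df_3[of "\<lambda>z x y. z = g x y"]) (auto intro: tmu_shift tmu_var)

text \<open>By extensionality the value is determined by its elements, so definable membership
  suffices for a definable operation.\<close>

lemma tm_mk:
  assumes "\<And>s. iss (A s)" "dfu (\<lambda>s. s 0 \<in> A (\<lambda>n. s (Suc n)))"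
  shows "tmu (\<lambda>s. mk (A s))"
proof -
  have *: "dfu (\<lambda>s. s 0 \<in> A (\<lambda>n. s (Suc (Suc n))))"
    using df_rename[OF assms(2), of "\<lambda>n. case n of 0 \<Rightarrow> 0 | Suc m \<Rightarrow> Suc (Suc m)"]
    by (simp add: inj_def split: nat.split)
  have "dfu (\<lambda>s. \<forall>x. x \<in> el (s 0) \<longleftrightarrow> x \<in> A (\<lambda>n. s (Suc n)))"
    by (intro dfI) (use * in simp)
  moreover have "(\<forall>x. x \<in> el z \<longleftrightarrow> x \<in> A s) \<longleftrightarrow> z = mk (A s)" for z s
    using el_mk[OF assms(1)] ext by (metis subsetI subset_antisym)
  ultimately show ?thesis unfolding tmu_def by simp
qed

lemma tm_if [dfI]: "dfu P \<Longrightarrow> tmu t1 \<Longrightarrow> tmu t2 \<Longrightarrow> tmu (\<lambda>s. if P s then t1 s else t2 s)"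
proof -
  assume a: "dfu P" "tmu t1" "tmu t2"
  have "dfu (\<lambda>s. P (\<lambda>n. s (Suc n)))" using df_rename[OF a(1), of Suc] by simp
  then have "dfu (\<lambda>s. (P (\<lambda>n. s (Suc n)) \<longrightarrow> s 0 = t1 (\<lambda>n. s (Suc n))) \<and>
      (\<not> P (\<lambda>n. s (Suc n)) \<longrightarrow> s 0 = t2 (\<lambda>n. s (Suc n))))"
    by (intro dfI tmu_shift a)
  then show "tmu (\<lambda>s. if P s then t1 s else t2 s)"
    unfolding tmu_def by (rule df_cong[rotated]) auto
qed

end

locale zfc = wfm +
  assumes ZFC: "ZFC E"
begin

lemma sep: assumes "dfu (\<lambda>s. P (s 0))" shows "iss {x \<in> el a. P x}"
proof -
  obtain \<phi> c where \<phi>: "\<And>s. P (s 0) \<longleftrightarrow> sat UNIV E (mix s c) \<phi>"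
    using assms unfolding df_def by auto
  have "(mix (\<lambda>_. a) c)(0 := x) = mix (x ## (\<lambda>_. a)) c" for x
    by (auto simp: mix_def fun_eq_iff scons_def split: nat.split elim!: evenE)
  then have P: "sat UNIV E ((mix (\<lambda>_. a) c)(0 := x)) \<phi> \<longleftrightarrow> P x" for x
    using \<phi>[of "x ## (\<lambda>_. a)"] by simp
  have "\<forall>\<phi> s a. \<exists>b. el b = {x \<in> el a. sat UNIV E (s(0 := x)) \<phi>}"
    using ZFC unfolding ZFC_def by (elim conjE)
  from spec[OF spec[OF spec[OF this, of \<phi>], of "mix (\<lambda>_. a) c"], of a] show ?thesis
    unfolding iss_def P .
qed

lemma repl_rel:
  assumes "dfu (\<lambda>s. P (s 0) (s (Suc 0)))" "\<And>x. x \<in> el a \<Longrightarrow> \<exists>!y. P x y"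
  shows "iss {y. \<exists>x\<in>el a. P x y}"
proof -
  obtain \<phi> c where \<phi>: "\<And>s. P (s 0) (s (Suc 0)) \<longleftrightarrow> sat UNIV E (mix s c) \<phi>"
    using assms(1) unfolding df_def by auto
  \<comment> \<open>The schema expects the image in variable 1, whereas the second environment
    variable of \<open>mix\<close> is variable 2; the two are exchanged.\<close>
  define f :: "nat \<Rightarrow> nat" where "f n = (if n = 2 then 1 else if n = 1 then 2 else n)" for n
  have "inj f" by (auto simp: inj_def f_def)
  define e where "e = (\<lambda>n. mix (\<lambda>_. a) c (f n))"
  have eq: "(\<lambda>n. (e(0 := x, 1 := y)) (f n)) = mix (x ## y ## (\<lambda>_. a)) c" for x y
  proof
    fix n show "(e(0 := x, 1 := y)) (f n) = mix (x ## y ## (\<lambda>_. a)) c n"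
    proof (cases "even n")
      case True
      then obtain k where "n = 2 * k" by blast
      then show ?thesis
        by (cases k; cases "k - 1") (auto simp: f_def e_def mix_def)
    next
      case False
      then obtain k where "n = 2 * k + 1" by (auto elim: oddE)
      then show ?thesis
        by (cases k) (auto simp: f_def e_def mix_def)
    qed
  qed
  have P: "sat UNIV E (e(0 := x, 1 := y)) (ren f \<phi>) \<longleftrightarrow> P x y" for x y
    unfolding sat_ren[OF \<open>inj f\<close>] eq \<phi>[of "x ## y ## (\<lambda>_. a)", symmetric] by simp
  have "\<forall>\<phi> s a. (\<forall>x\<in>elts E a. \<exists>!y. sat UNIV E (s(0 := x, 1 := y)) \<phi>) \<longrightarrow>
          (\<exists>b. elts E b = {y. \<exists>x\<in>elts E a. sat UNIV E (s(0 := x, 1 := y)) \<phi>})"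
    using ZFC unfolding ZFC_def by (elim conjE)
  from spec[OF spec[OF spec[OF this, of "ren f \<phi>"], of e], of a] show ?thesis
    unfolding iss_def P using assms(2) by blast
qed

lemma repl: assumes "tmu (\<lambda>s. h (s 0))" shows "iss (h ` el a)"
proof -
  have "dfu (\<lambda>s. s (Suc 0) = h (s 0))" by (intro dfI assms)
  from repl_rel[OF this, of a] show ?thesis by (simp add: image_def)
qed

section \<open>Set operations, functions and choice inside the model\<close>

definition emp :: 'a where "emp = mk {}"
definition up :: "'a \<Rightarrow> 'a \<Rightarrow> 'a" where "up a b = mk {a, b}"
definition pr :: "'a \<Rightarrow> 'a \<Rightarrow> 'a" where "pr a b = up (up a a) (up a b)"
definition bun :: "'a \<Rightarrow> 'a" where "bun a = mk (\<Union>y\<in>el a. el y)"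
definition un :: "'a \<Rightarrow> 'a \<Rightarrow> 'a" where "un a b = mk (el a \<union> el b)"
definition Pw :: "'a \<Rightarrow> 'a" where "Pw a = mk {x. el x \<subseteq> el a}"
definition ins :: "'a \<Rightarrow> 'a \<Rightarrow> 'a" where "ins x a = mk (insert x (el a))"
definition suc :: "'a \<Rightarrow> 'a" where "suc x = ins x x"
definition dif :: "'a \<Rightarrow> 'a \<Rightarrow> 'a" where "dif a b = mk (el a - el b)"
definition tms :: "'a \<Rightarrow> 'a \<Rightarrow> 'a" where "tms a b = mk {pr x y | x y. x \<in> el a \<and> y \<in> el b}"
text \<open>Application is made total by collecting the elements of the unique image; without a
  unique image the value is \<open>emp\<close>. So every element of the model acts as a function on
  all of it, and \<open>app\<close> is a definable operation.\<close>

definition app :: "'a \<Rightarrow> 'a \<Rightarrow> 'a" where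
  "app f x = mk {z. \<exists>y. pr x y \<in> el f \<and> (\<forall>y'. pr x y' \<in> el f \<longrightarrow> y' = y) \<and> z \<in> el y}"

lemma iss_pair [simp]: "iss {a, b}"
proof -
  have "\<forall>x y. \<exists>z. el z = {x, y}" using ZFC unfolding ZFC_def by (elim conjE)
  then show ?thesis unfolding iss_def by blast
qed
lemma el_up [simp]: "el (up a b) = {a, b}"
  by (simp add: up_def el_mk)
lemma iss_Union [simp]: "iss (\<Union>y\<in>el a. el y)"
proof -
  have "\<forall>x. \<exists>u. el u = (\<Union>y\<in>el x. el y)" using ZFC unfolding ZFC_def by (elim conjE)
  then show ?thesis unfolding iss_def by blast
qed
lemma el_bun [simp]: "el (bun a) = (\<Union>y\<in>el a. el y)"
  by (simp add: bun_def el_mk)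
lemma iss_union: "iss A \<Longrightarrow> iss B \<Longrightarrow> iss (A \<union> B)"
proof -
  assume "iss A" "iss B"
  then have "(\<Union>y\<in>el (up (mk A) (mk B)). el y) = A \<union> B" by (simp add: el_mk)
  then show ?thesis using iss_Union by metis
qed
lemma el_un [simp]: "el (un a b) = el a \<union> el b"
  by (simp add: un_def el_mk iss_union)
lemma iss_Pow: "iss {x. el x \<subseteq> el a}"
proof -
  have "\<forall>x. \<exists>p. el p = {y. el y \<subseteq> el x}" using ZFC unfolding ZFC_def by (elim conjE)
  then show ?thesis unfolding iss_def by blast
qed
lemma el_Pw [simp]: "el (Pw a) = {x. el x \<subseteq> el a}"
  by (simp add: Pw_def el_mk iss_Pow)
lemma iss_insert: "iss A \<Longrightarrow> iss (insert x A)"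
  using iss_union[OF iss_pair[of x x]] by simp
lemma el_ins [simp]: "el (ins x a) = insert x (el a)"
  by (simp add: ins_def el_mk iss_insert)
lemma el_suc [simp]: "el (suc x) = insert x (el x)"
  by (simp add: suc_def)
lemma iss_empty [simp]: "iss {}"
  using sep[of "\<lambda>_. False" undefined] by (simp add: dfI)
lemma el_emp [simp]: "el emp = {}"
  by (simp add: emp_def el_mk)
lemma iss_finite: "finite A \<Longrightarrow> iss A"
  by (induction A rule: finite_induct) (auto intro: iss_insert)
lemma iss_subset: "dfu (\<lambda>s. s 0 \<in> B) \<Longrightarrow> B \<subseteq> el a \<Longrightarrow> iss B"
  using sep[of "\<lambda>x. x \<in> B" a] by (simp add: Int_absorb1 Collect_conj_eq)
lemma el_dif [simp]: "el (dif a b) = el a - el b"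
proof -
  have "iss {x \<in> el a. x \<notin> el b}" by (rule sep) (intro dfI)
  then show ?thesis by (simp add: dif_def el_mk set_diff_eq)
qed

lemma up_eq [simp]: "up a b = up c d \<longleftrightarrow> (a = c \<and> b = d) \<or> (a = d \<and> b = c)"
  using ext[of "up a b" "up c d"] unfolding el_up doubleton_eq_iff by blast
lemma pr_eq [simp]: "pr a b = pr c d \<longleftrightarrow> a = c \<and> b = d"
  by (auto simp: pr_def)
lemma el_pr: "el (pr a b) = {up a a, up a b}"
  by (simp add: pr_def)
lemma emp_iff: "x = emp \<longleftrightarrow> el x = {}"
  by (metis ext el_emp)
lemma ins_neq_emp [simp]: "ins x a \<noteq> emp" "suc x \<noteq> emp"
  by (simp_all add: emp_iff)

lemma tm_up [dfI]: "tmu t1 \<Longrightarrow> tmu t2 \<Longrightarrow> tmu (\<lambda>s. up (t1 s) (t2 s))"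
  by (rule tm_2[of up]) (unfold up_def, rule tm_mk, simp, simp, intro dfI)
lemma tm_pr [dfI]: "tmu t1 \<Longrightarrow> tmu t2 \<Longrightarrow> tmu (\<lambda>s. pr (t1 s) (t2 s))"
  unfolding pr_def by (intro dfI)
lemma tm_bun [dfI]: "tmu t1 \<Longrightarrow> tmu (\<lambda>s. bun (t1 s))"
  by (rule tm_1[of bun]) (unfold bun_def, rule tm_mk, simp, simp, intro dfI)
lemma tm_un [dfI]: "tmu t1 \<Longrightarrow> tmu t2 \<Longrightarrow> tmu (\<lambda>s. un (t1 s) (t2 s))"
  by (rule tm_2[of un]) (unfold un_def, rule tm_mk, simp add: iss_union, simp, intro dfI)
lemma tm_Pw [dfI]: "tmu t1 \<Longrightarrow> tmu (\<lambda>s. Pw (t1 s))"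
  by (rule tm_1[of Pw]) (unfold Pw_def, rule tm_mk, rule iss_Pow, simp, intro dfI)
lemma tm_ins [dfI]: "tmu t1 \<Longrightarrow> tmu t2 \<Longrightarrow> tmu (\<lambda>s. ins (t1 s) (t2 s))"
  by (rule tm_2[of ins]) (unfold ins_def, rule tm_mk, simp add: iss_insert, simp, intro dfI)
lemma tm_suc [dfI]: "tmu t1 \<Longrightarrow> tmu (\<lambda>s. suc (t1 s))"
  unfolding suc_def by (intro dfI)
lemma tm_dif [dfI]: "tmu t1 \<Longrightarrow> tmu t2 \<Longrightarrow> tmu (\<lambda>s. dif (t1 s) (t2 s))"
  by (rule tm_2[of dif]) (unfold dif_def, rule tm_mk, metis el_dif iss_el, simp, intro dfI)

lemma iss_tms: "iss {pr x y | x y. x \<in> el a \<and> y \<in> el b}"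
proof (rule iss_subset)
  show "dfu (\<lambda>s. s 0 \<in> {pr x y |x y. x \<in> el a \<and> y \<in> el b})"
    unfolding mem_Collect_eq by (intro dfI)
  show "{pr x y |x y. x \<in> el a \<and> y \<in> el b} \<subseteq> el (Pw (Pw (un a b)))"
    by (auto simp: el_pr)
qed
lemma el_tms [simp]: "el (tms a b) = {pr x y | x y. x \<in> el a \<and> y \<in> el b}"
  by (simp add: tms_def el_mk iss_tms)
lemma tm_tms [dfI]: "tmu t1 \<Longrightarrow> tmu t2 \<Longrightarrow> tmu (\<lambda>s. tms (t1 s) (t2 s))"
  by (rule tm_2[of tms]) (unfold tms_def, rule tm_mk, rule iss_tms, unfold mem_Collect_eq, intro dfI)

lemma app_eq: assumes "pr x y \<in> el f" "\<And>y'. pr x y' \<in> el f \<Longrightarrow> y' = y" shows "app f x = y"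
proof -
  have "{z. \<exists>y. pr x y \<in> el f \<and> (\<forall>y'. pr x y' \<in> el f \<longrightarrow> y' = y) \<and> z \<in> el y} = el y"
    using assms by blast
  then show ?thesis by (simp only: app_def mk_el)
qed
lemma iss_app: "iss {z. \<exists>y. pr x y \<in> el f \<and> (\<forall>y'. pr x y' \<in> el f \<longrightarrow> y' = y) \<and> z \<in> el y}"
proof (cases "\<exists>y. pr x y \<in> el f \<and> (\<forall>y'. pr x y' \<in> el f \<longrightarrow> y' = y)")
  case True
  then obtain y where "pr x y \<in> el f" "\<And>y'. pr x y' \<in> el f \<Longrightarrow> y' = y" by blast
  then have "{z. \<exists>y. pr x y \<in> el f \<and> (\<forall>y'. pr x y' \<in> el f \<longrightarrow> y' = y) \<and> z \<in> el y} = el y"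
    by blast
  then show ?thesis by (simp only: iss_el iss_empty)
next
  case False
  then have "{z. \<exists>y. pr x y \<in> el f \<and> (\<forall>y'. pr x y' \<in> el f \<longrightarrow> y' = y) \<and> z \<in> el y} = {}"
    by blast
  then show ?thesis by (simp only: iss_el iss_empty)
qed
lemma tm_app [dfI]: "tmu t1 \<Longrightarrow> tmu t2 \<Longrightarrow> tmu (\<lambda>s. app (t1 s) (t2 s))"
  by (rule tm_2[of app]) (unfold app_def, rule tm_mk, rule iss_app, unfold mem_Collect_eq, intro dfI)

definition lam :: "'a \<Rightarrow> ('a \<Rightarrow> 'a) \<Rightarrow> 'a" where
  "lam a h = mk ((\<lambda>x. pr x (h x)) ` el a)"

lemma el_lam: "tmu (\<lambda>s. h (s 0)) \<Longrightarrow> el (lam a h) = (\<lambda>x. pr x (h x)) ` el a"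
  unfolding lam_def by (rule el_mk, rule repl) (intro dfI)
lemma app_lam: "tmu (\<lambda>s. h (s 0)) \<Longrightarrow> x \<in> el a \<Longrightarrow> app (lam a h) x = h x"
  by (rule app_eq) (auto simp: el_lam)

text \<open>The axiom chooses from disjoint families, so the sets of witnesses are made disjoint by
  tagging: \<open>h x\<close> consists of pairs with first component x. The selector is cut down to
  the union of the family, outside of which it may contain stray pairs.\<close>

lemma choice:
  assumes P: "dfu (\<lambda>s. P (s 0) (s (Suc 0)))"
    and ex: "\<And>x. x \<in> el a \<Longrightarrow> \<exists>y\<in>el b. P x y"
  obtains f where "\<And>x. x \<in> el a \<Longrightarrow> app f x \<in> el b \<and> P x (app f x)"
proof -
  note [dfI] = df_2[OF P]
  define h where "h x = mk {z \<in> el (tms a b). \<exists>y. z = pr x y \<and> P x y}" for x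
  have iss_h: "iss {z \<in> el (tms a b). \<exists>y. z = pr x y \<and> P x y}" for x
    by (rule sep) (intro dfI)
  then have elh: "el (h x) = {z \<in> el (tms a b). \<exists>y. z = pr x y \<and> P x y}" for x
    by (simp add: h_def el_mk)
  have tmh: "tmu (\<lambda>s. h (s 0))"
    unfolding h_def by (rule tm_mk, rule iss_h, unfold mem_Collect_eq, intro dfI)
  define F where "F = mk (h ` el a)"
  have elF: "el F = h ` el a" unfolding F_def by (rule el_mk[OF repl[OF tmh]])
  have "el (h x) \<noteq> {}" if x: "x \<in> el a" for x
  proof -
    obtain y where "y \<in> el b" "P x y" using ex[OF x] by blast
    then have "pr x y \<in> el (h x)" using x by (simp add: elh)
    then show ?thesis by blast
  qed
  then have 1: "\<forall>x\<in>el F. el x \<noteq> {}" unfolding elF by blast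
  have 2: "\<forall>x\<in>el F. \<forall>y\<in>el F. x \<noteq> y \<longrightarrow> el x \<inter> el y = {}"
    unfolding elF by (auto simp: elh)
  have "\<forall>a. (\<forall>x\<in>el a. el x \<noteq> {}) \<and>
      (\<forall>x\<in>el a. \<forall>y\<in>el a. x \<noteq> y \<longrightarrow> el x \<inter> el y = {}) \<longrightarrow>
      (\<exists>c. \<forall>x\<in>el a. \<exists>!y. y \<in> el x \<inter> el c)" using ZFC unfolding ZFC_def by (elim conjE)
  from spec[OF this, of F] 1 2 have "\<exists>c. \<forall>x\<in>el F. \<exists>!y. y \<in> el x \<inter> el c" by (simp only: simp_thms)
  then obtain c where c: "\<forall>x\<in>el F. \<exists>!y. y \<in> el x \<inter> el c" by (elim exE)
  have "iss {z \<in> el c. z \<in> el (bun F)}" by (rule sep) (intro dfI)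
  then obtain f where f: "el f = {z \<in> el c. z \<in> el (bun F)}" unfolding iss_def by (elim exE)
  show thesis
  proof
    fix x assume x: "x \<in> el a"
    then have hF: "h x \<in> el F" unfolding elF by (rule imageI)
    from bspec[OF c this] obtain z where z: "z \<in> el (h x)" "z \<in> el c"
      and uz: "\<And>z'. z' \<in> el (h x) \<Longrightarrow> z' \<in> el c \<Longrightarrow> z' = z" by (elim ex1E) blast
    from z(1) obtain y where y: "z = pr x y" "P x y" "y \<in> el b" by (auto simp: elh)
    have "app f x = y"
    proof (rule app_eq)
      show "pr x y \<in> el f" using z y hF by (auto simp: f)
      fix y' assume "pr x y' \<in> el f"
      then have c': "pr x y' \<in> el c" and "\<exists>x'\<in>el a. pr x y' \<in> el (h x')" by (auto simp: f elF)
      then have "pr x y' \<in> el (h x)" by (auto simp: elh)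
      from uz[OF this c'] show "y' = y" using y by simp
    qed
    then show "app f x \<in> el b \<and> P x (app f x)" using y by simp
  qed
qed

lemma is_pair_iff [simp]: "is_pair E a b z \<longleftrightarrow> z = pr a b"
proof -
  have "elts E c = {a} \<longleftrightarrow> c = up a a" "elts E d = {a, b} \<longleftrightarrow> d = up a b"
    "elts E z = {c, d} \<longleftrightarrow> z = up c d" for c d
    using el_up ext by (metis insert_absorb2)+
  then show ?thesis by (auto simp: is_pair_def pr_def)
qed

lemma rel_of_iff: "(a, b) \<in> rel_of E r \<longleftrightarrow> pr a b \<in> el r"
  by (auto simp: rel_of_def)

lemma is_fun_app: "is_fun E a f h \<Longrightarrow> x \<in> el a \<Longrightarrow> app f x = h x"
proof -
  assume f: "is_fun E a f h" and x: "x \<in> el a"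
  have "pr u v \<in> el f \<longleftrightarrow> u \<in> el a \<and> v = h u" for u v
    using f unfolding is_fun_def rel_of_iff[symmetric] by auto
  then show ?thesis using x by (intro app_eq) auto
qed

lemma is_fun_lam: "tmu (\<lambda>s. h (s 0)) \<Longrightarrow> is_fun E a (lam a h) h"
  unfolding is_fun_def by (auto simp: set_eq_iff rel_of_iff el_lam)

lemma lepoll_iff: "lepoll_in E a b \<longleftrightarrow> (\<exists>f. inj_on (app f) (el a) \<and> app f ` el a \<subseteq> el b)"
proof
  assume "lepoll_in E a b"
  then obtain f h where "is_fun E a f h" "inj_on h (el a)" "h ` el a \<subseteq> el b"
    unfolding lepoll_in_def by blast
  then have "inj_on (app f) (el a) \<and> app f ` el a \<subseteq> el b"
    by (simp add: is_fun_app inj_on_def image_subset_iff)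
  then show "\<exists>f. inj_on (app f) (el a) \<and> app f ` el a \<subseteq> el b" by blast
next
  assume "\<exists>f. inj_on (app f) (el a) \<and> app f ` el a \<subseteq> el b"
  then obtain f where "inj_on (app f) (el a) \<and> app f ` el a \<subseteq> el b" by blast
  moreover have "is_fun E a (lam a (app f)) (app f)" by (rule is_fun_lam) (intro dfI)
  ultimately show "lepoll_in E a b" unfolding lepoll_in_def by blast
qed

lemma lepollI: "tmu (\<lambda>s. h (s 0)) \<Longrightarrow> inj_on h (el a) \<Longrightarrow> h ` el a \<subseteq> el b \<Longrightarrow> lepoll_in E a b"
  using is_fun_lam unfolding lepoll_in_def by blast

lemma lepoll_trans: "lepoll_in E a b \<Longrightarrow> lepoll_in E b c \<Longrightarrow> lepoll_in E a c"
proof -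
  assume "lepoll_in E a b" "lepoll_in E b c"
  then obtain f g where "inj_on (app f) (el a)" "app f ` el a \<subseteq> el b"
    "inj_on (app g) (el b)" "app g ` el b \<subseteq> el c" unfolding lepoll_iff by blast
  then show ?thesis
    by (intro lepollI[of "\<lambda>x. app g (app f x)"]) (auto intro!: dfI simp: inj_on_def image_subset_iff)
qed

lemma lepoll_subset: "el a \<subseteq> el b \<Longrightarrow> lepoll_in E a b"
  by (rule lepollI[of "\<lambda>x. x"]) (auto intro!: dfI)

lemma lepoll_image:
  assumes h: "tmu (\<lambda>s. h (s 0))" and b: "el b = h ` el a" shows "lepoll_in E b a"
proof -
  have [dfI]: "tmu t \<Longrightarrow> tmu (\<lambda>s. h (t s))" for t by (rule tm_1[OF h])
  have "dfu (\<lambda>s. h (s (Suc 0)) = s 0)" by (intro dfI)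
  then obtain f where "\<And>y. y \<in> el b \<Longrightarrow> app f y \<in> el a \<and> h (app f y) = y"
    by (rule choice[of "\<lambda>y x. h x = y" b a]) (use b in auto)
  then show ?thesis by (intro lepollI[of "app f"]) (auto intro!: dfI simp: inj_on_def, metis)
qed

end

text \<open>As every element may serve as a parameter, the environment from variable 1 on can be
  frozen into parameters, interleaved with those of the formula. This makes separation usable with
  free variables of the context.\<close>

lemma df_fix:
  assumes "df UNIV UNIV E (\<lambda>s. P (\<lambda>n. s (Suc n)) (s 0))"
  shows "df UNIV UNIV E (\<lambda>s'. P s (s' 0))"
proof -
  obtain \<phi> c where \<phi>: "\<And>s. P (\<lambda>n. s (Suc n)) (s 0) \<longleftrightarrow> sat UNIV E (mix s c) \<phi>"
    using assms unfolding df_def by auto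
  define g where "g n = (if n = 0 then 0 else if even n then 2 * (n - 2) + 1 else 2 * n + 1)" for n :: nat
  have inj: "inj g" unfolding g_def by (rule injI) (auto elim!: evenE oddE split: if_splits; presburger)
  have "mix s' (mix s c) (g n) = mix (s' 0 ## s) c n" for s' n
  proof (cases "even n")
    case True
    then obtain k where "n = 2 * k" by blast
    then show ?thesis by (cases k) (auto simp: mix_def g_def)
  next
    case False
    then obtain k where "n = 2 * k + 1" by (auto elim: oddE)
    then show ?thesis by (auto simp: mix_def g_def)
  qed
  then have "(\<lambda>n. mix s' (mix s c) (g n)) = mix (s' 0 ## s) c" for s' by blast
  then have "P s (s' 0) \<longleftrightarrow> sat UNIV E (mix s' (mix s c)) (ren g \<phi>)" for s'
    using \<phi>[of "s' 0 ## s"] by (simp add: sat_ren[OF inj])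
  then show ?thesis unfolding df_def by auto
qed

context zfc begin

lemma iss_sep: "dfu (\<lambda>s. P (\<lambda>n. s (Suc n)) (s 0)) \<Longrightarrow> iss {x \<in> el a. P s x}"
  by (rule sep, rule df_fix)

lemma tm_Coll [dfI]:
  "tmu t \<Longrightarrow> dfu (\<lambda>s. P (\<lambda>n. s (Suc n)) (s 0)) \<Longrightarrow> tmu (\<lambda>s. mk {x \<in> el (t s). P s x})"
  by (rule tm_mk, erule iss_sep, unfold mem_Collect_eq) (intro dfI tmu_shift)

lemma el_sep: "dfu (\<lambda>s. P (s 0)) \<Longrightarrow> el (mk {x \<in> el a. P x}) = {x \<in> el a. P x}"
  by (simp add: el_mk sep)

lemma tm_img [dfI]:
  assumes "tmu t" "tmu (\<lambda>s. h (\<lambda>n. s (Suc n)) (s 0))"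
  shows "tmu (\<lambda>s. mk ((\<lambda>x. h s x) ` el (t s)))"
proof (rule tm_mk)
  have d: "dfu (\<lambda>s. s 0 = h (\<lambda>n. s (Suc (Suc n))) (s (Suc 0)))" using assms(2) unfolding tmu_def .
  have d': "dfu (\<lambda>s. s (Suc 0) = h (\<lambda>n. s (Suc (Suc n))) (s 0))"
    using df_rename[OF d, of "\<lambda>n. if n = 0 then 1 else if n = 1 then 0 else n"] by (simp add: inj_def)
  show "iss ((\<lambda>x. h s x) ` el (t s))" for s
  proof -
    have "dfu (\<lambda>s'. s' (Suc 0) = h s (s' 0))"
    proof -
      have "dfu (\<lambda>s. \<exists>x y. s 0 = pr x y \<and> y = h (\<lambda>n. s (Suc n)) x)"
      proof (rule df_ex, rule df_ex, rule df_conj)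
        show "dfu (\<lambda>s. s (Suc (Suc 0)) = pr (s (Suc 0)) (s 0))" by (intro dfI)
        show "dfu (\<lambda>s. s 0 = h (\<lambda>n. s (Suc (Suc (Suc n)))) (s (Suc 0)))"
          using df_rename[OF d, of "\<lambda>n. case n of 0 \<Rightarrow> 0 | Suc 0 \<Rightarrow> 1 | Suc (Suc k) \<Rightarrow> Suc (Suc (Suc k))"]
          by (simp add: inj_def split: nat.split)
      qed
      then have "dfu (\<lambda>s'. \<exists>x y. s' 0 = pr x y \<and> y = h s x)" by (rule df_fix)
      from df_1[OF this, of "\<lambda>s. pr (s 0) (s (Suc 0))"] show ?thesis by (simp add: dfI)
    qed
    then have "iss {y. \<exists>x\<in>el (t s). y = h s x}" by (rule repl_rel) simp
    then show ?thesis by (simp add: image_def)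
  qed
  show "dfu (\<lambda>s. s 0 \<in> (\<lambda>x. h (\<lambda>n. s (Suc n)) x) ` el (t (\<lambda>n. s (Suc n))))"
    unfolding image_iff
  proof (rule df_bex, rule tmu_shift, rule assms(1))
    show "dfu (\<lambda>s. s (Suc 0) = h (\<lambda>n. s (Suc (Suc n))) (s 0))" by (rule d')
  qed
qed

lemma el_img: "tmu (\<lambda>s. h (s 0)) \<Longrightarrow> el (mk (h ` el a)) = h ` el a"
  by (simp add: el_mk repl)

section \<open>Numerals, finiteness and countability\<close>

primrec num :: "nat \<Rightarrow> 'a" where
  "num 0 = emp"
| "num (Suc n) = suc (num n)"

lemma el_num: "el (num n) = num ` {..<n}"
  by (induction n) (auto simp: lessThan_Suc)

lemma num_eq [simp]: "num m = num n \<longleftrightarrow> m = n"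
proof -
  have "num m \<noteq> num n" if "m < n" for m n
  proof -
    have "num m \<in> el (num n)" using that by (simp add: el_num)
    then show ?thesis using E_irrefl by metis
  qed
  then show ?thesis by (metis linorder_neqE_nat)
qed

lemma num_mem [simp]: "num m \<in> el (num n) \<longleftrightarrow> m < n"
  by (auto simp: el_num)

lemma suc_iff: "el x = insert y (el y) \<longleftrightarrow> x = suc y"
  using ext[of x "suc y"] by simp

lemma is_numeral_iff: "is_numeral E n x \<longleftrightarrow> x = num n"
  by (induction n arbitrary: x) (auto simp: emp_iff suc_iff)

text \<open>An internal characterization of the numerals. That only true numerals satisfy it
  (\<open>natp_iff\<close>) rests on the well-foundedness of \<open>E\<close>; being first-order, it
  cuts \<omega> out of an inductive set.\<close>

definition natp :: "'a \<Rightarrow> bool" where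
  "natp x \<longleftrightarrow> (\<forall>y\<in>el x. el y \<subseteq> el x) \<and> (\<forall>y. y = x \<or> y \<in> el x \<longrightarrow> y = emp \<or> (\<exists>z. y = suc z))"

lemma natp_num: "natp (num n)"
proof -
  have "num m = emp \<or> (\<exists>z. num m = suc z)" for m by (cases m) auto
  then show ?thesis unfolding natp_def by (auto simp: el_num)
qed

lemma natp_iff: "natp x \<longleftrightarrow> x \<in> range num"
proof
  show "natp x \<Longrightarrow> x \<in> range num"
  proof (induction x rule: E_induct)
    case (step x)
    then consider "x = emp" | z where "x = suc z" unfolding natp_def by blast
    then show ?case
    proof cases
      case 1 then show ?thesis by (metis num.simps(1) rangeI)
    next
      case 2
      have z: "z \<in> el x" by (simp add: 2)
      have "el u \<subseteq> el z" if "u \<in> el z" for u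
      proof
        fix v assume v: "v \<in> el u"
        have "u \<in> el x" using that 2 by simp
        then have "v \<in> el x" using step.prems v unfolding natp_def by blast
        moreover have "v \<noteq> z" using v that E_asym by blast
        ultimately show "v \<in> el z" using 2 by simp
      qed
      moreover have "\<forall>y. y = z \<or> y \<in> el z \<longrightarrow> y = emp \<or> (\<exists>z. y = suc z)"
        using step.prems 2 unfolding natp_def by simp
      ultimately have "natp z" unfolding natp_def by blast
      then obtain n where "z = num n" using step.IH[OF z] by blast
      then have "x = num (Suc n)" using 2 by simp
      then show ?thesis by blast
    qed
  qed
qed (use natp_num in auto)

definition om :: 'a where "om = mk (range num)"

lemma el_om: "el om = range num"
proof -
  have "\<exists>w. (\<exists>e\<in>el w. el e = {}) \<and> (\<forall>x\<in>el w. \<exists>y\<in>el w. el y = insert x (el x))"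
    using ZFC unfolding ZFC_def by (elim conjE)
  then obtain w where w: "emp \<in> el w" "\<And>x. x \<in> el w \<Longrightarrow> suc x \<in> el w"
    by (auto simp: emp_iff[symmetric] suc_iff)
  have "num n \<in> el w" for n by (induction n) (auto simp: w)
  moreover have "iss {x \<in> el w. natp x}" by (rule sep) (unfold natp_def, intro dfI)
  ultimately have "iss (range num)" by (auto simp: natp_iff elim!: back_subst[of iss])
  then show ?thesis by (simp add: om_def el_mk)
qed

lemma num_om [simp]: "num n \<in> el om" by (simp add: el_om)

lemma omE: "x \<in> el om \<Longrightarrow> (\<And>n. x = num n \<Longrightarrow> thesis) \<Longrightarrow> thesis"
  by (auto simp: el_om)

lemma is_omega_iff: "is_omega E w \<longleftrightarrow> w = om"
  using ext[of w om] by (auto simp: is_omega_def is_numeral_iff el_om image_def)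

definition cbl :: "'a \<Rightarrow> bool" where
  "cbl x \<longleftrightarrow> (\<exists>f. inj_on (app f) (el x) \<and> app f ` el x \<subseteq> el om)"

lemma cbl_lepoll: "cbl x \<longleftrightarrow> lepoll_in E x om" by (simp add: cbl_def lepoll_iff)

lemma countable_iff: "countable_in E x \<longleftrightarrow> cbl x"
  by (simp add: countable_in_def is_omega_iff cbl_lepoll)

lemma df_cbl [dfI]: "tmu t \<Longrightarrow> dfu (\<lambda>s. cbl (t s))"
  by (rule df_1[of cbl]) (unfold cbl_def inj_on_def image_subset_iff, intro dfI)

lemma cbl_subset: "cbl b \<Longrightarrow> el a \<subseteq> el b \<Longrightarrow> cbl a"
  unfolding cbl_lepoll using lepoll_trans lepoll_subset by blast

lemma cbl_image: "tmu (\<lambda>s. h (s 0)) \<Longrightarrow> cbl a \<Longrightarrow> cbl (mk (h ` el a))"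
  unfolding cbl_lepoll using lepoll_trans lepoll_image el_img by blast

lemma cbl_finite: assumes "finite (el a)" shows "cbl a"
proof -
  obtain i :: "'a \<Rightarrow> nat" where i: "inj_on i (el a)"
    using assms finite_imp_inj_to_nat_seg by blast
  define f where "f = mk ((\<lambda>x. pr x (num (i x))) ` el a)"
  have f: "el f = (\<lambda>x. pr x (num (i x))) ` el a"
    unfolding f_def by (rule el_mk, rule iss_finite) (simp add: assms)
  have "app f x = num (i x)" if "x \<in> el a" for x
    by (rule app_eq) (use that in \<open>auto simp: f\<close>)
  then show ?thesis unfolding cbl_def by (intro exI[of _ f]) (use i in \<open>auto simp: inj_on_def\<close>)
qed

definition fin :: "'a \<Rightarrow> bool" where
  "fin p \<longleftrightarrow> (\<exists>n\<in>el om. \<exists>f. inj_on (app f) (el p) \<and> app f ` el p \<subseteq> el n)"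

text \<open>The numerals of the model are the true ones, and every externally finite collection of
  elements is a set of the model. Hence internal and external finiteness agree, which admits
  \<open>finite\<close> into definable predicates.\<close>

lemma fin_iff: "fin p \<longleftrightarrow> finite (el p)"
proof
  assume "fin p"
  then obtain n f where "inj_on (app f) (el p)" "app f ` el p \<subseteq> el (num n)"
    unfolding fin_def by (auto simp: el_om)
  moreover have "finite (el (num n))" by (simp add: el_num)
  ultimately show "finite (el p)" by (metis finite_imageD finite_subset)
next
  assume fin: "finite (el p)"
  then obtain i :: "'a \<Rightarrow> nat" and n where i: "inj_on i (el p)" "i ` el p = {k. k < n}"
    using finite_imp_inj_to_nat_seg by metis
  define f where "f = mk ((\<lambda>x. pr x (num (i x))) ` el p)"
  have f: "el f = (\<lambda>x. pr x (num (i x))) ` el p"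
    unfolding f_def by (rule el_mk, rule iss_finite) (simp add: fin)
  have "app f x = num (i x)" if "x \<in> el p" for x
    by (rule app_eq) (use that in \<open>auto simp: f\<close>)
  then have "inj_on (app f) (el p) \<and> app f ` el p \<subseteq> el (num n)"
    using i by (auto simp: inj_on_def)
  then show "fin p" unfolding fin_def using num_om by blast
qed

lemma df_finite [dfI]: "tmu t \<Longrightarrow> dfu (\<lambda>s. finite (el (t s)))"
  unfolding fin_iff[symmetric]
  by (rule df_1[of fin]) (unfold fin_def inj_on_def image_subset_iff, intro dfI)

subsection \<open>Recursion\<close>

text \<open>The step sees only the set of the earlier values. \<open>wfrec\<close> defines the
  function externally; that the sets of earlier values exist in the model and that the function is
  definable is shown through attempts.\<close>

definition rec :: "('a \<Rightarrow> 'a) \<Rightarrow> 'a \<Rightarrow> 'a" where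
  "rec \<Phi> = wfrec {(x, y). E x y} (\<lambda>f x. \<Phi> (mk (f ` el x)))"

lemma rec_eq: "rec \<Phi> x = \<Phi> (mk (rec \<Phi> ` el x))"
proof -
  have "wf {(x, y). E x y}" using wf by (simp add: wfp_def)
  from wfrec[OF this, of "\<lambda>f x. \<Phi> (mk (f ` el x))" x]
  have "rec \<Phi> x = \<Phi> (mk (cut (rec \<Phi>) {(x, y). E x y} x ` el x))" by (simp add: rec_def)
  also have "cut (rec \<Phi>) {(x, y). E x y} x ` el x = rec \<Phi> ` el x"
    by (auto simp: cut_apply E_iff intro!: image_cong)
  finally show ?thesis .
qed

text \<open>An attempt is an approximation to the recursion, closed under predecessors; w is the set
  of the values at the elements of x.\<close>

definition att :: "('a \<Rightarrow> 'a) \<Rightarrow> 'a \<Rightarrow> bool" where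
  "att \<Phi> f \<longleftrightarrow> (\<forall>z\<in>el f. \<exists>x y. z = pr x y \<and> (\<forall>v\<in>el x. \<exists>u. pr v u \<in> el f) \<and>
     (\<exists>w. (\<forall>u. u \<in> el w \<longleftrightarrow> (\<exists>v\<in>el x. pr v u \<in> el f)) \<and> y = \<Phi> w))"

lemma att_rec: "att \<Phi> f \<Longrightarrow> pr x y \<in> el f \<Longrightarrow> y = rec \<Phi> x"
proof (induction x arbitrary: y rule: E_induct)
  case (step x)
  from step.prems obtain w where w: "\<forall>v\<in>el x. \<exists>u. pr v u \<in> el f"
    "\<And>u. u \<in> el w \<longleftrightarrow> (\<exists>v\<in>el x. pr v u \<in> el f)" "y = \<Phi> w"
    unfolding att_def by fastforce
  have "el w = rec \<Phi> ` el x"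
    using w(1) step.IH[OF _ step.prems(1)] by (fastforce simp: w(2) set_eq_iff image_iff)
  then show ?case using w(3) rec_eq[of \<Phi> x] by (metis mk_el)
qed

lemma att_D: "att \<Phi> f \<Longrightarrow> pr x y \<in> el f \<Longrightarrow> v \<in> el x \<Longrightarrow> pr v (rec \<Phi> v) \<in> el f"
proof -
  assume a: "att \<Phi> f" "pr x y \<in> el f" "v \<in> el x"
  then obtain u where "pr v u \<in> el f" unfolding att_def by fastforce
  with att_rec[OF a(1) this] show ?thesis by simp
qed

lemma att_I:
  assumes "\<And>z. z \<in> el f \<Longrightarrow> \<exists>x. z = pr x (rec \<Phi> x) \<and> (\<forall>v\<in>el x. pr v (rec \<Phi> v) \<in> el f) \<and> iss (rec \<Phi> ` el x)"
  shows "att \<Phi> f"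
  unfolding att_def
proof
  fix z assume "z \<in> el f"
  then obtain x where x: "z = pr x (rec \<Phi> x)" "\<forall>v\<in>el x. pr v (rec \<Phi> v) \<in> el f" "iss (rec \<Phi> ` el x)"
    using assms by blast
  have "u = rec \<Phi> v" if "pr v u \<in> el f" for u v using assms[OF that] by auto
  then have "\<forall>u. u \<in> el (mk (rec \<Phi> ` el x)) \<longleftrightarrow> (\<exists>v\<in>el x. pr v u \<in> el f)"
    using x by (auto simp: el_mk)
  then show "\<exists>x y. z = pr x y \<and> (\<forall>v\<in>el x. \<exists>u. pr v u \<in> el f) \<and>
     (\<exists>w. (\<forall>u. u \<in> el w \<longleftrightarrow> (\<exists>v\<in>el x. pr v u \<in> el f)) \<and> y = \<Phi> w)"
    using x rec_eq[of \<Phi> x] by blast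
qed

lemma att_iss: "att \<Phi> f \<Longrightarrow> pr x y \<in> el f \<Longrightarrow> iss (rec \<Phi> ` el x)"
proof -
  assume a: "att \<Phi> f" "pr x y \<in> el f"
  then obtain w where w: "\<And>u. u \<in> el w \<longleftrightarrow> (\<exists>v\<in>el x. pr v u \<in> el f)"
    unfolding att_def by fastforce
  have "el w = rec \<Phi> ` el x"
    using att_rec[OF a(1)] att_D[OF a] by (auto simp: w set_eq_iff)
  then show ?thesis unfolding iss_def by blast
qed

lemma att_ex:
  assumes \<Phi>: "tmu (\<lambda>s. \<Phi> (s 0))"
  shows "\<exists>f. att \<Phi> f \<and> pr x (rec \<Phi> x) \<in> el f"
proof (induction x rule: E_induct)
  case (step x)
  have [dfI]: "tmu t \<Longrightarrow> tmu (\<lambda>s. \<Phi> (t s))" for t by (rule tm_1[OF \<Phi>])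
  have [dfI]: "tmu t \<Longrightarrow> dfu (\<lambda>s. att \<Phi> (t s))" for t
    by (rule df_1[of "att \<Phi>"]) (unfold att_def, intro dfI)
  define Q where "Q y f \<longleftrightarrow> att \<Phi> f \<and> (\<exists>u. pr y u \<in> el f)" for y f
  have [dfI]: "tmu t \<Longrightarrow> tmu t' \<Longrightarrow> dfu (\<lambda>s. Q (t s) (t' s))" for t t'
    by (rule df_2[of Q]) (unfold Q_def, intro dfI)
  have Q_D: "Q y f \<Longrightarrow> pr y (rec \<Phi> y) \<in> el f" for y f unfolding Q_def using att_rec by blast
  \<comment> \<open>Replacement needs a unique witness, but there are many attempts at y. The least
    one is selected; it is the intersection of all of them.\<close>
  define M where "M y f \<longleftrightarrow> Q y f \<and> (\<forall>f'. Q y f' \<longrightarrow> el f \<subseteq> el f')" for y f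
  have "\<exists>!f. M y f" if y: "y \<in> el x" for y
  proof -
    obtain f0 where f0: "Q y f0" using step.IH[OF y] unfolding Q_def by blast
    define f where "f = mk {z \<in> el f0. \<forall>f'. Q y f' \<longrightarrow> z \<in> el f'}"
    have f: "el f = {z \<in> el f0. \<forall>f'. Q y f' \<longrightarrow> z \<in> el f'}"
      unfolding f_def by (rule el_sep) (intro dfI)
    have "att \<Phi> f"
    proof (rule att_I)
      fix z assume z: "z \<in> el f"
      then obtain a b where ab: "z = pr a b" using f0 unfolding f Q_def att_def by blast
      have 1: "b = rec \<Phi> a" using z f0 ab att_rec unfolding f Q_def by blast
      have "pr v (rec \<Phi> v) \<in> el f" if "v \<in> el a" for v
        using z f0 ab that att_D unfolding f Q_def by blast
      moreover have "iss (rec \<Phi> ` el a)" using z f0 ab att_iss unfolding f Q_def by blast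
      ultimately show "\<exists>x. z = pr x (rec \<Phi> x) \<and> (\<forall>v\<in>el x. pr v (rec \<Phi> v) \<in> el f) \<and> iss (rec \<Phi> ` el x)"
        using ab 1 by blast
    qed
    moreover have "pr y (rec \<Phi> y) \<in> el f" using Q_D f0 by (auto simp: f)
    ultimately have "M y f" unfolding M_def using f by (auto simp: Q_def)
    moreover have "g = f" if "M y g" for g
      using that \<open>M y f\<close> unfolding M_def by (metis ext subset_antisym)
    ultimately show ?thesis by blast
  qed
  note exM = this
  have "iss {f. \<exists>y\<in>el x. M y f}"
    by (rule repl_rel, unfold M_def, intro dfI, fold M_def, rule exM)
  then obtain T where T: "el T = {f. \<exists>y\<in>el x. M y f}" unfolding iss_def by blast
  have FD: "\<exists>f. att \<Phi> f \<and> z \<in> el f \<and> f \<in> el T" if "z \<in> el (bun T)" for z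
    using that by (auto simp: T M_def Q_def)
  have F: "pr v (rec \<Phi> v) \<in> el (bun T)" if v: "v \<in> el x" for v
  proof -
    obtain f where "M v f" using exM[OF v] by blast
    then have "f \<in> el T" "pr v (rec \<Phi> v) \<in> el f" using v Q_D unfolding M_def by (auto simp: T M_def)
    then show ?thesis by auto
  qed
  have issx: "iss (rec \<Phi> ` el x)"
  proof -
    have "iss {u. \<exists>v\<in>el x. pr v u \<in> el (bun T)}"
    proof (rule repl_rel)
      show "dfu (\<lambda>s. pr (s 0) (s (Suc 0)) \<in> el (bun T))" by (intro dfI)
      show "\<exists>!u. pr v u \<in> el (bun T)" if "v \<in> el x" for v
        using F[OF that] FD att_rec by blast
    qed
    also have "{u. \<exists>v\<in>el x. pr v u \<in> el (bun T)} = rec \<Phi> ` el x"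
      using F FD att_rec by blast
    finally show ?thesis .
  qed
  have "att \<Phi> (ins (pr x (rec \<Phi> x)) (bun T))"
  proof (rule att_I)
    fix z assume "z \<in> el (ins (pr x (rec \<Phi> x)) (bun T))"
    then consider "z = pr x (rec \<Phi> x)" | f where "att \<Phi> f" "z \<in> el f" "f \<in> el T"
      using FD by (metis el_ins insertE)
    then show "\<exists>x'. z = pr x' (rec \<Phi> x') \<and>
      (\<forall>v\<in>el x'. pr v (rec \<Phi> v) \<in> el (ins (pr x (rec \<Phi> x)) (bun T))) \<and> iss (rec \<Phi> ` el x')"
    proof cases
      case 1 then show ?thesis using F issx by auto
    next
      case 2
      then obtain a b where ab: "z = pr a b" unfolding att_def by blast
      show ?thesis
        using 2 ab att_rec[OF 2(1), of a b] att_D[OF 2(1), of a b] att_iss[OF 2(1), of a b] by auto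
    qed
  qed
  then show ?case by (intro exI conjI) auto
qed

lemma tm_rec:
  assumes "tmu (\<lambda>s. \<Phi> (s 0) (s (Suc 0)))"
  shows "tmu (\<lambda>s. rec (\<Phi> (s 0)) (s (Suc 0)))"
proof -
  have [dfI]: "tmu t \<Longrightarrow> tmu t' \<Longrightarrow> tmu (\<lambda>s. \<Phi> (t s) (t' s))" for t t' by (rule tm_2[OF assms])
  have "y = rec (\<Phi> p) x \<longleftrightarrow> (\<exists>f. att (\<Phi> p) f \<and> pr x y \<in> el f)" for p x y
  proof -
    have "tmu (\<lambda>s. \<Phi> p (s 0))" by (intro dfI)
    from att_ex[OF this] show ?thesis using att_rec by blast
  qed
  then show ?thesis unfolding tmu_def by simp (unfold att_def, intro dfI)
qed

lemma tm_rec1: "tmu (\<lambda>s. \<Phi> (s 0)) \<Longrightarrow> tmu t \<Longrightarrow> tmu (\<lambda>s. rec \<Phi> (t s))"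
  using tm_1[of "rec \<Phi>"] tm_2[OF tm_rec[of "\<lambda>_. \<Phi>"], of "\<lambda>s. undefined" "\<lambda>s. s 0"]
    tm_rename[of UNIV UNIV E "\<lambda>s. \<Phi> (s 0)" Suc] by (simp add: dfI)

end

context wfm begin

section \<open>Ordinals, well-ordering and \<omega>_1\<close>

lemma ord_trans: "is_ordinal E a \<Longrightarrow> x \<in> el a \<Longrightarrow> y \<in> el x \<Longrightarrow> y \<in> el a"
  by (auto simp: is_ordinal_def transitive_in_def)

lemma ord_mem: "is_ordinal E a \<Longrightarrow> x \<in> el a \<Longrightarrow> is_ordinal E x"
  unfolding is_ordinal_def transitive_in_def by blast

lemma ord_cmp:
  "is_ordinal E a \<Longrightarrow> is_ordinal E b \<Longrightarrow> a \<in> el b \<or> a = b \<or> b \<in> el a"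
proof (induction a arbitrary: b rule: E_induct)
  case (step a)
  note IHa = step.IH and a = step.prems(1)
  show ?case using step.prems(2)
  proof (induction b rule: E_induct)
    case (step b)
    show ?case
    proof (rule ccontr)
      assume n: "\<not> (a \<in> el b \<or> a = b \<or> b \<in> el a)"
      have "x \<in> el b" if "x \<in> el a" for x
        using IHa[OF that ord_mem[OF a that] step.prems] n that ord_trans[OF a that] by blast
      moreover have "y \<in> el a" if "y \<in> el b" for y
        using step.IH[OF that ord_mem[OF step.prems that]] n that ord_trans[OF step.prems that] by blast
      ultimately show False using n ext[of a b] by blast
    qed
  qed
qed

lemma ord_subset: "is_ordinal E a \<Longrightarrow> is_ordinal E b \<Longrightarrow> a = b \<or> a \<in> el b \<longleftrightarrow> el a \<subseteq> el b"
  using ord_cmp[of a b] ord_trans[of b] E_irrefl ext by blast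

lemma ord_initial:
  assumes "is_ordinal E k" "A \<subseteq> el k" "\<And>x y. x \<in> A \<Longrightarrow> y \<in> el x \<Longrightarrow> y \<in> A"
  shows "A = el k \<or> (\<exists>a\<in>el k. A = el a)"
proof (cases "el k \<subseteq> A")
  case False
  then obtain x where "x \<in> el k - A" by blast
  from E_min[OF this] obtain a where a: "a \<in> el k" "a \<notin> A" "\<And>z. z \<in> el a \<Longrightarrow> z \<notin> el k - A" by blast
  have "el a \<subseteq> A" using a ord_trans[OF assms(1)] by blast
  moreover have "x \<in> el a" if "x \<in> A" for x
    using ord_cmp[OF ord_mem[OF assms(1), of x] ord_mem[OF assms(1) a(1)]] assms(2,3) that a(2) by blast
  ultimately show ?thesis using a(1) by blast
qed (use assms in blast)

end

context zfc begin

lemma df_ord [dfI]: "tmu t \<Longrightarrow> dfu (\<lambda>s. is_ordinal E (t s))"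
  by (rule df_1[of "is_ordinal E"]) (unfold is_ordinal_def transitive_in_def, intro dfI)

lemma ord_suc: "is_ordinal E a \<Longrightarrow> is_ordinal E (suc a)"
  by (auto simp: is_ordinal_def transitive_in_def)

lemma choice_fn:
  assumes P: "dfu (\<lambda>s. P (s 0) (s (Suc 0)))"
    and ex: "\<And>w. el w \<subseteq> el a \<Longrightarrow> el w \<noteq> {} \<Longrightarrow> \<exists>y\<in>el w. P w y"
  obtains c where "\<And>w. el w \<subseteq> el a \<Longrightarrow> el w \<noteq> {} \<Longrightarrow> app c w \<in> el w \<and> P w (app c w)"
proof -
  note [dfI] = df_2[OF P]
  have 1: "dfu (\<lambda>s. s (Suc 0) \<in> el (s 0) \<and> P (s 0) (s (Suc 0)))" by (intro dfI)
  have 2: "\<exists>y\<in>el a. y \<in> el w \<and> P w y" if "w \<in> el (dif (Pw a) (up emp emp))" for w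
    using ex[of w] that by (auto simp: emp_iff)
  from choice[of "\<lambda>w y. y \<in> el w \<and> P w y", OF 1 2] obtain c where
    "\<And>w. w \<in> el (dif (Pw a) (up emp emp)) \<Longrightarrow> app c w \<in> el a \<and> app c w \<in> el w \<and> P w (app c w)"
    by blast
  then show thesis by (intro that[of c]) (auto simp: emp_iff)
qed

text \<open>Transfinite recursion applies c to what is not yet enumerated. If \<open>a\<close> were
  never exhausted, H would be injective on the ordinals, and replacement along its inverse would
  collect all ordinals into a set. The last conclusion keeps the rule of choice visible, which
  \<open>lepoll_w1\<close> exploits.\<close>

lemma numeration:
  assumes c: "\<And>w. el w \<subseteq> el a \<Longrightarrow> el w \<noteq> {} \<Longrightarrow> app c w \<in> el w"
  obtains \<theta> H where "tmu (\<lambda>s. H (s 0))" "is_ordinal E \<theta>" "inj_on H (el \<theta>)" "H ` el \<theta> = el a"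
    "\<And>\<beta>. \<beta> \<in> el \<theta> \<Longrightarrow> H \<beta> = app c (dif a (mk (H ` el \<beta>)))"
proof -
  define \<Phi> where "\<Phi> w = (if el (dif a w) = {} then a else app c (dif a w))" for w
  define H where "H = rec \<Phi>"
  have "tmu (\<lambda>s. \<Phi> (s 0))" unfolding \<Phi>_def by (intro dfI)
  then have tmH: "tmu t \<Longrightarrow> tmu (\<lambda>s. H (t s))" for t unfolding H_def by (rule tm_rec1)
  note [dfI] = tmH
  have elH: "el (mk (H ` el x)) = H ` el x" for x by (rule el_img) (intro dfI)
  have H: "H x = (if el a \<subseteq> H ` el x then a else app c (dif a (mk (H ` el x))))" for x
    using rec_eq[of \<Phi> x] by (auto simp: H_def[symmetric] \<Phi>_def elH)
  have Hin: "H x \<in> el a \<and> H x \<notin> H ` el x" if "\<not> el a \<subseteq> H ` el x" for x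
    using c[of "dif a (mk (H ` el x))"] that H[of x] by (auto simp: elH)
  have inj: "x = y" if "is_ordinal E x" "is_ordinal E y" "H x = H y"
    "\<not> el a \<subseteq> H ` el x" "\<not> el a \<subseteq> H ` el y" for x y
    using ord_cmp[OF that(1,2)] that(3) Hin[OF that(4)] Hin[OF that(5)] by (metis imageI)
  have "\<exists>x. is_ordinal E x \<and> el a \<subseteq> H ` el x"
  proof (rule ccontr)
    assume "\<not> ?thesis"
    then have n: "\<And>x. is_ordinal E x \<Longrightarrow> \<not> el a \<subseteq> H ` el x" by blast
    define A where "A = mk {b \<in> el a. \<exists>x. is_ordinal E x \<and> H x = b}"
    have A: "el A = {b \<in> el a. \<exists>x. is_ordinal E x \<and> H x = b}"
      unfolding A_def by (rule el_sep) (intro dfI)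
    have "\<exists>!x. is_ordinal E x \<and> H x = b" if b: "b \<in> el A" for b
    proof -
      obtain x where x: "is_ordinal E x" "H x = b" using b unfolding A by blast
      then have "y = x" if "is_ordinal E y \<and> H y = b" for y
        using inj[of y x] n that by simp
      then show ?thesis using x by blast
    qed
    then have "iss {x. \<exists>b\<in>el A. is_ordinal E x \<and> H x = b}"
      by (intro repl_rel) (intro dfI)
    then obtain Ord where Ord: "el Ord = {x. \<exists>b\<in>el A. is_ordinal E x \<and> H x = b}"
      unfolding iss_def by blast
    have O: "x \<in> el Ord \<longleftrightarrow> is_ordinal E x" for x using Hin[OF n] by (auto simp: Ord A)
    have "transitive_in E Ord" unfolding transitive_in_def using O ord_mem by blast
    moreover have "\<forall>x\<in>el Ord. transitive_in E x" using O by (auto simp: is_ordinal_def)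
    ultimately have "is_ordinal E Ord" unfolding is_ordinal_def by blast
    then show False using O[of Ord] by simp
  qed
  then obtain x0 where "x0 \<in> {x. is_ordinal E x \<and> el a \<subseteq> H ` el x}" by blast
  from E_min[OF this] obtain \<theta> where \<theta>: "is_ordinal E \<theta>" "el a \<subseteq> H ` el \<theta>"
    "\<And>\<beta>. \<beta> \<in> el \<theta> \<Longrightarrow> \<not> el a \<subseteq> H ` el \<beta>" using ord_mem by blast
  show thesis
  proof
    show "tmu (\<lambda>s. H (s 0))" by (intro dfI)
    show "is_ordinal E \<theta>" by fact
    show "inj_on H (el \<theta>)" using inj \<theta>(3) ord_mem[OF \<theta>(1)] by (auto simp: inj_on_def)
    show "H ` el \<theta> = el a" using \<theta>(2,3) Hin by blast
    show "\<And>\<beta>. \<beta> \<in> el \<theta> \<Longrightarrow> H \<beta> = app c (dif a (mk (H ` el \<beta>)))"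
      subgoal for \<beta> using H[of \<beta>] \<theta>(3)[of \<beta>] by (simp only: if_False)
      done
  qed
qed

definition is_w1 :: "'a \<Rightarrow> bool" where
  "is_w1 k \<longleftrightarrow> is_ordinal E k \<and> \<not> cbl k \<and> (\<forall>a\<in>el k. cbl a)"

text \<open>The power set of \<omega> is enumerated along an ordinal, a diagonal set shows that this
  ordinal is uncountable, and well-foundedness gives a least uncountable one.\<close>

lemma ex_w1: "\<exists>k. is_w1 k"
proof -
  have 1: "dfu (\<lambda>s. True)" by (rule df_bool)
  obtain c where c: "\<And>w. el w \<subseteq> el (Pw om) \<Longrightarrow> el w \<noteq> {} \<Longrightarrow> app c w \<in> el w"
    by (rule choice_fn[of "\<lambda>_ _. True", OF 1, of "Pw om"]) blast+
  obtain \<theta> H where H: "tmu (\<lambda>s. H (s 0))" "is_ordinal E \<theta>" "inj_on H (el \<theta>)" "H ` el \<theta> = el (Pw om)"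
    by (rule numeration[OF c]) blast+
  note [dfI] = tm_1[OF H(1)]
  have "\<not> cbl \<theta>"
  proof
    assume "cbl \<theta>"
    then obtain f where f: "inj_on (app f) (el \<theta>)" "app f ` el \<theta> \<subseteq> el om" unfolding cbl_def by blast
    define D where "D = mk {n \<in> el om. \<forall>b\<in>el \<theta>. app f b = n \<longrightarrow> n \<notin> el (H b)}"
    have D: "el D = {n \<in> el om. \<forall>b\<in>el \<theta>. app f b = n \<longrightarrow> n \<notin> el (H b)}"
      unfolding D_def by (rule el_sep) (intro dfI)
    then have "D \<in> H ` el \<theta>" by (auto simp: H(4))
    then obtain b where b: "b \<in> el \<theta>" "D = H b" by blast
    have "app f b \<in> el om" using f(2) b(1) by blast
    then have "app f b \<in> el D \<longleftrightarrow> (\<forall>b'\<in>el \<theta>. app f b' = app f b \<longrightarrow> app f b \<notin> el (H b'))"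
      by (simp add: D)
    also have "\<dots> \<longleftrightarrow> app f b \<notin> el (H b)" using f(1) b(1) unfolding inj_on_def by blast
    finally show False by (simp add: b(2))
  qed
  with H(2) have "\<theta> \<in> {k. is_ordinal E k \<and> \<not> cbl k}" by blast
  from E_min[OF this] show ?thesis unfolding is_w1_def using ord_mem by blast
qed

definition w1 :: 'a where "w1 = (SOME k. is_w1 k)"

lemma w1: "is_ordinal E w1" "\<not> cbl w1" "a \<in> el w1 \<Longrightarrow> cbl a"
proof -
  have "is_w1 w1" unfolding w1_def by (rule someI_ex[OF ex_w1])
  then show "is_ordinal E w1" "\<not> cbl w1" "a \<in> el w1 \<Longrightarrow> cbl a" unfolding is_w1_def by blast+
qed

lemma w1_mem: "is_ordinal E a \<Longrightarrow> cbl a \<Longrightarrow> a \<in> el w1"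
  using ord_cmp[OF _ w1(1), of a] w1(2) cbl_subset[of a w1] ord_subset[OF w1(1), of a] by blast

lemma w1_ord: "a \<in> el w1 \<Longrightarrow> is_ordinal E a"
  using ord_mem w1(1) by blast

subsection \<open>Arithmetic and countable sets\<close>

text \<open>For numerals m + n is the union of m and {m + k | k < n}, and the product of m and n is
  the union over k < n of the product of m and k, plus m. Both fit a recursion that sees only the
  set of earlier values.\<close>

definition add :: "'a \<Rightarrow> 'a \<Rightarrow> 'a" where "add m = rec (un m)"
definition mul :: "'a \<Rightarrow> 'a \<Rightarrow> 'a" where
  "mul m = rec (\<lambda>w. bun (mk ((\<lambda>u. add u m) ` el w)))"

lemma tm_add [dfI]: "tmu t1 \<Longrightarrow> tmu t2 \<Longrightarrow> tmu (\<lambda>s. add (t1 s) (t2 s))"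
  by (rule tm_2[of add]) (unfold add_def, rule tm_rec, intro dfI)

lemma tm_mul [dfI]: "tmu t1 \<Longrightarrow> tmu t2 \<Longrightarrow> tmu (\<lambda>s. mul (t1 s) (t2 s))"
  by (rule tm_2[of mul]) (unfold mul_def, rule tm_rec, intro dfI)

lemma add_num: "add (num m) (num n) = num (m + n)"
proof (induction n rule: less_induct)
  case (less n)
  have "el (mk (add (num m) ` el (num n))) = add (num m) ` el (num n)" by (rule el_img) (intro dfI)
  also have "\<dots> = num ` ((+) m ` {..<n})" using less by (auto simp: el_num image_image)
  also have "(+) m ` {..<n} = {m..<m + n}" by (simp add: lessThan_atLeast0 add.commute)
  finally have "el (add (num m) (num n)) = num ` ({..<m} \<union> {m..<m + n})"
    unfolding add_def by (subst rec_eq) (simp add: el_num image_Un)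
  also have "{..<m} \<union> {m..<m + n} = {..<m + n}" by auto
  finally show ?case using ext[of "add (num m) (num n)" "num (m + n)"] el_num[of "m + n"] by blast
qed

lemma mul_num: "mul (num m) (num n) = num (m * n)"
proof (induction n rule: less_induct)
  case (less n)
  let ?\<Phi> = "\<lambda>w. bun (mk ((\<lambda>u. add u (num m)) ` el w))"
  have "el (mk (mul (num m) ` el (num n))) = mul (num m) ` el (num n)" by (rule el_img) (intro dfI)
  also have "\<dots> = num ` ((*) m ` {..<n})" using less by (auto simp: el_num image_image)
  finally have 1: "el (mk (mul (num m) ` el (num n))) = num ` ((*) m ` {..<n})" .
  have add_img: "el (mk ((\<lambda>u. add u (num m)) ` el w)) = (\<lambda>u. add u (num m)) ` el w" for w
    by (rule el_img) (intro dfI)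
  have mul: "mul (num m) (num n) = ?\<Phi> (mk (mul (num m) ` el (num n)))"
    unfolding mul_def by (rule rec_eq)
  have "el (mul (num m) (num n)) = (\<Union>u\<in>num ` ((*) m ` {..<n}). el (add u (num m)))"
    by (subst mul, simp only: el_bun add_img, simp only: 1 image_image)
  also have "\<dots> = (\<Union>k<n. el (num (m * k + m)))" by (simp add: add_num)
  also have "\<dots> = num ` {..<m * n}"
  proof -
    have "(\<Union>k<n. {..<m * k + m}) = {..<m * n}"
    proof (cases n)
      case (Suc n')
      have le: "m * k + m \<le> m * n" if "k < n" for k
        using mult_le_mono2[of "Suc k" n m] that by simp
      have "(\<Union>k<n. {..<m * k + m}) \<subseteq> {..<m * n}" by (auto intro: less_le_trans[OF _ le])
      moreover have "{..<m * n' + m} \<subseteq> (\<Union>k<n. {..<m * k + m})"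
        using UN_upper[of n' "{..<n}" "\<lambda>k. {..<m * k + m}"] Suc by blast
      moreover have "m * n = m * n' + m" using Suc by simp
      ultimately show ?thesis by (simp only: subset_antisym)
    qed simp
    then show ?thesis by (simp add: el_num image_UN[symmetric])
  qed
  finally show ?case using ext[of "mul (num m) (num n)" "num (m * n)"] el_num[of "m * n"] by blast
qed

text \<open>The graph of \<open>prod_encode\<close>, with the equation doubled to avoid the division
  in the triangular number.\<close>

definition PE :: "'a \<Rightarrow> 'a \<Rightarrow> 'a \<Rightarrow> bool" where
  "PE x y c \<longleftrightarrow> add c c = add (mul (add x y) (suc (add x y))) (add x x)"

lemma df_PE [dfI]: "tmu t1 \<Longrightarrow> tmu t2 \<Longrightarrow> tmu t3 \<Longrightarrow> dfu (\<lambda>s. PE (t1 s) (t2 s) (t3 s))"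
  unfolding PE_def by (intro dfI)

lemma PE_num: "PE (num x) (num y) (num c) \<longleftrightarrow> c = prod_encode (x, y)"
proof -
  have t: "2 * triangle n = n * Suc n" for n by (induction n) auto
  have "c = prod_encode (x, y) \<longleftrightarrow> c + c = (x + y) * Suc (x + y) + (x + x)"
    unfolding prod_encode_def split t[symmetric] by linarith
  then show ?thesis by (simp add: PE_def add_num mul_num flip: num.simps(2))
qed

lemma PE_omD: "PE x y c \<Longrightarrow> PE x' y' c \<Longrightarrow> x \<in> el om \<Longrightarrow> y \<in> el om \<Longrightarrow> x' \<in> el om \<Longrightarrow> y' \<in> el om \<Longrightarrow>
    c \<in> el om \<Longrightarrow> x = x' \<and> y = y'"
  by (auto elim!: omE simp: PE_num)

lemma PE_ex: "x \<in> el om \<Longrightarrow> y \<in> el om \<Longrightarrow> \<exists>c\<in>el om. PE x y c"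
proof -
  assume "x \<in> el om" "y \<in> el om"
  then obtain m n where "x = num m" "y = num n" by (auto elim!: omE)
  then show ?thesis by (intro bexI[of _ "num (prod_encode (m, n))"]) (simp_all add: PE_num)
qed

lemma cbl_om2: "cbl (tms om om)"
proof -
  have 1: "dfu (\<lambda>s. \<exists>x\<in>el om. \<exists>y\<in>el om. s 0 = pr x y \<and> PE x y (s (Suc 0)))" by (intro dfI)
  have ex: "\<exists>c\<in>el om. \<exists>x\<in>el om. \<exists>y\<in>el om. z = pr x y \<and> PE x y c" if "z \<in> el (tms om om)" for z
    using that PE_ex by fastforce
  obtain f where f: "\<And>z. z \<in> el (tms om om) \<Longrightarrow>
      app f z \<in> el om \<and> (\<exists>x\<in>el om. \<exists>y\<in>el om. z = pr x y \<and> PE x y (app f z))"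
    by (rule choice[OF 1 ex]) blast+
  have "inj_on (app f) (el (tms om om))"
  proof (rule inj_onI)
    fix z z' assume z: "z \<in> el (tms om om)" "z' \<in> el (tms om om)" and eq: "app f z = app f z'"
    obtain x y x' y' where "x \<in> el om" "y \<in> el om" "x' \<in> el om" "y' \<in> el om" "z = pr x y" "z' = pr x' y'"
      "PE x y (app f z)" "PE x' y' (app f z)" using f[OF z(1)] f[OF z(2)] eq by auto
    then show "z = z'" using PE_omD f[OF z(1)] by blast
  qed
  then show ?thesis unfolding cbl_def using f by blast
qed

lemma cbl_UN:
  assumes x: "cbl x" and y: "\<And>y. y \<in> el x \<Longrightarrow> cbl y"
  shows "cbl (bun x)"
proof -
  obtain i where i: "inj_on (app i) (el x)" "app i ` el x \<subseteq> el om" using x unfolding cbl_def by blast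
  let ?P = "\<lambda>y f. inj_on (app f) (el y) \<and> app f ` el y \<subseteq> el om"
  have 1: "dfu (\<lambda>s. ?P (s 0) (s (Suc 0)))" unfolding inj_on_def image_subset_iff by (intro dfI)
  have ex: "\<exists>f\<in>el (Pw (tms (bun x) om)). ?P y f" if yx: "y \<in> el x" for y
  proof -
    obtain f where f: "?P y f" using y[OF yx] unfolding cbl_def by blast
    have t: "tmu (\<lambda>s. app f (s 0))" by (intro dfI)
    have "?P y (lam y (app f))" using f by (simp add: inj_on_def image_subset_iff app_lam[OF t])
    moreover have "lam y (app f) \<in> el (Pw (tms (bun x) om))" using f yx by (auto simp: el_lam[OF t])
    ultimately show ?thesis by blast
  qed
  obtain J where J: "\<And>y. y \<in> el x \<Longrightarrow> ?P y (app J y)" by (rule choice[OF 1 ex]) blast+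
  have 2: "dfu (\<lambda>s. s 0 \<in> el (s (Suc 0)))" by (intro dfI)
  obtain k where k: "\<And>z. z \<in> el (bun x) \<Longrightarrow> app k z \<in> el x \<and> z \<in> el (app k z)"
    by (rule choice[of "\<lambda>z y. z \<in> el y", OF 2, of "bun x" x]) auto
  let ?h = "\<lambda>z. pr (app i (app k z)) (app (app J (app k z)) z)"
  have "lepoll_in E (bun x) (tms om om)"
  proof (rule lepollI[of ?h])
    show "tmu (\<lambda>s. ?h (s 0))" by (intro dfI)
    show "inj_on ?h (el (bun x))"
    proof (rule inj_onI)
      fix z z' assume z: "z \<in> el (bun x)" "z' \<in> el (bun x)" and eq: "?h z = ?h z'"
      have "app k z = app k z'" using eq i(1) k[OF z(1)] k[OF z(2)] by (auto simp: inj_on_def)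
      then show "z = z'" using eq J[of "app k z"] k[OF z(1)] k[OF z(2)] by (auto simp: inj_on_def)
    qed
    show "?h ` el (bun x) \<subseteq> el (tms om om)" using k i(2) J by (auto simp: image_subset_iff)
  qed
  then show ?thesis using cbl_om2 lepoll_trans unfolding cbl_lepoll by blast
qed

lemma el_bun_img: "tmu (\<lambda>s. h (s 0)) \<Longrightarrow> el (bun (mk (h ` el a))) = (\<Union>x\<in>el a. el (h x))"
  unfolding el_bun by (subst el_img) auto

lemma cbl_UN':
  assumes h: "tmu (\<lambda>s. h (s 0))" and "cbl a" "\<And>x. x \<in> el a \<Longrightarrow> cbl (h x)"
  shows "cbl (bun (mk (h ` el a)))"
  by (rule cbl_UN) (use assms cbl_image el_img[OF h] in auto)

lemma cbl_un: "cbl a \<Longrightarrow> cbl b \<Longrightarrow> cbl (un a b)"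
proof -
  assume "cbl a" "cbl b"
  moreover have "cbl (up a b)" by (rule cbl_finite) simp
  ultimately have "cbl (bun (up a b))" by (intro cbl_UN) auto
  then show ?thesis by (rule cbl_subset) auto
qed

lemma cbl_tms: assumes "cbl a" "cbl b" shows "cbl (tms a b)"
proof -
  have t1: "tmu (\<lambda>s. pr x (s 0))" for x by (intro dfI)
  have t: "tmu (\<lambda>s. mk (pr (s 0) ` el b))" by (intro dfI)
  have "cbl (bun (mk ((\<lambda>x. mk (pr x ` el b)) ` el a)))"
    by (rule cbl_UN'[OF t]) (auto simp: assms intro: cbl_image[OF t1])
  then show ?thesis
    by (rule cbl_subset) (auto simp: el_img[OF t] el_img[OF t1])
qed

text \<open>An index is read as the code of a pair whose first component selects the element and
  whose second is arbitrary, so each element is listed infinitely often. The generic condition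
  depends on this repetition.\<close>

lemma cbl_enum:
  assumes a: "cbl a" "y0 \<in> el a"
  obtains f where "\<And>n. app f (num n) \<in> el a"
    "\<And>y m. y \<in> el a \<Longrightarrow> \<exists>i\<ge>m. app f (num i) = y"
proof -
  obtain j where j: "inj_on (app j) (el a)" "app j ` el a \<subseteq> el om" using a(1) unfolding cbl_def by blast
  let ?R = "\<lambda>n y. \<exists>k\<in>el om. PE (app j y) k n"
  let ?P = "\<lambda>n y. (\<exists>y'\<in>el a. ?R n y') \<longrightarrow> ?R n y"
  have 1: "dfu (\<lambda>s. ?P (s 0) (s (Suc 0)))" by (intro dfI)
  obtain f where f: "\<And>n. n \<in> el om \<Longrightarrow> app f n \<in> el a \<and> ?P n (app f n)"
    by (rule choice[OF 1, of om a]) (use a(2) in blast)+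
  show thesis
  proof
    show "app f (num n) \<in> el a" for n using f[of "num n"] by simp
    fix y m assume y: "y \<in> el a"
    then obtain jy where jy: "app j y = num jy" using j(2) omE by (metis imageI subsetD)
    let ?i = "prod_encode (jy, m)"
    have "?R (num ?i) y" unfolding jy by (intro bexI[of _ "num m"]) (simp_all add: PE_num)
    then obtain k where k: "k \<in> el om" "PE (app j (app f (num ?i))) k (num ?i)" using f[of "num ?i"] y by auto
    have "app j (app f (num ?i)) = app j y"
      using PE_omD[OF k(2), of "num jy" "num m"] k(1) j(2) f[of "num ?i"] jy by (auto simp: PE_num)
    then have "app f (num ?i) = y" using j(1) y f[of "num ?i"] by (auto simp: inj_on_def)
    then show "\<exists>i\<ge>m. app f (num i) = y" using le_prod_encode_2 by blast
  qed
qed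

text \<open>Stage n adds the results for all pairs from earlier stages, and the union of these
  \<omega> countable stages is countable. As \<open>op u v\<close> is itself a set of results, many
  operations can be packed into one.\<close>

lemma cbl_closure:
  assumes op: "tmu (\<lambda>s. op (s 0) (s (Suc 0)))"
    and L: "\<And>u v. u \<in> el L \<Longrightarrow> v \<in> el L \<Longrightarrow> cbl (op u v) \<and> el (op u v) \<subseteq> el L"
    and x: "cbl x" "el x \<subseteq> el L"
  obtains C where "cbl C" "el x \<subseteq> el C" "el C \<subseteq> el L"
    "\<And>u v. u \<in> el C \<Longrightarrow> v \<in> el C \<Longrightarrow> el (op u v) \<subseteq> el C"
proof -
  note [dfI] = tm_2[OF op]
  define O1 where "O1 A u = bun (mk (op u ` el A))" for A u
  have t1: "tmu (\<lambda>s. op u (s 0))" for u by (intro dfI)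
  have tO1: "tmu t \<Longrightarrow> tmu t' \<Longrightarrow> tmu (\<lambda>s. O1 (t s) (t' s))" for t t'
    by (rule tm_2[of O1]) (unfold O1_def, intro dfI)
  note [dfI] = tO1
  define O2 where "O2 A = bun (mk (O1 A ` el A))" for A
  have t2: "tmu (\<lambda>s. O1 A (s 0))" for A by (intro dfI)
  have tO2: "tmu t \<Longrightarrow> tmu (\<lambda>s. O2 (t s))" for t
    by (rule tm_1[of O2]) (unfold O2_def, intro dfI)
  note [dfI] = tO2
  have O2: "el (O2 A) = (\<Union>u\<in>el A. \<Union>v\<in>el A. el (op u v))" for A
    by (simp add: O2_def O1_def el_img[OF t1] el_img[OF t2[unfolded O1_def]])
  have cO2: "cbl (O2 A)" if "cbl A" "el A \<subseteq> el L" for A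
    unfolding O2_def O1_def
    by (rule cbl_UN'[OF t2[unfolded O1_def] that(1)], rule cbl_UN'[OF t1 that(1)]) (use that L in blast)
  have O2L: "el (O2 A) \<subseteq> el L" if "el A \<subseteq> el L" for A using that L unfolding O2 by blast
  define H where "H = rec (\<lambda>w. un x (O2 (bun w)))"
  have tH: "tmu t \<Longrightarrow> tmu (\<lambda>s. H (t s))" for t unfolding H_def by (rule tm_rec1) (intro dfI)
  note [dfI] = tH
  have t3: "tmu (\<lambda>s. H (s 0))" by (intro dfI)
  have H: "H n = un x (O2 (bun (mk (H ` el n))))" for n unfolding H_def by (rule rec_eq)
  have HL: "cbl (H (num n)) \<and> el (H (num n)) \<subseteq> el L" for n
  proof (induction n rule: less_induct)
    case (less n)
    have "cbl (num n)" by (rule cbl_finite) (simp add: el_num)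
    then have "cbl (bun (mk (H ` el (num n))))" by (rule cbl_UN'[OF t3]) (use less in \<open>auto simp: el_num\<close>)
    moreover have "el (bun (mk (H ` el (num n)))) \<subseteq> el L"
      unfolding el_bun el_img[OF t3] unfolding el_num by (rule UN_least) (use less in auto)
    ultimately have "cbl (O2 (bun (mk (H ` el (num n)))))" "el (O2 (bun (mk (H ` el (num n))))) \<subseteq> el L"
      using cO2 O2L by blast+
    then show ?case unfolding H[of "num n"] el_un using cbl_un[OF x(1)] x(2) by blast
  qed
  define C where "C = bun (mk (H ` el om))"
  have C: "el C = (\<Union>n. el (H (num n)))" 
    by (simp only: C_def el_bun_img[OF t3]) (simp only: el_om image_image)
  show thesis
  proof
    have "cbl om" unfolding cbl_lepoll by (rule lepoll_subset) simp
    then show "cbl C" unfolding C_def by (rule cbl_UN'[OF t3]) (use HL in \<open>auto elim!: omE\<close>)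
    show "el x \<subseteq> el C" 
    proof -
      have "el x \<subseteq> el (H (num 0))" by (subst H) simp
      then show ?thesis unfolding C by blast
    qed
    show "el C \<subseteq> el L" unfolding C using HL by blast
    fix u v assume "u \<in> el C" "v \<in> el C"
    then obtain m n where "u \<in> el (H (num m))" "v \<in> el (H (num n))" by (auto simp: C)
    then have "u \<in> el (bun (mk (H ` el (num (Suc (max m n))))))" "v \<in> el (bun (mk (H ` el (num (Suc (max m n))))))"
      unfolding el_bun_img[OF t3] unfolding el_num by force+
    then have "el (op u v) \<subseteq> el (H (num (Suc (max m n))))" by (subst H) (auto simp: O2 simp del: num.simps(2) el_bun)
    then show "el (op u v) \<subseteq> el C" unfolding C by blast
  qed
qed

lemma cbl_suc: "cbl a \<Longrightarrow> cbl (suc a)"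
proof -
  assume "cbl a"
  moreover have "cbl (up a a)" by (rule cbl_finite) simp
  ultimately have "cbl (un a (up a a))" by (intro cbl_un)
  then show ?thesis by (rule cbl_subset) auto
qed

lemma w1_suc: "a \<in> el w1 \<Longrightarrow> suc a \<in> el w1"
  using w1_mem[OF ord_suc[OF w1_ord] cbl_suc[OF w1(3)]] by blast

lemma w1_sup:
  assumes "cbl x" "el x \<subseteq> el w1"
  shows "\<exists>b\<in>el w1. \<forall>a\<in>el x. a \<in> el b"
proof -
  have "is_ordinal E (bun x)"
    using assms(2) w1_ord unfolding is_ordinal_def transitive_in_def by auto blast+
  moreover have "cbl (bun x)" by (rule cbl_UN) (use assms w1(3) in auto)
  ultimately have b: "bun x \<in> el w1" by (rule w1_mem)
  have "a \<in> el (suc (bun x))" if "a \<in> el x" for a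
  proof -
    have "is_ordinal E a" using that assms(2) w1_ord by blast
    moreover have "el a \<subseteq> el (bun x)" using that by auto
    ultimately show ?thesis using ord_subset[of a "bun x"] w1_ord[OF b] by auto
  qed
  then show ?thesis using w1_suc[OF b] by blast
qed

text \<open>The set is enumerated by always taking an element of least rank, the rank of y being the
  first \<alpha> with y in \<open>h \<alpha>\<close>. Each proper initial segment then lies in a
  union of countably many of the sets \<open>h \<alpha>\<close>, so its length is countable and the
  enumeration has length at most \<omega>_1.\<close>

lemma lepoll_w1:
  assumes h: "tmu (\<lambda>s. h (s 0))" and a: "el a \<subseteq> (\<Union>\<alpha>\<in>el w1. el (h \<alpha>))"
    and c: "\<And>\<alpha>. \<alpha> \<in> el w1 \<Longrightarrow> cbl (h \<alpha>)"
  shows "lepoll_in E a w1"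
proof -
  note [dfI] = tm_1[OF h]
  let ?P = "\<lambda>w y. \<exists>\<alpha>\<in>el w1. y \<in> el (h \<alpha>) \<and> (\<forall>\<beta>\<in>el \<alpha>. \<forall>z\<in>el w. z \<notin> el (h \<beta>))"
  have 1: "dfu (\<lambda>s. ?P (s 0) (s (Suc 0)))" by (intro dfI)
  have ex: "\<exists>y\<in>el w. ?P w y" if w: "el w \<subseteq> el a" "el w \<noteq> {}" for w
  proof -
    obtain \<alpha>0 where "\<alpha>0 \<in> {\<alpha> \<in> el w1. el w \<inter> el (h \<alpha>) \<noteq> {}}" using w a by blast
    from E_min[OF this] show ?thesis using ord_trans[OF w1(1)] by blast
  qed
  obtain ch where ch: "\<And>w. el w \<subseteq> el a \<Longrightarrow> el w \<noteq> {} \<Longrightarrow> app ch w \<in> el w \<and> ?P w (app ch w)"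
    by (rule choice_fn[OF 1 ex]) blast+
  have ch1: "\<And>w. el w \<subseteq> el a \<Longrightarrow> el w \<noteq> {} \<Longrightarrow> app ch w \<in> el w" using ch by blast
  obtain \<theta> H where H: "tmu (\<lambda>s. H (s 0))" "is_ordinal E \<theta>" "inj_on H (el \<theta>)" "H ` el \<theta> = el a"
    "\<And>\<beta>. \<beta> \<in> el \<theta> \<Longrightarrow> H \<beta> = app ch (dif a (mk (H ` el \<beta>)))"
    by (rule numeration[of a ch]; (rule ch1 | rule that); assumption)
  have elH: "el (mk (H ` el x)) = H ` el x" for x by (rule el_img[OF H(1)])
  have Hs: "\<exists>\<alpha>\<in>el w1. H \<beta> \<in> el (h \<alpha>) \<and> (\<forall>\<gamma>\<in>el \<alpha>. \<forall>z\<in>el a - H ` el \<beta>. z \<notin> el (h \<gamma>))"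
    if b: "\<beta> \<in> el \<theta>" for \<beta>
  proof -
    have "H \<beta> \<in> el a" using H(4) b by blast
    moreover have "H \<beta> \<notin> H ` el \<beta>"
      using H(3) b ord_trans[OF H(2) b] unfolding inj_on_def by (metis E_irrefl imageE)
    ultimately have "el (dif a (mk (H ` el \<beta>))) \<noteq> {}" by (auto simp: elH)
    from ch[OF _ this] H(5)[OF b] show ?thesis by (auto simp: elH)
  qed
  have "cbl \<beta>" if b: "\<beta> \<in> el \<theta>" for \<beta>
  proof -
    obtain \<alpha> where \<alpha>: "\<alpha> \<in> el w1" "H \<beta> \<in> el (h \<alpha>)" using Hs[OF b] by blast
    have sub: "H \<gamma> \<in> el (bun (mk (h ` el (suc \<alpha>))))" if g: "\<gamma> \<in> el \<beta>" for \<gamma>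
    proof -
      have g': "\<gamma> \<in> el \<theta>" using ord_trans[OF H(2) b g] .
      then obtain \<delta> where d: "\<delta> \<in> el w1" "H \<gamma> \<in> el (h \<delta>)"
        "\<And>\<epsilon> z. \<epsilon> \<in> el \<delta> \<Longrightarrow> z \<in> el a - H ` el \<gamma> \<Longrightarrow> z \<notin> el (h \<epsilon>)" using Hs by blast
      have "H \<beta> \<notin> H ` el \<gamma>"
        using H(3) b g' ord_trans[OF H(2) g'] g E_asym[of \<beta> \<gamma>] unfolding inj_on_def by (metis imageE)
      then have "\<alpha> \<notin> el \<delta>" using d(3)[of \<alpha> "H \<beta>"] \<alpha>(2) H(4) b by blast
      then have "\<delta> \<in> el (suc \<alpha>)" using ord_cmp[OF w1_ord[OF \<alpha>(1)] w1_ord[OF d(1)]] by auto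
      then show ?thesis using d(2) unfolding el_bun_img[OF h] by blast
    qed
    have "cbl (bun (mk (h ` el (suc \<alpha>))))"
      by (rule cbl_UN'[OF h cbl_suc[OF w1(3)[OF \<alpha>(1)]]])
        (use c w1_suc[OF \<alpha>(1)] ord_trans[OF w1(1)] in blast)
    moreover have "lepoll_in E \<beta> (bun (mk (h ` el (suc \<alpha>))))"
      by (rule lepollI[OF H(1)]) (use H(3) sub ord_trans[OF H(2) b] in \<open>auto simp: inj_on_def image_subset_iff simp del: el_bun\<close>)
    ultimately show ?thesis using lepoll_trans unfolding cbl_lepoll by blast
  qed
  then have "el \<theta> \<subseteq> el w1" using w1_mem ord_mem[OF H(2)] by blast
  then have "lepoll_in E \<theta> w1" by (rule lepoll_subset)
  moreover have "lepoll_in E a \<theta>" by (rule lepoll_image[OF H(1)]) (simp add: H(4))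
  ultimately show ?thesis using lepoll_trans by blast
qed

end

section \<open>Adding Cohen reals\<close>

text \<open>This takes the place of a \<Delta>-system argument. Every other member conflicts with a
  fixed member A0, hence contains one of finitely many points w. Removing w from the members that
  contain it lowers n, and their conflicts survive because no conflict occurs within a
  member.\<close>

lemma finite_antichain:
  fixes cf :: "'b \<Rightarrow> 'b \<Rightarrow> bool"
  assumes sym: "\<And>z w. cf z w \<Longrightarrow> cf w z" and fin: "\<And>z. finite {w. cf z w}"
  shows "\<lbrakk>\<And>A. A \<in> \<A> \<Longrightarrow> finite A \<and> card A \<le> n \<and> (\<forall>z\<in>A. \<forall>w\<in>A. \<not> cf z w);
    \<And>A B. A \<in> \<A> \<Longrightarrow> B \<in> \<A> \<Longrightarrow> A \<noteq> B \<Longrightarrow> \<exists>z\<in>A. \<exists>w\<in>B. cf z w\<rbrakk> \<Longrightarrow> finite \<A>"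
proof (induction n arbitrary: \<A>)
  case 0
  have "A = {}" if "A \<in> \<A>" for A using 0(1)[OF that] by (metis card_0_eq le_zero_eq)
  then have "\<A> \<subseteq> {{}}" by blast
  then show ?case by (rule finite_subset) simp
next
  case (Suc n)
  show ?case
  proof (cases "\<A> = {}")
    case False
    then obtain A0 where A0: "A0 \<in> \<A>" by blast
    have "finite {B \<in> \<A>. w \<in> B}" for w
    proof -
      let ?B = "{B \<in> \<A>. w \<in> B}"
      have "finite ((\<lambda>B. B - {w}) ` ?B)"
      proof (rule Suc.IH)
        fix A assume "A \<in> (\<lambda>B. B - {w}) ` ?B"
        then obtain B where B: "B \<in> \<A>" "w \<in> B" "A = B - {w}" by blast
        then show "finite A \<and> card A \<le> n \<and> (\<forall>z\<in>A. \<forall>w\<in>A. \<not> cf z w)"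
          using Suc.prems(1)[OF B(1)] by (auto simp: card_Diff_singleton)
      next
        fix A A' assume "A \<in> (\<lambda>B. B - {w}) ` ?B" "A' \<in> (\<lambda>B. B - {w}) ` ?B" and ne: "A \<noteq> A'"
        then obtain B B' where B: "B \<in> \<A>" "w \<in> B" "A = B - {w}" "B' \<in> \<A>" "w \<in> B'" "A' = B' - {w}" by blast
        obtain z z' where z: "z \<in> B" "z' \<in> B'" "cf z z'" using Suc.prems(2)[OF B(1) B(4)] ne B by blast
        have "z \<noteq> w" using z(2,3) Suc.prems(1)[OF B(4)] B(5) by blast
        moreover have "z' \<noteq> w" using z(1,3) Suc.prems(1)[OF B(1)] B(2) by blast
        ultimately show "\<exists>z\<in>A. \<exists>w\<in>A'. cf z w" using z B by blast
      qed
      moreover have "inj_on (\<lambda>B. B - {w}) ?B" by (auto simp: inj_on_def)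
      ultimately show ?thesis by (rule finite_imageD)
    qed
    then have "finite ({A0} \<union> (\<Union>z\<in>A0. \<Union>w\<in>{w. cf z w}. {B \<in> \<A>. w \<in> B}))"
      using Suc.prems(1)[OF A0] fin by blast
    moreover have "\<A> \<subseteq> {A0} \<union> (\<Union>z\<in>A0. \<Union>w\<in>{w. cf z w}. {B \<in> \<A>. w \<in> B})"
      using Suc.prems(2)[OF A0] by blast
    ultimately show ?thesis by (rule finite_subset[rotated])
  qed simp
qed

context zfc begin

section \<open>Conditions, chain condition and generic filters\<close>

definition o0 :: 'a where "o0 = emp"
definition o1 :: 'a where "o1 = suc emp"

lemma o01 [simp]: "o0 \<noteq> o1" "o1 \<noteq> o0"
  by (simp_all add: o0_def o1_def) (metis ins_neq_emp(2))

definition cons :: "'a set \<Rightarrow> bool" where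
  "cons A \<longleftrightarrow> (\<forall>x. \<not> (pr x o0 \<in> A \<and> pr x o1 \<in> A))"

text \<open>A condition is a finite consistent set of literals \<open>pr x o0\<close>,
  \<open>pr x o1\<close>; stronger conditions are larger sets.\<close>

definition Fn :: "'a \<Rightarrow> 'a" where
  "Fn K = mk {p \<in> el (Pw (tms K (up o0 o1))). finite (el p) \<and> (\<forall>x. \<not> (pr x o0 \<in> el p \<and> pr x o1 \<in> el p))}"

lemma el_Fn: "p \<in> el (Fn K) \<longleftrightarrow>
    finite (el p) \<and> (\<forall>z\<in>el p. \<exists>x\<in>el K. \<exists>i. (i = o0 \<or> i = o1) \<and> z = pr x i) \<and> cons (el p)"
proof -
  have "el (Fn K) = {p \<in> el (Pw (tms K (up o0 o1))). finite (el p) \<and> (\<forall>x. \<not> (pr x o0 \<in> el p \<and> pr x o1 \<in> el p))}"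
    unfolding Fn_def by (rule el_sep) (intro dfI)
  moreover have "el p \<subseteq> el (tms K (up o0 o1)) \<longleftrightarrow>
      (\<forall>z\<in>el p. \<exists>x\<in>el K. \<exists>i. (i = o0 \<or> i = o1) \<and> z = pr x i)"
    unfolding subset_eq el_tms el_up by blast
  ultimately show ?thesis unfolding cons_def by (simp only: mem_Collect_eq el_Pw) blast
qed

lemma cons_subset: "cons B \<Longrightarrow> A \<subseteq> B \<Longrightarrow> cons A"
  unfolding cons_def by blast

lemma Fn_subset: "p \<in> el (Fn K) \<Longrightarrow> A \<subseteq> el p \<Longrightarrow> iss A \<and> mk A \<in> el (Fn K) \<and> el (mk A) = A"
  using finite_subset[of A "el p"] cons_subset iss_finite[of A] el_mk[of A] unfolding el_Fn by auto

lemma Fn_un: "p \<in> el (Fn K) \<Longrightarrow> q \<in> el (Fn K) \<Longrightarrow> cons (el p \<union> el q) \<Longrightarrow> un p q \<in> el (Fn K)"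
  unfolding el_Fn by auto

lemma emp_Fn [simp]: "emp \<in> el (Fn K)"
  by (simp add: el_Fn cons_def)

lemma single_Fn: "x \<in> el K \<Longrightarrow> i = o0 \<or> i = o1 \<Longrightarrow>
    up (pr x i) (pr x i) \<in> el (Fn K)"
  by (elim disjE) (simp_all add: el_Fn cons_def)

lemma df_cons [dfI]: "tmu t1 \<Longrightarrow> tmu t2 \<Longrightarrow> dfu (\<lambda>s. cons (el (t1 s) \<union> el (t2 s)))"
  by (rule df_2[of "\<lambda>a b. cons (el a \<union> el b)"]) (unfold cons_def Un_iff, intro dfI)

text \<open>A literal conflicts only with its opposite, so by \<open>finite_antichain\<close> the
  part of an antichain with at most n literals is finite, for each n.\<close>

lemma ccc_Fn:
  assumes A: "el A \<subseteq> el (Fn K)"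
    and anti: "\<And>p q. p \<in> el A \<Longrightarrow> q \<in> el A \<Longrightarrow> p \<noteq> q \<Longrightarrow> \<not> cons (el p \<union> el q)"
  shows "cbl A"
proof -
  define h where "h n = mk {p \<in> el A. \<exists>f. inj_on (app f) (el p) \<and> app f ` el p \<subseteq> el n}" for n
  have h0: "dfu (\<lambda>s. \<exists>f. inj_on (app f) (el (s 0)) \<and> app f ` el (s 0) \<subseteq> el n)" for n
    unfolding inj_on_def image_subset_iff by (intro dfI)
  have elh: "el (h n) = {p \<in> el A. \<exists>f. inj_on (app f) (el p) \<and> app f ` el p \<subseteq> el n}" for n
    unfolding h_def by (rule el_sep[OF h0])
  have th: "tmu (\<lambda>s. h (s 0))" unfolding h_def inj_on_def image_subset_iff by (intro dfI)
  define cf where "cf z w \<longleftrightarrow> (\<exists>x. z = pr x o0 \<and> w = pr x o1 \<or> z = pr x o1 \<and> w = pr x o0)" for z w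
  have "cbl (h n)" if "n \<in> el om" for n
  proof (rule cbl_finite)
    from that obtain k where k: "n = num k" by (rule omE)
    have "finite (el ` el (h n))"
    proof (rule finite_antichain[of cf _ k])
      show "cf z w \<Longrightarrow> cf w z" for z w unfolding cf_def by blast
      show "finite {w. cf z w}" for z
      proof (cases "\<exists>x i. z = pr x i")
        case True
        then obtain x i where z: "z = pr x i" by blast
        have "{w. cf z w} \<subseteq> {pr x o0, pr x o1}" unfolding cf_def z by auto
        then show ?thesis by (rule finite_subset) simp
      next
        case False
        then have "{w. cf z w} = {}" unfolding cf_def by blast
        then show ?thesis by simp
      qed
    next
      fix B assume "B \<in> el ` el (h n)"
      then obtain p f where p: "B = el p" "p \<in> el A" "inj_on (app f) (el p)" "app f ` el p \<subseteq> el n"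
        by (auto simp: elh)
      have pF: "p \<in> el (Fn K)" using p(2) A by blast
      have "finite (el n)" "card (el n) = k" by (simp_all add: k el_num card_image inj_on_def)
      then have "card B \<le> k" using card_inj_on_le[OF p(3,4)] by (simp add: p(1))
      then show "finite B \<and> card B \<le> k \<and> (\<forall>z\<in>B. \<forall>w\<in>B. \<not> cf z w)"
        using pF unfolding el_Fn p(1) cf_def cons_def by blast
    next
      fix B B' assume "B \<in> el ` el (h n)" "B' \<in> el ` el (h n)" "B \<noteq> B'"
      then obtain p q where p: "B = el p" "p \<in> el A" "B' = el q" "q \<in> el A" "p \<noteq> q" by (auto simp: elh)
      have "cons (el p)" "cons (el q)" using p(2,4) A unfolding el_Fn subset_eq by blast+
      then show "\<exists>z\<in>B. \<exists>w\<in>B'. cf z w" using anti[OF p(2,4,5)] unfolding p(1,3) cons_def cf_def by blast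
    qed
    moreover have "inj_on el (el (h n))" using ext by (auto simp: inj_on_def)
    ultimately show "finite (el (h n))" by (rule finite_imageD)
  qed
  moreover have "cbl om" unfolding cbl_lepoll by (rule lepoll_subset) simp
  ultimately have "cbl (bun (mk (h ` el om)))" by (intro cbl_UN'[OF th])
  moreover have "el A \<subseteq> el (bun (mk (h ` el om)))"
  proof
    fix p assume p: "p \<in> el A"
    then have "fin p" using A unfolding fin_iff el_Fn subset_eq by blast
    then show "p \<in> el (bun (mk (h ` el om)))" using p unfolding el_bun_img[OF th] fin_def elh by blast
  qed
  ultimately show ?thesis by (rule cbl_subset)
qed

definition gen :: "'a \<Rightarrow> 'a set \<Rightarrow> bool" where
  "gen K H \<longleftrightarrow> H \<subseteq> el (Fn K) \<and> H \<noteq> {} \<and> (\<forall>p\<in>H. \<forall>q\<in>el (Fn K). el q \<subseteq> el p \<longrightarrow> q \<in> H) \<and>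
     (\<forall>p\<in>H. \<forall>q\<in>H. \<exists>r\<in>H. el p \<subseteq> el r \<and> el q \<subseteq> el r) \<and>
     (\<forall>D. el D \<subseteq> el (Fn K) \<longrightarrow> (\<forall>p\<in>el (Fn K). \<exists>d\<in>el D. el p \<subseteq> el d) \<longrightarrow> (\<exists>d\<in>el D. d \<in> H))"

lemma gen_Fn: "gen K H \<Longrightarrow> p \<in> H \<Longrightarrow> p \<in> el (Fn K)"
  unfolding gen_def by blast

lemma gen_up: "gen K H \<Longrightarrow> p \<in> H \<Longrightarrow> q \<in> el (Fn K) \<Longrightarrow> el q \<subseteq> el p \<Longrightarrow> q \<in> H"
  unfolding gen_def by blast

lemma gen_dir: "gen K H \<Longrightarrow> p \<in> H \<Longrightarrow> q \<in> H \<Longrightarrow> \<exists>r\<in>H. el p \<subseteq> el r \<and> el q \<subseteq> el r"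
  unfolding gen_def by blast

lemma gen_dense:
  assumes "gen K H" "dfu (\<lambda>s. P (s 0))"
    and d: "\<And>p. p \<in> el (Fn K) \<Longrightarrow> \<exists>d\<in>el (Fn K). el p \<subseteq> el d \<and> P d"
  obtains d where "d \<in> H" "P d"
proof -
  define D where "D = mk {d \<in> el (Fn K). P d}"
  have D: "el D = {d \<in> el (Fn K). P d}" unfolding D_def by (rule el_sep) fact
  have "el D \<subseteq> el (Fn K)" "\<forall>p\<in>el (Fn K). \<exists>d\<in>el D. el p \<subseteq> el d" using d unfolding D by blast+
  then have "\<exists>d\<in>el D. d \<in> H" using assms(1) unfolding gen_def by blast
  then show thesis using that unfolding D by blast
qed

lemma gen_ne: "gen K H \<Longrightarrow> emp \<in> H"
  unfolding gen_def using emp_Fn by (metis all_not_in_conv el_emp empty_subsetI)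

lemma gen_lits:
  assumes G: "gen K H" and p: "p \<in> el (Fn K)"
  shows "p \<in> H \<longleftrightarrow> (\<forall>z\<in>el p. \<exists>q\<in>H. z \<in> el q)"
proof
  assume "\<forall>z\<in>el p. \<exists>q\<in>H. z \<in> el q"
  moreover have "finite A \<Longrightarrow> (\<forall>z\<in>A. \<exists>q\<in>H. z \<in> el q) \<Longrightarrow> \<exists>q\<in>H. A \<subseteq> el q" for A
  proof (induction A rule: finite_induct)
    case empty then show ?case using gen_ne[OF G] by blast
  next
    case (insert z A)
    then obtain q q' where q: "q \<in> H" "A \<subseteq> el q" "q' \<in> H" "z \<in> el q'" by auto
    show ?case using gen_dir[OF G q(1,3)] q(2,4) by blast
  qed
  moreover have "finite (el p)" using p by (simp add: el_Fn)
  ultimately obtain q where "q \<in> H" "el p \<subseteq> el q" by blast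
  then show "p \<in> H" using gen_up[OF G _ p] by blast
qed blast

lemma gen_cons: "gen K H \<Longrightarrow> p \<in> H \<Longrightarrow> q \<in> H \<Longrightarrow> cons (el p \<union> el q)"
proof -
  assume G: "gen K H" "p \<in> H" "q \<in> H"
  then obtain r where "r \<in> H" "el p \<subseteq> el r" "el q \<subseteq> el r" using gen_dir by blast
  moreover from this have "cons (el r)" using gen_Fn[OF G(1)] by (simp add: el_Fn)
  ultimately show ?thesis using cons_subset[of "el r" "el p \<union> el q"] by blast
qed

definition pull :: "('a \<Rightarrow> 'a) \<Rightarrow> 'a \<Rightarrow> 'a set \<Rightarrow> 'a set" where
  "pull \<sigma> K' G = {u \<in> el (Fn K'). \<forall>x i. pr x i \<in> el u \<longrightarrow> (\<exists>p\<in>G. pr (\<sigma> x) i \<in> el p)}"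

text \<open>For D dense on the coordinates K' and a condition p on K, the literals of p in the range
  of \<sigma> are pulled back to U, extended to some d in D and pushed forward again. As d respects
  U, the result is compatible with p.\<close>

lemma gen_pull:
  assumes G: "gen K G" and \<sigma>: "tmu (\<lambda>s. \<sigma> (s 0))" "inj_on \<sigma> (el K')" "\<sigma> ` el K' \<subseteq> el K"
  shows "gen K' (pull \<sigma> K' G)"
  unfolding gen_def
proof (intro conjI allI impI ballI)
  note [dfI] = tm_1[OF \<sigma>(1)]
  let ?G = "pull \<sigma> K' G"
  show "?G \<subseteq> el (Fn K')" unfolding pull_def by blast
  have "emp \<in> ?G" unfolding pull_def by simp
  then show "?G \<noteq> {}" by blast
  show "p \<in> ?G \<Longrightarrow> q \<in> el (Fn K') \<Longrightarrow> el q \<subseteq> el p \<Longrightarrow> q \<in> ?G" for p q unfolding pull_def by blast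
  show "\<exists>r\<in>?G. el p \<subseteq> el r \<and> el q \<subseteq> el r" if p: "p \<in> ?G" "q \<in> ?G" for p q
  proof -
    have t: "\<exists>r\<in>G. pr (\<sigma> x) i \<in> el r" if "pr x i \<in> el p \<union> el q" for x i
      using that p unfolding pull_def by blast
    have "cons (el p \<union> el q)" unfolding cons_def
    proof (intro allI notI, elim conjE)
      fix x assume "pr x o0 \<in> el p \<union> el q" "pr x o1 \<in> el p \<union> el q"
      then obtain r r' where r: "r \<in> G" "pr (\<sigma> x) o0 \<in> el r" "r' \<in> G" "pr (\<sigma> x) o1 \<in> el r'" using t by blast
      with gen_cons[OF G r(1,3)] show False unfolding cons_def by blast
    qed
    then have "un p q \<in> el (Fn K')" using p by (intro Fn_un) (auto simp: pull_def)
    then have "un p q \<in> ?G" using t unfolding pull_def by simp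
    then show ?thesis by (intro bexI[of _ "un p q"]) auto
  qed
  fix D assume D: "el D \<subseteq> el (Fn K')" "\<forall>p\<in>el (Fn K'). \<exists>d\<in>el D. el p \<subseteq> el d"
  let ?P = "\<lambda>p. \<exists>d\<in>el D. \<forall>x i. pr x i \<in> el d \<longrightarrow> pr (\<sigma> x) i \<in> el p"
  obtain p where "p \<in> G" "?P p"
  proof (rule gen_dense[OF G, of ?P])
    show "dfu (\<lambda>s. ?P (s 0))" by (intro dfI)
    fix p assume p: "p \<in> el (Fn K)"
    define U where "U = {z. \<exists>x i. x \<in> el K' \<and> (i = o0 \<or> i = o1) \<and> z = pr x i \<and> pr (\<sigma> x) i \<in> el p}"
    \<comment> \<open>The action of \<sigma> on literals. Its images are sets of the model because
      only finite sets are pushed forward.\<close>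
    define f where "f z = (SOME w. \<exists>x i. z = pr x i \<and> w = pr (\<sigma> x) i)" for z
    have f: "f (pr x i) = pr (\<sigma> x) i" for x i unfolding f_def by (rule some_equality) auto
    have "inj_on f U" unfolding U_def inj_on_def using \<sigma>(2) by (auto simp: f inj_on_def)
    moreover have "f ` U \<subseteq> el p" unfolding U_def by (auto simp: f)
    moreover have "finite (el p)" using p by (simp add: el_Fn)
    ultimately have finU: "finite U" by (meson finite_imageD finite_subset)
    then have elU: "el (mk U) = U" by (intro el_mk iss_finite)
    have "mk U \<in> el (Fn K')" using finU p unfolding el_Fn elU by (auto simp: U_def cons_def)
    then obtain d where d: "d \<in> el D" "U \<subseteq> el d" using D(2) elU by blast
    then have dF: "d \<in> el (Fn K')" using D(1) by blast
    have elf: "el (mk (f ` el d)) = f ` el d" using dF by (intro el_mk iss_finite) (simp add: el_Fn)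
    have fd: "pr y i \<in> f ` el d \<Longrightarrow> \<exists>x\<in>el K'. y = \<sigma> x \<and> pr x i \<in> el d" for y i
    proof -
      assume "pr y i \<in> f ` el d"
      then obtain z where z: "z \<in> el d" "pr y i = f z" by blast
      then obtain x j where x: "x \<in> el K'" "z = pr x j" using dF unfolding el_Fn by blast
      with z show ?thesis by (auto simp: f)
    qed
    have "cons (el p \<union> f ` el d)" unfolding cons_def
    proof (intro allI notI, elim conjE)
      fix y assume y: "pr y o0 \<in> el p \<union> f ` el d" "pr y o1 \<in> el p \<union> f ` el d"
      show False
      proof (cases "\<exists>x\<in>el K'. y = \<sigma> x")
        case True
        then obtain x where x: "x \<in> el K'" "y = \<sigma> x" by blast
        have "pr x i \<in> el d" if "pr y i \<in> el p \<union> f ` el d" "i = o0 \<or> i = o1" for i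
        proof (cases "pr y i \<in> el p")
          case True
          then have "pr x i \<in> U" using x that(2) unfolding U_def by blast
          then show ?thesis using d(2) by blast
        next
          case False
          then show ?thesis using that(1) fd[of y i] x \<sigma>(2) by (auto simp: inj_on_def)
        qed
        then show False using y dF unfolding el_Fn cons_def by blast
      next
        case False
        then show False using y fd p unfolding el_Fn cons_def by blast
      qed
    qed
    moreover have "\<exists>y\<in>el K. \<exists>i. (i = o0 \<or> i = o1) \<and> w = pr y i" if w: "w \<in> f ` el d" for w
    proof -
      obtain z where z: "z \<in> el d" "w = f z" using w by blast
      then obtain x i where x: "x \<in> el K'" "i = o0 \<or> i = o1" "z = pr x i" using dF unfolding el_Fn by blast
      then have "w = pr (\<sigma> x) i" "\<sigma> x \<in> el K" using z(2) f \<sigma>(3) by auto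
      then show ?thesis using x(2) by blast
    qed
    then have "mk (f ` el d) \<in> el (Fn K)"
      using dF cons_subset[OF calculation, of "f ` el d"] unfolding el_Fn elf by blast
    ultimately have "un p (mk (f ` el d)) \<in> el (Fn K)" using p by (intro Fn_un) (simp_all add: elf)
    moreover have "?P (un p (mk (f ` el d)))"
      using d(1) f by (intro bexI[of _ d]) (auto simp: elf image_iff, metis)
    ultimately show "\<exists>q\<in>el (Fn K). el p \<subseteq> el q \<and> ?P q" by (intro bexI[of _ "un p (mk (f ` el d))"]) auto
  qed
  then obtain d where "d \<in> el D" "\<forall>x i. pr x i \<in> el d \<longrightarrow> pr (\<sigma> x) i \<in> el p" by blast
  then have "d \<in> ?G" using D(1) \<open>p \<in> G\<close> unfolding pull_def by blast
  then show "\<exists>d\<in>el D. d \<in> ?G" using \<open>d \<in> el D\<close> by blast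
qed

text \<open>Instead of a maximal antichain, a countable set C of conditions is closed under a choice
  w of members of W compatible with a given condition. If r lies below a member of W, the choice for
  the part U of r visible in C is compatible with all of r: a conflict would be at a literal of r
  whose opposite occurs in a condition of C, hence at a literal of U.\<close>

lemma predense_cbl:
  assumes W: "el W \<subseteq> el (Fn K)"
  obtains W' where "el W' \<subseteq> el W" "cbl W'"
    "\<And>p r. p \<in> el W \<Longrightarrow> r \<in> el (Fn K) \<Longrightarrow> el p \<subseteq> el r \<Longrightarrow> \<exists>w\<in>el W'. cons (el w \<union> el r)"
proof -
  let ?P = "\<lambda>u y. (\<exists>p\<in>el W. cons (el p \<union> el u)) \<longrightarrow> y \<in> el W \<and> cons (el y \<union> el u)"
  have 1: "dfu (\<lambda>s. ?P (s 0) (s (Suc 0)))" by (intro dfI)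
  obtain w where w: "\<And>u. u \<in> el (Fn K) \<Longrightarrow> app w u \<in> el (Fn K) \<and> ?P u (app w u)"
    by (rule choice[OF 1, of "Fn K" "Fn K"]) (use W emp_Fn in blast)+
  \<comment> \<open>Unions and single literals put every finite consistent set of literals of C into
    C; opposite literals are what detects a conflict with r.\<close>
  let ?R = "\<lambda>u v q. q = un u v \<or> (\<exists>z\<in>el u. q = up z z) \<or>
     (\<exists>x. pr x o0 \<in> el u \<and> q = up (pr x o1) (pr x o1) \<or> pr x o1 \<in> el u \<and> q = up (pr x o0) (pr x o0)) \<or>
     q = app w u"
  define op where "op u v = mk {q \<in> el (Fn K). ?R u v q}" for u v
  have op: "el (op u v) = {q \<in> el (Fn K). ?R u v q}" for u v unfolding op_def by (rule el_sep) (intro dfI)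
  have top: "tmu (\<lambda>s. op (s 0) (s (Suc 0)))" unfolding op_def by (intro dfI)
  define ng where "ng z = (SOME w. \<exists>x. z = pr x o0 \<and> w = pr x o1 \<or> z = pr x o1 \<and> w = pr x o0)" for z
  have ng: "ng (pr x o0) = pr x o1" "ng (pr x o1) = pr x o0" for x
    unfolding ng_def by (rule some_equality; auto)+
  have fop: "cbl (op u v)" if "u \<in> el (Fn K)" for u v
  proof (rule cbl_finite)
    have "el (op u v) \<subseteq> {un u v, app w u} \<union> (\<lambda>z. up z z) ` el u \<union> (\<lambda>z. up (ng z) (ng z)) ` el u"
      unfolding op by (auto simp: ng image_iff) (metis ng)+
    then show "finite (el (op u v))" by (rule finite_subset) (use that in \<open>simp add: el_Fn\<close>)
  qed
  have ce: "cbl (up emp emp)" by (rule cbl_finite) simp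
  obtain C where C: "cbl C" "el (up emp emp) \<subseteq> el C" "el C \<subseteq> el (Fn K)"
    "\<And>u v. u \<in> el C \<Longrightarrow> v \<in> el C \<Longrightarrow> el (op u v) \<subseteq> el C"
    by (rule cbl_closure[OF top, of "Fn K" "up emp emp"]) (use fop op ce in auto)
  have single: "up z z \<in> el C" if "u \<in> el C" "z \<in> el u" for u z
  proof -
    have "up z z \<in> el (Fn K)" using Fn_subset[of u K "{z}"] C(3) that by (auto simp: up_def)
    then show ?thesis using C(4)[OF that(1) that(1)] that(2) unfolding op by blast
  qed
  have neg: "up (pr x i) (pr x i) \<in> el C" if "up (pr x j) (pr x j) \<in> el C" "(i = o0 \<and> j = o1) \<or> (i = o1 \<and> j = o0)" for x i j
  proof -
    have "up (pr x j) (pr x j) \<in> el (Fn K)" using that(1) C(3) by blast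
    then have "up (pr x i) (pr x i) \<in> el (Fn K)" using that(2) by (auto simp: el_Fn cons_def)
    then show ?thesis using C(4)[OF that(1) that(1)] that(2) unfolding op by auto
  qed
  define W' where "W' = mk {p \<in> el W. p \<in> el C}"
  have W': "el W' = {p \<in> el W. p \<in> el C}" unfolding W'_def by (rule el_sep) (intro dfI)
  show thesis
  proof
    show "el W' \<subseteq> el W" using W' by blast
    show "cbl W'" using C(1) by (rule cbl_subset) (use W' in blast)
    fix p r assume p: "p \<in> el W" "r \<in> el (Fn K)" "el p \<subseteq> el r"
    have sub: "finite A \<Longrightarrow> A \<subseteq> {z \<in> el r. up z z \<in> el C} \<Longrightarrow> mk A \<in> el C" for A
    proof (induction A rule: finite_induct)
      case empty then show ?case using C(2) by (simp add: emp_def)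
    next
      case (insert z A)
      have A: "el (mk A) = A" using insert by (intro el_mk iss_finite)
      have "el (mk (insert z A)) = insert z A" using insert by (intro el_mk iss_finite) simp
      then have eq: "mk (insert z A) = un (mk A) (up z z)" by (simp add: A flip: ext)
      have "mk (insert z A) \<in> el (Fn K)" using Fn_subset[OF p(2), of "insert z A"] insert by auto
      then show ?case using C(4)[of "mk A" "up z z"] insert unfolding op eq by auto
    qed
    define U where "U = {z \<in> el r. up z z \<in> el C}"
    have U: "mk U \<in> el (Fn K)" "el (mk U) = U" using Fn_subset[OF p(2), of U] by (auto simp: U_def)
    have "finite U" using p(2) by (simp add: U_def el_Fn)
    then have UC: "mk U \<in> el C" using sub[of U] by (simp add: U_def)
    have pc: "cons (el p \<union> el (mk U))" unfolding U(2)
      by (rule cons_subset[of "el r"]) (use p in \<open>auto simp: el_Fn U_def\<close>)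
    have "app w (mk U) \<in> el W \<and> cons (el (app w (mk U)) \<union> el (mk U))" using w[OF U(1)] p(1) pc by blast
    then have wU: "app w (mk U) \<in> el W" "cons (el (app w (mk U)) \<union> U)" unfolding U(2) by blast+
    have wC: "app w (mk U) \<in> el C" using C(4)[OF UC UC] wU(1) W unfolding op by blast
    have "cons (el (app w (mk U)) \<union> el r)" unfolding cons_def
    proof (intro allI notI, elim conjE)
      fix x assume x: "pr x o0 \<in> el (app w (mk U)) \<union> el r" "pr x o1 \<in> el (app w (mk U)) \<union> el r"
      have 1: "\<not> (pr x o0 \<in> el r \<and> pr x o1 \<in> el r)" using p(2) unfolding el_Fn cons_def by blast
      have "pr x i \<in> U" if "pr x i \<in> el r" "pr x j \<in> el (app w (mk U))" "(i = o0 \<and> j = o1) \<or> (i = o1 \<and> j = o0)" for i j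
        using neg[OF single[OF wC that(2)] that(3)] that(1) unfolding U_def by blast
      then show False using x 1 wU(2) unfolding cons_def by blast
    qed
    then show "\<exists>w\<in>el W'. cons (el w \<union> el r)" using wU(1) wC unfolding W' by blast
  qed
qed

lemma gen_predense:
  assumes G: "gen K H" and W: "el W' \<subseteq> el W" "el W \<subseteq> el (Fn K)"
    and pd: "\<And>p r. p \<in> el W \<Longrightarrow> r \<in> el (Fn K) \<Longrightarrow> el p \<subseteq> el r \<Longrightarrow> \<exists>w\<in>el W'. cons (el w \<union> el r)"
  shows "(\<exists>p\<in>H. p \<in> el W) \<longleftrightarrow> (\<exists>p\<in>H. p \<in> el W')"
proof
  assume "\<exists>p\<in>H. p \<in> el W"
  then obtain p where p: "p \<in> H" "p \<in> el W" by blast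
  let ?P = "\<lambda>q. (\<exists>w\<in>el W'. el w \<subseteq> el q) \<or> (\<forall>w\<in>el W'. \<not> cons (el w \<union> el q))"
  obtain q where q: "q \<in> H" "?P q"
  proof (rule gen_dense[OF G, of ?P])
    show "dfu (\<lambda>s. ?P (s 0))" by (intro dfI)
    fix q assume q: "q \<in> el (Fn K)"
    show "\<exists>d\<in>el (Fn K). el q \<subseteq> el d \<and> ?P d"
    proof (cases "\<exists>w\<in>el W'. cons (el w \<union> el q)")
      case True
      then obtain w where w: "w \<in> el W'" "cons (el w \<union> el q)" by blast
      then have "un w q \<in> el (Fn K)" using W q by (intro Fn_un) auto
      then show ?thesis using w(1) by (intro bexI[of _ "un w q"]) auto
    next
      case False then show ?thesis using q by blast
    qed
  qed
  from q(2) show "\<exists>p\<in>H. p \<in> el W'"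
  proof
    assume "\<exists>w\<in>el W'. el w \<subseteq> el q"
    then show ?thesis using gen_up[OF G q(1)] W by blast
  next
    assume n: "\<forall>w\<in>el W'. \<not> cons (el w \<union> el q)"
    obtain r where r: "r \<in> H" "el p \<subseteq> el r" "el q \<subseteq> el r" using gen_dir[OF G p(1) q(1)] by blast
    obtain w where "w \<in> el W'" "cons (el w \<union> el r)" using pd[OF p(2) gen_Fn[OF G r(1)] r(2)] by blast
    then show ?thesis using n r(3) cons_subset[of "el w \<union> el r" "el w \<union> el q"] by blast
  qed
qed (use W in blast)

end

section \<open>Forcing over the ground model\<close>

(* Quantifiers range over the ground model only; the generic filter is an extra predicate.  One and
   the same ground model relation Q has to work for all the filters in GG. *)
locale forc = zfc +
  fixes K :: 'a and GG :: "'a set set"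
  assumes GG: "H \<in> GG \<Longrightarrow> gen K H"
begin

definition Frc :: "('a set \<Rightarrow> (nat \<Rightarrow> 'a) \<Rightarrow> bool) \<Rightarrow> bool" where
  "Frc P \<longleftrightarrow> (\<exists>Q. dfu (\<lambda>s. Q (s 0) (\<lambda>n. s (Suc n))) \<and> (\<forall>H\<in>GG. \<forall>s. P H s \<longleftrightarrow> (\<exists>p\<in>H. Q p s)))"

named_theorems frcI

lemma FrcI: "dfu (\<lambda>s. Q (s 0) (\<lambda>n. s (Suc n))) \<Longrightarrow>
    (\<And>H s. H \<in> GG \<Longrightarrow> P H s \<longleftrightarrow> (\<exists>p\<in>H. Q p s)) \<Longrightarrow> Frc P"
  unfolding Frc_def by (rule exI[of _ Q]) simp

lemma FrcE:
  assumes "Frc P"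
  obtains Q where "dfu (\<lambda>s. Q (s 0) (\<lambda>n. s (Suc n)))"
    "\<And>H s. H \<in> GG \<Longrightarrow> P H s \<longleftrightarrow> (\<exists>p\<in>H. Q p s)"
proof -
  from assms obtain Q where "dfu (\<lambda>s. Q (s 0) (\<lambda>n. s (Suc n))) \<and>
      (\<forall>H\<in>GG. \<forall>s. P H s \<longleftrightarrow> (\<exists>p\<in>H. Q p s))" unfolding Frc_def ..
  then show thesis by (intro that[of Q]) simp_all
qed

lemma dfu_skip1: "dfu (\<lambda>s. Q (s 0) (\<lambda>n. s (Suc n))) \<Longrightarrow> dfu (\<lambda>s. Q (s 0) (\<lambda>n. s (Suc (Suc n))))"
  using df_rename[of UNIV UNIV E "\<lambda>s. Q (s 0) (\<lambda>n. s (Suc n))" "\<lambda>n. case n of 0 \<Rightarrow> 0 | Suc m \<Rightarrow> Suc (Suc m)"]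
  by (simp add: inj_def split: nat.split)

text \<open>Closing Q under stronger conditions does not change what a filter satisfies, and it
  allows witnesses in G to be combined.\<close>

lemma Frc_mono:
  assumes "Frc P"
  obtains Q where "dfu (\<lambda>s. Q (s 0) (\<lambda>n. s (Suc n)))"
    "\<And>H s. H \<in> GG \<Longrightarrow> P H s \<longleftrightarrow> (\<exists>p\<in>H. Q p s)"
    "\<And>p q s. Q p s \<Longrightarrow> p \<in> el (Fn K) \<Longrightarrow> el p \<subseteq> el q \<Longrightarrow> Q q s"
proof -
  obtain Q where Q: "dfu (\<lambda>s. Q (s 0) (\<lambda>n. s (Suc n)))"
    "\<And>H s. H \<in> GG \<Longrightarrow> P H s \<longleftrightarrow> (\<exists>p\<in>H. Q p s)" by (rule FrcE[OF assms]) (rule that)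
  let ?Q = "\<lambda>p s. \<exists>p'. (p' \<in> el (Fn K) \<and> el p' \<subseteq> el p) \<and> Q p' s"
  show thesis
  proof (rule that[of ?Q])
    show "dfu (\<lambda>s. ?Q (s 0) (\<lambda>n. s (Suc n)))"
      by (rule df_ex, rule df_conj, (intro dfI)[1], rule dfu_skip1[OF Q(1)])
    show "P H s \<longleftrightarrow> (\<exists>p\<in>H. ?Q p s)" if H: "H \<in> GG" for H s
    proof -
      have "p' \<in> H" if "p \<in> H" "p' \<in> el (Fn K)" "el p' \<subseteq> el p" for p p'
        using gen_up[OF GG[OF H] that] .
      then show ?thesis unfolding Q(2)[OF H] using gen_Fn[OF GG[OF H]] by blast
    qed
    show "?Q p s \<Longrightarrow> p \<in> el (Fn K) \<Longrightarrow> el p \<subseteq> el q \<Longrightarrow> ?Q q s" for p q s by blast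
  qed
qed

lemma Frc_df: "dfu P \<Longrightarrow> Frc (\<lambda>H. P)"
proof -
  assume "dfu P"
  then have "dfu (\<lambda>s. P (\<lambda>n. s (Suc n)))" by (rule df_rename) auto
  then show ?thesis by (rule FrcI[where Q = "\<lambda>p. P"]) (use gen_ne[OF GG] in blast)
qed

text \<open>The conditions that satisfy Q, together with those that have no extension satisfying Q,
  form a dense set of the ground model, so the filter contains one of them.\<close>

lemma Frc_not [frcI]: "Frc P \<Longrightarrow> Frc (\<lambda>H s. \<not> P H s)"
proof -
  assume FP: "Frc P"
  obtain Q where Q: "dfu (\<lambda>s. Q (s 0) (\<lambda>n. s (Suc n)))"
    "\<And>H s. H \<in> GG \<Longrightarrow> P H s \<longleftrightarrow> (\<exists>p\<in>H. Q p s)"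
    "\<And>p q s. Q p s \<Longrightarrow> p \<in> el (Fn K) \<Longrightarrow> el p \<subseteq> el q \<Longrightarrow> Q q s" by (rule Frc_mono[OF FP]) (rule that)
  let ?Q = "\<lambda>p s. \<forall>q. (q \<in> el (Fn K) \<and> el p \<subseteq> el q) \<longrightarrow> \<not> Q q s"
  have 1: "dfu (\<lambda>s. ?Q (s 0) (\<lambda>n. s (Suc n)))"
    by (rule df_all, rule df_imp, (intro dfI)[1], rule df_not, rule dfu_skip1[OF Q(1)])
  have "\<not> P H s \<longleftrightarrow> (\<exists>p\<in>H. ?Q p s)" if H: "H \<in> GG" for H s
  proof
    assume n: "\<not> P H s"
    have "dfu (\<lambda>s'. ?Q (s' 0) s \<or> Q (s' 0) s)"
      by (rule df_disj) (rule df_fix[where P = "\<lambda>s p. ?Q p s", OF 1], rule df_fix[where P = "\<lambda>s p. Q p s", OF Q(1)])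
    then obtain d where "d \<in> H" "?Q d s \<or> Q d s"
      by (rule gen_dense[OF GG[OF H], of "\<lambda>d. ?Q d s \<or> Q d s"]) blast+
    then show "\<exists>p\<in>H. ?Q p s" using n Q(2)[OF H] by blast
  next
    assume "\<exists>p\<in>H. ?Q p s"
    then obtain p where p: "p \<in> H" "?Q p s" by blast
    show "\<not> P H s"
    proof
      assume "P H s"
      then obtain q where q: "q \<in> H" "Q q s" using Q(2)[OF H] by blast
      obtain r where r: "r \<in> H" "el p \<subseteq> el r" "el q \<subseteq> el r" using gen_dir[OF GG[OF H] p(1) q(1)] by blast
      have "Q r s" using Q(3)[OF q(2) gen_Fn[OF GG[OF H] q(1)] r(3)] .
      then show False using p(2) r(2) gen_Fn[OF GG[OF H] r(1)] by blast
    qed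
  qed
  then show ?thesis by (rule FrcI[where Q = ?Q, OF 1])
qed

lemma Frc_conj [frcI]: "Frc P \<Longrightarrow> Frc P' \<Longrightarrow> Frc (\<lambda>H s. P H s \<and> P' H s)"
proof -
  assume "Frc P" "Frc P'"
  obtain Q where Q: "dfu (\<lambda>s. Q (s 0) (\<lambda>n. s (Suc n)))"
    "\<And>H s. H \<in> GG \<Longrightarrow> P H s \<longleftrightarrow> (\<exists>p\<in>H. Q p s)"
    "\<And>p q s. Q p s \<Longrightarrow> p \<in> el (Fn K) \<Longrightarrow> el p \<subseteq> el q \<Longrightarrow> Q q s" by (rule Frc_mono[OF \<open>Frc P\<close>]) (rule that)
  obtain Q' where Q': "dfu (\<lambda>s. Q' (s 0) (\<lambda>n. s (Suc n)))"
    "\<And>H s. H \<in> GG \<Longrightarrow> P' H s \<longleftrightarrow> (\<exists>p\<in>H. Q' p s)"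
    "\<And>p q s. Q' p s \<Longrightarrow> p \<in> el (Fn K) \<Longrightarrow> el p \<subseteq> el q \<Longrightarrow> Q' q s" by (rule Frc_mono[OF \<open>Frc P'\<close>]) (rule that)
  have "P H s \<and> P' H s \<longleftrightarrow> (\<exists>p\<in>H. Q p s \<and> Q' p s)" if H: "H \<in> GG" for H s
  proof
    assume "P H s \<and> P' H s"
    then obtain p q where p: "p \<in> H" "Q p s" "q \<in> H" "Q' q s" using Q(2)[OF H] Q'(2)[OF H] by auto
    obtain r where r: "r \<in> H" "el p \<subseteq> el r" "el q \<subseteq> el r" using gen_dir[OF GG[OF H] p(1,3)] by blast
    have "Q r s" by (rule Q(3)[OF p(2) gen_Fn[OF GG[OF H] p(1)] r(2)])
    moreover have "Q' r s" by (rule Q'(3)[OF p(4) gen_Fn[OF GG[OF H] p(3)] r(3)])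
    ultimately show "\<exists>p\<in>H. Q p s \<and> Q' p s" using r(1) by blast
  qed (use Q(2)[OF H] Q'(2)[OF H] in blast)
  then show ?thesis by (rule FrcI[where Q = "\<lambda>p s. Q p s \<and> Q' p s", OF df_conj[OF Q(1) Q'(1)]])
qed

lemma Frc_ex [frcI]: "Frc (\<lambda>H s. P H (\<lambda>n. s (Suc n)) (s 0)) \<Longrightarrow> Frc (\<lambda>H s. \<exists>x. P H s x)"
proof -
  assume F: "Frc (\<lambda>H s. P H (\<lambda>n. s (Suc n)) (s 0))"
  obtain Q where Q: "dfu (\<lambda>s. Q (s 0) (\<lambda>n. s (Suc n)))"
    "\<And>H s. H \<in> GG \<Longrightarrow> P H (\<lambda>n. s (Suc n)) (s 0) \<longleftrightarrow> (\<exists>p\<in>H. Q p s)" by (rule FrcE[OF F]) (rule that)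
  have "dfu (\<lambda>s. Q (s (Suc 0)) (s 0 ## (\<lambda>n. s (Suc (Suc n)))))"
  proof -
    define f :: "nat \<Rightarrow> nat" where "f n = (if n = 0 then 1 else if n = 1 then 0 else n)" for n
    have "inj f" unfolding f_def by (auto simp: inj_def)
    then have "dfu (\<lambda>s. Q (s (f 0)) (\<lambda>n. s (f (Suc n))))" by (rule df_rename[OF Q(1)])
    moreover have "(\<lambda>n. s (f (Suc n))) = s 0 ## (\<lambda>n. s (Suc (Suc n)))" for s :: "nat \<Rightarrow> 'a"
      by (auto simp: scons_def fun_eq_iff f_def split: nat.split)
    moreover have "f 0 = Suc 0" by (simp add: f_def)
    ultimately show ?thesis by (simp only:)
  qed
  then have 1: "dfu (\<lambda>s. \<exists>x. Q (s 0) (x ## (\<lambda>n. s (Suc n))))" by (rule df_ex)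
  have "(\<exists>x. P H s x) \<longleftrightarrow> (\<exists>p\<in>H. \<exists>x. Q p (x ## s))" if "H \<in> GG" for H s
    using Q(2)[OF that, of "_ ## s"] by auto
  then show ?thesis by (rule FrcI[where Q = "\<lambda>p s. \<exists>x. Q p (x ## s)", OF 1])
qed

lemma Frc_cong: "(\<And>H s. H \<in> GG \<Longrightarrow> P H s = P' H s) \<Longrightarrow> Frc P \<Longrightarrow> Frc P'"
  unfolding Frc_def by (metis (no_types, lifting))

lemma Frc_disj [frcI]: "Frc P \<Longrightarrow> Frc P' \<Longrightarrow> Frc (\<lambda>H s. P H s \<or> P' H s)"
  using Frc_not[OF Frc_conj[OF Frc_not Frc_not]] by simp

lemma Frc_imp [frcI]: "Frc P \<Longrightarrow> Frc P' \<Longrightarrow> Frc (\<lambda>H s. P H s \<longrightarrow> P' H s)"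
  using Frc_not[OF Frc_conj[OF _ Frc_not]] by simp

lemma Frc_iff [frcI]: "Frc P \<Longrightarrow> Frc P' \<Longrightarrow> Frc (\<lambda>H s. P H s \<longleftrightarrow> P' H s)"
  using Frc_conj[OF Frc_imp Frc_imp, of P P' P' P] by (simp add: iff_conv_conj_imp)

lemma Frc_all [frcI]: "Frc (\<lambda>H s. P H (\<lambda>n. s (Suc n)) (s 0)) \<Longrightarrow> Frc (\<lambda>H s. \<forall>x. P H s x)"
  using Frc_not[OF Frc_ex[OF Frc_not]] by simp

lemma Frc_bex [frcI]:
  "tmu t \<Longrightarrow> Frc (\<lambda>H s. P H (\<lambda>n. s (Suc n)) (s 0)) \<Longrightarrow> Frc (\<lambda>H s. \<exists>x\<in>el (t s). P H s x)"
  unfolding Bex_def by (intro frcI Frc_df dfI tmu_shift)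

lemma Frc_ball [frcI]:
  "tmu t \<Longrightarrow> Frc (\<lambda>H s. P H (\<lambda>n. s (Suc n)) (s 0)) \<Longrightarrow> Frc (\<lambda>H s. \<forall>x\<in>el (t s). P H s x)"
  unfolding Ball_def by (intro frcI Frc_df dfI tmu_shift)

lemma Frc_G [frcI]: "tmu t \<Longrightarrow> Frc (\<lambda>H s. t s \<in> H)"
  by (rule FrcI[where Q = "\<lambda>p s. p = t s"]) (intro dfI tmu_shift, assumption, blast)

lemma Frc_bexG [frcI]:
  "Frc (\<lambda>H s. P H (\<lambda>n. s (Suc n)) (s 0)) \<Longrightarrow> Frc (\<lambda>H s. \<exists>x\<in>H. P H s x)"
  unfolding Bex_def by (intro frcI dfI)

lemma Frc_sub_step: "Frc (\<lambda>H s. P H (s 0) (\<lambda>n. s (Suc n))) \<Longrightarrow> tmu t \<Longrightarrow> Frc (\<lambda>H s. P H (t s) s)"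
proof -
  assume "Frc (\<lambda>H s. P H (s 0) (\<lambda>n. s (Suc n)))" "tmu t"
  then have "Frc (\<lambda>H s. \<exists>x. x = t s \<and> P H x s)"
    by (intro Frc_ex Frc_conj) (auto intro!: Frc_df dfI tmu_shift)
  then show ?thesis by simp
qed

lemma Frc_rename:
  assumes "Frc P" "inj f" shows "Frc (\<lambda>H s. P H (\<lambda>n. s (f n)))"
proof -
  obtain Q where Q: "dfu (\<lambda>s. Q (s 0) (\<lambda>n. s (Suc n)))"
    "\<And>H s. H \<in> GG \<Longrightarrow> P H s \<longleftrightarrow> (\<exists>p\<in>H. Q p s)" by (rule FrcE[OF assms(1)]) (rule that)
  have "dfu (\<lambda>s. Q (s 0) (\<lambda>n. s (Suc (f n))))"
  proof -
    have "inj (\<lambda>n. case n of 0 \<Rightarrow> 0 | Suc m \<Rightarrow> Suc (f m))"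
      by (rule injI) (auto dest: injD[OF assms(2)] split: nat.splits)
    from df_rename[OF Q(1) this] show ?thesis by simp
  qed
  then show ?thesis by (rule FrcI[where Q = "\<lambda>p s. Q p (\<lambda>n. s (f n))"]) (rule Q(2))
qed

lemma Frc_1: "Frc (\<lambda>H s. P H (s 0)) \<Longrightarrow> tmu t \<Longrightarrow> Frc (\<lambda>H s. P H (t s))"
  by (rule Frc_sub_step[of "\<lambda>H x s. P H x"])

lemma Frc_2:
  assumes "Frc (\<lambda>H s. P H (s 0) (s (Suc 0)))" "tmu t1" "tmu t2"
  shows "Frc (\<lambda>H s. P H (t1 s) (t2 s))"
proof -
  have 1: "Frc (\<lambda>H s. P H (s (Suc 0)) (s 0))"
    using Frc_rename[OF assms(1), of "\<lambda>n. if n = 0 then 1 else if n = 1 then 0 else n"]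
    by (simp add: inj_def)
  have 2: "Frc (\<lambda>H s. P H (s 0) (t2 (\<lambda>n. s (Suc n))))"
    using Frc_sub_step[of "\<lambda>H x s. P H (s 0) x", OF 1 tmu_shift[OF assms(3)]] by simp
  show ?thesis using Frc_sub_step[of "\<lambda>H x s. P H x (t2 s)", OF 2 assms(2)] .
qed

lemma Frc_3:
  assumes "Frc (\<lambda>H s. P H (s 0) (s (Suc 0)) (s (Suc (Suc 0))))" "tmu t1" "tmu t2" "tmu t3"
  shows "Frc (\<lambda>H s. P H (t1 s) (t2 s) (t3 s))"
proof -
  have "Frc (\<lambda>H s. \<exists>x y z. (x = t1 s \<and> y = t2 s \<and> z = t3 s) \<and> P H x y z)"
  proof (rule Frc_ex, rule Frc_ex, rule Frc_ex, rule Frc_conj)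
    show "Frc (\<lambda>H s. s (Suc (Suc 0)) = t1 (\<lambda>n. s (Suc (Suc (Suc n)))) \<and>
        s (Suc 0) = t2 (\<lambda>n. s (Suc (Suc (Suc n)))) \<and> s 0 = t3 (\<lambda>n. s (Suc (Suc (Suc n)))))"
      using tmu_shift[OF tmu_shift[OF tmu_shift[OF assms(2)]]] tmu_shift[OF tmu_shift[OF tmu_shift[OF assms(3)]]]
        tmu_shift[OF tmu_shift[OF tmu_shift[OF assms(4)]]]
      by (intro Frc_df df_conj df_eq tmu_var)
    show "Frc (\<lambda>H s. P H (s (Suc (Suc 0))) (s (Suc 0)) (s 0))"
      using Frc_rename[OF assms(1), of "\<lambda>n. if n = 0 then 2 else if n = 2 then 0 else n"]
      by (simp add: inj_def numeral_2_eq_2)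
  qed
  then show ?thesis by simp
qed

end

context zfc begin

text \<open>The recursion yields levels of the cumulative hierarchy: \<open>H x\<close> is the union
  of the power sets of \<open>H y\<close> for y in x.\<close>

lemma transitive_hull: "\<exists>t. el x \<subseteq> el t \<and> (\<forall>y\<in>el t. el y \<subseteq> el t)"
proof -
  define H where "H = rec (\<lambda>w. bun (mk (Pw ` el w)))"
  have "tmu (\<lambda>s. H (s 0))" unfolding H_def by (rule tm_rec1) (intro dfI)+
  note tH = tm_1[OF this]
  have tH0: "tmu (\<lambda>s. H (s 0))" and tP: "tmu (\<lambda>s. Pw (s 0))" by (intro dfI tH)+
  have H: "el (H x) = (\<Union>y\<in>el x. {z. el z \<subseteq> el (H y)})" for x
  proof -
    have Hx: "H x = bun (mk (Pw ` el (mk (H ` el x))))" unfolding H_def by (rule rec_eq)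
    have "el (H x) = (\<Union>y\<in>el (mk (H ` el x)). el (Pw y))" by (subst Hx, rule el_bun_img[OF tP])
    also have "\<dots> = (\<Union>y\<in>el x. {z. el z \<subseteq> el (H y)})" unfolding el_img[OF tH0] el_Pw by (simp only: image_image)
    finally show ?thesis .
  qed
  have 1: "el x \<subseteq> el (H x)" for x
  proof (induction x rule: E_induct)
    case (step x) then show ?case unfolding H[of x] by blast
  qed
  have 2: "\<forall>y\<in>el (H x). el y \<subseteq> el (H x)" for x
  proof (induction x rule: E_induct)
    case (step x)
    show ?case
    proof (intro ballI subsetI)
      fix z w assume "z \<in> el (H x)" "w \<in> el z"
      then obtain y where y: "y \<in> el x" "w \<in> el (H y)" unfolding H[of x] by blast
      then have "el w \<subseteq> el (H y)" using step by blast
      then show "w \<in> el (H x)" using y(1) unfolding H[of x] by blast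
    qed
  qed
  show ?thesis using 1 2 by blast
qed

lemma dfu_fix2:
  assumes "dfu (\<lambda>s. Q (s 0) (\<lambda>n. s (Suc n)))" shows "dfu (\<lambda>s. Q (s 0) (s (Suc 0) ## u))"
proof -
  let ?R = "\<lambda>s z. \<exists>p x. z = pr p x \<and> Q p (x ## s)"
  have "dfu (\<lambda>s. \<exists>p x. s 0 = pr p x \<and> Q p (x ## (\<lambda>n. s (Suc n))))"
  proof (rule df_ex, rule df_ex, rule df_conj)
    show "dfu (\<lambda>s. s (Suc (Suc 0)) = pr (s (Suc 0)) (s 0))" by (intro dfI)
    define f :: "nat \<Rightarrow> nat" where "f n = (if n = 0 then 1 else if n = 1 then 0 else Suc n)" for n
    have "inj f" unfolding f_def by (auto simp: inj_def)
    then have "dfu (\<lambda>s. Q (s (f 0)) (\<lambda>n. s (f (Suc n))))" by (rule df_rename[OF assms])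
    moreover have "(\<lambda>n. s (f (Suc n))) = s 0 ## (\<lambda>n. s (Suc (Suc (Suc n))))" for s :: "nat \<Rightarrow> 'a"
      by (auto simp: scons_def fun_eq_iff f_def split: nat.split)
    moreover have "f 0 = Suc 0" by (simp add: f_def)
    ultimately show "dfu (\<lambda>s. Q (s (Suc 0)) (s 0 ## (\<lambda>n. s (Suc (Suc (Suc n))))))" by (simp only:)
  qed
  from df_fix[where P = ?R, OF this, of u]
  have "dfu (\<lambda>s'. ?R u (s' 0))" .
  from df_1[OF this, of "\<lambda>s. pr (s 0) (s (Suc 0))"] show ?thesis by (simp add: dfI)
qed

end

context forc begin

lemma Frc_rel:
  assumes "Frc (\<lambda>H s. P H (s 0))"
  obtains Q where "dfu (\<lambda>s. Q (s 0) (s (Suc 0)))"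
    "\<And>H b. H \<in> GG \<Longrightarrow> P H b \<longleftrightarrow> (\<exists>p\<in>H. Q p b)"
    "\<And>p q b. Q p b \<Longrightarrow> p \<in> el (Fn K) \<Longrightarrow> el p \<subseteq> el q \<Longrightarrow> Q q b"
proof -
  obtain Q where Q: "dfu (\<lambda>s. Q (s 0) (\<lambda>n. s (Suc n)))"
    "\<And>H s. H \<in> GG \<Longrightarrow> P H (s 0) \<longleftrightarrow> (\<exists>p\<in>H. Q p s)"
    "\<And>p q s. Q p s \<Longrightarrow> p \<in> el (Fn K) \<Longrightarrow> el p \<subseteq> el q \<Longrightarrow> Q q s"
    by (rule Frc_mono[OF assms]) (rule that)
  define u :: "nat \<Rightarrow> 'a" where "u = (\<lambda>_. emp)"
  show thesis
  proof (rule that[of "\<lambda>p b. Q p (b ## u)"])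
    show "dfu (\<lambda>s. Q (s 0) (s (Suc 0) ## u))" by (rule dfu_fix2[OF Q(1)])
    show "P H b \<longleftrightarrow> (\<exists>p\<in>H. Q p (b ## u))" if "H \<in> GG" for H b using Q(2)[OF that, of "b ## u"] by simp
  qed (rule Q(3))
qed

lemma Frc_rel2:
  assumes "Frc (\<lambda>H s. P H (s 0) (s (Suc 0)))"
  obtains Q where "dfu (\<lambda>s. Q (s 0) (s (Suc 0)) (s (Suc (Suc 0))))"
    "\<And>H b c. H \<in> GG \<Longrightarrow> P H b c \<longleftrightarrow> (\<exists>p\<in>H. Q p b c)"
    "\<And>p q b c. Q p b c \<Longrightarrow> p \<in> el (Fn K) \<Longrightarrow> el p \<subseteq> el q \<Longrightarrow> Q q b c"
proof -
  have 1: "Frc (\<lambda>H s. P H (s (Suc 0)) (s 0))"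
    by (rule Frc_2[OF assms]) (intro dfI)+
  have "Frc (\<lambda>H s. \<exists>b c. s 0 = pr b c \<and> P H b c)"
    by (rule Frc_ex, rule Frc_ex, rule Frc_conj, rule Frc_df, (intro dfI)[1], rule 1)
  then obtain Q where Q: "dfu (\<lambda>s. Q (s 0) (s (Suc 0)))"
    "\<And>H z. H \<in> GG \<Longrightarrow> (\<exists>b c. z = pr b c \<and> P H b c) \<longleftrightarrow> (\<exists>p\<in>H. Q p z)"
    "\<And>p q z. Q p z \<Longrightarrow> p \<in> el (Fn K) \<Longrightarrow> el p \<subseteq> el q \<Longrightarrow> Q q z"
    by (rule Frc_rel[of "\<lambda>H z. \<exists>b c. z = pr b c \<and> P H b c"]) (rule that)
  show thesis
  proof (rule that[of "\<lambda>p b c. Q p (pr b c)"])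
    show "dfu (\<lambda>s. Q (s 0) (pr (s (Suc 0)) (s (Suc (Suc 0)))))"
      by (rule df_2[OF Q(1)]) (intro dfI)+
    show "P H b c \<longleftrightarrow> (\<exists>p\<in>H. Q p (pr b c))" if "H \<in> GG" for H b c
      using Q(2)[OF that, of "pr b c"] by simp
  qed (rule Q(3))
qed

text \<open>For each b the witnessing conditions are thinned out to a countable subset that a
  generic filter meets whenever it meets the full set; choice makes this a function of b.\<close>

lemma Frc_ctbl:
  assumes "Frc (\<lambda>H s. P H (s 0))"
  obtains f where "\<And>b. b \<in> el B \<Longrightarrow> cbl (app f b) \<and> el (app f b) \<subseteq> el (Fn K)"
    "\<And>H b. H \<in> GG \<Longrightarrow> b \<in> el B \<Longrightarrow> P H b \<longleftrightarrow> (\<exists>p\<in>H. p \<in> el (app f b))"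
proof -
  obtain Q where Q: "dfu (\<lambda>s. Q (s 0) (s (Suc 0)))"
    "\<And>H b. H \<in> GG \<Longrightarrow> P H b \<longleftrightarrow> (\<exists>p\<in>H. Q p b)"
    "\<And>p q b. Q p b \<Longrightarrow> p \<in> el (Fn K) \<Longrightarrow> el p \<subseteq> el q \<Longrightarrow> Q q b"
    by (rule Frc_rel[OF assms]) (rule that)
  note [dfI] = df_2[OF Q(1)]
  define W where "W b = mk {p \<in> el (Fn K). Q p b}" for b
  have W: "el (W b) = {p \<in> el (Fn K). Q p b}" for b unfolding W_def by (rule el_sep) (intro dfI)
  have tW: "tmu (\<lambda>s. W (s 0))" unfolding W_def by (intro dfI)
  note [dfI] = tm_1[OF tW]
  let ?P = "\<lambda>b W'. el W' \<subseteq> el (W b) \<and> cbl W' \<and>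
    (\<forall>p\<in>el (W b). \<forall>r\<in>el (Fn K). el p \<subseteq> el r \<longrightarrow> (\<exists>w\<in>el W'. cons (el w \<union> el r)))"
  have 1: "dfu (\<lambda>s. ?P (s 0) (s (Suc 0)))" by (intro dfI)
  have ex: "\<exists>W'\<in>el (Pw (Fn K)). ?P b W'" if "b \<in> el B" for b
  proof -
    have "el (W b) \<subseteq> el (Fn K)" unfolding W by blast
    then obtain W' where "el W' \<subseteq> el (W b)" "cbl W'"
      "\<And>p r. p \<in> el (W b) \<Longrightarrow> r \<in> el (Fn K) \<Longrightarrow> el p \<subseteq> el r \<Longrightarrow> \<exists>w\<in>el W'. cons (el w \<union> el r)"
      by (rule predense_cbl) (rule that)
    then show ?thesis unfolding W el_Pw by blast
  qed
  obtain f where f: "\<And>b. b \<in> el B \<Longrightarrow> app f b \<in> el (Pw (Fn K)) \<and> ?P b (app f b)"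
    by (rule choice[OF 1 ex]) (assumption, rule that)
  show thesis
  proof (rule that[of f])
    show "cbl (app f b) \<and> el (app f b) \<subseteq> el (Fn K)" if "b \<in> el B" for b using f[OF that] by simp
    fix H b assume H: "H \<in> GG" and b: "b \<in> el B"
    have "(\<exists>p\<in>H. p \<in> el (W b)) \<longleftrightarrow> (\<exists>p\<in>H. p \<in> el (app f b))"
    proof (rule gen_predense[OF GG[OF H]])
      show "el (app f b) \<subseteq> el (W b)" using f[OF b] by blast
      show "el (W b) \<subseteq> el (Fn K)" unfolding W by blast
      show "\<And>p r. p \<in> el (W b) \<Longrightarrow> r \<in> el (Fn K) \<Longrightarrow> el p \<subseteq> el r \<Longrightarrow> \<exists>w\<in>el (app f b). cons (el w \<union> el r)"
        using f[OF b] by blast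
    qed
    moreover have "(\<exists>p\<in>H. p \<in> el (W b)) \<longleftrightarrow> P H b"
      unfolding Q(2)[OF H] W using gen_Fn[OF GG[OF H]] by blast
    ultimately show "P H b \<longleftrightarrow> (\<exists>p\<in>H. p \<in> el (app f b))" by blast
  qed
qed

text \<open>The countable sets of conditions for the single numbers are assembled into one nice
  name, a set of pairs (number, condition), that depends definably on the parameter a and is correct
  for all filters in GG.\<close>

lemma Frc_ctbl_om:
  assumes "Frc (\<lambda>H s. P H (s 0) (s (Suc 0)))"
  obtains g where "tmu (\<lambda>s. g (s 0))"
    "\<And>a. a \<in> el B \<Longrightarrow> cbl (g a) \<and> el (g a) \<subseteq> el (tms om (Fn K))"
    "\<And>H n a. H \<in> GG \<Longrightarrow> a \<in> el B \<Longrightarrow> P H (num n) a \<longleftrightarrow> (\<exists>p\<in>H. pr (num n) p \<in> el (g a))"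
proof -
  have 1: "Frc (\<lambda>H s. P H (s (Suc 0)) (s 0))"
    by (rule Frc_2[OF assms]) (intro dfI)+
  have "Frc (\<lambda>H s. \<exists>n a. s 0 = pr n a \<and> P H n a)"
    by (rule Frc_ex, rule Frc_ex, rule Frc_conj, rule Frc_df, (intro dfI)[1], rule 1)
  then obtain f where f: "\<And>b. b \<in> el (tms om B) \<Longrightarrow> cbl (app f b) \<and> el (app f b) \<subseteq> el (Fn K)"
    "\<And>H b. H \<in> GG \<Longrightarrow> b \<in> el (tms om B) \<Longrightarrow> (\<exists>n a. b = pr n a \<and> P H n a) \<longleftrightarrow> (\<exists>p\<in>H. p \<in> el (app f b))"
    by (rule Frc_ctbl[of "\<lambda>H z. \<exists>n a. z = pr n a \<and> P H n a" "tms om B"]) (rule that)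
  define g where "g a = mk {z \<in> el (tms om (Fn K)). \<exists>n p. z = pr n p \<and> p \<in> el (app f (pr n a))}" for a
  have g: "el (g a) = {z \<in> el (tms om (Fn K)). \<exists>n p. z = pr n p \<and> p \<in> el (app f (pr n a))}" for a
    unfolding g_def by (rule el_sep) (intro dfI)
  show thesis
  proof (rule that[of g])
    show "tmu (\<lambda>s. g (s 0))" unfolding g_def by (intro dfI)
    fix a assume a: "a \<in> el B"
    let ?h = "\<lambda>n. mk (pr n ` el (app f (pr n a)))"
    have th: "tmu (\<lambda>s. ?h (s 0))" and tp: "tmu (\<lambda>s. pr n (s 0))" for n by (intro dfI)+
    have "cbl om" unfolding cbl_lepoll by (rule lepoll_subset) simp
    then have c: "cbl (bun (mk (?h ` el om)))"
    proof (rule cbl_UN'[OF th])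
      fix n assume "n \<in> el om"
      then show "cbl (?h n)" using f(1)[of "pr n a"] a by (intro cbl_image[OF tp]) simp
    qed
    have "el (g a) \<subseteq> el (bun (mk (?h ` el om)))"
      unfolding el_bun_img[OF th] el_img[OF tp] g by auto
    from cbl_subset[OF c this] show "cbl (g a) \<and> el (g a) \<subseteq> el (tms om (Fn K))" unfolding g by blast
  next
    fix H n a assume H: "H \<in> GG" and a: "a \<in> el B"
    then have "pr (num n) a \<in> el (tms om B)" by simp
    from f(2)[OF H this] f(1)[OF this]
    show "P H (num n) a \<longleftrightarrow> (\<exists>p\<in>H. pr (num n) p \<in> el (g a))" unfolding g by auto
  qed
qed

end

section \<open>The generic extension\<close>

locale gext = forc E K "{G}" for E :: "'a \<Rightarrow> 'a \<Rightarrow> bool" and K G +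
  fixes F :: "'a \<Rightarrow> 'a \<Rightarrow> bool" and val :: "'a \<Rightarrow> 'a"
  assumes ext_F: "extensional_rel F" and surj_val: "surj val"
    and elF: "elts F (val t) = {val s | s. \<exists>p\<in>G. pr s p \<in> elts E t}"
begin

abbreviation FG :: "((nat \<Rightarrow> 'a) \<Rightarrow> bool) \<Rightarrow> bool" where "FG P \<equiv> Frc (\<lambda>H. P)"

named_theorems fgI

lemma G: "gen K G" using GG by simp

lemma FG_G [fgI]: "tmu t \<Longrightarrow> FG (\<lambda>s. t s \<in> G)"
  by (rule Frc_cong[OF _ Frc_G[of t]]) simp

lemma FG_not [fgI]: "FG P \<Longrightarrow> FG (\<lambda>s. \<not> P s)" by (rule Frc_not)
lemma FG_conj [fgI]: "FG P \<Longrightarrow> FG Q \<Longrightarrow> FG (\<lambda>s. P s \<and> Q s)" by (rule Frc_conj)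
lemma FG_disj [fgI]: "FG P \<Longrightarrow> FG Q \<Longrightarrow> FG (\<lambda>s. P s \<or> Q s)" by (rule Frc_disj)
lemma FG_imp [fgI]: "FG P \<Longrightarrow> FG Q \<Longrightarrow> FG (\<lambda>s. P s \<longrightarrow> Q s)" by (rule Frc_imp)
lemma FG_ex [fgI]: "FG (\<lambda>s. P (\<lambda>n. s (Suc n)) (s 0)) \<Longrightarrow> FG (\<lambda>s. \<exists>x. P s x)" by (rule Frc_ex)
lemma FG_all [fgI]: "FG (\<lambda>s. P (\<lambda>n. s (Suc n)) (s 0)) \<Longrightarrow> FG (\<lambda>s. \<forall>x. P s x)" by (rule Frc_all)
lemma FG_bex [fgI]: "tmu t \<Longrightarrow> FG (\<lambda>s. P (\<lambda>n. s (Suc n)) (s 0)) \<Longrightarrow> FG (\<lambda>s. \<exists>x\<in>el (t s). P s x)"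
  by (rule Frc_bex)
lemma FG_ball [fgI]: "tmu t \<Longrightarrow> FG (\<lambda>s. P (\<lambda>n. s (Suc n)) (s 0)) \<Longrightarrow> FG (\<lambda>s. \<forall>x\<in>el (t s). P s x)"
  by (rule Frc_ball)
lemma FG_bexG [fgI]: "FG (\<lambda>s. P (\<lambda>n. s (Suc n)) (s 0)) \<Longrightarrow> FG (\<lambda>s. \<exists>x\<in>G. P s x)"
  unfolding Bex_def by (intro fgI dfI)

abbreviation (input) act :: "'a \<Rightarrow> 'a \<Rightarrow> bool" where "act s t \<equiv> \<exists>p\<in>G. pr s p \<in> el t"

(* Equality of values is expressed by a bisimulation coded as a name, so that no recursion on names
   is needed. *)
definition bis :: "'a \<Rightarrow> bool" where
  "bis N \<longleftrightarrow> (\<forall>u v. act (pr u v) N \<longrightarrow>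
     (\<forall>u'. act u' u \<longrightarrow> (\<exists>v'. act v' v \<and> act (pr u' v') N)) \<and>
     (\<forall>v'. act v' v \<longrightarrow> (\<exists>u'. act u' u \<and> act (pr u' v') N)))"

lemma val_ext: "elts F (val a) = elts F (val b) \<Longrightarrow> val a = val b"
  using ext_F unfolding extensional_rel_def by blast

lemma act_mem: "act s t \<Longrightarrow> \<exists>p. s \<in> el (up s s) \<and> up s s \<in> el (pr s p) \<and> pr s p \<in> el t"
  by (auto simp: el_pr)

lemma act_induct [case_names step]: "(\<And>t. (\<And>s. act s t \<Longrightarrow> P s) \<Longrightarrow> P t) \<Longrightarrow> P t"
proof -
  assume step: "\<And>t. (\<And>s. act s t \<Longrightarrow> P s) \<Longrightarrow> P t"
  let ?R = "{(x, y). E x y}\<^sup>+"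
  have "wf ?R" using wf by (simp add: wfp_def wf_trancl)
  then show "P t"
  proof (induction t)
    case (less t)
    have "(s, t) \<in> ?R" if a: "act s t" for s
    proof -
      obtain p where "s \<in> el (up s s)" "up s s \<in> el (pr s p)" "pr s p \<in> el t" using act_mem[OF a] by blast
      then have "(s, up s s) \<in> ?R" "(up s s, pr s p) \<in> ?R" "(pr s p, t) \<in> ?R" by (auto simp: E_iff)
      then show ?thesis by (meson trancl_trans)
    qed
    then show ?case using step less by blast
  qed
qed

lemma wf_F: "wfp F"
  unfolding wfp_def wf_def
proof (intro allI impI)
  fix P x assume P: "\<forall>x. (\<forall>y. (y, x) \<in> {(x, y). F x y} \<longrightarrow> P y) \<longrightarrow> P x"
  have "P (val t)" for t
  proof (induction t rule: act_induct)
    case (step t)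
    have "P y" if "F y (val t)" for y
    proof -
      have "y \<in> elts F (val t)" using that by (simp add: elts_def)
      then show ?thesis using step unfolding elF by blast
    qed
    then show ?case using P by blast
  qed
  then show "P x" using surj_val by (metis surjD)
qed

sublocale F: wfm F
  using wf_F ext_F by unfold_locales

lemma elv: "F.el (val t) = {val s | s. act s t}" by (rule elF)

lemma bis_val: "bis N \<Longrightarrow> act (pr u v) N \<Longrightarrow> val u = val v"
proof (induction u arbitrary: v rule: act_induct)
  case (step u)
  have 1: "\<And>u'. act u' u \<Longrightarrow> \<exists>v'. act v' v \<and> act (pr u' v') N"
    and 2: "\<And>v'. act v' v \<Longrightarrow> \<exists>u'. act u' u \<and> act (pr u' v') N"
    using step.prems unfolding bis_def by blast+
  have "F.el (val u) = F.el (val v)"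
  proof (intro equalityI subsetI)
    fix x assume "x \<in> F.el (val u)"
    then obtain u' where u': "act u' u" "x = val u'" unfolding elv by blast
    obtain v' where v': "act v' v" "act (pr u' v') N" using 1[OF u'(1)] by blast
    have "val u' = val v'" using step.IH[OF u'(1) step.prems(1) v'(2)] .
    then show "x \<in> F.el (val v)" using u'(2) v'(1) unfolding elv by blast
  next
    fix x assume "x \<in> F.el (val v)"
    then obtain v' where v': "act v' v" "x = val v'" unfolding elv by blast
    obtain u' where u': "act u' u" "act (pr u' v') N" using 2[OF v'(1)] by blast
    have "val u' = val v'" using step.IH[OF u'(1) step.prems(1) u'(2)] .
    then have "x = val u'" using v'(2) by simp
    then show "x \<in> F.el (val u)" using u'(1) unfolding elv by blast
  qed
  then show ?case by (rule val_ext)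
qed

lemma FG_set:
  assumes "FG (\<lambda>s. P (s 0))"
  obtains N where "\<And>z. act z N \<longleftrightarrow> z \<in> el B \<and> P z"
proof -
  obtain Q where Q: "dfu (\<lambda>s. Q (s 0) (s (Suc 0)))" "\<And>H b. H \<in> {G} \<Longrightarrow> P b \<longleftrightarrow> (\<exists>p\<in>H. Q p b)"
    by (rule Frc_rel[OF assms]) (rule that)
  note [dfI] = df_2[OF Q(1)]
  define N where "N = mk {w \<in> el (tms B (Fn K)). \<exists>z p. w = pr z p \<and> Q p z}"
  have "el N = {w \<in> el (tms B (Fn K)). \<exists>z p. w = pr z p \<and> Q p z}"
    unfolding N_def by (rule el_sep) (intro dfI)
  then have "act z N \<longleftrightarrow> z \<in> el B \<and> P z" for z using Q(2)[of G z] gen_Fn[OF G] by auto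
  then show thesis by (rule that)
qed

text \<open>By induction each pair of active elements with equal values lies in some bisimulation.
  The union of all bisimulations together with (u, v) is again one; it is cut down to a transitive
  set T to become a name, and B is admissible because it merely quantifies over names.\<close>

lemma val_bis: "val u = val v \<Longrightarrow> \<exists>N. bis N \<and> act (pr u v) N"
proof (induction u arbitrary: v rule: act_induct)
  case (step u)
  define B where "B z \<longleftrightarrow> (\<exists>N. bis N \<and> (\<exists>p\<in>G. pr z p \<in> el N))" for z
  obtain T where T: "el (up u v) \<subseteq> el T" "\<forall>y\<in>el T. el y \<subseteq> el T" using transitive_hull by blast
  have Tact: "s \<in> el T" if "act s t" "t \<in> el T" for s t
    using act_mem[OF that(1)] that(2) T(2) by blast
  have "FG (\<lambda>s. B (s 0))" unfolding B_def bis_def by (intro fgI Frc_df dfI)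
  then obtain N0 where N0: "\<And>z. act z N0 \<longleftrightarrow> z \<in> el (tms T T) \<and> B z"
    by (rule FG_set[of B "tms T T"]) blast
  define N where "N = ins (pr (pr u v) emp) N0"
  have N: "act z N \<longleftrightarrow> z = pr u v \<or> act z N0" for z
    unfolding N_def using gen_ne[OF G] by auto
  have uT: "u \<in> el T" "v \<in> el T" using T(1) by auto
  have 1: "\<exists>v'. act v' v \<and> act (pr u' v') N" if u': "act u' u" for u'
  proof -
    have "val u' \<in> F.el (val u)" using u' unfolding elv by blast
    then obtain v' where v': "act v' v" "val u' = val v'" unfolding step.prems elv by blast
    have "B (pr u' v')" unfolding B_def using step.IH[OF u' v'(2)] .
    then have "act (pr u' v') N0" unfolding N0 using Tact[OF u' uT(1)] Tact[OF v'(1) uT(2)] by simp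
    then show ?thesis using v'(1) N by blast
  qed
  have 2: "\<exists>u'. act u' u \<and> act (pr u' v') N" if v': "act v' v" for v'
  proof -
    have "val v' \<in> F.el (val v)" using v' unfolding elv by blast
    then obtain u' where u': "act u' u" "val v' = val u'" unfolding step.prems[symmetric] elv by blast
    have "B (pr u' v')" unfolding B_def using step.IH[OF u'(1) u'(2)[symmetric]] .
    then have "act (pr u' v') N0" unfolding N0 using Tact[OF u'(1) uT(1)] Tact[OF v' uT(2)] by simp
    then show ?thesis using u'(1) N by blast
  qed
  note 12 = 1 2
  have 3: "(\<forall>u'. act u' a \<longrightarrow> (\<exists>v'. act v' b \<and> act (pr u' v') N)) \<and>
     (\<forall>v'. act v' b \<longrightarrow> (\<exists>u'. act u' a \<and> act (pr u' v') N))" if "act (pr a b) N0" for a b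
  proof -
    have ab: "a \<in> el T" "b \<in> el T" "B (pr a b)" using that unfolding N0 by auto
    then obtain M where M: "bis M" "act (pr a b) M" unfolding B_def by blast
    have M0: "act (pr a' b') N" if "act (pr a' b') M" "act a' a" "act b' b" for a' b'
    proof -
      have "B (pr a' b')" unfolding B_def using M(1) that(1) by blast
      then have "act (pr a' b') N0" unfolding N0 using Tact[OF that(2) ab(1)] Tact[OF that(3) ab(2)] by simp
      then show ?thesis unfolding N by blast
    qed
    have 1: "\<And>u'. act u' a \<Longrightarrow> \<exists>v'. act v' b \<and> act (pr u' v') M"
      and 2: "\<And>v'. act v' b \<Longrightarrow> \<exists>u'. act u' a \<and> act (pr u' v') M"
      using M unfolding bis_def by blast+
    show ?thesis
    proof (intro conjI allI impI)
      fix u' assume u': "act u' a"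
      then obtain v' where "act v' b" "act (pr u' v') M" using 1 by blast
      then show "\<exists>v'. act v' b \<and> act (pr u' v') N" using M0 u' by blast
    next
      fix v' assume v': "act v' b"
      then obtain u' where "act u' a" "act (pr u' v') M" using 2 by blast
      then show "\<exists>u'. act u' a \<and> act (pr u' v') N" using M0 v' by blast
    qed
  qed
  have "bis N" unfolding bis_def
  proof (intro allI impI)
    fix a b assume "act (pr a b) N"
    then consider "a = u" "b = v" | "act (pr a b) N0" using N[of "pr a b"] by auto
    then show "(\<forall>u'. act u' a \<longrightarrow> (\<exists>v'. act v' b \<and> act (pr u' v') N)) \<and>
     (\<forall>v'. act v' b \<longrightarrow> (\<exists>u'. act u' a \<and> act (pr u' v') N))"
    proof cases
      case 1
      show ?thesis unfolding \<open>a = u\<close> \<open>b = v\<close> using 12 by blast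
    qed (rule 3)
  qed
  then show ?case using N by blast
qed

lemma FG_eq [fgI]: "tmu t1 \<Longrightarrow> tmu t2 \<Longrightarrow> FG (\<lambda>s. val (t1 s) = val (t2 s))"
proof -
  have "FG (\<lambda>s. \<exists>N. bis N \<and> act (pr (s 0) (s (Suc 0))) N)"
    unfolding bis_def by (intro fgI Frc_df dfI)
  then have "FG (\<lambda>s. val (s 0) = val (s (Suc 0)))"
    by (rule Frc_cong[rotated]) (use bis_val val_bis in blast)
  then show "tmu t1 \<Longrightarrow> tmu t2 \<Longrightarrow> FG (\<lambda>s. val (t1 s) = val (t2 s))"
    by (rule Frc_2[of "\<lambda>H x y. val x = val y"])
qed

lemma FG_mem [fgI]: "tmu t1 \<Longrightarrow> tmu t2 \<Longrightarrow> FG (\<lambda>s. val (t1 s) \<in> F.el (val (t2 s)))"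
proof -
  have "FG (\<lambda>s. \<exists>a. val (s 0) = val a \<and> act a (s (Suc 0)))"
    by (intro fgI Frc_df dfI)
  then have "FG (\<lambda>s. val (s 0) \<in> F.el (val (s (Suc 0))))"
    by (rule Frc_cong[rotated]) (auto simp: elv)
  then show "tmu t1 \<Longrightarrow> tmu t2 \<Longrightarrow> FG (\<lambda>s. val (t1 s) \<in> F.el (val (t2 s)))"
    by (rule Frc_2[of "\<lambda>H x y. val x \<in> F.el (val y)"])
qed

lemma valE: obtains t where "x = val t"
  using surj_val by (metis surjD)

subsection \<open>Comprehension in the extension\<close>

text \<open>The name pairs \<open>f b a\<close> with the conditions that witness P. This is
  comprehension for the extension; as the name depends definably on a, families of such sets can be
  collected into further sets.\<close>

lemma Fname:
  assumes P: "FG (\<lambda>s. P (s 0) (s (Suc 0)))" and f: "tmu (\<lambda>s. f (s 0) (s (Suc 0)))" and B: "tmu (\<lambda>s. B (s 0))"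
  obtains \<nu> where "tmu (\<lambda>s. \<nu> (s 0))"
    "\<And>a. F.el (val (\<nu> a)) = {val (f b a) | b. b \<in> el (B a) \<and> P b a}"
proof -
  obtain Q where Q: "dfu (\<lambda>s. Q (s 0) (s (Suc 0)) (s (Suc (Suc 0))))"
    "\<And>H b c. H \<in> {G} \<Longrightarrow> P b c \<longleftrightarrow> (\<exists>p\<in>H. Q p b c)" by (rule Frc_rel2[OF P]) (rule that)
  note [dfI] = df_3[OF Q(1)] tm_2[OF f] tm_1[OF B]
  let ?X = "\<lambda>a. tms (mk ((\<lambda>b. f b a) ` el (B a))) (Fn K)"
  define \<nu> where "\<nu> a = mk {z \<in> el (?X a). \<exists>b\<in>el (B a). \<exists>p. z = pr (f b a) p \<and> Q p b a}" for a
  have \<nu>: "el (\<nu> a) = {z \<in> el (?X a). \<exists>b\<in>el (B a). \<exists>p. z = pr (f b a) p \<and> Q p b a}" for a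
    unfolding \<nu>_def by (rule el_sep) (intro dfI)
  have tf: "tmu (\<lambda>s. f (s 0) a)" for a by (intro dfI)
  show thesis
  proof (rule that[of \<nu>])
    show "tmu (\<lambda>s. \<nu> (s 0))" unfolding \<nu>_def by (intro dfI)
    fix a
    have act: "act z (\<nu> a) \<longleftrightarrow> (\<exists>b\<in>el (B a). z = f b a \<and> P b a)" for z
      using gen_Fn[OF G] Q(2)[of G _ a] unfolding \<nu> by (fastforce simp: el_img[OF tf])
    show "F.el (val (\<nu> a)) = {val (f b a) | b. b \<in> el (B a) \<and> P b a}" unfolding elv act by blast
  qed
qed

lemma Fcomp:
  assumes P: "FG (\<lambda>s. P (s 0))" and f: "tmu (\<lambda>s. f (s 0))"
  shows "\<exists>t. F.el (val t) = {val (f b) | b. b \<in> el B \<and> P b}"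
proof -
  have "FG (\<lambda>s. P (s 0))" "tmu (\<lambda>s. f (s 0))" "tmu (\<lambda>s. B)" by (fact P, fact f, intro dfI)
  then show ?thesis using Fname[of "\<lambda>b _. P b" "\<lambda>b _. f b" "\<lambda>_. B"] by metis
qed

text \<open>Every condition is attached to every element, so all elements are active,
  \<open>emp\<close> being in G. These are the canonical names of unordered pairs, of pairs and of
  ground model sets.\<close>

definition fup :: "'a \<Rightarrow> 'a \<Rightarrow> 'a" where "fup a b = tms (up a b) (Fn K)"
definition fpr :: "'a \<Rightarrow> 'a \<Rightarrow> 'a" where "fpr a b = fup (fup a a) (fup a b)"
definition ck :: "'a \<Rightarrow> 'a" where "ck = rec (\<lambda>w. tms w (Fn K))"

lemma tm_fup [dfI]: "tmu t1 \<Longrightarrow> tmu t2 \<Longrightarrow> tmu (\<lambda>s. fup (t1 s) (t2 s))"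
  unfolding fup_def by (intro dfI)
lemma tm_fpr [dfI]: "tmu t1 \<Longrightarrow> tmu t2 \<Longrightarrow> tmu (\<lambda>s. fpr (t1 s) (t2 s))"
  unfolding fpr_def by (intro dfI)
lemma tm_ck [dfI]: "tmu t \<Longrightarrow> tmu (\<lambda>s. ck (t s))"
  unfolding ck_def by (rule tm_rec1) (intro dfI)

lemma act_tms: "act s (tms a (Fn K)) \<longleftrightarrow> s \<in> el a"
  by (auto intro!: bexI[of _ emp] simp: gen_ne[OF G])

lemma el_fup: "F.el (val (fup a b)) = {val a, val b}"
  unfolding elv fup_def act_tms by auto

lemma el_ck: "F.el (val (ck x)) = val ` ck ` el x"
proof -
  have t: "tmu (\<lambda>s. ck (s 0))" by (intro dfI)
  have "ck x = tms (mk (ck ` el x)) (Fn K)" unfolding ck_def by (rule rec_eq)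
  then show ?thesis unfolding elv using act_tms[of _ "mk (ck ` el x)"] el_img[OF t, of x] by auto
qed

lemma ck_inj: "val (ck x) = val (ck y) \<longleftrightarrow> x = y"
proof
  show "val (ck x) = val (ck y) \<Longrightarrow> x = y"
  proof (induction x arbitrary: y rule: E_induct)
    case (step x)
    have eq: "val ` ck ` el x = val ` ck ` el y" using el_ck[of x] el_ck[of y] step.prems by simp
    have "el x \<subseteq> el y" using eq step.IH by auto
    moreover have "el y \<subseteq> el x"
    proof
      fix w assume "w \<in> el y"
      then obtain z where "z \<in> el x" "val (ck z) = val (ck w)" using eq by (metis (no_types, lifting) image_iff)
      then show "w \<in> el x" using step.IH by blast
    qed
    ultimately show ?case using ext by blast
  qed
qed simp

lemma ck_mem: "val (ck x) \<in> F.el (val (ck y)) \<longleftrightarrow> x \<in> el y"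
  unfolding el_ck using ck_inj by auto

lemma pair_F: "is_pair F (val a) (val b) z \<longleftrightarrow> z = val (fpr a b)"
proof -
  have 1: "elts F c = {val a} \<longleftrightarrow> c = val (fup a a)" "elts F d = {val a, val b} \<longleftrightarrow> d = val (fup a b)" for c d
    using el_fup[of a a] el_fup[of a b] F.ext[of c "val (fup a a)"] F.ext[of d "val (fup a b)"] by auto
  have "elts F z = {val (fup a a), val (fup a b)} \<longleftrightarrow> z = val (fpr a b)"
    using el_fup[of "fup a a" "fup a b"] F.ext[of z "val (fpr a b)"] by (simp add: fpr_def)
  then show ?thesis unfolding is_pair_def 1 by auto
qed

lemma fpr_eq: "val (fpr a b) = val (fpr c d) \<longleftrightarrow> val a = val c \<and> val b = val d"
proof -
  have up: "val (fup a b) = val (fup c d) \<longleftrightarrow> {val a, val b} = {val c, val d}" for a b c d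
    using F.ext[of "val (fup a b)" "val (fup c d)"] unfolding el_fup by simp
  show ?thesis unfolding fpr_def up by (auto simp: doubleton_eq_iff up)
qed

lemma rel_F: "(val a, val b) \<in> rel_of F (val t) \<longleftrightarrow> val (fpr a b) \<in> F.el (val t)"
  by (auto simp: rel_of_def pair_F)

lemma is_funI:
  assumes P: "FG (\<lambda>s. P (s 0))" and f: "tmu (\<lambda>s. f (s 0))" and g: "tmu (\<lambda>s. g (s 0))"
    and A: "F.el A = {val (f x) | x. x \<in> el B \<and> P x}"
    and h: "\<And>x. x \<in> el B \<Longrightarrow> P x \<Longrightarrow> h (val (f x)) = val (g x)"
  shows "\<exists>r. is_fun F A r h"
proof -
  note [dfI] = tm_1[OF f] tm_1[OF g]
  have "tmu (\<lambda>s. fpr (f (s 0)) (g (s 0)))" by (intro dfI)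
  from Fcomp[OF P this, of B] obtain r
    where r: "F.el (val r) = {val (fpr (f b) (g b)) | b. b \<in> el B \<and> P b}" by blast
  have "(x, y) \<in> rel_of F (val r) \<longleftrightarrow> x \<in> F.el A \<and> y = h x" for x y
  proof -
    obtain a b where "x = val a" "y = val b" by (metis valE)
    then show ?thesis unfolding A using h by (auto simp: rel_F r fpr_eq)
  qed
  then have "is_fun F A (val r) h" unfolding is_fun_def by auto
  then show ?thesis by blast
qed

text \<open>The assumption \<open>eq\<close> makes the passage from the value of f x to the value of
  g x well defined and injective; its graph is a set by \<open>Fcomp\<close>.\<close>

lemma lepollI_F:
  assumes P: "FG (\<lambda>s. P (s 0))" and f: "tmu (\<lambda>s. f (s 0))" and g: "tmu (\<lambda>s. g (s 0))"
    and A: "F.el A = {val (f x) | x. x \<in> el B \<and> P x}"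
    and C: "\<And>x. x \<in> el B \<Longrightarrow> P x \<Longrightarrow> val (g x) \<in> F.el C"
    and eq: "\<And>x y. x \<in> el B \<Longrightarrow> P x \<Longrightarrow> y \<in> el B \<Longrightarrow> P y \<Longrightarrow> val (f x) = val (f y) \<longleftrightarrow> val (g x) = val (g y)"
  shows "lepoll_in F A C"
proof -
  define h where "h v = val (g (SOME x. x \<in> el B \<and> P x \<and> val (f x) = v))" for v
  have h: "h (val (f x)) = val (g x)" if "x \<in> el B" "P x" for x
  proof -
    have "\<exists>y. y \<in> el B \<and> P y \<and> val (f y) = val (f x)" using that by blast
    from someI_ex[OF this] show ?thesis unfolding h_def using eq that by blast
  qed
  obtain r where "is_fun F A r h" using is_funI[OF P f g A h] by blast
  moreover have "inj_on h (F.el A)" unfolding A inj_on_def using h eq by auto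
  moreover have "h ` F.el A \<subseteq> F.el C" unfolding A using h C by auto
  ultimately show ?thesis unfolding lepoll_in_def by blast
qed

lemma eqpollI_F:
  assumes P: "FG (\<lambda>s. P (s 0))" and f: "tmu (\<lambda>s. f (s 0))" and g: "tmu (\<lambda>s. g (s 0))"
    and A: "F.el A = {val (f x) | x. x \<in> el B \<and> P x}"
    and C: "F.el C = {val (g x) | x. x \<in> el B \<and> P x}"
    and eq: "\<And>x y. x \<in> el B \<Longrightarrow> P x \<Longrightarrow> y \<in> el B \<Longrightarrow> P y \<Longrightarrow> val (f x) = val (f y) \<longleftrightarrow> val (g x) = val (g y)"
  shows "eqpoll_in F A C"
proof -
  define h where "h v = val (g (SOME x. x \<in> el B \<and> P x \<and> val (f x) = v))" for v
  have h: "h (val (f x)) = val (g x)" if "x \<in> el B" "P x" for x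
  proof -
    have "\<exists>y. y \<in> el B \<and> P y \<and> val (f y) = val (f x)" using that by blast
    from someI_ex[OF this] show ?thesis unfolding h_def using eq that by blast
  qed
  obtain r where "is_fun F A r h" using is_funI[OF P f g A h] by blast
  moreover have "inj_on h (F.el A)" unfolding A inj_on_def using h eq by auto
  moreover have "h ` F.el A = F.el C" unfolding A C using h by (auto simp: image_iff) (metis h)
  ultimately show ?thesis unfolding eqpoll_in_def bij_betw_def by blast
qed

end

context zfc begin

definition pfst :: "'a \<Rightarrow> 'a" where "pfst z = bun (mk {x \<in> el (bun z). \<exists>y. z = pr x y})"
definition psnd :: "'a \<Rightarrow> 'a" where "psnd z = bun (mk {y \<in> el (bun z). \<exists>x. z = pr x y})"

lemma tm_pfst [dfI]: "tmu t \<Longrightarrow> tmu (\<lambda>s. pfst (t s))"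
  by (rule tm_1[of pfst]) (unfold pfst_def, intro dfI)
lemma tm_psnd [dfI]: "tmu t \<Longrightarrow> tmu (\<lambda>s. psnd (t s))"
  by (rule tm_1[of psnd]) (unfold psnd_def, intro dfI)

lemma bun_single: "el w = {x} \<Longrightarrow> bun w = x"
  by (simp add: ext[symmetric])

lemma pfst_pr [simp]: "pfst (pr x y) = x"
proof -
  have "el (mk {u \<in> el (bun (pr x y)). \<exists>v. pr x y = pr u v}) = {u \<in> el (bun (pr x y)). \<exists>v. pr x y = pr u v}"
    by (rule el_sep) (intro dfI)
  also have "\<dots> = {x}" by (auto simp: el_pr)
  finally show ?thesis unfolding pfst_def by (rule bun_single)
qed

lemma psnd_pr [simp]: "psnd (pr x y) = y"
proof -
  have "el (mk {v \<in> el (bun (pr x y)). \<exists>u. pr x y = pr u v}) = {v \<in> el (bun (pr x y)). \<exists>u. pr x y = pr u v}"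
    by (rule el_sep) (intro dfI)
  also have "\<dots> = {y}" by (auto simp: el_pr)
  finally show ?thesis unfolding psnd_def by (rule bun_single)
qed

end

context gext begin

definition nF :: "nat \<Rightarrow> 'a" where "nF n = val (ck (num n))"

lemma nF_eq [simp]: "nF m = nF n \<longleftrightarrow> m = n"
  by (simp add: nF_def ck_inj)

lemma el_ck_om: "F.el (val (ck om)) = range nF"
  unfolding el_ck el_om by (auto simp: nF_def)

lemma is_numeral_F: "is_numeral F n x \<longleftrightarrow> x = nF n"
proof (induction n arbitrary: x)
  case 0
  have "F.el (val (ck emp)) = {}" by (simp add: el_ck)
  then show ?case using F.ext[of x "val (ck emp)"] by (simp add: nF_def)
next
  case (Suc n)
  have "F.el (nF (Suc n)) = insert (nF n) (F.el (nF n))" by (simp add: nF_def el_ck)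
  then show ?case using F.ext[of x "nF (Suc n)"] by (simp add: Suc)
qed

lemma is_omega_F: "is_omega F w \<longleftrightarrow> w = val (ck om)"
  using F.ext[of w "val (ck om)"] by (auto simp: is_omega_def is_numeral_F el_ck_om)

lemma countable_F: "countable_in F x \<longleftrightarrow> lepoll_in F x (val (ck om))"
  by (simp add: countable_in_def is_omega_F)

lemma is_ordinal_ck: "is_ordinal E a \<Longrightarrow> is_ordinal F (val (ck a))"
  unfolding is_ordinal_def transitive_in_def el_ck by (auto simp: el_ck; blast)

lemma real_F: "real_of F x = {n. nF n \<in> F.el x}"
  by (auto simp: real_of_def is_numeral_F)

lemma is_fun_F:
  assumes "is_fun F A (val r) h" "val x \<in> F.el A"
  shows "h (val x) = val y \<longleftrightarrow> val (fpr x y) \<in> F.el (val r)"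
  using assms unfolding is_fun_def rel_F[symmetric] by auto

text \<open>P is functional at G, so G contains a condition p0 none of whose extensions gives two
  values to one b. Below p0 conditions that give different values to b are incompatible, and the
  chain condition leaves countably many possible values.\<close>

lemma covering:
  assumes P: "FG (\<lambda>s. P (s 0) (s (Suc 0)))"
    and fn: "\<And>b c c'. b \<in> el B \<Longrightarrow> c \<in> el C \<Longrightarrow> c' \<in> el C \<Longrightarrow> P b c \<Longrightarrow> P b c' \<Longrightarrow> c = c'"
  obtains W where "tmu (\<lambda>s. W (s 0))" "\<And>b. b \<in> el B \<Longrightarrow> cbl (W b)"
    "\<And>b c. b \<in> el B \<Longrightarrow> c \<in> el C \<Longrightarrow> P b c \<Longrightarrow> c \<in> el (W b)"
proof -
  obtain Q where Q: "dfu (\<lambda>s. Q (s 0) (s (Suc 0)) (s (Suc (Suc 0))))"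
    "\<And>H b c. H \<in> {G} \<Longrightarrow> P b c \<longleftrightarrow> (\<exists>p\<in>H. Q p b c)"
    "\<And>p q b c. Q p b c \<Longrightarrow> p \<in> el (Fn K) \<Longrightarrow> el p \<subseteq> el q \<Longrightarrow> Q q b c" by (rule Frc_rel2[OF P]) (rule that)
  note [dfI] = df_3[OF Q(1)]
  let ?bad = "\<lambda>p. \<exists>b\<in>el B. \<exists>c\<in>el C. \<exists>c'\<in>el C. c \<noteq> c' \<and> Q p b c \<and> Q p b c'"
  obtain p0 where p0: "p0 \<in> G" "?bad p0 \<or> (\<forall>q\<in>el (Fn K). el p0 \<subseteq> el q \<longrightarrow> \<not> ?bad q)"
  proof (rule gen_dense[OF G, of "\<lambda>p. ?bad p \<or> (\<forall>q\<in>el (Fn K). el p \<subseteq> el q \<longrightarrow> \<not> ?bad q)"])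
    show "dfu (\<lambda>s. ?bad (s 0) \<or> (\<forall>q\<in>el (Fn K). el (s 0) \<subseteq> el q \<longrightarrow> \<not> ?bad q))" by (intro dfI)
  qed blast+
  have "\<not> ?bad p0"
  proof
    assume "?bad p0"
    then obtain b c c' where b: "b \<in> el B" "c \<in> el C" "c' \<in> el C" "c \<noteq> c'" "Q p0 b c" "Q p0 b c'" by blast
    then have "P b c" "P b c'" using Q(2)[of G] p0(1) by blast+
    then show False using fn b by blast
  qed
  then have nb: "\<And>q. q \<in> el (Fn K) \<Longrightarrow> el p0 \<subseteq> el q \<Longrightarrow> \<not> ?bad q" using p0(2) by blast
  define W where "W b = mk {c \<in> el C. \<exists>q\<in>el (Fn K). el p0 \<subseteq> el q \<and> Q q b c}" for b
  have W: "el (W b) = {c \<in> el C. \<exists>q\<in>el (Fn K). el p0 \<subseteq> el q \<and> Q q b c}" for b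
    unfolding W_def by (rule el_sep) (intro dfI)
  show thesis
  proof (rule that[of W])
    show "tmu (\<lambda>s. W (s 0))" unfolding W_def by (intro dfI)
    fix b assume b: "b \<in> el B"
    show "cbl (W b)"
    proof -
      have 1: "dfu (\<lambda>s. el p0 \<subseteq> el (s (Suc 0)) \<and> Q (s (Suc 0)) b (s 0))" by (intro dfI)
      have ex: "\<exists>q\<in>el (Fn K). el p0 \<subseteq> el q \<and> Q q b c" if "c \<in> el (W b)" for c using that unfolding W by blast
      obtain f where f: "\<And>c. c \<in> el (W b) \<Longrightarrow> app f c \<in> el (Fn K) \<and> el p0 \<subseteq> el (app f c) \<and> Q (app f c) b c"
        by (rule choice[OF 1 ex]) (assumption, rule that)
      have inc: "\<not> cons (el (app f c) \<union> el (app f c'))" if c: "c \<in> el (W b)" "c' \<in> el (W b)" "c \<noteq> c'" for c c'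
      proof
        assume co: "cons (el (app f c) \<union> el (app f c'))"
        let ?u = "un (app f c) (app f c')"
        have u: "?u \<in> el (Fn K)" using f[OF c(1)] f[OF c(2)] co by (intro Fn_un) auto
        have "Q ?u b c" by (rule Q(3)[of "app f c"]) (use f[OF c(1)] in auto)
        moreover have "Q ?u b c'" by (rule Q(3)[of "app f c'"]) (use f[OF c(2)] in auto)
        moreover have "el p0 \<subseteq> el ?u" using f[OF c(1)] by auto
        ultimately show False using nb[OF u] b c unfolding W by blast
      qed
      have ta: "tmu (\<lambda>s. app f (s 0))" by (intro dfI)
      have A: "el (mk (app f ` el (W b))) = app f ` el (W b)" by (rule el_img[OF ta])
      have "cbl (mk (app f ` el (W b)))"
        by (rule ccc_Fn) (unfold A, use f inc in auto)
      moreover have "inj_on (app f) (el (W b))"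
      proof (rule inj_onI, rule ccontr)
        fix c c' assume c: "c \<in> el (W b)" "c' \<in> el (W b)" "app f c = app f c'" "c \<noteq> c'"
        then show False using inc[OF c(1,2,4)] f[OF c(2)] by (simp add: el_Fn)
      qed
      then have "lepoll_in E (W b) (mk (app f ` el (W b)))" by (rule lepollI[OF ta]) (simp add: A)
      ultimately show ?thesis using lepoll_trans unfolding cbl_lepoll by blast
    qed
    fix c assume c: "c \<in> el C" "P b c"
    then obtain q where q: "q \<in> G" "Q q b c" using Q(2)[of G] by blast
    obtain r where r: "r \<in> G" "el p0 \<subseteq> el r" "el q \<subseteq> el r" using gen_dir[OF G p0(1) q(1)] by blast
    have "Q r b c" using Q(3)[OF q(2) gen_Fn[OF G q(1)] r(3)] .
    then show "c \<in> el (W b)" using c(1) r gen_Fn[OF G r(1)] unfolding W by blast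
  qed
qed

text \<open>An injection of \<omega>_1 into \<omega> in the extension is read backwards as a partial
  function on \<omega>; \<open>covering\<close> would then make \<omega>_1 a countable union of
  countable sets of the ground model.\<close>

lemma omega1_F: "is_omega1 F k \<longleftrightarrow> k = val (ck w1)"
proof -
  have ord: "is_ordinal F (val (ck w1))" by (rule is_ordinal_ck[OF w1(1)])
  have ctbl: "countable_in F a" if a: "a \<in> F.el (val (ck w1))" for a
  proof -
    obtain \<alpha> where \<alpha>: "\<alpha> \<in> el w1" "a = val (ck \<alpha>)" using a unfolding el_ck by blast
    obtain f where f: "inj_on (app f) (el \<alpha>)" "app f ` el \<alpha> \<subseteq> el om" using w1(3)[OF \<alpha>(1)] unfolding cbl_def by blast
    show ?thesis unfolding countable_F \<alpha>(2)
    proof (rule lepollI_F[of "\<lambda>_. True" ck "\<lambda>x. ck (app f x)" _ \<alpha>])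
      show "FG (\<lambda>s. True)" by (intro Frc_df dfI)
      show "tmu (\<lambda>s. ck (s 0))" "tmu (\<lambda>s. ck (app f (s 0)))" by (intro dfI)+
      show "F.el (val (ck \<alpha>)) = {val (ck x) |x. x \<in> el \<alpha> \<and> True}" unfolding el_ck by blast
    qed (use f in \<open>auto simp: ck_inj ck_mem inj_on_def\<close>)
  qed
  have unc: "\<not> countable_in F (val (ck w1))"
  proof
    assume "countable_in F (val (ck w1))"
    then obtain r h where r: "is_fun F (val (ck w1)) (val r) h" "inj_on h (F.el (val (ck w1)))"
      "h ` F.el (val (ck w1)) \<subseteq> F.el (val (ck om))" unfolding countable_F lepoll_in_def by (metis valE)
    let ?P = "\<lambda>n \<alpha>. val (fpr (ck \<alpha>) (ck n)) \<in> F.el (val r)"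
    have P: "FG (\<lambda>s. ?P (s 0) (s (Suc 0)))" by (intro fgI dfI)
    have h: "h (val (ck \<alpha>)) = val (ck n) \<longleftrightarrow> ?P n \<alpha>" if "\<alpha> \<in> el w1" for \<alpha> n
      by (rule is_fun_F[OF r(1)]) (simp add: ck_mem that)
    obtain W where W: "tmu (\<lambda>s. W (s 0))" "\<And>b. b \<in> el om \<Longrightarrow> cbl (W b)"
      "\<And>b c. b \<in> el om \<Longrightarrow> c \<in> el w1 \<Longrightarrow> ?P b c \<Longrightarrow> c \<in> el (W b)"
    proof (rule covering[OF P, of om w1])
      fix n \<alpha> \<beta> assume a: "\<alpha> \<in> el w1" "\<beta> \<in> el w1" "?P n \<alpha>" "?P n \<beta>"
      then have "h (val (ck \<alpha>)) = h (val (ck \<beta>))" using h by metis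
      then have "val (ck \<alpha>) = val (ck \<beta>)" using r(2) a unfolding inj_on_def by (simp add: ck_mem)
      then show "\<alpha> = \<beta>" by (simp add: ck_inj)
    qed (rule that)
    have "cbl om" unfolding cbl_lepoll by (rule lepoll_subset) simp
    then have "cbl (bun (mk (W ` el om)))" by (rule cbl_UN'[OF W(1)]) (rule W(2))
    moreover have "el w1 \<subseteq> el (bun (mk (W ` el om)))"
    proof
      fix \<alpha> assume \<alpha>: "\<alpha> \<in> el w1"
      then have "h (val (ck \<alpha>)) \<in> F.el (val (ck om))" using r(3) by (auto simp: ck_mem)
      then obtain n where n: "n \<in> el om" "h (val (ck \<alpha>)) = val (ck n)" unfolding el_ck by blast
      then have "\<alpha> \<in> el (W n)" using W(3) h \<alpha> by blast
      then show "\<alpha> \<in> el (bun (mk (W ` el om)))" using n(1) unfolding el_bun_img[OF W(1)] by blast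
    qed
    ultimately show False using w1(2) cbl_subset by blast
  qed
  show ?thesis
  proof
    assume k: "is_omega1 F k"
    then have "is_ordinal F k" unfolding is_omega1_def by blast
    from F.ord_cmp[OF this ord] k show "k = val (ck w1)" using ctbl unc unfolding is_omega1_def by blast
  next
    assume "k = val (ck w1)"
    then show "is_omega1 F k" using ord ctbl unc unfolding is_omega1_def by blast
  qed
qed

lemma act_dom: "act s t \<Longrightarrow> s \<in> el (bun (bun t))"
  using act_mem[of s t] unfolding el_bun by blast

text \<open>The composite has to be named. Its points are represented by pairs of names from double
  unions, which contain all active names, and the intermediate value is expressed by a quantifier
  over names.\<close>

lemma lepoll_trans_F:
  assumes "lepoll_in F A B" "lepoll_in F B C"
  shows "lepoll_in F A C"
proof -
  obtain ta tc where t: "A = val ta" "C = val tc" by (metis valE)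
  obtain f h where f: "is_fun F A (val f) h" "inj_on h (F.el A)" "h ` F.el A \<subseteq> F.el B"
    using assms(1) unfolding lepoll_in_def by (metis valE)
  obtain g k where g: "is_fun F B (val g) k" "inj_on k (F.el B)" "k ` F.el B \<subseteq> F.el C"
    using assms(2) unfolding lepoll_in_def by (metis valE)
  let ?P = "\<lambda>z. val (pfst z) \<in> F.el (val ta) \<and>
    (\<exists>m. val (fpr (pfst z) m) \<in> F.el (val f) \<and> val (fpr m (psnd z)) \<in> F.el (val g))"
  have P: "FG (\<lambda>s. ?P (s 0))" by (intro fgI dfI)
  have Pz: "?P z \<longleftrightarrow> val (pfst z) \<in> F.el A \<and> val (psnd z) = k (h (val (pfst z)))" for z
  proof -
    have "(\<exists>m. val (fpr (pfst z) m) \<in> F.el (val f) \<and> val (fpr m (psnd z)) \<in> F.el (val g)) \<longleftrightarrow>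
        val (psnd z) = k (h (val (pfst z)))" if a: "val (pfst z) \<in> F.el A"
    proof -
      obtain m0 where m0: "h (val (pfst z)) = val m0" by (metis valE)
      have hB: "val m0 \<in> F.el B" using f(3) a m0 by (metis image_subset_iff)
      have 1: "val (fpr (pfst z) m) \<in> F.el (val f) \<longleftrightarrow> val m0 = val m" for m
        using is_fun_F[OF f(1) a, of m] m0 by simp
      have "val (fpr m (psnd z)) \<in> F.el (val g) \<longleftrightarrow> k (val m0) = val (psnd z)" if "val m0 = val m" for m
        using is_fun_F[OF g(1), of m "psnd z"] hB that by simp
      then show ?thesis using 1 m0 by metis
    qed
    then show ?thesis using t by blast
  qed
  have tms: "tmu (\<lambda>s. pfst (s 0))" "tmu (\<lambda>s. psnd (s 0))" by (intro dfI)+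
  have kh: "k (h x) \<in> F.el C" if "x \<in> F.el A" for x using f(3) g(3) that by blast
  have inj: "x = y" if "x \<in> F.el A" "y \<in> F.el A" "k (h x) = k (h y)" for x y
    using that f(2,3) g(2) unfolding inj_on_def by blast
  show ?thesis
  proof (rule lepollI_F[of ?P pfst psnd _ "tms (bun (bun ta)) (bun (bun tc))", OF P tms])
    show "F.el A = {val (pfst z) |z. z \<in> el (tms (bun (bun ta)) (bun (bun tc))) \<and> ?P z}"
    proof (intro equalityI subsetI)
      fix x assume x: "x \<in> F.el A"
      then obtain s where s: "act s ta" "x = val s" unfolding t elv by blast
      have "k (h x) \<in> F.el C" using kh x by blast
      then obtain s' where s': "act s' tc" "k (h x) = val s'" unfolding t elv by blast
      have "pr s s' \<in> el (tms (bun (bun ta)) (bun (bun tc)))" using act_dom[OF s(1)] act_dom[OF s'(1)] by simp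
      moreover have "?P (pr s s')" unfolding Pz using x s s' by simp
      ultimately show "x \<in> {val (pfst z) |z. z \<in> el (tms (bun (bun ta)) (bun (bun tc))) \<and> ?P z}"
        using s(2) by (intro CollectI exI[of _ "pr s s'"]) simp
    qed (use Pz in blast)
    show "val (psnd z) \<in> F.el C" if "?P z" for z using that kh unfolding Pz by simp
    show "val (pfst x) = val (pfst y) \<longleftrightarrow> val (psnd x) = val (psnd y)" if "?P x" "?P y" for x y
      using that inj unfolding Pz by metis
  qed
qed

text \<open>Different names can have the same value; keeping the name of least index selects one per
  value by an admissible predicate.\<close>

lemma least_reps:
  assumes f: "tmu (\<lambda>s. f (s 0))" and i: "inj_on (app i) (el B)" "app i ` el B \<subseteq> el w1"
  obtains U where "FG (\<lambda>s. U (s 0))" "\<And>b. U b \<Longrightarrow> b \<in> el B"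
    "\<And>b. b \<in> el B \<Longrightarrow> \<exists>u. U u \<and> val (f u) = val (f b)"
    "\<And>u v. U u \<Longrightarrow> U v \<Longrightarrow> val (f u) = val (f v) \<Longrightarrow> u = v"
proof -
  note [dfI] = tm_1[OF f]
  define U where "U b \<longleftrightarrow> b \<in> el B \<and> (\<forall>b'\<in>el B. val (f b') = val (f b) \<longrightarrow> app i b' \<notin> el (app i b))" for b
  have FGU: "FG (\<lambda>s. U (s 0))" unfolding U_def by (intro fgI, (intro Frc_df dfI)[1], (intro fgI dfI)+, (intro Frc_df dfI)[1])
  have U_ex: "\<exists>u. U u \<and> val (f u) = val (f b)" if b: "b \<in> el B" for b
  proof -
    have "app i b \<in> app i ` {b' \<in> el B. val (f b') = val (f b)}" using b by blast
    from E_min[OF this] obtain u where u: "u \<in> el B" "val (f u) = val (f b)"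
      "\<forall>z\<in>el (app i u). z \<notin> app i ` {b' \<in> el B. val (f b') = val (f b)}" by blast
    then have "U u" unfolding U_def by fastforce
    then show ?thesis using u(2) by blast
  qed
  have U_un: "u = v" if "U u" "U v" "val (f u) = val (f v)" for u v
  proof -
    have "u \<in> el B" "v \<in> el B" using that unfolding U_def by blast+
    moreover from this have "is_ordinal E (app i u)" "is_ordinal E (app i v)" using i(2) w1_ord by blast+
    ultimately have "app i u = app i v" using ord_cmp that unfolding U_def by metis
    then show ?thesis using i(1) \<open>u \<in> el B\<close> \<open>v \<in> el B\<close> unfolding inj_on_def by blast
  qed
  show thesis using that[OF FGU _ U_ex U_un] unfolding U_def by blast
qed

lemma lepoll_w1_F:
  assumes f: "tmu (\<lambda>s. f (s 0))" and Z: "F.el Z = {val (f b) | b. b \<in> el B}" and B: "lepoll_in E B w1"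
  shows "lepoll_in F Z (val (ck w1))"
proof -
  obtain i where i: "inj_on (app i) (el B)" "app i ` el B \<subseteq> el w1" using B unfolding lepoll_iff by blast
  obtain U where U: "FG (\<lambda>s. U (s 0))" "\<And>b. U b \<Longrightarrow> b \<in> el B"
    "\<And>b. b \<in> el B \<Longrightarrow> \<exists>u. U u \<and> val (f u) = val (f b)"
    "\<And>u v. U u \<Longrightarrow> U v \<Longrightarrow> val (f u) = val (f v) \<Longrightarrow> u = v" by (rule least_reps[OF f i]) (rule that)
  have g: "tmu (\<lambda>s. ck (app i (s 0)))" by (intro dfI)
  show ?thesis
  proof (rule lepollI_F[OF U(1) f g])
    show "F.el Z = {val (f x) |x. x \<in> el B \<and> U x}" unfolding Z using U(2,3) by (auto; metis)
    show "val (ck (app i x)) \<in> F.el (val (ck w1))" if "x \<in> el B" for x using i(2) that unfolding ck_mem by blast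
    show "val (f x) = val (f y) \<longleftrightarrow> val (ck (app i x)) = val (ck (app i y))" if "U x" "U y" for x y
      unfolding ck_inj using U(2,4) that i(1) unfolding inj_on_def by blast
  qed
qed

text \<open>Cantor-Bernstein, carried out with admissible predicates: U represents the values,
  \<open>app i\<close> injects U into \<omega>_1, and J sends \<alpha> to the representative of
  \<open>e \<alpha>\<close>.\<close>

lemma size_w1:
  assumes f: "tmu (\<lambda>s. f (s 0))" and Z: "F.el Z = {val (f b) | b. b \<in> el B}"
    and i: "lepoll_in E B w1"
    and e: "tmu (\<lambda>s. e (s 0))" "\<And>\<alpha>. \<alpha> \<in> el w1 \<Longrightarrow> e \<alpha> \<in> el B"
      "\<And>\<alpha> \<beta>. \<alpha> \<in> el w1 \<Longrightarrow> \<beta> \<in> el w1 \<Longrightarrow> val (f (e \<alpha>)) = val (f (e \<beta>)) \<Longrightarrow> \<alpha> = \<beta>"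
  shows "eqpoll_in F Z (val (ck w1))"
proof -
  obtain i where i: "inj_on (app i) (el B)" "app i ` el B \<subseteq> el w1" using i unfolding lepoll_iff by blast
  note [dfI] = tm_1[OF f] tm_1[OF e(1)]
  obtain U where FGU0: "FG (\<lambda>s. U (s 0))" and U_B: "\<And>b. U b \<Longrightarrow> b \<in> el B"
    and U_ex: "\<And>b. b \<in> el B \<Longrightarrow> \<exists>u. U u \<and> val (f u) = val (f b)"
    and U_un: "\<And>u v. U u \<Longrightarrow> U v \<Longrightarrow> val (f u) = val (f v) \<Longrightarrow> u = v" by (rule least_reps[OF f i]) (rule that)
  from FGU0 have FGU: "tmu t \<Longrightarrow> FG (\<lambda>s. U (t s))" for t by (rule Frc_1[of "\<lambda>H. U"])
  define J where "J \<alpha> u \<longleftrightarrow> U u \<and> val (f u) = val (f (e \<alpha>))" for \<alpha> u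
  have FGJ: "tmu t \<Longrightarrow> tmu t' \<Longrightarrow> FG (\<lambda>s. J (t s) (t' s))" for t t'
    unfolding J_def by (intro fgI FGU dfI)
  have J_ex: "\<exists>u. J \<alpha> u" if "\<alpha> \<in> el w1" for \<alpha> using U_ex[OF e(2)[OF that]] unfolding J_def by blast
  have J_un: "J \<alpha> u \<Longrightarrow> J \<alpha> v \<Longrightarrow> u = v" for \<alpha> u v unfolding J_def using U_un by simp
  have J_inj: "J \<alpha> u \<Longrightarrow> J \<beta> u \<Longrightarrow> \<alpha> \<in> el w1 \<Longrightarrow> \<beta> \<in> el w1 \<Longrightarrow> \<alpha> = \<beta>" for \<alpha> \<beta> u unfolding J_def using e(3) by metis
  \<comment> \<open>The least set that contains the ordinals outside the range of
    \<open>app i\<close> on U and is closed under J followed by \<open>app i\<close>; names N stand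
    for the candidates. On X the bijection follows J, elsewhere the inverse of
    \<open>app i\<close>.\<close>
  define X where "X \<alpha> \<longleftrightarrow> (\<forall>N. (\<forall>\<gamma>\<in>el w1. (\<forall>u\<in>el B. U u \<longrightarrow> \<gamma> \<noteq> app i u) \<longrightarrow> act \<gamma> N) \<and>
     (\<forall>\<gamma>\<in>el w1. \<forall>u\<in>el B. act \<gamma> N \<and> J \<gamma> u \<longrightarrow> act (app i u) N) \<longrightarrow> act \<alpha> N)" for \<alpha>
  have FGX: "FG (\<lambda>s. X (s 0))" unfolding X_def by (intro fgI FGU FGJ Frc_df dfI)
  then have FGX': "tmu t \<Longrightarrow> FG (\<lambda>s. X (t s))" for t by (rule Frc_1[of "\<lambda>H. X"])
  have X0: "X \<gamma>" if "\<gamma> \<in> el w1" "\<And>u. U u \<Longrightarrow> \<gamma> \<noteq> app i u" for \<gamma> unfolding X_def using that by blast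
  have X1: "X (app i u)" if "X \<gamma>" "\<gamma> \<in> el w1" "J \<gamma> u" for \<gamma> u
    using that U_B unfolding X_def J_def by blast
  have X2: "\<exists>\<gamma>\<in>el w1. X \<gamma> \<and> J \<gamma> u" if u: "U u" "X (app i u)" for u
  proof (rule ccontr)
    assume n: "\<not> ?thesis"
    have uB: "u \<in> el B" using u U_B by blast
    have "FG (\<lambda>s. X (s 0) \<and> s 0 \<noteq> app i u)" by (intro fgI FGX' Frc_df dfI)
    then obtain N where N: "\<And>z. act z N \<longleftrightarrow> z \<in> el w1 \<and> X z \<and> z \<noteq> app i u"
      by (rule FG_set[of "\<lambda>z. X z \<and> z \<noteq> app i u" w1]) blast
    have a: "act \<gamma> N" if "\<gamma> \<in> el w1" "\<forall>u\<in>el B. U u \<longrightarrow> \<gamma> \<noteq> app i u" for \<gamma>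
      unfolding N using that X0[OF that(1)] u(1) uB U_B by blast
    have b: "act (app i v) N" if v: "\<gamma> \<in> el w1" "v \<in> el B" "act \<gamma> N" "J \<gamma> v" for \<gamma> v
    proof -
      have X\<gamma>: "X \<gamma>" using v(3) unfolding N by blast
      have "app i v \<noteq> app i u"
      proof
        assume "app i v = app i u"
        then have "v = u" using i(1) v(2) uB unfolding inj_on_def by blast
        then show False using n v X\<gamma> by blast
      qed
      moreover have "app i v \<in> el w1" using i(2) v(2) by blast
      ultimately show ?thesis unfolding N using X1[OF X\<gamma> v(1,4)] by blast
    qed
    have "act (app i u) N" using u(2) a b unfolding X_def by blast
    then show False unfolding N by blast
  qed
  define bb where "bb \<alpha> u \<longleftrightarrow> \<alpha> \<in> el w1 \<and> U u \<and> (X \<alpha> \<and> J \<alpha> u \<or> \<not> X \<alpha> \<and> \<alpha> = app i u)" for \<alpha> u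
  have FGb: "tmu t \<Longrightarrow> tmu t' \<Longrightarrow> FG (\<lambda>s. bb (t s) (t' s))" for t t'
    unfolding bb_def by (intro fgI FGU FGJ FGX'; (assumption | (intro Frc_df dfI)[1]))
  have b1: "\<exists>u. bb \<alpha> u" if \<alpha>: "\<alpha> \<in> el w1" for \<alpha>
  proof (cases "X \<alpha>")
    case True then show ?thesis using J_ex[OF \<alpha>] \<alpha> unfolding bb_def J_def by blast
  next
    case False
    then obtain u where "U u" "\<alpha> = app i u" using X0[OF \<alpha>] by blast
    then show ?thesis using False \<alpha> unfolding bb_def by blast
  qed
  have b2: "\<exists>\<alpha>. bb \<alpha> u" if u: "U u" for u
  proof (cases "X (app i u)")
    case True then show ?thesis using X2[OF u] u unfolding bb_def by blast
  next
    case False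
    moreover have "app i u \<in> el w1" using u i(2) U_B by blast
    ultimately show ?thesis using u unfolding bb_def by blast
  qed
  have b3: "u = v \<longleftrightarrow> \<alpha> = \<beta>" if b: "bb \<alpha> u" "bb \<beta> v" for \<alpha> \<beta> u v
  proof
    assume [simp]: "u = v"
    show "\<alpha> = \<beta>" using b X1[of \<alpha> v] X1[of \<beta> v] J_inj[of \<alpha> v \<beta>] unfolding bb_def by auto
  next
    assume [simp]: "\<alpha> = \<beta>"
    have "app i u = app i v \<Longrightarrow> u = v" using b i(1) U_B unfolding bb_def inj_on_def by blast
    then show "u = v" using b J_un[of \<beta> u v] unfolding bb_def by auto
  qed
  let ?P = "\<lambda>z. bb (pfst z) (psnd z)"
  show ?thesis
  proof (rule eqpollI_F[of ?P "\<lambda>z. f (psnd z)" "\<lambda>z. ck (pfst z)" _ "tms w1 B"])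
    show "FG (\<lambda>s. ?P (s 0))" by (intro FGb dfI)
    show "tmu (\<lambda>s. f (psnd (s 0)))" "tmu (\<lambda>s. ck (pfst (s 0)))" by (intro dfI)+
    have bB: "\<alpha> \<in> el w1 \<and> u \<in> el B" if "bb \<alpha> u" for \<alpha> u using that U_B unfolding bb_def by blast
    show "F.el Z = {val (f (psnd z)) |z. z \<in> el (tms w1 B) \<and> ?P z}"
    proof (intro equalityI subsetI)
      fix x assume "x \<in> F.el Z"
      then obtain b where "b \<in> el B" "x = val (f b)" unfolding Z by blast
      then obtain u where u: "U u" "x = val (f u)" using U_ex by metis
      then obtain \<alpha> where a: "bb \<alpha> u" using b2 by blast
      have "pr \<alpha> u \<in> el (tms w1 B)" using bB[OF a] by simp
      then show "x \<in> {val (f (psnd z)) |z. z \<in> el (tms w1 B) \<and> ?P z}"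
        using u(2) a by (intro CollectI exI[of _ "pr \<alpha> u"]) simp
    next
      fix x assume "x \<in> {val (f (psnd z)) |z. z \<in> el (tms w1 B) \<and> ?P z}"
      then show "x \<in> F.el Z" unfolding Z using bB by blast
    qed
    show "F.el (val (ck w1)) = {val (ck (pfst z)) |z. z \<in> el (tms w1 B) \<and> ?P z}"
    proof (intro equalityI subsetI)
      fix x assume "x \<in> F.el (val (ck w1))"
      then obtain \<alpha> where \<alpha>: "\<alpha> \<in> el w1" "x = val (ck \<alpha>)" unfolding el_ck by blast
      then obtain u where a: "bb \<alpha> u" using b1 by blast
      have "pr \<alpha> u \<in> el (tms w1 B)" using bB[OF a] by simp
      then show "x \<in> {val (ck (pfst z)) |z. z \<in> el (tms w1 B) \<and> ?P z}"
        using \<alpha>(2) a by (intro CollectI exI[of _ "pr \<alpha> u"]) simp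
    next
      fix x assume "x \<in> {val (ck (pfst z)) |z. z \<in> el (tms w1 B) \<and> ?P z}"
      then show "x \<in> F.el (val (ck w1))" unfolding el_ck using bB by blast
    qed
    fix x y assume x: "?P x" and y: "?P y"
    have "val (f (psnd x)) = val (f (psnd y)) \<longleftrightarrow> psnd x = psnd y"
      using x y U_un unfolding bb_def by metis
    then show "val (f (psnd x)) = val (f (psnd y)) \<longleftrightarrow> val (ck (pfst x)) = val (ck (pfst y))"
      using b3[OF x y] by (simp add: ck_inj)
  qed
qed

end

section \<open>Arithmetical closure\<close>

abbreviation pe :: "nat \<Rightarrow> nat \<Rightarrow> nat" where "pe m n \<equiv> prod_encode (m, n)"

lemma pe_cases: obtains m n where "c = pe m n"
  by (metis prod_decode_inverse surj_pair)

locale arith_ops =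
  fixes Z :: "nat set set"
  assumes compl: "A \<in> Z \<Longrightarrow> - A \<in> Z" and union: "A \<in> Z \<Longrightarrow> B \<in> Z \<Longrightarrow> A \<union> B \<in> Z"
    and ex: "A \<in> Z \<Longrightarrow> {n. \<exists>m. pe m n \<in> A} \<in> Z"
    and fst: "A \<in> Z \<Longrightarrow> {n. \<exists>m k. n = pe m k \<and> m \<in> A} \<in> Z"
    and snd: "A \<in> Z \<Longrightarrow> {n. \<exists>m k. n = pe m k \<and> k \<in> A} \<in> Z"
    and skip: "A \<in> Z \<Longrightarrow> {n. \<exists>x y c. n = pe x (pe y c) \<and> pe x c \<in> A} \<in> Z"
    and dup: "{n. \<exists>x c. n = pe x (pe x c)} \<in> Z"
    and plus: "{n. \<exists>x y z c. n = pe x (pe y (pe z c)) \<and> x + y = z} \<in> Z"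
    and times: "{n. \<exists>x y z c. n = pe x (pe y (pe z c)) \<and> x * y = z} \<in> Z"
    and diag: "{n. \<exists>x. n = pe x x} \<in> Z"
    and zero: "{0} \<in> Z" and suc: "A \<in> Z \<Longrightarrow> Suc ` A \<in> Z"
begin

lemma inter: "A \<in> Z \<Longrightarrow> B \<in> Z \<Longrightarrow> A \<inter> B \<in> Z"
  using compl[OF union[OF compl compl], of A B] by simp

text \<open>The values of the variables are coded in one number c, and v i reads variable i off the
  code. The graph is the form in which such a function enters the closure operations.\<close>

definition gr :: "(nat \<Rightarrow> nat) \<Rightarrow> nat set" where "gr v = {n. \<exists>c. n = pe (v c) c}"

lemma single: "{k} \<in> Z"
proof (induction k)
  case (Suc k) then show ?case using suc[of "{k}"] by simp
qed (rule zero)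

lemma gr_const: "gr (\<lambda>_. k) \<in> Z"
proof -
  have "{n. \<exists>m c. n = pe m c \<and> m \<in> {k}} = gr (\<lambda>_. k)" by (auto simp: gr_def)
  then show ?thesis using fst[OF single[of k]] by (simp only:)
qed

lemma gr_id: "gr (\<lambda>c. c) \<in> Z"
  using diag by (simp add: gr_def)

text \<open>The induction generalizes over the way in which variables are read off the code. A
  quantifier pushes a new value in front of the code: \<open>dup\<close> reads the new variable,
  \<open>skip\<close> the old ones, and \<open>ex\<close> projects.\<close>

lemma sat_closed:
  assumes S: "range S \<subseteq> Z"
  shows "(\<And>i. gr (v i) \<in> Z) \<Longrightarrow> {c. arith_sat S (\<lambda>i. v i c) \<phi>} \<in> Z"
proof (induction \<phi> arbitrary: v)
  case (AEq i j)
  have "{n. \<exists>m. pe m n \<in> gr (v i) \<inter> gr (v j)} = {c. arith_sat S (\<lambda>i. v i c) (AEq i j)}"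
    by (auto simp: gr_def)
  then show ?case using ex[OF inter[OF AEq AEq]] by metis
next
  case (APlus i j k)
  let ?A = "{n. \<exists>x y z c. n = pe x (pe y (pe z c)) \<and> x + y = z}"
  let ?sk = "\<lambda>A. {n. \<exists>x y c. n = pe x (pe y c) \<and> pe x c \<in> A}"
  let ?sn = "\<lambda>A. {n. \<exists>m k. n = pe m k \<and> k \<in> A}"
  \<comment> \<open>Codes prefixed with the three values of the variables; three projections remove
    the prefixes again.\<close>
  define B where "B = ?A \<inter> (?sk (?sk (gr (v i))) \<inter> (?sn (?sk (gr (v j))) \<inter> ?sn (?sn (gr (v k)))))"
  have B: "B \<in> Z" unfolding B_def by (intro inter plus skip snd APlus)
  have eq: "pe x (pe y (pe z c)) \<in> B \<longleftrightarrow> x = v i c \<and> y = v j c \<and> z = v k c \<and> x + y = z" for x y z c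
    by (auto simp: B_def gr_def)
  have "{c. \<exists>z. pe z c \<in> {b. \<exists>y. pe y b \<in> {a. \<exists>x. pe x a \<in> B}}} \<in> Z" by (intro ex B)
  then show ?case unfolding mem_Collect_eq eq by simp
next
  case (ATimes i j k)
  let ?A = "{n. \<exists>x y z c. n = pe x (pe y (pe z c)) \<and> x * y = z}"
  let ?sk = "\<lambda>A. {n. \<exists>x y c. n = pe x (pe y c) \<and> pe x c \<in> A}"
  let ?sn = "\<lambda>A. {n. \<exists>m k. n = pe m k \<and> k \<in> A}"
  define B where "B = ?A \<inter> (?sk (?sk (gr (v i))) \<inter> (?sn (?sk (gr (v j))) \<inter> ?sn (?sn (gr (v k)))))"
  have B: "B \<in> Z" unfolding B_def by (intro inter times skip snd ATimes)
  have eq: "pe x (pe y (pe z c)) \<in> B \<longleftrightarrow> x = v i c \<and> y = v j c \<and> z = v k c \<and> x * y = z" for x y z c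
    by (auto simp: B_def gr_def)
  have "{c. \<exists>z. pe z c \<in> {b. \<exists>y. pe y b \<in> {a. \<exists>x. pe x a \<in> B}}} \<in> Z" by (intro ex B)
  then show ?case unfolding mem_Collect_eq eq by simp
next
  case (AIn i j)
  have Sj: "S j \<in> Z" using S by blast
  have "{n. \<exists>m. pe m n \<in> gr (v i) \<inter> {n. \<exists>m k. n = pe m k \<and> m \<in> S j}} \<in> Z"
    by (intro ex inter AIn fst Sj)
  moreover have "pe m n \<in> gr (v i) \<inter> {n. \<exists>m k. n = pe m k \<and> m \<in> S j} \<longleftrightarrow> m = v i n \<and> m \<in> S j" for m n
    by (auto simp: gr_def)
  ultimately show ?case by simp
next
  case (ANeg \<phi>)
  then have "- {c. arith_sat S (\<lambda>i. v i c) \<phi>} \<in> Z" by (intro compl ANeg.IH ANeg.prems)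
  then show ?case by (simp add: Compl_eq)
next
  case (AConj \<phi> \<psi>)
  then have "{c. arith_sat S (\<lambda>i. v i c) \<phi>} \<inter> {c. arith_sat S (\<lambda>i. v i c) \<psi>} \<in> Z" by (intro inter AConj.IH AConj.prems)
  then show ?case by (simp add: Collect_conj_eq)
next
  case (AAll i \<phi>)
  define w where "w j c = (if j = i then fst (prod_decode c) else v j (snd (prod_decode c)))" for j c
  have "gr (w j) \<in> Z" for j
  proof (cases "j = i")
    case True
    have "gr (w j) = {n. \<exists>x c. n = pe x (pe x c)}"
    proof (intro equalityI subsetI)
      fix n assume "n \<in> gr (w j)"
      then obtain c where c: "n = pe (w j c) c" unfolding gr_def by blast
      obtain a b where "c = pe a b" by (rule pe_cases)
      then show "n \<in> {n. \<exists>x c. n = pe x (pe x c)}" using c True by (auto simp: w_def)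
    qed (auto simp: gr_def w_def True)
    then show ?thesis using dup by simp
  next
    case False
    have "gr (w j) = {n. \<exists>x y c. n = pe x (pe y c) \<and> pe x c \<in> gr (v j)}"
    proof (intro equalityI subsetI)
      fix n assume "n \<in> gr (w j)"
      then obtain c where c: "n = pe (w j c) c" unfolding gr_def by blast
      obtain a b where "c = pe a b" by (rule pe_cases)
      then show "n \<in> {n. \<exists>x y c. n = pe x (pe y c) \<and> pe x c \<in> gr (v j)}" using c False by (auto simp: w_def gr_def)
    qed (auto simp: gr_def w_def False)
    then show ?thesis using skip[OF AAll.prems[of j]] by simp
  qed
  then have B: "- {c. arith_sat S (\<lambda>i. w i c) \<phi>} \<in> Z" by (intro compl AAll.IH)
  have "(\<lambda>j. w j (pe n c)) = (\<lambda>j. v j c)(i := n)" for n c by (auto simp: w_def)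
  then have "- {n. \<exists>m. pe m n \<in> - {c. arith_sat S (\<lambda>i. w i c) \<phi>}} = {c. arith_sat S (\<lambda>i. v i c) (AAll i \<phi>)}"
    by auto
  then show ?case using compl[OF ex[OF B]] by simp
qed

text \<open>At the start the code is the argument itself: variable 0 is the identity, whose graph is
  \<open>diag\<close>, and the other variables are constants, generated from \<open>zero\<close> and
  \<open>suc\<close>.\<close>

lemma arith_closed:
  assumes "range S \<subseteq> Z" shows "{n. arith_sat S (e(0 := n)) \<phi>} \<in> Z"
proof -
  define v where "v i = (if i = 0 then (\<lambda>c. c) else (\<lambda>_. e i))" for i :: nat
  have "gr (v i) \<in> Z" for i using gr_id gr_const by (simp add: v_def)
  then have "{c. arith_sat S (\<lambda>i. v i c) \<phi>} \<in> Z" by (rule sat_closed[OF assms])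
  moreover have "(\<lambda>i. v i c) = e(0 := c)" for c by (auto simp: v_def)
  ultimately show ?thesis by simp
qed

end

section \<open>A chain of countable sets of names\<close>

context zfc begin

section \<open>The set of coordinates\<close>

definition B0 :: 'a where "B0 = tms w1 om"
definition Lh :: "'a \<Rightarrow> 'a" where "Lh = rec (\<lambda>w. Pw (un B0 (bun w)))"
(* Coordinates of the Cohen reals.  All subsets of omega_1 x omega occur, which is used against CH,
   and countable subsets of L are in L again, so that names can serve as coordinates. *)
definition L :: 'a where "L = bun (mk (Lh ` el w1))"

lemma tm_Lh [dfI]: "tmu t \<Longrightarrow> tmu (\<lambda>s. Lh (t s))"
  unfolding Lh_def by (rule tm_rec1) (intro dfI)

lemma tm_Lh0: "tmu (\<lambda>s. Lh (s 0))"
  by (intro dfI)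

lemma el_Lh: "x \<in> el (Lh a) \<longleftrightarrow> el x \<subseteq> el B0 \<union> (\<Union>b\<in>el a. el (Lh b))"
proof -
  have "Lh a = Pw (un B0 (bun (mk (Lh ` el a))))" unfolding Lh_def by (rule rec_eq)
  then show ?thesis using el_bun_img[OF tm_Lh0, of a] by (metis (no_types, lifting) el_Pw el_un mem_Collect_eq)
qed

lemma el_L: "el L = (\<Union>a\<in>el w1. el (Lh a))"
  unfolding L_def by (rule el_bun_img[OF tm_Lh0])

lemma emp_w1: "emp \<in> el w1"
  by (rule w1_mem) (auto simp: is_ordinal_def transitive_in_def intro: cbl_finite)

lemma L_B0: "el x \<subseteq> el B0 \<Longrightarrow> x \<in> el L"
  unfolding el_L using emp_w1 el_Lh[of x emp] by auto

text \<open>Countably many stages are bounded below \<omega>_1, and a stage contains all subsets of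
  the union of the earlier ones.\<close>

lemma L_cbl:
  assumes x: "el x \<subseteq> el L" "cbl x" shows "x \<in> el L"
proof -
  have 1: "dfu (\<lambda>s. s 0 \<in> el (Lh (s (Suc 0))))" by (intro dfI)
  have ex: "\<exists>a\<in>el w1. y \<in> el (Lh a)" if "y \<in> el x" for y using x(1) that unfolding el_L by blast
  obtain f where f: "\<And>y. y \<in> el x \<Longrightarrow> app f y \<in> el w1 \<and> y \<in> el (Lh (app f y))"
    by (rule choice[OF 1 ex]) (assumption, rule that)
  have tf: "tmu (\<lambda>s. app f (s 0))" by (intro dfI)
  obtain b where b: "b \<in> el w1" "\<And>a. a \<in> el (mk (app f ` el x)) \<Longrightarrow> a \<in> el b"
    using w1_sup[OF cbl_image[OF tf x(2)]] f unfolding el_img[OF tf] by blast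
  have "el x \<subseteq> (\<Union>a\<in>el b. el (Lh a))" using f b(2) unfolding el_img[OF tf] by blast
  then show ?thesis using b(1) el_Lh[of x b] unfolding el_L by blast
qed

lemma cbl_up [simp]: "cbl (up x y)" by (rule cbl_finite) simp
lemma cbl_pr [simp]: "cbl (pr x y)" unfolding pr_def by simp
lemma cbl_num [simp]: "cbl (num n)" by (rule cbl_finite) (simp add: el_num)
lemma cbl_om [simp]: "cbl om" unfolding cbl_lepoll by (rule lepoll_subset) simp

lemma L_up: "x \<in> el L \<Longrightarrow> y \<in> el L \<Longrightarrow> up x y \<in> el L"
  by (rule L_cbl) auto
lemma L_pr: "x \<in> el L \<Longrightarrow> y \<in> el L \<Longrightarrow> pr x y \<in> el L"
  unfolding pr_def by (intro L_up)
lemma L_num: "num n \<in> el L"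
proof (induction n rule: less_induct)
  case (less n) then show ?case by (intro L_cbl) (auto simp: el_num)
qed
lemma L_w1: "a \<in> el w1 \<Longrightarrow> a \<in> el L"
proof (induction a rule: E_induct)
  case (step a)
  have "el a \<subseteq> el L" using step ord_trans[OF w1(1) step.prems] by blast
  then show ?case using w1(3)[OF step.prems] by (rule L_cbl)
qed

lemma L_trans: "x \<in> el L \<Longrightarrow> y \<in> el x \<Longrightarrow> y \<in> el L"
proof -
  assume "x \<in> el L" "y \<in> el x"
  then obtain a where a: "a \<in> el w1" "y \<in> el B0 \<union> (\<Union>b\<in>el a. el (Lh b))" unfolding el_L el_Lh UN_iff by blast
  then show ?thesis
  proof (cases "y \<in> el B0")
    case True then show ?thesis unfolding B0_def using L_w1 L_num by (auto simp: el_om intro!: L_pr)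
  next
    case False then show ?thesis using a ord_trans[OF w1(1)] unfolding el_L by blast
  qed
qed

lemma L_o: "o0 \<in> el L" "o1 \<in> el L"
  using L_num[of 0] L_num[of 1] by (simp_all add: o0_def o1_def)

lemma L_Fn: "p \<in> el (Fn L) \<Longrightarrow> p \<in> el L"
proof (rule L_cbl)
  assume p: "p \<in> el (Fn L)"
  show "el p \<subseteq> el L"
  proof
    fix z assume "z \<in> el p"
    then obtain x i where "x \<in> el L" "i = o0 \<or> i = o1" "z = pr x i" using p unfolding el_Fn by blast
    then show "z \<in> el L" using L_pr L_o by auto
  qed
  show "cbl p" using p by (intro cbl_finite) (simp add: el_Fn)
qed

(* The sets of names below are closed under passing to countable elements of their elements, which
   brings the labels that occur in a name into the set (clp_label). *)
definition LC :: 'a where "LC = mk {x \<in> el L. cbl x}"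

lemma el_LC: "el LC = {x \<in> el L. cbl x}"
  unfolding LC_def by (rule el_sep) (intro dfI)

lemma LC_cbl: "el x \<subseteq> el LC \<Longrightarrow> cbl x \<Longrightarrow> x \<in> el LC"
  unfolding el_LC using L_cbl[of x] by blast

text \<open>Every element recurs at arbitrarily large indices; on numerals the disjunction in the
  second clause means m \<le> i.\<close>

definition enp :: "'a \<Rightarrow> 'a \<Rightarrow> bool" where
  "enp Y f \<longleftrightarrow> (\<forall>i\<in>el om. app f i \<in> el Y) \<and>
     (\<forall>y\<in>el Y. \<forall>m\<in>el om. \<exists>i\<in>el om. (m \<in> el i \<or> m = i) \<and> app f i = y)"

lemma ex_en: "\<exists>e. \<forall>Y\<in>el LC. el Y \<subseteq> el LC \<and> Y \<noteq> emp \<longrightarrow> enp Y (app e Y)"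
proof -
  let ?P = "\<lambda>Y f. el Y \<subseteq> el LC \<and> Y \<noteq> emp \<longrightarrow> enp Y f"
  have 1: "dfu (\<lambda>s. ?P (s 0) (s (Suc 0)))" unfolding enp_def by (intro dfI)
  have ex: "\<exists>f\<in>el (Pw (tms om LC)). ?P Y f" if Y: "Y \<in> el LC" for Y
  proof (cases "el Y \<subseteq> el LC \<and> Y \<noteq> emp")
    case True
    then obtain y0 where y0: "y0 \<in> el Y" by (auto simp: emp_iff)
    have "cbl Y" using Y by (simp add: el_LC)
    then obtain f where f: "\<And>n. app f (num n) \<in> el Y"
      "\<And>y m. y \<in> el Y \<Longrightarrow> \<exists>i\<ge>m. app f (num i) = y" using y0 by (rule cbl_enum) (rule that)
    have t: "tmu (\<lambda>s. app f (s 0))" by (intro dfI)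
    have a: "app (lam om (app f)) (num i) = app f (num i)" for i by (rule app_lam[OF t]) simp
    have "enp Y (lam om (app f))" unfolding enp_def
    proof (intro conjI ballI)
      fix i assume "i \<in> el om" then show "app (lam om (app f)) i \<in> el Y" using f(1) a by (auto elim: omE)
    next
      fix y m assume y: "y \<in> el Y" and "m \<in> el om"
      then obtain k where k: "m = num k" by (auto elim: omE)
      obtain i where "i \<ge> k" "app f (num i) = y" using f(2)[OF y] by blast
      then show "\<exists>i\<in>el om. (m \<in> el i \<or> m = i) \<and> app (lam om (app f)) i = y"
        unfolding k by (intro bexI[of _ "num i"]) (auto simp: a)
    qed
    moreover have "lam om (app f) \<in> el (Pw (tms om LC))"
    proof -
      have "z \<in> el (tms om LC)" if z: "z \<in> el (lam om (app f))" for z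
      proof -
        obtain i where "z = pr (num i) (app f (num i))" using z by (auto simp: el_lam[OF t] el_om)
        then show ?thesis using f(1)[of i] True by auto
      qed
      then show ?thesis by auto
    qed
    ultimately show ?thesis by blast
  next
    case False then show ?thesis by (intro bexI[of _ emp]) auto
  qed
  obtain e where "\<And>Y. Y \<in> el LC \<Longrightarrow> app e Y \<in> el (Pw (tms om LC)) \<and> ?P Y (app e Y)"
    by (rule choice[OF 1 ex]) (assumption, rule that)
  then show ?thesis by blast
qed

text \<open>One set enumerates all Y at once, so that \<open>en\<close> is a definable operation of
  the set and the index.\<close>

definition en :: "'a \<Rightarrow> 'a \<Rightarrow> 'a" where
  "en Y = app (app (SOME e. \<forall>Y\<in>el LC. el Y \<subseteq> el LC \<and> Y \<noteq> emp \<longrightarrow> enp Y (app e Y)) Y)"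

lemma tm_en [dfI]: "tmu t \<Longrightarrow> tmu t' \<Longrightarrow> tmu (\<lambda>s. en (t s) (t' s))"
  unfolding en_def by (intro dfI)

lemma en:
  assumes "Y \<in> el LC" "el Y \<subseteq> el LC" "Y \<noteq> emp"
  shows "en Y (num i) \<in> el Y" "y \<in> el Y \<Longrightarrow> \<exists>i\<ge>m. en Y (num i) = y"
proof -
  have *: "enp Y (app (SOME e. \<forall>Y\<in>el LC. el Y \<subseteq> el LC \<and> Y \<noteq> emp \<longrightarrow> enp Y (app e Y)) Y)"
    using someI_ex[OF ex_en] assms by blast
  show "en Y (num i) \<in> el Y" using * unfolding enp_def en_def by simp
  assume "y \<in> el Y"
  then obtain j where "j \<in> el om" "num m \<in> el j \<or> num m = j" "en Y j = y"
    using * num_om[of m] unfolding enp_def en_def by blast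
  moreover from this obtain i where "j = num i" by (auto elim: omE)
  ultimately show "\<exists>i\<ge>m. en Y (num i) = y" by (intro exI[of _ i]) auto
qed

text \<open>A name of a real is a set of pairs (number, condition), evaluated at a filter H on
  \<open>Fn L\<close>. Its value is \<open>rl\<close>, while \<open>bt\<close> reads a bit of the
  Cohen real labelled Y directly from the filter.\<close>

definition mm :: "'a set \<Rightarrow> 'a \<Rightarrow> 'a \<Rightarrow> bool" where "mm H n u \<longleftrightarrow> (\<exists>p\<in>H. pr n p \<in> el u)"
definition rl :: "'a set \<Rightarrow> 'a \<Rightarrow> nat set" where "rl H N = {n. mm H (num n) N}"
definition bt :: "'a set \<Rightarrow> 'a \<Rightarrow> 'a \<Rightarrow> bool" where "bt H Y n \<longleftrightarrow> (\<exists>p\<in>H. pr (pr Y n) o1 \<in> el p)"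

(* t is the set of indices below m that are accepted when the generic set proposes to shrink N to its
   intersection with the members of the enumeration of Y, provided that the result is infinite. *)
definition run :: "'a set \<Rightarrow> 'a \<Rightarrow> 'a \<Rightarrow> 'a \<Rightarrow> 'a \<Rightarrow> bool" where
  "run H Y N t m \<longleftrightarrow> el t \<subseteq> el m \<and> (\<forall>i\<in>el m. i \<in> el t \<longleftrightarrow> bt H Y i \<and>
     (\<forall>k\<in>el om. \<exists>n\<in>el om. k \<in> el n \<and> mm H n N \<and> (\<forall>j\<in>el t. j \<in> el i \<longrightarrow> mm H n (en Y j)) \<and> mm H n (en Y i)))"
definition mb :: "'a set \<Rightarrow> 'a \<Rightarrow> 'a \<Rightarrow> 'a \<Rightarrow> 'a \<Rightarrow> bool" where
  "mb H Y N t n \<longleftrightarrow> mm H n N \<and> (\<forall>i\<in>el t. mm H n (en Y i))"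
text \<open>Stage m contributes the first number from m on in the set left after the run of length
  m. The contributed numbers diagonalize the decreasing sequence of these sets.\<close>

definition qop :: "'a set \<Rightarrow> 'a \<Rightarrow> 'a \<Rightarrow> 'a \<Rightarrow> bool" where
  "qop H n Y N \<longleftrightarrow> (\<exists>m\<in>el om. \<exists>t. (m \<in> el n \<or> m = n) \<and> run H Y N t m \<and> mb H Y N t n \<and>
     (\<forall>n'\<in>el n. m \<in> el n' \<or> m = n' \<longrightarrow> \<not> mb H Y N t n'))"

(* Codes 0-8 and 11-13 are the operations of the locale arith_ops, code 9 is the Cohen real labelled u,
   and code 10 is the condition below v that this Cohen real builds from the reals named in u. *)
definition opr :: "'a set \<Rightarrow> 'a \<Rightarrow> 'a \<Rightarrow> bool" where
  "opr H n a \<longleftrightarrow> (\<exists>i u v. a = pr i (pr u v) \<and>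
     (i = num 0 \<and> \<not> mm H n u \<or>
      i = num 1 \<and> (mm H n u \<or> mm H n v) \<or>
      i = num 2 \<and> (\<exists>m\<in>el om. \<exists>c\<in>el om. PE m n c \<and> mm H c u) \<or>
      i = num 3 \<and> (\<exists>m\<in>el om. \<exists>k\<in>el om. PE m k n \<and> mm H m u) \<or>
      i = num 4 \<and> (\<exists>m\<in>el om. \<exists>k\<in>el om. PE m k n \<and> mm H k u) \<or>
      i = num 5 \<and> (\<exists>x\<in>el om. \<exists>y\<in>el om. \<exists>c\<in>el om. \<exists>d\<in>el om. \<exists>e\<in>el om. PE y c d \<and> PE x d n \<and> PE x c e \<and> mm H e u) \<or>
      i = num 6 \<and> (\<exists>x\<in>el om. \<exists>c\<in>el om. \<exists>d\<in>el om. PE x c d \<and> PE x d n) \<or>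
      i = num 7 \<and> (\<exists>x\<in>el om. \<exists>y\<in>el om. \<exists>c\<in>el om. \<exists>d\<in>el om. \<exists>e\<in>el om. PE (add x y) c d \<and> PE y d e \<and> PE x e n) \<or>
      i = num 8 \<and> (\<exists>x\<in>el om. \<exists>y\<in>el om. \<exists>c\<in>el om. \<exists>d\<in>el om. \<exists>e\<in>el om. PE (mul x y) c d \<and> PE y d e \<and> PE x e n) \<or>
      i = num 9 \<and> bt H u n \<or>
      i = num 10 \<and> qop H n u v \<or>
      i = num 11 \<and> (\<exists>x. n = suc x \<and> mm H x u) \<or>
      i = num 12 \<and> n = emp \<or>
      i = num 13 \<and> (\<exists>x\<in>el om. PE x x n)))"

definition isog :: "('a \<Rightarrow> 'a) \<Rightarrow> bool" where
  "isog g \<longleftrightarrow> tmu (\<lambda>s. g (s 0)) \<and> (\<forall>a\<in>el L. cbl (g a) \<and> el (g a) \<subseteq> el (tms om (Fn L)) \<and>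
     (\<forall>H n. gen L H \<longrightarrow> (opr H (num n) a \<longleftrightarrow> mm H (num n) (g a))))"

text \<open>The forcing calculus is instantiated with all generic filters on \<open>Fn L\<close>: a
  name chosen in the ground model has to compute the operation at every block of the generic
  filter.\<close>

lemma ex_og: "\<exists>g. isog g"
proof -
  interpret A: forc E L "Collect (gen L)" by unfold_locales simp
  have "A.Frc (\<lambda>H s. opr H (s 0) (s (Suc 0)))"
    unfolding opr_def mm_def bt_def qop_def run_def mb_def by (intro A.frcI A.Frc_df dfI)
  then obtain g where "tmu (\<lambda>s. g (s 0))"
    "\<And>a. a \<in> el L \<Longrightarrow> cbl (g a) \<and> el (g a) \<subseteq> el (tms om (Fn L))"
    "\<And>H n a. H \<in> Collect (gen L) \<Longrightarrow> a \<in> el L \<Longrightarrow> opr H (num n) a \<longleftrightarrow> (\<exists>p\<in>H. pr (num n) p \<in> el (g a))"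
    by (rule A.Frc_ctbl_om) (rule that)
  then show ?thesis unfolding isog_def mm_def by (intro exI[of _ g]) simp
qed

definition og :: "'a \<Rightarrow> 'a" where "og = (SOME g. isog g)"

lemma og: "isog og"
  unfolding og_def by (rule someI_ex[OF ex_og])

lemma tm_og [dfI]: "tmu t \<Longrightarrow> tmu (\<lambda>s. og (t s))"
  by (rule tm_1) (use og in \<open>simp_all add: isog_def\<close>)

lemma og_mm: "gen L H \<Longrightarrow> a \<in> el L \<Longrightarrow> mm H (num n) (og a) \<longleftrightarrow> opr H (num n) a"
  using og unfolding isog_def by blast

lemma og_LC: "a \<in> el L \<Longrightarrow> og a \<in> el LC"
proof -
  assume a: "a \<in> el L"
  then have c: "cbl (og a)" "el (og a) \<subseteq> el (tms om (Fn L))" using og unfolding isog_def by blast+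
  have "el (og a) \<subseteq> el LC"
    using c(2) L_Fn unfolding el_LC by (auto simp: el_om intro!: L_pr L_num)
  then show ?thesis using c(1) by (rule LC_cbl)
qed

text \<open>All operations on u and v and the countable elements of u are packed into one set, the
  format expected by \<open>cbl_closure\<close>.\<close>

definition opc :: "'a \<Rightarrow> 'a \<Rightarrow> 'a" where
  "opc u v = un (mk ((\<lambda>i. og (pr i (pr u v))) ` el om)) (mk {z \<in> el u. cbl z})"

lemma tm_opc [dfI]: "tmu t \<Longrightarrow> tmu t' \<Longrightarrow> tmu (\<lambda>s. opc (t s) (t' s))"
  by (rule tm_2[of opc]) (unfold opc_def, intro dfI)

lemma el_opc: "el (opc u v) = (\<lambda>i. og (pr (num i) (pr u v))) ` UNIV \<union> {z \<in> el u. cbl z}"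
proof -
  have t: "tmu (\<lambda>s. og (pr (s 0) (pr u v)))" by (intro dfI)
  have "el (mk {z \<in> el u. cbl z}) = {z \<in> el u. cbl z}" by (rule el_sep) (intro dfI)
  then show ?thesis unfolding opc_def el_un el_img[OF t] unfolding el_om by (simp add: image_image)
qed

lemma opc_LC: "u \<in> el LC \<Longrightarrow> v \<in> el LC \<Longrightarrow> cbl (opc u v) \<and> el (opc u v) \<subseteq> el LC"
proof
  assume u: "u \<in> el LC" and v: "v \<in> el LC"
  have t: "tmu (\<lambda>s. og (pr (s 0) (pr u v)))" by (intro dfI)
  have e: "el (mk {z \<in> el u. cbl z}) = {z \<in> el u. cbl z}" by (rule el_sep) (intro dfI)
  have "cbl u" using u by (simp add: el_LC)
  then have "cbl (mk {z \<in> el u. cbl z})" by (rule cbl_subset) (use e in blast)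
  then show "cbl (opc u v)" unfolding opc_def by (intro cbl_un cbl_image[OF t] cbl_om)
  have "og (pr (num i) (pr u v)) \<in> el LC" for i
    using u v by (intro og_LC L_pr L_num) (simp_all add: el_LC)
  moreover have "{z \<in> el u. cbl z} \<subseteq> el LC" using u L_trans unfolding el_LC by blast
  ultimately show "el (opc u v) \<subseteq> el LC" unfolding el_opc by blast
qed

definition clp :: "'a \<Rightarrow> bool" where
  "clp C \<longleftrightarrow> (\<forall>u\<in>el C. \<forall>v\<in>el C. el (opc u v) \<subseteq> el C)"

lemma df_clp [dfI]: "tmu t \<Longrightarrow> dfu (\<lambda>s. clp (t s))"
  by (rule df_1[of clp]) (unfold clp_def, intro dfI)

lemma ex_cl: "\<exists>f. \<forall>x\<in>el LC. el x \<subseteq> el LC \<longrightarrow> app f x \<in> el LC \<and> el (app f x) \<subseteq> el LC \<and> el x \<subseteq> el (app f x) \<and> clp (app f x)"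
proof -
  let ?P = "\<lambda>x C. el x \<subseteq> el LC \<longrightarrow> el C \<subseteq> el LC \<and> el x \<subseteq> el C \<and> clp C"
  have 1: "dfu (\<lambda>s. ?P (s 0) (s (Suc 0)))" by (intro dfI)
  have t: "tmu (\<lambda>s. opc (s 0) (s (Suc 0)))" by (intro dfI)
  have ex: "\<exists>C\<in>el LC. ?P x C" if x: "x \<in> el LC" for x
  proof (cases "el x \<subseteq> el LC")
    case True
    have cx: "cbl x" using x by (simp add: el_LC)
    obtain C where "cbl C" "el x \<subseteq> el C" "el C \<subseteq> el LC"
      "\<And>u v. u \<in> el C \<Longrightarrow> v \<in> el C \<Longrightarrow> el (opc u v) \<subseteq> el C"
      by (rule cbl_closure[OF t opc_LC cx True]) (assumption, assumption, rule that)
    then show ?thesis using LC_cbl[of C] unfolding clp_def by blast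
  next
    case False then show ?thesis using x by blast
  qed
  obtain f where "\<And>x. x \<in> el LC \<Longrightarrow> app f x \<in> el LC \<and> ?P x (app f x)"
    by (rule choice[OF 1 ex]) (assumption, rule that)
  then show ?thesis by blast
qed

definition cl :: "'a \<Rightarrow> 'a" where
  "cl = app (SOME f. \<forall>x\<in>el LC. el x \<subseteq> el LC \<longrightarrow>
     app f x \<in> el LC \<and> el (app f x) \<subseteq> el LC \<and> el x \<subseteq> el (app f x) \<and> clp (app f x))"

lemma tm_cl [dfI]: "tmu t \<Longrightarrow> tmu (\<lambda>s. cl (t s))"
  unfolding cl_def by (intro dfI)

lemma cl: "x \<in> el LC \<Longrightarrow> el x \<subseteq> el LC \<Longrightarrow>
    cl x \<in> el LC \<and> el (cl x) \<subseteq> el LC \<and> el x \<subseteq> el (cl x) \<and> clp (cl x)"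
  using someI_ex[OF ex_cl] unfolding cl_def by blast

text \<open>Stage a is the union over b < a of the closures of \<open>Yc b\<close> with
  \<open>Yc b\<close> itself added as an element, which makes it available as a label later. So
  stage 0 is empty, limit stages are unions, and \<open>Yc w1\<close> is the union of the
  chain.\<close>

definition Yc :: "'a \<Rightarrow> 'a" where "Yc = rec (\<lambda>w. bun (mk ((\<lambda>y. cl (suc y)) ` el w)))"

lemma tm_Yc [dfI]: "tmu t \<Longrightarrow> tmu (\<lambda>s. Yc (t s))"
  unfolding Yc_def by (rule tm_rec1) (intro dfI)

lemma el_Yc: "el (Yc a) = (\<Union>b\<in>el a. el (cl (suc (Yc b))))"
proof -
  have t: "tmu (\<lambda>s. Yc (s 0))" "tmu (\<lambda>s. cl (suc (s 0)))" by (intro dfI)+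
  have Y: "Yc a = bun (mk ((\<lambda>y. cl (suc y)) ` el (mk (Yc ` el a))))" unfolding Yc_def by (rule rec_eq)
  have "el (Yc a) = (\<Union>y\<in>el (mk (Yc ` el a)). el (cl (suc y)))" by (subst Y, rule el_bun_img[OF t(2)])
  also have "\<dots> = (\<Union>b\<in>el a. el (cl (suc (Yc b))))" unfolding el_img[OF t(1)] by (simp only: image_image)
  finally show ?thesis .
qed

lemma Yc_w1: "a \<in> el w1 \<Longrightarrow> Yc a \<in> el LC \<and> el (Yc a) \<subseteq> el LC"
proof (induction a rule: E_induct)
  case (step a)
  have b: "cl (suc (Yc b)) \<in> el LC \<and> el (cl (suc (Yc b))) \<subseteq> el LC" if "b \<in> el a" for b
  proof -
    have Y: "Yc b \<in> el LC" "el (Yc b) \<subseteq> el LC" using step.IH[OF that] ord_trans[OF w1(1) step.prems that] by blast+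
    then have "suc (Yc b) \<in> el LC" by (intro LC_cbl cbl_suc) (auto simp: el_LC)
    then show ?thesis using cl[of "suc (Yc b)"] Y by auto
  qed
  then have 1: "el (Yc a) \<subseteq> el LC" unfolding el_Yc by blast
  have t: "tmu (\<lambda>s. cl (suc (Yc (s 0))))" by (intro dfI)
  have "cbl (bun (mk ((\<lambda>b. cl (suc (Yc b))) ` el a)))"
    by (rule cbl_UN'[OF t w1(3)[OF step.prems]]) (use b in \<open>auto simp: el_LC\<close>)
  then have "cbl (Yc a)" by (rule cbl_subset) (simp only: el_Yc el_bun_img[OF t] subset_refl)
  then show ?case using 1 LC_cbl by blast
qed

lemma Yc_suc_cl: "b \<in> el w1 \<Longrightarrow> el (suc (Yc b)) \<subseteq> el (cl (suc (Yc b))) \<and> clp (cl (suc (Yc b)))"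
proof -
  assume "b \<in> el w1"
  then have Y: "Yc b \<in> el LC" "el (Yc b) \<subseteq> el LC" using Yc_w1 by blast+
  then have "suc (Yc b) \<in> el LC" by (intro LC_cbl cbl_suc) (auto simp: el_LC)
  then show ?thesis using cl[of "suc (Yc b)"] Y by auto
qed

lemma w1_le: "a \<in> el w1 \<or> a = w1 \<Longrightarrow> b \<in> el a \<Longrightarrow> b \<in> el w1"
  using ord_trans[OF w1(1)] by blast

lemma Yc_mono: "a \<in> el w1 \<or> a = w1 \<Longrightarrow> b \<in> el a \<Longrightarrow> Yc b \<in> el (Yc a) \<and> el (Yc b) \<subseteq> el (Yc a)"
  using Yc_suc_cl[OF w1_le] unfolding el_Yc[of a] by auto

lemma Yc_clp: assumes a: "a \<in> el w1 \<or> a = w1" shows "clp (Yc a)"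
  unfolding clp_def
proof (intro ballI)
  fix u v assume "u \<in> el (Yc a)" "v \<in> el (Yc a)"
  then obtain b c where b: "b \<in> el a" "u \<in> el (cl (suc (Yc b)))" and c: "c \<in> el a" "v \<in> el (cl (suc (Yc c)))"
    unfolding el_Yc by blast
  have mono: "el (cl (suc (Yc x))) \<subseteq> el (cl (suc (Yc y)))" if "x \<in> el y" "y \<in> el a" for x y
  proof -
    have y: "y \<in> el w1" using w1_le[OF a that(2)] .
    have "el (cl (suc (Yc x))) \<subseteq> el (Yc y)" using that(1) unfolding el_Yc[of y] by blast
    then show ?thesis using Yc_suc_cl[OF y] by auto
  qed
  have "is_ordinal E b" "is_ordinal E c" using w1_ord w1_le[OF a] b(1) c(1) by blast+
  from ord_cmp[OF this] obtain d where d: "d \<in> el a" "u \<in> el (cl (suc (Yc d)))" "v \<in> el (cl (suc (Yc d)))"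
    using b c mono by blast
  then have "el (opc u v) \<subseteq> el (cl (suc (Yc d)))" using Yc_suc_cl[OF w1_le[OF a d(1)]] unfolding clp_def by blast
  then show "el (opc u v) \<subseteq> el (Yc a)" using d(1) unfolding el_Yc by blast
qed

lemma clp_op: "clp C \<Longrightarrow> u \<in> el C \<Longrightarrow> v \<in> el C \<Longrightarrow> og (pr (num i) (pr u v)) \<in> el C"
  unfolding clp_def el_opc by blast

lemma clp_absorb: "clp C \<Longrightarrow> u \<in> el C \<Longrightarrow> z \<in> el u \<Longrightarrow> cbl z \<Longrightarrow> z \<in> el C"
  unfolding clp_def el_opc by blast

text \<open>Y is reached from N by descending through pairs, the condition p and one of its
  literals. All sets on the way are countable, so the closure absorbs them one after the
  other.\<close>

lemma clp_label:
  assumes C: "clp C" and N: "N \<in> el C" "pr n p \<in> el N" "pr (pr Y m) i \<in> el p" and c: "cbl p" "cbl Y"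
  shows "Y \<in> el C"
proof -
  note ab = clp_absorb[OF C]
  have "pr n p \<in> el C" using ab[OF N(1,2)] by simp
  then have "up n p \<in> el C" by (rule ab) (auto simp: el_pr)
  then have "p \<in> el C" by (rule ab) (use c in auto)
  then have "pr (pr Y m) i \<in> el C" by (rule ab) (use N in auto)
  then have "up (pr Y m) (pr Y m) \<in> el C" by (rule ab) (auto simp: el_pr)
  then have "pr Y m \<in> el C" by (rule ab) auto
  then have "up Y Y \<in> el C" by (rule ab) (auto simp: el_pr)
  then show ?thesis by (rule ab) (use c in auto)
qed

lemma suc_eq [simp]: "suc x = suc y \<longleftrightarrow> x = y"
proof
  assume "suc x = suc y"
  then have "el (suc x) = el (suc y)" by simp
  then have e: "insert x (el x) = insert y (el y)" by (simp only: el_suc)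
  show "x = y"
  proof (rule ccontr)
    assume "x \<noteq> y"
    moreover have "x \<in> insert y (el y)" unfolding e[symmetric] by (rule insertI1)
    moreover have "y \<in> insert x (el x)" unfolding e by (rule insertI1)
    ultimately have "x \<in> el y" "y \<in> el x" by simp_all
    then show False using E_asym by simp
  qed
qed simp

lemma num_suc_iff: "num n = suc x \<longleftrightarrow> (\<exists>m. n = Suc m \<and> x = num m)"
  using ins_neq_emp(2)[of x] by (cases n) (auto simp: eq_commute[of emp])

lemma bex_om: "(\<exists>x\<in>el om. P x) \<longleftrightarrow> (\<exists>m. P (num m))"
  by (auto simp: el_om)

lemma ball_om: "(\<forall>x\<in>el om. P x) \<longleftrightarrow> (\<forall>m. P (num m))"
  by (auto simp: el_om)

lemma rl_og: "gen L H \<Longrightarrow> u \<in> el L \<Longrightarrow> v \<in> el L \<Longrightarrow>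
    rl H (og (pr (num i) (pr u v))) = {n. opr H (num n) (pr (num i) (pr u v))}"
  unfolding rl_def using og_mm L_pr L_num by simp

lemma rl_ops:
  assumes H: "gen L H" "u \<in> el L" "v \<in> el L"
  shows "rl H (og (pr (num 0) (pr u v))) = - rl H u"
    and "rl H (og (pr (num 1) (pr u v))) = rl H u \<union> rl H v"
    and "rl H (og (pr (num 2) (pr u v))) = {n. \<exists>m. pe m n \<in> rl H u}"
    and "rl H (og (pr (num 3) (pr u v))) = {n. \<exists>m k. n = pe m k \<and> m \<in> rl H u}"
    and "rl H (og (pr (num 4) (pr u v))) = {n. \<exists>m k. n = pe m k \<and> k \<in> rl H u}"
    and "rl H (og (pr (num 5) (pr u v))) = {n. \<exists>x y c. n = pe x (pe y c) \<and> pe x c \<in> rl H u}"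
    and "rl H (og (pr (num 6) (pr u v))) = {n. \<exists>x c. n = pe x (pe x c)}"
    and "rl H (og (pr (num 7) (pr u v))) = {n. \<exists>x y z c. n = pe x (pe y (pe z c)) \<and> x + y = z}"
    and "rl H (og (pr (num 8) (pr u v))) = {n. \<exists>x y z c. n = pe x (pe y (pe z c)) \<and> x * y = z}"
    and "rl H (og (pr (num 9) (pr u v))) = {n. bt H u (num n)}"
    and "rl H (og (pr (num 10) (pr u v))) = {n. qop H (num n) u v}"
    and "rl H (og (pr (num 11) (pr u v))) = Suc ` rl H u"
    and "rl H (og (pr (num 12) (pr u v))) = {0}"
    and "rl H (og (pr (num 13) (pr u v))) = {n. \<exists>x. n = pe x x}"
proof -
  note s = opr_def pr_eq num_eq bex_om PE_num add_num mul_num rl_def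
  \<comment> \<open>The codes have to stay folded as \<open>num k\<close>, so that they are compared
    by \<open>num_eq\<close>.\<close>
  note d = num.simps
  show "rl H (og (pr (num 0) (pr u v))) = - rl H u"
    unfolding rl_og[OF H] by (auto simp: s simp del: d)
  show "rl H (og (pr (num 1) (pr u v))) = rl H u \<union> rl H v"
    unfolding rl_og[OF H] by (auto simp: s simp del: d)
  show "rl H (og (pr (num 2) (pr u v))) = {n. \<exists>m. pe m n \<in> rl H u}"
    unfolding rl_og[OF H] by (auto simp: s simp del: d)
  show "rl H (og (pr (num 3) (pr u v))) = {n. \<exists>m k. n = pe m k \<and> m \<in> rl H u}"
    unfolding rl_og[OF H] by (auto simp: s simp del: d)
  show "rl H (og (pr (num 4) (pr u v))) = {n. \<exists>m k. n = pe m k \<and> k \<in> rl H u}"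
    unfolding rl_og[OF H] by (auto simp: s simp del: d)
  show "rl H (og (pr (num 5) (pr u v))) = {n. \<exists>x y c. n = pe x (pe y c) \<and> pe x c \<in> rl H u}"
    unfolding rl_og[OF H] by (auto simp: s simp del: d)
  show "rl H (og (pr (num 6) (pr u v))) = {n. \<exists>x c. n = pe x (pe x c)}"
    unfolding rl_og[OF H] by (auto simp: s simp del: d)
  show "rl H (og (pr (num 7) (pr u v))) = {n. \<exists>x y z c. n = pe x (pe y (pe z c)) \<and> x + y = z}"
    unfolding rl_og[OF H] by (auto simp: s simp del: d)
  show "rl H (og (pr (num 8) (pr u v))) = {n. \<exists>x y z c. n = pe x (pe y (pe z c)) \<and> x * y = z}"
    unfolding rl_og[OF H] by (auto simp: s simp del: d)
  show "rl H (og (pr (num 9) (pr u v))) = {n. bt H u (num n)}"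
    unfolding rl_og[OF H] by (auto simp: s simp del: d)
  show "rl H (og (pr (num 10) (pr u v))) = {n. qop H (num n) u v}"
    unfolding rl_og[OF H] by (auto simp: s simp del: d)
  show "rl H (og (pr (num 11) (pr u v))) = Suc ` rl H u"
    unfolding rl_og[OF H] by (auto simp: s num_suc_iff simp del: d)
  show "rl H (og (pr (num 13) (pr u v))) = {n. \<exists>x. n = pe x x}"
    unfolding rl_og[OF H] by (auto simp: s simp del: d)
  have "num n = emp \<longleftrightarrow> n = 0" for n using num_eq[of n 0] by simp
  then show "rl H (og (pr (num 12) (pr u v))) = {0}"
    unfolding rl_og[OF H] by (auto simp: s simp del: d)
qed

lemma arith_ops_rl:
  assumes H: "gen L H" and C: "clp C" "el C \<subseteq> el L" "el C \<noteq> {}"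
  shows "arith_ops (rl H ` el C)"
proof -
  let ?Z = "rl H ` el C"
  obtain u0 where u0: "u0 \<in> el C" using C(3) by blast
  have in_Z: "rl H (og (pr (num i) (pr u v))) \<in> ?Z" if "u \<in> el C" "v \<in> el C" for i u v
    using clp_op[OF C(1) that] by blast
  note r = rl_ops[OF H subsetD[OF C(2)] subsetD[OF C(2)]]
  show ?thesis
  proof
    fix A B assume "A \<in> ?Z" "B \<in> ?Z"
    then obtain u v where u: "u \<in> el C" "A = rl H u" "v \<in> el C" "B = rl H v" by blast
    show "A \<union> B \<in> ?Z" using in_Z[OF u(1,3), of 1] r(2)[OF u(1,3)] u by simp
  next
    fix A assume "A \<in> ?Z"
    then obtain u where u: "u \<in> el C" "A = rl H u" by blast
    note i = in_Z[OF u(1) u(1)] and r = r[OF u(1) u(1)]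
    show "- A \<in> ?Z" using i[of 0] unfolding r(1) u(2) .
    show "{n. \<exists>m. pe m n \<in> A} \<in> ?Z" using i[of 2] unfolding r(3) u(2) .
    show "{n. \<exists>m k. n = pe m k \<and> m \<in> A} \<in> ?Z" using i[of 3] unfolding r(4) u(2) .
    show "{n. \<exists>m k. n = pe m k \<and> k \<in> A} \<in> ?Z" using i[of 4] unfolding r(5) u(2) .
    show "{n. \<exists>x y c. n = pe x (pe y c) \<and> pe x c \<in> A} \<in> ?Z" using i[of 5] unfolding r(6) u(2) .
    show "Suc ` A \<in> ?Z" using i[of 11] unfolding r(12) u(2) .
  next
    note i = in_Z[OF u0 u0] and r = r[OF u0 u0]
    show "{n. \<exists>x c. n = pe x (pe x c)} \<in> ?Z" using i[of 6] unfolding r(7) .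
    show "{n. \<exists>x y z c. n = pe x (pe y (pe z c)) \<and> x + y = z} \<in> ?Z" using i[of 7] unfolding r(8) .
    show "{n. \<exists>x y z c. n = pe x (pe y (pe z c)) \<and> x * y = z} \<in> ?Z" using i[of 8] unfolding r(9) .
    show "{0} \<in> ?Z" using i[of 12] unfolding r(13) .
    show "{n. \<exists>x. n = pe x x} \<in> ?Z" using i[of 13] unfolding r(14) .
  qed
qed

section \<open>Mutual genericity of one block and the remaining coordinates\<close>

lemma pull_id:
  assumes G: "gen K G" and J: "el J \<subseteq> el K"
  shows "p \<in> pull (\<lambda>x. x) J G \<longleftrightarrow> p \<in> el (Fn J) \<and> p \<in> G"
proof -
  have "p \<in> el (Fn K)" if "p \<in> el (Fn J)" using that J unfolding el_Fn by blast
  moreover have "(\<forall>x i. pr x i \<in> el p \<longrightarrow> (\<exists>q\<in>G. pr x i \<in> el q)) \<longleftrightarrow> (\<forall>z\<in>el p. \<exists>q\<in>G. z \<in> el q)" if "p \<in> el (Fn J)"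
  proof -
    have "\<exists>x i. z = pr x i" if "z \<in> el p" for z using \<open>p \<in> el (Fn J)\<close> that unfolding el_Fn by blast
    then show ?thesis by blast
  qed
  ultimately show ?thesis unfolding pull_def using gen_lits[OF G, of p] by blast
qed

text \<open>The part of G on K0 is generic even over the extension by the other coordinates, on
  which D may depend. Otherwise some q in G excludes success; splitting q, extending its K0-part
  into D and adding a condition from the other part of G that witnesses this contradicts the choice
  of q.\<close>

lemma product:
  assumes G: "gen K G" and K0: "el K0 \<subseteq> el K"
    and D: "forc.Frc E {pull (\<lambda>x. x) (dif K K0) G} (\<lambda>H s. D (s 0))"
    and dense: "\<And>r. r \<in> el (Fn K0) \<Longrightarrow> \<exists>r'\<in>el (Fn K0). el r \<subseteq> el r' \<and> D r'"
  shows "\<exists>r\<in>G. r \<in> el (Fn K0) \<and> D r"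
proof -
  define J where "J = dif K K0"
  define GJ where "GJ = pull (\<lambda>x. x) J G"
  have GJ: "gen J GJ" unfolding GJ_def by (rule gen_pull[OF G]) (auto simp: J_def intro: dfI)
  interpret J: forc E J "{GJ}" by unfold_locales (use GJ in simp)
  obtain Q where Q: "dfu (\<lambda>s. Q (s 0) (s (Suc 0)))"
    "\<And>H b. H \<in> {GJ} \<Longrightarrow> D b \<longleftrightarrow> (\<exists>p\<in>H. Q p b)"
    by (rule J.Frc_rel[OF D[folded J_def, folded GJ_def]]) (rule that)
  note [dfI] = df_2[OF Q(1)]
  \<comment> \<open>q contains a condition r on K0 and a condition p on the remaining coordinates
    such that p witnesses \<open>D r\<close>.\<close>
  let ?U = "\<lambda>q. \<exists>p\<in>el (Fn J). \<exists>r\<in>el (Fn K0). el p \<subseteq> el q \<and> el r \<subseteq> el q \<and> Q p r"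
  let ?P = "\<lambda>q. ?U q \<or> (\<forall>q'\<in>el (Fn K). el q \<subseteq> el q' \<longrightarrow> \<not> ?U q')"
  obtain q where q: "q \<in> G" "?P q"
  proof (rule gen_dense[OF G, of ?P])
    show "dfu (\<lambda>s. ?P (s 0))" by (intro dfI)
  qed blast+
  have sub: "p \<in> el (Fn K)" if "p \<in> el (Fn J) \<or> p \<in> el (Fn K0)" for p
    using that K0 unfolding el_Fn J_def by auto blast+
  have GJ_G: "p \<in> GJ \<longleftrightarrow> p \<in> el (Fn J) \<and> p \<in> G" for p
    unfolding GJ_def by (rule pull_id[OF G]) (auto simp: J_def)
  from q(2) show ?thesis
  proof
    assume "?U q"
    then obtain p r where p: "p \<in> el (Fn J)" "r \<in> el (Fn K0)" "el p \<subseteq> el q" "el r \<subseteq> el q" "Q p r" by blast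
    then have "p \<in> G" "r \<in> G" using gen_up[OF G q(1)] sub by blast+
    then show ?thesis using p Q(2)[of GJ r] GJ_G by blast
  next
    assume n: "\<forall>q'\<in>el (Fn K). el q \<subseteq> el q' \<longrightarrow> \<not> ?U q'"
    have qF: "q \<in> el (Fn K)" using gen_Fn[OF G q(1)] .
    define A where "A = {z \<in> el q. \<exists>x\<in>el K0. \<exists>i. z = pr x i}"
    define B where "B = {z \<in> el q. \<exists>x\<in>el J. \<exists>i. z = pr x i}"
    have AB: "el (mk A) = A" "el (mk B) = B" using Fn_subset[OF qF, of A] Fn_subset[OF qF, of B] by (auto simp: A_def B_def)
    have fin: "finite A" "finite B" "cons A" "cons B" "el q \<subseteq> A \<union> B"
      using qF unfolding A_def B_def el_Fn cons_def J_def by (auto; blast)+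
    have A: "mk A \<in> el (Fn K0)" using qF fin unfolding el_Fn AB by (auto simp: A_def)
    have B: "mk B \<in> el (Fn J)" using qF fin unfolding el_Fn AB by (auto simp: B_def)
    have "mk B \<in> G" by (rule gen_up[OF G q(1)]) (use sub B AB in \<open>auto simp: B_def\<close>)
    then have BG: "mk B \<in> GJ" using B GJ_G by blast
    obtain r where r: "r \<in> el (Fn K0)" "A \<subseteq> el r" "D r" using dense[OF A] AB by auto
    then obtain p where p: "p \<in> GJ" "Q p r" using Q(2)[of GJ r] by blast
    obtain p' where p': "p' \<in> GJ" "el p \<subseteq> el p'" "B \<subseteq> el p'" using gen_dir[OF GJ p(1) BG] AB by auto
    have p'F: "p' \<in> el (Fn J)" using GJ_G p'(1) by blast
    have "cons (el p' \<union> el r)" unfolding cons_def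
    proof (intro allI notI, elim conjE)
      fix x assume x: "pr x o0 \<in> el p' \<union> el r" "pr x o1 \<in> el p' \<union> el r"
      have 1: "x \<in> el J" if "pr x i \<in> el p'" for i using p'F that unfolding el_Fn by fastforce
      have 2: "x \<in> el K0" if "pr x i \<in> el r" for i using r(1) that unfolding el_Fn by fastforce
      show False using x 1 2 p'F r(1) unfolding el_Fn cons_def J_def by auto
    qed
    then have "un p' r \<in> el (Fn K)" using sub p'F r(1) by (intro Fn_un) auto
    moreover have "el q \<subseteq> el (un p' r)" using fin(5) p'(3) r(2) by auto
    moreover have "?U (un p' r)"
      using p p'(2) r(1) GJ_G by (intro bexI[of _ p] bexI[of _ r]) auto
    ultimately show ?thesis using n by blast
  qed
qed

end

locale coh = gext E "zfc.L E" G F val for E :: "'a \<Rightarrow> 'a \<Rightarrow> bool" and G F val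
begin

definition Gl :: "'a \<Rightarrow> 'a set" where "Gl l = pull (pr l) L G"

lemma gen_Gl: "l \<in> el L \<Longrightarrow> gen L (Gl l)"
  unfolding Gl_def by (rule gen_pull[OF G]) (auto intro: dfI simp: inj_on_def L_pr)

lemma mm_Gl: "mm (Gl l) n N \<longleftrightarrow> (\<exists>u\<in>el (Fn L). pr n u \<in> el N \<and>
    (\<forall>x i. pr x i \<in> el u \<longrightarrow> (\<exists>p\<in>G. pr (pr l x) i \<in> el p)))"
  by (auto simp: mm_def Gl_def pull_def)

lemma FG_mm: "tmu t1 \<Longrightarrow> tmu t2 \<Longrightarrow> tmu t3 \<Longrightarrow> FG (\<lambda>s. mm (Gl (t1 s)) (t2 s) (t3 s))"
  by (rule Frc_3[of "\<lambda>H l n N. mm (Gl l) n N"]) (unfold mm_Gl, intro fgI Frc_df dfI)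

lemma ex_nu: "\<exists>\<nu>. tmu (\<lambda>s. \<nu> (s 0)) \<and> (\<forall>a. F.el (val (\<nu> a)) =
    {val (ck n) | n. n \<in> el om \<and> mm (Gl (pfst a)) n (psnd a)})"
proof -
  have 1: "FG (\<lambda>s. mm (Gl (pfst (s (Suc 0)))) (s 0) (psnd (s (Suc 0))))" by (intro FG_mm dfI)
  have 2: "tmu (\<lambda>s. ck (s 0))" "tmu (\<lambda>s. om)" by (intro dfI)+
  obtain \<nu> where "tmu (\<lambda>s. \<nu> (s 0))"
    "\<And>a. F.el (val (\<nu> a)) = {val (ck b) | b. b \<in> el om \<and> mm (Gl (pfst a)) b (psnd a)}"
    by (rule Fname[of "\<lambda>n a. mm (Gl (pfst a)) n (psnd a)" "\<lambda>b a. ck b" "\<lambda>a. om", OF 1 2]) (rule that)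
  then show ?thesis by blast
qed

definition nu :: "'a \<Rightarrow> 'a \<Rightarrow> 'a" where
  "nu l N = (SOME \<nu>. tmu (\<lambda>s. \<nu> (s 0)) \<and> (\<forall>a. F.el (val (\<nu> a)) =
    {val (ck n) | n. n \<in> el om \<and> mm (Gl (pfst a)) n (psnd a)})) (pr l N)"

lemma tm_nu [dfI]: "tmu t \<Longrightarrow> tmu t' \<Longrightarrow> tmu (\<lambda>s. nu (t s) (t' s))"
  unfolding nu_def by (rule tm_1[OF conjunct1[OF someI_ex[OF ex_nu]]]) (intro dfI)

lemma el_nu: "F.el (val (nu l N)) = nF ` rl (Gl l) N"
proof -
  have "F.el (val (nu l N)) = {val (ck n) | n. n \<in> el om \<and> mm (Gl l) n N}"
    using someI_ex[OF ex_nu] unfolding nu_def by simp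
  then show ?thesis by (auto simp: el_om rl_def nF_def)
qed

lemma real_nu: "real_of F (val (nu l N)) = rl (Gl l) N"
  unfolding real_F el_nu by auto

lemma nu_eq: "val (nu l N) = val (nu l' N') \<longleftrightarrow> rl (Gl l) N = rl (Gl l') N'"
proof
  assume "rl (Gl l) N = rl (Gl l') N'"
  then show "val (nu l N) = val (nu l' N')" using el_nu by (intro val_ext) simp
next
  assume "val (nu l N) = val (nu l' N')"
  then show "rl (Gl l) N = rl (Gl l') N'" using real_nu by metis
qed

definition K0 :: "'a \<Rightarrow> 'a \<Rightarrow> 'a" where "K0 l Y = mk ((\<lambda>n. pr l (pr Y n)) ` el om)"

lemma el_K0: "el (K0 l Y) = (\<lambda>n. pr l (pr Y (num n))) ` UNIV"
proof -
  have "el (K0 l Y) = (\<lambda>n. pr l (pr Y n)) ` el om" unfolding K0_def by (rule el_img) (intro dfI)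
  then show ?thesis by (simp add: el_om image_image)
qed

abbreviation GJ :: "'a \<Rightarrow> 'a \<Rightarrow> 'a set" where "GJ l Y \<equiv> pull (\<lambda>x. x) (dif L (K0 l Y)) G"

lemma forc_J: "forc E (dif L (K0 l Y)) {GJ l Y}"
proof -
  have "gen (dif L (K0 l Y)) (GJ l Y)" by (rule gen_pull[OF G]) (auto intro: dfI)
  then show ?thesis by unfold_locales simp
qed

(* Truth of the membership "n in N" can be computed from the generic filter without the block (l, Y). *)
definition mJ :: "'a set \<Rightarrow> 'a \<Rightarrow> 'a \<Rightarrow> 'a \<Rightarrow> bool" where
  "mJ H l n N \<longleftrightarrow> (\<exists>u\<in>el (Fn L). pr n u \<in> el N \<and>
    (\<forall>x i. pr x i \<in> el u \<longrightarrow> (\<exists>p\<in>H. pr (pr l x) i \<in> el p)))"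

lemma GJ_lit:
  assumes "x \<in> el L" "x \<notin> el (K0 l Y)"
  shows "(\<exists>p\<in>GJ l Y. pr x i \<in> el p) \<longleftrightarrow> (\<exists>p\<in>G. pr x i \<in> el p)"
proof
  show "\<exists>p\<in>GJ l Y. pr x i \<in> el p \<Longrightarrow> \<exists>p\<in>G. pr x i \<in> el p" unfolding pull_def by blast
  assume a: "\<exists>p\<in>G. pr x i \<in> el p"
  then obtain p where p: "p \<in> G" "pr x i \<in> el p" by blast
  have "i = o0 \<or> i = o1" using gen_Fn[OF G p(1)] p(2) unfolding el_Fn by fastforce
  then have "up (pr x i) (pr x i) \<in> el (Fn (dif L (K0 l Y)))" using assms by (intro single_Fn) auto
  then have "up (pr x i) (pr x i) \<in> GJ l Y" using a unfolding pull_def by simp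
  then show "\<exists>p\<in>GJ l Y. pr x i \<in> el p" by (rule rev_bexI) simp
qed

lemma mJ:
  assumes l': "l' \<in> el L"
    and N: "l' \<noteq> l \<or> (\<forall>n u m i. pr n u \<in> el N \<and> u \<in> el (Fn L) \<longrightarrow> pr (pr Y m) i \<notin> el u)"
  shows "mJ (GJ l Y) l' n N \<longleftrightarrow> mm (Gl l') n N"
proof -
  have "(\<exists>p\<in>GJ l Y. pr (pr l' x) i \<in> el p) \<longleftrightarrow> (\<exists>p\<in>G. pr (pr l' x) i \<in> el p)"
    if u: "u \<in> el (Fn L)" "pr n u \<in> el N" "pr x i \<in> el u" for u x i
  proof (rule GJ_lit)
    have "x \<in> el L" using u(1,3) unfolding el_Fn by fastforce
    then show "pr l' x \<in> el L" using l' L_pr by blast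
    show "pr l' x \<notin> el (K0 l Y)" using N u unfolding el_K0 by auto
  qed
  then show ?thesis unfolding mJ_def mm_Gl by blast
qed

text \<open>If the label occurred in N, \<open>clp_label\<close> would make
  \<open>Yc \<alpha>\<close> an element of itself.\<close>

lemma Yc_support:
  assumes a: "\<alpha> \<in> el w1" and N: "N \<in> el (Yc \<alpha>)"
  shows "\<forall>n u m i. pr n u \<in> el N \<and> u \<in> el (Fn L) \<longrightarrow> pr (pr (Yc \<alpha>) m) i \<notin> el u"
proof (intro allI impI notI)
  fix n u m i assume u: "pr n u \<in> el N \<and> u \<in> el (Fn L)" and p: "pr (pr (Yc \<alpha>) m) i \<in> el u"
  have "cbl u" using u by (intro cbl_finite) (simp add: el_Fn)
  moreover have "cbl (Yc \<alpha>)" using Yc_w1[OF a] by (simp add: el_LC)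
  ultimately have "Yc \<alpha> \<in> el (Yc \<alpha>)"
    using clp_label[OF Yc_clp N _ p] a u by blast
  then show False by simp
qed

definition cb :: "'a \<Rightarrow> 'a \<Rightarrow> nat set" where "cb l Y = {n. bt (Gl l) Y (num n)}"

lemma cb_iff:
  assumes "l \<in> el L" "Y \<in> el L"
  shows "n \<in> cb l Y \<longleftrightarrow> (\<exists>p\<in>G. pr (pr l (pr Y (num n))) o1 \<in> el p)"
proof
  show "n \<in> cb l Y \<Longrightarrow> \<exists>p\<in>G. pr (pr l (pr Y (num n))) o1 \<in> el p"
    unfolding cb_def bt_def Gl_def pull_def by blast
  assume a: "\<exists>p\<in>G. pr (pr l (pr Y (num n))) o1 \<in> el p"
  have "up (pr (pr Y (num n)) o1) (pr (pr Y (num n)) o1) \<in> el (Fn L)"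
    using assms by (intro single_Fn L_pr L_num) auto
  then have "up (pr (pr Y (num n)) o1) (pr (pr Y (num n)) o1) \<in> Gl l"
    using a unfolding Gl_def pull_def by simp
  then show "n \<in> cb l Y" unfolding cb_def bt_def by (auto intro!: bexI)
qed

text \<open>A condition on the block decides finitely many bits, so either value can be added at a
  large n in the infinite set. By \<open>product\<close> this works although the set exists only in
  the extension by the other coordinates.\<close>

lemma splitting:
  assumes l: "l \<in> el L" and Y: "Y \<in> el L"
    and X: "forc.Frc E {GJ l Y} (\<lambda>H s. X (s 0))" and inf: "infinite {n. X (num n)}"
  shows "infinite ({n. X (num n)} \<inter> cb l Y)" "infinite ({n. X (num n)} - cb l Y)"
proof -
  interpret J: forc E "dif L (K0 l Y)" "{GJ l Y}" by (rule forc_J)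
  have XI: "J.Frc (\<lambda>H s. X (t s))" if "tmu t" for t using J.Frc_1[OF X that] .
  have K: "el (K0 l Y) \<subseteq> el L" unfolding el_K0 using l Y by (auto intro!: L_pr L_num)
  have *: "\<exists>n>k. X (num n) \<and> (\<exists>p\<in>G. pr (pr l (pr Y (num n))) i \<in> el p)" if i: "i = o0 \<or> i = o1" for i k
  proof -
    let ?D = "\<lambda>r. \<exists>n\<in>el om. num k \<in> el n \<and> X n \<and> pr (pr l (pr Y n)) i \<in> el r"
    have "\<exists>r\<in>G. r \<in> el (Fn (K0 l Y)) \<and> ?D r"
    proof (rule product[OF G K])
      show "J.Frc (\<lambda>H s. ?D (s 0))" by (intro J.frcI XI J.Frc_df dfI)
      fix r assume r: "r \<in> el (Fn (K0 l Y))"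
      have "finite {n. \<exists>j. pr (pr l (pr Y (num n))) j \<in> el r}" (is "finite ?S")
      proof -
        have "(THE n. \<exists>j. pr (pr l (pr Y (num m))) i = pr (pr l (pr Y (num n))) j) = m" for m i
          by (rule the_equality) (auto simp del: num.simps)
        then have "?S \<subseteq> (\<lambda>z. THE n. \<exists>j. z = pr (pr l (pr Y (num n))) j) ` el r"
          by (force simp del: num.simps)
        moreover have "finite (el r)" using r by (simp add: el_Fn)
        ultimately show ?thesis by (meson finite_imageI finite_subset)
      qed
      then have "infinite ({n. X (num n)} - (?S \<union> {..k}))" using inf by (intro Diff_infinite_finite) auto
      then have "{n. X (num n)} - (?S \<union> {..k}) \<noteq> {}" by (rule infinite_imp_nonempty)
      then obtain n where "n \<in> {n. X (num n)} - (?S \<union> {..k})" by blast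
      then have n: "X (num n)" "n \<notin> ?S" "k < n" by simp_all
      let ?z = "pr (pr l (pr Y (num n))) i"
      have "cons (el r \<union> el (up ?z ?z))" using r n(2) unfolding el_Fn cons_def by auto
      moreover have "up ?z ?z \<in> el (Fn (K0 l Y))" using i by (intro single_Fn) (auto simp: el_K0)
      ultimately have "un r (up ?z ?z) \<in> el (Fn (K0 l Y))" using r by (intro Fn_un)
      moreover have "?D (un r (up ?z ?z))" using n by (intro bexI[of _ "num n"]) auto
      ultimately show "\<exists>r'\<in>el (Fn (K0 l Y)). el r \<subseteq> el r' \<and> ?D r'" by (intro bexI[of _ "un r (up ?z ?z)"]) auto
    qed
    then obtain r n where "r \<in> G" "num k \<in> el (num n)" "X (num n)" "pr (pr l (pr Y (num n))) i \<in> el r"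
      unfolding bex_om by blast
    then show ?thesis by (intro exI[of _ n]) auto
  qed
  have "\<exists>n>k. n \<in> {n. X (num n)} \<inter> cb l Y" for k using *[of o1 k] cb_iff[OF l Y] by auto
  then show "infinite ({n. X (num n)} \<inter> cb l Y)" unfolding infinite_nat_iff_unbounded by blast
  have "\<exists>n>k. n \<in> {n. X (num n)} - cb l Y" for k
  proof -
    obtain n p where n: "n > k" "X (num n)" "p \<in> G" "pr (pr l (pr Y (num n))) o0 \<in> el p" using *[of o0 k] by blast
    have "n \<notin> cb l Y"
    proof
      assume "n \<in> cb l Y"
      then obtain q where "q \<in> G" "pr (pr l (pr Y (num n))) o1 \<in> el q" using cb_iff[OF l Y] by blast
      with gen_cons[OF G n(3)] n(4) show False unfolding cons_def by blast
    qed
    then show ?thesis using n by blast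
  qed
  then show "infinite ({n. X (num n)} - cb l Y)" unfolding infinite_nat_iff_unbounded by blast
qed

end

section \<open>Generic conditions\<close>

(* The bits b propose indices; an index i is accepted if A i leaves the current set infinite, and Qs
   diagonalizes the resulting decreasing sequence. *)
fun Bs :: "(nat \<Rightarrow> bool) \<Rightarrow> nat set \<Rightarrow> (nat \<Rightarrow> nat set) \<Rightarrow> nat \<Rightarrow> nat set" where
  "Bs b A0 A 0 = A0"
| "Bs b A0 A (Suc m) = (if b m \<and> infinite (Bs b A0 A m \<inter> A m) then Bs b A0 A m \<inter> A m else Bs b A0 A m)"

definition Ts :: "(nat \<Rightarrow> bool) \<Rightarrow> nat set \<Rightarrow> (nat \<Rightarrow> nat set) \<Rightarrow> nat \<Rightarrow> nat set" where
  "Ts b A0 A m = {i. i < m \<and> b i \<and> infinite (Bs b A0 A i \<inter> A i)}"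

definition Qs :: "(nat \<Rightarrow> bool) \<Rightarrow> nat set \<Rightarrow> (nat \<Rightarrow> nat set) \<Rightarrow> nat set" where
  "Qs b A0 A = {n. \<exists>m\<le>n. n \<in> Bs b A0 A m \<and> (\<forall>n'<n. m \<le> n' \<longrightarrow> n' \<notin> Bs b A0 A m)}"

lemma Bs_inf: "infinite A0 \<Longrightarrow> infinite (Bs b A0 A m)"
  by (induction m) auto

lemma Bs_mono: "m \<le> m' \<Longrightarrow> Bs b A0 A m' \<subseteq> Bs b A0 A m"
  by (induction m' rule: dec_induct) auto

lemma Bs_cong: "(\<And>i. i < m \<Longrightarrow> b i = b' i) \<Longrightarrow> Bs b A0 A m = Bs b' A0 A m"
  by (induction m) auto

lemma Bs_idle: "m \<le> m' \<Longrightarrow> (\<And>i. m \<le> i \<Longrightarrow> i < m' \<Longrightarrow> \<not> b i) \<Longrightarrow> Bs b A0 A m' = Bs b A0 A m"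
  by (induction m' rule: dec_induct) auto

lemma Ts_Suc: "Ts b A0 A (Suc m) = (if b m \<and> infinite (Bs b A0 A m \<inter> A m) then insert m (Ts b A0 A m) else Ts b A0 A m)"
  by (auto simp: Ts_def less_Suc_eq)

lemma Bs_Ts: "Bs b A0 A m = {n \<in> A0. \<forall>j\<in>Ts b A0 A m. n \<in> A j}"
proof (induction m)
  case 0 then show ?case by (simp add: Ts_def)
next
  case (Suc m) then show ?case by (auto simp: Ts_Suc)
qed

text \<open>The condition on T refers to T itself, but at i only to elements below i, so it has
  exactly one solution. In this way \<open>run\<close> expresses a recursion by a first-order
  condition.\<close>

lemma Ts_iff:
  "T \<subseteq> {..<m} \<and> (\<forall>i<m. i \<in> T \<longleftrightarrow> b i \<and> infinite {n \<in> A0. (\<forall>j\<in>T. j < i \<longrightarrow> n \<in> A j) \<and> n \<in> A i}) \<longleftrightarrow>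
   T = Ts b A0 A m" (is "?l \<longleftrightarrow> _")
proof -
  have eq: "{n \<in> A0. (\<forall>j\<in>T. j < i \<longrightarrow> n \<in> A j) \<and> n \<in> A i} = Bs b A0 A i \<inter> A i"
    if "\<And>j. j < i \<Longrightarrow> j \<in> T \<longleftrightarrow> j \<in> Ts b A0 A m" "i < m" for i
  proof -
    have "j \<in> T \<and> j < i \<longleftrightarrow> j \<in> Ts b A0 A i" for j using that by (auto simp: Ts_def)
    then show ?thesis unfolding Bs_Ts by blast
  qed
  show ?thesis
  proof
    assume l: ?l
    have "i < m \<Longrightarrow> i \<in> T \<longleftrightarrow> i \<in> Ts b A0 A m" for i
    proof (induction i rule: less_induct)
      case (less i)
      have "i \<in> T \<longleftrightarrow> b i \<and> infinite (Bs b A0 A i \<inter> A i)"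
        using l less.prems eq[OF less.IH less.prems] by auto
      then show ?case using less.prems by (simp add: Ts_def)
    qed
    then show "T = Ts b A0 A m" using l by (auto simp: Ts_def)
  next
    assume T: "T = Ts b A0 A m"
    then have "i < m \<Longrightarrow> {n \<in> A0. (\<forall>j\<in>T. j < i \<longrightarrow> n \<in> A j) \<and> n \<in> A i} = Bs b A0 A i \<inter> A i" for i
      by (intro eq) auto
    then show ?l using T by (auto simp: Ts_def)
  qed
qed

lemma Qs_sub: "Qs b A0 A \<subseteq> A0"
  using Bs_mono[of 0] by (force simp: Qs_def)

lemma Qs_inf:
  assumes "infinite A0" shows "infinite (Qs b A0 A)"
  unfolding infinite_nat_iff_unbounded_le
proof
  fix m
  let ?P = "\<lambda>n. m \<le> n \<and> n \<in> Bs b A0 A m"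
  have "\<exists>n. ?P n" using Bs_inf[OF assms] unfolding infinite_nat_iff_unbounded_le by blast
  then have "?P (LEAST n. ?P n)" by (rule LeastI_ex)
  moreover have "\<forall>n'<(LEAST n. ?P n). \<not> ?P n'" using not_less_Least by blast
  ultimately show "\<exists>n\<ge>m. n \<in> Qs b A0 A" unfolding Qs_def by blast
qed

text \<open>A number outside the set of stage m was contributed at a stage before m, and each stage
  contributes at most one number.\<close>

lemma Qs_almost: "finite (Qs b A0 A - Bs b A0 A m)"
proof -
  have "Qs b A0 A - Bs b A0 A m \<subseteq> (\<lambda>k. LEAST n. k \<le> n \<and> n \<in> Bs b A0 A k) ` {..<m}"
  proof
    fix n assume n: "n \<in> Qs b A0 A - Bs b A0 A m"
    then obtain k where k: "k \<le> n" "n \<in> Bs b A0 A k" "\<forall>n'<n. k \<le> n' \<longrightarrow> n' \<notin> Bs b A0 A k"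
      unfolding Qs_def by blast
    have "k < m" using n k(2) Bs_mono[of m k] by (meson DiffD2 not_less subsetD)
    moreover have "(LEAST n. k \<le> n \<and> n \<in> Bs b A0 A k) = n"
      by (rule Least_equality) (use k not_less in blast)+
    ultimately show "n \<in> (\<lambda>k. LEAST n. k \<le> n \<and> n \<in> Bs b A0 A k) ` {..<m}" by blast
  qed
  then show ?thesis by (rule finite_subset) simp
qed

context zfc begin

text \<open>\<open>run\<close> with the bits and the membership relation abstracted, so that the
  same computation can use the bits of a finite condition and membership computed without the
  block.\<close>

definition runp :: "('a \<Rightarrow> bool) \<Rightarrow> ('a \<Rightarrow> 'a \<Rightarrow> bool) \<Rightarrow> 'a \<Rightarrow> 'a \<Rightarrow> 'a \<Rightarrow> 'a \<Rightarrow> bool" where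
  "runp \<beta> \<mu> Y N t m \<longleftrightarrow> el t \<subseteq> el m \<and> (\<forall>i\<in>el m. i \<in> el t \<longleftrightarrow> \<beta> i \<and>
     (\<forall>k\<in>el om. \<exists>n\<in>el om. k \<in> el n \<and> \<mu> n N \<and> (\<forall>j\<in>el t. j \<in> el i \<longrightarrow> \<mu> n (en Y j)) \<and> \<mu> n (en Y i)))"

lemma runp_iff: "runp \<beta> \<mu> Y N t (num m) \<longleftrightarrow>
  el t = num ` Ts (\<lambda>i. \<beta> (num i)) {n. \<mu> (num n) N} (\<lambda>j. {n. \<mu> (num n) (en Y (num j))}) m"
proof -
  have em: "el (num m) = num ` {..<m}" by (auto simp: el_num)
  show ?thesis
  proof (cases "el t \<subseteq> el (num m)")
    case True
    define T where "T = {i. num i \<in> el t}"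
    have t: "el t = num ` T" using True by (auto simp: T_def em)
    have ni: "num i \<in> num ` T \<longleftrightarrow> i \<in> T" for i by (auto simp: num_eq)
    have "runp \<beta> \<mu> Y N t (num m) \<longleftrightarrow> T \<subseteq> {..<m} \<and> (\<forall>i<m. i \<in> T \<longleftrightarrow> \<beta> (num i) \<and>
       infinite {n \<in> {n. \<mu> (num n) N}. (\<forall>j\<in>T. j < i \<longrightarrow> n \<in> {n. \<mu> (num n) (en Y (num j))}) \<and> n \<in> {n. \<mu> (num n) (en Y (num i))}})"
      unfolding runp_def t em ball_om bex_om infinite_nat_iff_unbounded
      by (auto simp: ni num_eq num_mem image_subset_iff simp del: num.simps)
    then show ?thesis unfolding Ts_iff t by (auto simp: num_eq inj_image_eq_iff[of num] inj_def)
  next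
    case False
    then show ?thesis unfolding runp_def em by (auto simp: Ts_def)
  qed
qed

lemma qop_iff: "qop H (num n) Y N \<longleftrightarrow>
  n \<in> Qs (\<lambda>i. bt H Y (num i)) (rl H N) (\<lambda>j. rl H (en Y (num j)))"
proof -
  let ?b = "\<lambda>i. bt H Y (num i)" and ?A = "\<lambda>j. rl H (en Y (num j))"
  have run: "run H Y N t (num m) \<longleftrightarrow> el t = num ` Ts ?b (rl H N) ?A m" for t m
    using runp_iff[of "bt H Y" "mm H"] unfolding run_def runp_def rl_def .
  have mb: "mb H Y N t (num n) \<longleftrightarrow> n \<in> Bs ?b (rl H N) ?A m" if "el t = num ` Ts ?b (rl H N) ?A m" for t m n
    unfolding mb_def that Bs_Ts by (auto simp: rl_def)
  have ex: "\<exists>t. el t = num ` Ts ?b (rl H N) ?A m" for m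
  proof
    have "finite (Ts ?b (rl H N) ?A m)" by (rule finite_subset[of _ "{..<m}"]) (auto simp: Ts_def)
    then show "el (mk (num ` Ts ?b (rl H N) ?A m)) = num ` Ts ?b (rl H N) ?A m" by (intro el_mk iss_finite finite_imageI)
  qed
  have le: "num m \<in> el (num n) \<or> num m = num n \<longleftrightarrow> m \<le> n" for m n by (auto simp: num_mem num_eq simp del: num.simps)
  have ball: "(\<forall>x\<in>el (num n). P x) \<longleftrightarrow> (\<forall>i<n. P (num i))" for P n by (auto simp: el_num)
  have "(\<exists>t. run H Y N t (num m) \<and> mb H Y N t (num n) \<and> (\<forall>n'<n. num m \<in> el (num n') \<or> num m = num n' \<longrightarrow> \<not> mb H Y N t (num n'))) \<longleftrightarrow>
    n \<in> Bs ?b (rl H N) ?A m \<and> (\<forall>n'<n. m \<le> n' \<longrightarrow> n' \<notin> Bs ?b (rl H N) ?A m)" for m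
  proof -
    obtain t0 where t0: "el t0 = num ` Ts ?b (rl H N) ?A m" using ex by blast
    then have "run H Y N t (num m) \<longleftrightarrow> t = t0" for t unfolding run t0[symmetric] using ext by blast
    then show ?thesis unfolding le by (simp add: mb[OF t0])
  qed
  moreover have "qop H (num n) Y N \<longleftrightarrow> (\<exists>m. m \<le> n \<and> (\<exists>t. run H Y N t (num m) \<and> mb H Y N t (num n) \<and>
      (\<forall>n'<n. num m \<in> el (num n') \<or> num m = num n' \<longrightarrow> \<not> mb H Y N t (num n'))))"
    unfolding qop_def bex_om ball le by blast
  ultimately show ?thesis unfolding Qs_def mem_Collect_eq by simp
qed

end

context coh begin

lemma q_basic:
  assumes l: "l \<in> el L" and Y: "Y \<in> el L" "N \<in> el L"
  shows "rl (Gl l) (og (pr (num 10) (pr Y N))) =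
    Qs (\<lambda>i. i \<in> cb l Y) (rl (Gl l) N) (\<lambda>j. rl (Gl l) (en Y (num j)))"
  unfolding rl_ops(11)[OF gen_Gl[OF l] Y] by (simp only: qop_iff cb_def mem_Collect_eq Collect_mem_eq)

lemma K0_fin:
  assumes "r \<in> el (Fn (K0 l Y))"
  obtains M where "\<And>i k. pr (pr l (pr Y (num i))) k \<in> el r \<Longrightarrow> i < M"
proof -
  let ?S = "{n. \<exists>j. pr (pr l (pr Y (num n))) j \<in> el r}"
  have "(THE n. \<exists>j. pr (pr l (pr Y (num m))) i = pr (pr l (pr Y (num n))) j) = m" for m i
    by (rule the_equality) (auto simp del: num.simps)
  then have "?S \<subseteq> (\<lambda>z. THE n. \<exists>j. z = pr (pr l (pr Y (num n))) j) ` el r"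
    by (force simp del: num.simps)
  moreover have "finite (el r)" using assms by (simp add: el_Fn)
  ultimately have "finite ?S" by (meson finite_imageI finite_subset)
  then obtain M where "\<forall>n\<in>?S. n < M" using finite_nat_set_iff_bounded by blast
  then show thesis using that by blast
qed

text \<open>Undecided bits below j become 0, so that nothing further is proposed there, and bit j
  becomes 1; it is still undecided because of M \<le> j.\<close>

lemma K0_extend:
  assumes r: "r \<in> el (Fn (K0 l Y))" and M: "\<And>i k. pr (pr l (pr Y (num i))) k \<in> el r \<Longrightarrow> i < M" and j: "M \<le> j"
  obtains r' where "r' \<in> el (Fn (K0 l Y))" "el r \<subseteq> el r'"
    "\<And>i. i \<le> j \<Longrightarrow> pr (pr l (pr Y (num i))) o0 \<in> el r' \<or> pr (pr l (pr Y (num i))) o1 \<in> el r'"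
    "\<And>i. i \<le> j \<Longrightarrow> pr (pr l (pr Y (num i))) o1 \<in> el r' \<longleftrightarrow> i = j \<or> pr (pr l (pr Y (num i))) o1 \<in> el r"
proof -
  let ?x = "\<lambda>i. pr l (pr Y (num i))"
  define S where "S = el r \<union> {pr (?x j) o1} \<union> (\<lambda>i. pr (?x i) o0) ` {i. i < j \<and> pr (?x i) o1 \<notin> el r}"
  have x: "?x i = ?x k \<longleftrightarrow> i = k" for i k by (auto simp del: num.simps)
  have o: "o0 \<noteq> o1" "o1 \<noteq> o0" using ins_neq_emp(2)[of emp] by (auto simp: o0_def o1_def eq_commute[of emp])
  have fr: "finite (el r)" using r by (simp add: el_Fn)
  then have fS: "finite S" unfolding S_def by simp
  then have eS: "el (mk S) = S" by (intro el_mk iss_finite)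
  have o1S: "pr (?x i) o1 \<in> S \<longleftrightarrow> i = j \<or> pr (?x i) o1 \<in> el r" for i
    using x o by (auto simp: S_def simp del: num.simps)
  have c: "cons (el r)" using r by (simp add: el_Fn)
  have "cons S" unfolding cons_def
  proof (intro allI notI, elim conjE)
    fix y assume y: "pr y o0 \<in> S" "pr y o1 \<in> S"
    have "y \<in> el (K0 l Y)"
    proof -
      have "pr y o0 \<in> el r \<or> (\<exists>i. y = ?x i)" using y(1) o unfolding S_def by auto
      then show ?thesis using r unfolding el_Fn el_K0 by fastforce
    qed
    then obtain i where i: "y = ?x i" unfolding el_K0 by blast
    have 1: "i = j \<or> pr (?x i) o1 \<in> el r" using y(2) o1S i by blast
    have 2: "pr (?x i) o0 \<in> el r \<or> i < j \<and> pr (?x i) o1 \<notin> el r" using y(1) o x unfolding i S_def by (auto simp del: num.simps)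
    show False using 1 2 c M[of i] j unfolding cons_def by (metis leD order_less_irrefl)
  qed
  moreover have "\<forall>z\<in>S. \<exists>x\<in>el (K0 l Y). \<exists>i. (i = o0 \<or> i = o1) \<and> z = pr x i"
    using r unfolding S_def el_Fn el_K0 by (auto; blast)
  ultimately have "mk S \<in> el (Fn (K0 l Y))" unfolding el_Fn using fS eS by simp
  moreover have "el r \<subseteq> el (mk S)" unfolding eS by (auto simp: S_def)
  moreover have "pr (?x i) o0 \<in> S \<or> pr (?x i) o1 \<in> S" if "i \<le> j" for i
    using that unfolding o1S by (cases "i = j") (auto simp: S_def)
  ultimately show thesis using that[of "mk S"] o1S eS by simp
qed

text \<open>A finite part r of the Cohen real determines the set B reached so far, which is named in
  \<open>Yc \<alpha>\<close> by arithmetical closure. Density yields N' with X almost below B; r is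
  extended to propose N', and the proposal is accepted because B meets it in an infinite set. All
  later sets lie inside N', so the pseudo-intersection is almost contained in it. By
  \<open>product\<close> this happens for the actual Cohen real.\<close>

lemma q_generic:
  assumes l: "l \<in> el L" and a: "\<alpha> \<in> el w1" and N0: "N0 \<in> el (Yc \<alpha>)" "infinite (rl (Gl l) N0)"
    and X: "forc.Frc E {GJ l (Yc \<alpha>)} (\<lambda>H s. X (s 0))"
    and dense: "\<And>N. N \<in> el (Yc \<alpha>) \<Longrightarrow> infinite (rl (Gl l) N) \<Longrightarrow>
      \<exists>N'\<in>el (Yc \<alpha>). X N' \<and> infinite (rl (Gl l) N') \<and> finite (rl (Gl l) N' - rl (Gl l) N)"
  shows "\<exists>N\<in>el (Yc \<alpha>). X N \<and> finite (rl (Gl l) (og (pr (num 10) (pr (Yc \<alpha>) N0))) - rl (Gl l) N)"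
proof -
  define Y where "Y = Yc \<alpha>"
  interpret J: forc E "dif L (K0 l Y)" "{GJ l Y}" by (rule forc_J)
  have Y: "Y \<in> el LC" "el Y \<subseteq> el LC" "Y \<noteq> emp" "Y \<in> el L" "el Y \<subseteq> el L"
    using Yc_w1[OF a] N0(1) unfolding Y_def by (auto simp: el_LC emp_iff)
  note N0 = N0[folded Y_def] and dense = dense[folded Y_def]
  have enY: "en Y (num i) \<in> el Y" for i using en(1)[OF Y(1-3)] .
  have XI: "J.Frc (\<lambda>H s. X (t s))" if "tmu t" for t using J.Frc_1[OF X[folded Y_def] that] .
  have K: "el (K0 l Y) \<subseteq> el L" unfolding el_K0 using l Y by (auto intro!: L_pr L_num)
  have mj: "mJ (GJ l Y) l n N \<longleftrightarrow> mm (Gl l) n N" if "N \<in> el Y" for n N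
    by (rule mJ[OF l]) (use Yc_support[OF a that[unfolded Y_def]] Y_def in blast)
  have rlY: "{n. mJ (GJ l Y) l (num n) N} = rl (Gl l) N" if "N \<in> el Y" for N
    unfolding rl_def using mj[OF that] by simp
  let ?x = "\<lambda>i. pr l (pr Y i)"
  let ?A = "\<lambda>j. rl (Gl l) (en Y (num j))" and ?I = "rl (Gl l) N0"
  define b where "b r i \<longleftrightarrow> pr (?x (num i)) o1 \<in> el r" for r i
  let ?run = "\<lambda>r. runp (\<lambda>i. pr (?x i) o1 \<in> el r) (mJ (GJ l Y) l) Y N0"
  \<comment> \<open>r decides all bits below m, and the set left after these proposals is contained
    in the value of a name satisfying X.\<close>
  let ?D = "\<lambda>r. \<exists>m\<in>el om. \<exists>t. (\<forall>i\<in>el m. pr (?x i) o0 \<in> el r \<or> pr (?x i) o1 \<in> el r) \<and>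
     ?run r t m \<and> (\<exists>j\<in>el om. X (en Y j) \<and>
       (\<forall>n\<in>el om. mJ (GJ l Y) l n N0 \<and> (\<forall>i\<in>el t. mJ (GJ l Y) l n (en Y i)) \<longrightarrow> mJ (GJ l Y) l n (en Y j)))"
  have run: "?run r t (num m) \<longleftrightarrow> el t = num ` Ts (b r) ?I ?A m" for r t m
    unfolding runp_iff b_def rlY[OF N0(1)] rlY[OF enY] ..
  have ball: "(\<forall>x\<in>el (num n). P x) \<longleftrightarrow> (\<forall>i<n. P (num i))" for P n by (auto simp: el_num)
  have mJn: "mJ (GJ l Y) l (num n) N \<longleftrightarrow> n \<in> rl (Gl l) N" if "N \<in> el Y" for n N
    unfolding mj[OF that] rl_def by simp
  have ex: "\<exists>t. el t = num ` Ts (b r) ?I ?A m" for r m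
  proof
    have "finite (Ts (b r) ?I ?A m)" by (rule finite_subset[of _ "{..<m}"]) (auto simp: Ts_def)
    then show "el (mk (num ` Ts (b r) ?I ?A m)) = num ` Ts (b r) ?I ?A m" by (intro el_mk iss_finite finite_imageI)
  qed
  have D: "?D r \<longleftrightarrow> (\<exists>m. (\<forall>i<m. pr (?x (num i)) o0 \<in> el r \<or> pr (?x (num i)) o1 \<in> el r) \<and>
     (\<exists>j. X (en Y (num j)) \<and> Bs (b r) ?I ?A m \<subseteq> ?A j))" for r
  proof -
    have *: "(\<forall>n\<in>el om. mJ (GJ l Y) l n N0 \<and> (\<forall>i\<in>el t. mJ (GJ l Y) l n (en Y i)) \<longrightarrow> mJ (GJ l Y) l n (en Y (num j))) \<longleftrightarrow>
      Bs (b r) ?I ?A m \<subseteq> ?A j" if "el t = num ` Ts (b r) ?I ?A m" for t m j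
      unfolding that ball_om Bs_Ts using mJn[OF N0(1)] mJn[OF enY] by auto
    have "(\<exists>t. P \<and> ?run r t (num m) \<and> (\<exists>j. X (en Y (num j)) \<and>
        (\<forall>n\<in>el om. mJ (GJ l Y) l n N0 \<and> (\<forall>i\<in>el t. mJ (GJ l Y) l n (en Y i)) \<longrightarrow> mJ (GJ l Y) l n (en Y (num j))))) \<longleftrightarrow>
      P \<and> (\<exists>j. X (en Y (num j)) \<and> Bs (b r) ?I ?A m \<subseteq> ?A j)" for P m
    proof -
      obtain t0 where t0: "el t0 = num ` Ts (b r) ?I ?A m" using ex by blast
      then have "?run r t (num m) \<longleftrightarrow> t = t0" for t unfolding run t0[symmetric] using ext by blast
      then show ?thesis by (simp add: *[OF t0])
    qed
    then show ?thesis unfolding bex_om ball by (simp only:)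
  qed
  have Dfrc: "J.Frc (\<lambda>H s. ?D (s 0))"
  proof -
    have *: "J.Frc (\<lambda>H s. mJ H l (t1 s) (t2 s))" if "tmu t1" "tmu t2" for t1 t2
      by (rule J.Frc_2[of "\<lambda>H. mJ H l", OF _ that]) (unfold mJ_def, intro J.frcI J.Frc_df dfI)
    have "J.Frc (\<lambda>H s. \<exists>m\<in>el om. \<exists>t. (\<forall>i\<in>el m. pr (?x i) o0 \<in> el (s 0) \<or> pr (?x i) o1 \<in> el (s 0)) \<and>
     runp (\<lambda>i. pr (?x i) o1 \<in> el (s 0)) (mJ H l) Y N0 t m \<and> (\<exists>j\<in>el om. X (en Y j) \<and>
       (\<forall>n\<in>el om. mJ H l n N0 \<and> (\<forall>i\<in>el t. mJ H l n (en Y i)) \<longrightarrow> mJ H l n (en Y j))))"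
      unfolding runp_def by (intro J.frcI * XI J.Frc_df dfI)
    then show ?thesis by (rule J.Frc_cong[rotated]) simp
  qed
  interpret ao: arith_ops "rl (Gl l) ` el Y"
    using arith_ops_rl[OF gen_Gl[OF l], of Y] Yc_clp[of \<alpha>] a Y(5) N0(1) unfolding Y_def by blast
  have BsY: "Bs b' ?I ?A m \<in> rl (Gl l) ` el Y" for b' m
    by (induction m) (use N0(1) enY ao.inter in auto)
  obtain r where r: "r \<in> G" "?D r"
  proof -
    have "\<exists>r\<in>G. r \<in> el (Fn (K0 l Y)) \<and> ?D r"
    proof (rule product[OF G K Dfrc])
      fix r assume r: "r \<in> el (Fn (K0 l Y))"
      obtain M where M: "\<And>i k. pr (?x (num i)) k \<in> el r \<Longrightarrow> i < M" by (rule K0_fin[OF r]) (rule that)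
      obtain N where N: "N \<in> el Y" "rl (Gl l) N = Bs (b r) ?I ?A M" using imageE[OF BsY[of "b r" M]] by metis
      obtain N' where N': "N' \<in> el Y" "X N'" "infinite (rl (Gl l) N')" "finite (rl (Gl l) N' - Bs (b r) ?I ?A M)"
        using dense[OF N(1)] Bs_inf[OF N0(2)] N(2) by metis
      \<comment> \<open>The index has to lie beyond all bits mentioned by r; here the repetitions in
        the enumeration are used.\<close>
      obtain j where j: "j \<ge> M" "en Y (num j) = N'" using en(2)[OF Y(1-3) N'(1)] by blast
      obtain r' where r': "r' \<in> el (Fn (K0 l Y))" "el r \<subseteq> el r'"
        "\<And>i. i \<le> j \<Longrightarrow> pr (?x (num i)) o0 \<in> el r' \<or> pr (?x (num i)) o1 \<in> el r'"
        "\<And>i. i \<le> j \<Longrightarrow> pr (?x (num i)) o1 \<in> el r' \<longleftrightarrow> i = j \<or> pr (?x (num i)) o1 \<in> el r"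
        by (rule K0_extend[OF r M j(1)]) (assumption, rule that)
      have b': "b r' i \<longleftrightarrow> i = j \<or> b r i" if "i \<le> j" for i using r'(4)[OF that] by (simp add: b_def)
      have bM: "i < M" if "b r i" for i using M that by (simp add: b_def)
      have "Bs (b r') ?I ?A j = Bs (b r) ?I ?A j" by (rule Bs_cong) (simp add: b')
      also have "\<dots> = Bs (b r) ?I ?A M" using bM by (intro Bs_idle j(1)) (meson not_less)
      finally have eq: "Bs (b r') ?I ?A j = Bs (b r) ?I ?A M" .
      have "infinite (Bs (b r) ?I ?A M \<inter> ?A j)"
      proof
        assume "finite (Bs (b r) ?I ?A M \<inter> ?A j)"
        then have "finite (?A j)" using N'(4) j(2) by (metis Int_commute finite_Diff2 Diff_Int2 Int_Diff_Un finite_UnI)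
        then show False using N'(3) j(2) by simp
      qed
      then have "Bs (b r') ?I ?A (Suc j) \<subseteq> ?A j" using eq b'[of j] by simp
      then have "?D r'" unfolding D using r'(3) N'(2) j(2)
        by (intro exI[of _ "Suc j"] conjI exI[of _ j]) (auto simp: less_Suc_eq_le simp del: num.simps Bs.simps)
      then show "\<exists>r'\<in>el (Fn (K0 l Y)). el r \<subseteq> el r' \<and> ?D r'" using r'(1,2) by blast
    qed
    then show thesis using that by blast
  qed
  then obtain m j where m: "\<And>i. i < m \<Longrightarrow> pr (?x (num i)) o0 \<in> el r \<or> pr (?x (num i)) o1 \<in> el r"
    and j: "X (en Y (num j))" "Bs (b r) ?I ?A m \<subseteq> ?A j" unfolding D by blast
  \<comment> \<open>As r is in G and decides every bit below m, its run is the run of the actual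
    Cohen real up to m.\<close>
  have "b r i \<longleftrightarrow> i \<in> cb l Y" if "i < m" for i
  proof
    show "b r i \<Longrightarrow> i \<in> cb l Y" unfolding cb_iff[OF l Y(4)] b_def using r(1) by blast
    assume "i \<in> cb l Y"
    then obtain p where p: "p \<in> G" "pr (?x (num i)) o1 \<in> el p" unfolding cb_iff[OF l Y(4)] by blast
    have "pr (?x (num i)) o0 \<notin> el r" using gen_cons[OF G p(1) r(1)] p(2) unfolding cons_def by blast
    then show "b r i" using m[OF that] unfolding b_def by blast
  qed
  then have "Bs (b r) ?I ?A m = Bs (\<lambda>i. i \<in> cb l Y) ?I ?A m" by (rule Bs_cong)
  then have "Qs (\<lambda>i. i \<in> cb l Y) ?I ?A - ?A j \<subseteq> Qs (\<lambda>i. i \<in> cb l Y) ?I ?A - Bs (\<lambda>i. i \<in> cb l Y) ?I ?A m"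
    using j(2) by blast
  then have "finite (Qs (\<lambda>i. i \<in> cb l Y) ?I ?A - ?A j)" using Qs_almost by (rule finite_subset)
  then show ?thesis unfolding Y_def[symmetric] q_basic[OF l Y(4) subsetD[OF Y(5) N0(1)]] using j(1) enY by blast
qed

end

section \<open>A criterion for properness\<close>

text \<open>H plays the role of H(k). By \<open>inter\<close> sets can be cut down to X, because X
  is an element of the ambient model.\<close>

locale submodel = wfm E for E :: "'a \<Rightarrow> 'a \<Rightarrow> bool" +
  fixes X :: 'a and H :: "'a set"
  assumes H_trans: "x \<in> H \<Longrightarrow> el x \<subseteq> H"
    and H_subset: "x \<in> H \<Longrightarrow> el y \<subseteq> el x \<Longrightarrow> y \<in> H"
    and elem: "elementary_in E (el X) H"
    and inter: "\<exists>b. el b = el a \<inter> el X" and X_ne: "el X \<noteq> {}"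
begin

abbreviation "dfh \<equiv> df (el X) H E"
abbreviation "tmh \<equiv> tm (el X) H E"

named_theorems dhI

lemma X_H: "x \<in> el X \<Longrightarrow> x \<in> H"
  using elem unfolding elementary_in_def by blast

text \<open>The Tarski-Vaught property, in the form in which elementarity is used: witnesses in H
  for predicates definable from X can be found in X.\<close>

lemma tv:
  assumes P: "dfh (\<lambda>s. P (s 0))" and x: "x \<in> H" "P x"
  shows "\<exists>x\<in>el X. P x"
proof -
  obtain \<phi> c where c: "range c \<subseteq> el X" and
    \<phi>: "\<And>s. range s \<subseteq> H \<Longrightarrow> P (s 0) \<longleftrightarrow> sat H E (mix s c) \<phi>" using P unfolding df_def by blast
  have up: "sat (el X) E s \<psi> \<longleftrightarrow> sat H E s \<psi>" if "range s \<subseteq> el X" for s \<psi>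
    using elem that unfolding elementary_in_def by blast
  define u where "u = (\<lambda>_::nat. c 0)"
  have u: "range u \<subseteq> el X" using c unfolding u_def by auto
  have mix: "(mix u c)(0 := y) = mix (u(0 := y)) c" for y by (auto simp: mix_def fun_eq_iff)
  have mX: "range (mix v c) \<subseteq> el X" if "range v \<subseteq> el X" for v
    using that c by (auto simp: mix_def image_subset_iff)
  have uy: "range (u(0 := y)) \<subseteq> S" if "el X \<subseteq> S" "y \<in> S" for y S
    using that u by (auto simp: image_subset_iff)
  have HX: "el X \<subseteq> H" using X_H by blast
  have "sat H E (mix u c) (FNeg (FAll 0 (FNeg \<phi>)))"
    using \<phi>[of "u(0 := x)"] x uy[OF HX x(1)] by (auto simp: mix)
  then have "sat (el X) E (mix u c) (FNeg (FAll 0 (FNeg \<phi>)))" using up[OF mX[OF u]] by blast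
  then obtain y where y: "y \<in> el X" "sat (el X) E (mix (u(0 := y)) c) \<phi>" by (auto simp: mix)
  then have "sat H E (mix (u(0 := y)) c) \<phi>" using up[OF mX[OF uy[OF order_refl y(1)]]] by blast
  then have "P y" using \<phi>[of "u(0 := y)"] uy[OF HX X_H[OF y(1)]] by simp
  then show ?thesis using y(1) by blast
qed

lemma th_var [dhI]: "tmh (\<lambda>s. s i)" by (rule tm_var) (rule X_ne)
lemma th_const [dhI]: "u \<in> el X \<Longrightarrow> tmh (\<lambda>s. u)" by (rule tm_const) (use X_H in blast)+

lemma dh_eq [dhI]: "tmh t1 \<Longrightarrow> tmh t2 \<Longrightarrow> dfh (\<lambda>s. t1 s = t2 s)"
  by (rule df_sub2[of "el X" H E "(=)", OF df_eq_var[OF X_ne]])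

lemma dh_mem [dhI]: "tmh t1 \<Longrightarrow> tmh t2 \<Longrightarrow> dfh (\<lambda>s. t1 s \<in> el (t2 s))"
  unfolding E_iff[symmetric] by (rule df_sub2[of "el X" H E E, OF df_mem_var[OF X_ne]])

lemmas [dhI] = df_conj[of "el X" H E] df_disj[of "el X" H E] df_imp[of "el X" H E]
  df_iff[of "el X" H E] df_not[of "el X" H E] df_ball_D[of "el X" H E] df_bex_D[of "el X" H E]

lemma th_shift: "tmh t \<Longrightarrow> tmh (\<lambda>s. t (\<lambda>n. s (Suc n)))"
  by (rule tm_rename) auto

text \<open>Since H is transitive, bounded quantifiers keep their meaning when formulas are
  evaluated in H.\<close>

lemma dh_bex [dhI]:
  assumes t: "tmh t" and P: "dfh (\<lambda>s. P (\<lambda>n. s (Suc n)) (s 0))"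
  shows "dfh (\<lambda>s. \<exists>x\<in>el (t s). P s x)"
proof -
  have "dfh (\<lambda>s. \<exists>x\<in>H. x \<in> el (t s) \<and> P s x)" by (intro dhI P th_shift[OF t])
  then show ?thesis
    by (rule df_cong[rotated]) (use t H_trans in \<open>unfold tm_def, blast\<close>)
qed

lemma dh_ball [dhI]:
  assumes t: "tmh t" and P: "dfh (\<lambda>s. P (\<lambda>n. s (Suc n)) (s 0))"
  shows "dfh (\<lambda>s. \<forall>x\<in>el (t s). P s x)"
  using df_not[OF dh_bex[OF t df_not[OF P]]] by simp

lemma dh_subset [dhI]: "tmh t1 \<Longrightarrow> tmh t2 \<Longrightarrow> dfh (\<lambda>s. el (t1 s) \<subseteq> el (t2 s))"
  unfolding subset_eq by (intro dhI th_shift)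

lemma dh_empty [dhI]: "tmh t1 \<Longrightarrow> dfh (\<lambda>s. el (t1 s) = {})"
proof -
  assume t: "tmh t1"
  have "dfh (\<lambda>s. \<forall>x\<in>el (t1 s). \<not> x = x)" by (intro dhI t)
  then show ?thesis by (rule df_cong[rotated]) blast
qed

lemma dh_rel [dhI]: "tmh t1 \<Longrightarrow> tmh t2 \<Longrightarrow> tmh t3 \<Longrightarrow> dfh (\<lambda>s. (t1 s, t2 s) \<in> rel_of E (t3 s))"
proof -
  have "(x, y) \<in> rel_of E r \<longleftrightarrow> (\<exists>z\<in>el r. \<exists>c\<in>el z. \<exists>d\<in>el z.
    (x \<in> el c \<and> (\<forall>u\<in>el c. u = x)) \<and> (x \<in> el d \<and> y \<in> el d \<and> (\<forall>u\<in>el d. u = x \<or> u = y)) \<and> (\<forall>u\<in>el z. u = c \<or> u = d))" for x y r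
  proof -
    have "A = {a, b} \<longleftrightarrow> a \<in> A \<and> b \<in> A \<and> (\<forall>u\<in>A. u = a \<or> u = b)" for A and a b :: 'a by blast
    moreover have "A = {a} \<longleftrightarrow> a \<in> A \<and> (\<forall>u\<in>A. u = a)" for A and a :: 'a by blast
    ultimately show ?thesis unfolding rel_of_def is_pair_def by auto
  qed
  then show "tmh t1 \<Longrightarrow> tmh t2 \<Longrightarrow> tmh t3 \<Longrightarrow> dfh (\<lambda>s. (t1 s, t2 s) \<in> rel_of E (t3 s))"
    by (simp only:) (intro dhI th_shift)
qed

definition nxt :: "'a \<Rightarrow> 'a \<Rightarrow> 'a \<Rightarrow> bool" where
  "nxt x y a \<longleftrightarrow> a \<notin> el x \<and> a \<in> el y \<and> el x \<subseteq> el y \<and> (\<forall>u\<in>el y. u = a \<or> u \<in> el x)"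

lemma nxt_iff: "nxt x y a \<longleftrightarrow> a \<notin> el x \<and> el y = insert a (el x)"
  unfolding nxt_def by auto

(* A chain of finite sets that exhausts A.  The induction principle replaces an enumeration of A by
   the natural numbers: it yields f \<subseteq> X, hence A \<subseteq> X, as soon as f belongs to the submodel X. *)
definition enumf :: "'a \<Rightarrow> 'a \<Rightarrow> bool" where
  "enumf A f \<longleftrightarrow> (\<exists>x\<in>el f. el x = {}) \<and> (\<forall>x\<in>el f. \<forall>y\<in>el f. el x \<subseteq> el y \<or> el y \<subseteq> el x) \<and>
     (\<forall>a\<in>el A. \<exists>x\<in>el f. \<exists>y\<in>el f. nxt x y a) \<and>
     (\<forall>g\<in>H. el g \<subseteq> el f \<longrightarrow> (\<exists>x\<in>el g. el x = {}) \<longrightarrow>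
        (\<forall>x\<in>el g. \<forall>y\<in>el f. (\<exists>a\<in>el y. nxt x y a) \<longrightarrow> y \<in> el g) \<longrightarrow> el f \<subseteq> el g)"

text \<open>By elementarity f may be taken in X. The part of f in X contains the empty set and is
  closed under one-point extensions in f: in a chain such an extension of x is unique, hence
  definable from x and in X. Induction puts f inside X, and each a is definable from the two sets
  that it separates.\<close>

lemma enumf_subset:
  assumes A: "A \<in> el X" and f: "\<exists>f\<in>H. enumf A f"
  shows "el A \<subseteq> el X"
proof -
  have "dfh (\<lambda>s. enumf A (s 0))" unfolding enumf_def nxt_def by (intro dhI A)
  then obtain f where f: "f \<in> el X" "enumf A f" using tv f by blast
  note f2 = f(2)[unfolded enumf_def]
  note f3 = f2[THEN conjunct1] f2[THEN conjunct2, THEN conjunct1, rule_format]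
    f2[THEN conjunct2, THEN conjunct2, THEN conjunct1, rule_format]
    f2[THEN conjunct2, THEN conjunct2, THEN conjunct2, THEN bspec, THEN mp, THEN mp, THEN mp]
  obtain g where g: "el g = el f \<inter> el X" using inter by blast
  have gH: "g \<in> H" using H_subset[OF X_H[OF f(1)]] g by blast
  have "\<exists>x\<in>el g. el x = {}"
  proof -
    have "dfh (\<lambda>s. s 0 \<in> el f \<and> el (s 0) = {})" by (intro dhI f)
    moreover obtain x where "x \<in> el f" "el x = {}" using f3(1) by (elim bexE)
    ultimately obtain x where "x \<in> el X" "x \<in> el f \<and> el x = {}"
      using tv[of "\<lambda>x. x \<in> el f \<and> el x = {}" x] H_trans[OF X_H[OF f(1)]] by blast
    then show ?thesis unfolding g by blast
  qed
  moreover have "y \<in> el g" if x: "x \<in> el g" and y: "y \<in> el f" "\<exists>a\<in>el y. nxt x y a" for x y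
  proof -
    have xX: "x \<in> el X" using x g by blast
    have "dfh (\<lambda>s. s 0 \<in> el f \<and> (\<exists>a\<in>el (s 0). nxt x (s 0) a))" unfolding nxt_def by (intro dhI f xX)
    then obtain y' where y': "y' \<in> el X" "y' \<in> el f" "\<exists>a\<in>el y'. nxt x y' a"
      using tv[of "\<lambda>y. y \<in> el f \<and> (\<exists>a\<in>el y. nxt x y a)"] y H_trans[OF X_H[OF f(1)]] by blast
    have "el y \<subseteq> el y' \<or> el y' \<subseteq> el y" by (rule f3(2)[OF y(1) y'(2)])
    moreover obtain a a' where "nxt x y a" "nxt x y' a'" using y(2) y'(3) by blast
    then have "a \<notin> el x" "a' \<notin> el x" "el y = insert a (el x)" "el y' = insert a' (el x)" by (simp_all add: nxt_iff)
    ultimately have "el y = el y'" by auto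
    then have "y \<in> el X" "y \<in> el f" using y'(1) y(1) ext by simp_all
    then show ?thesis using g by simp
  qed
  moreover have "el g \<subseteq> el f" using g by simp
  ultimately have "el f \<subseteq> el g" by (intro f3(4)[OF gH]) blast+
  then have fX: "el f \<subseteq> el X" using g by simp
  show ?thesis
  proof
    fix a assume "a \<in> el A"
    then obtain x y where xy: "x \<in> el f" "y \<in> el f" "nxt x y a" using f3(3) by blast
    have "dfh (\<lambda>s. nxt x y (s 0))" unfolding nxt_def by (intro dhI) (use xy fX in auto)
    moreover have "a \<in> H" using H_trans[OF X_H] xy fX unfolding nxt_def by blast
    ultimately obtain a' where "a' \<in> el X" "nxt x y a'" using tv[of "nxt x y" a] xy(3) by blast
    moreover from this have "a = a'" using xy(3) unfolding nxt_def by auto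
    ultimately show "a \<in> el X" by simp
  qed
qed

definition covers :: "'a \<Rightarrow> 'a \<Rightarrow> bool" where "covers P I \<longleftrightarrow> (\<forall>a\<in>el P. \<exists>A\<in>el I. a \<in> el A)"

text \<open>C acts as a club of stages: the conclusion is demanded of every stage that is a union of
  members of C, not only of the members themselves.\<close>

definition traps :: "'a \<Rightarrow> 'a \<Rightarrow> 'a \<Rightarrow> 'a \<Rightarrow> 'a \<Rightarrow> 'a \<Rightarrow> bool" where
  "traps P R I T D C \<longleftrightarrow> (\<forall>A\<in>el I. (\<forall>a\<in>el A. \<exists>B\<in>el C. el B \<subseteq> el A \<and> a \<in> el B) \<longrightarrow>
     (\<forall>q\<in>el P. (A, q) \<in> rel_of E T \<longrightarrow> (\<exists>d\<in>el D. d \<in> el A \<and> (q, d) \<in> rel_of E R)))"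

(* I is a continuous chain of countable suborders, T attaches generic conditions to its members, and
   the sets C are unbounded families of stages which reflect the density of D. *)
definition guided :: "'a \<Rightarrow> 'a \<Rightarrow> 'a \<Rightarrow> 'a \<Rightarrow> bool" where
  "guided P R I T \<longleftrightarrow> covers P I \<and> (\<forall>A\<in>el I. el A \<subseteq> el P \<and> (\<exists>f\<in>H. enumf A f)) \<and>
     (\<forall>s\<in>H. el s \<subseteq> el I \<and> \<not> el s = {} \<longrightarrow> covers P s \<or>
        (\<exists>B\<in>el I. (\<forall>a\<in>el B. \<exists>A\<in>el s. a \<in> el A) \<and> (\<forall>A\<in>el s. el A \<subseteq> el B))) \<and>
     (\<forall>A\<in>el I. \<forall>p\<in>el A. \<exists>q\<in>el P. (q, p) \<in> rel_of E R \<and> (A, q) \<in> rel_of E T) \<and>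
     (\<forall>D\<in>H. (\<forall>p\<in>el P. \<exists>d\<in>el D. (d, p) \<in> rel_of E R) \<longrightarrow>
        (\<exists>C\<in>H. el C \<subseteq> el I \<and> covers P C \<and>
          traps P R I T D C))"

text \<open>The stages in X have a supremum B in the chain, and B has exactly the elements of P in
  X: stages in X are subsets of X and cover all of P in X. For dense D in X the set C can be chosen
  in X, so B is a union of members of C, and one condition attached to B is trapped for all these
  D.\<close>

lemma guided_generic:
  assumes P: "P \<in> el X" and R: "R \<in> el X" and nP: "\<not> el P \<subseteq> el X"
    and IT: "I0 \<in> H" "T0 \<in> H" "guided P R I0 T0" and p: "p \<in> el P" "p \<in> el X"
  shows "\<exists>q\<in>el P. (q, p) \<in> rel_of E R \<and>
    (\<forall>D\<in>el X. dense_in (el P) (rel_of E R) (el D) \<longrightarrow> (\<exists>d\<in>el D. d \<in> el X \<and> (q, d) \<in> rel_of E R))"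
proof -
  have "dfh (\<lambda>s. \<exists>T\<in>H. guided P R (s 0) T)" unfolding guided_def traps_def covers_def enumf_def nxt_def by (intro dhI P R)
  then obtain I where I: "I \<in> el X" "\<exists>T\<in>H. guided P R I T" using tv[of "\<lambda>I. \<exists>T\<in>H. guided P R I T"] IT by blast
  have "dfh (\<lambda>s. guided P R I (s 0))" unfolding guided_def traps_def covers_def enumf_def nxt_def by (intro dhI P R I)
  then obtain T where T: "T \<in> el X" "guided P R I T" using tv[of "guided P R I"] I(2) by blast
  have g1: "covers P I" and g2: "\<And>A. A \<in> el I \<Longrightarrow> el A \<subseteq> el P \<and> (\<exists>f\<in>H. enumf A f)"
    and g3: "\<And>s. s \<in> H \<Longrightarrow> el s \<subseteq> el I \<and> \<not> el s = {} \<Longrightarrow> covers P s \<or>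
        (\<exists>B\<in>el I. (\<forall>a\<in>el B. \<exists>A\<in>el s. a \<in> el A) \<and> (\<forall>A\<in>el s. el A \<subseteq> el B))"
    and g4: "\<And>A p. A \<in> el I \<Longrightarrow> p \<in> el A \<Longrightarrow> \<exists>q\<in>el P. (q, p) \<in> rel_of E R \<and> (A, q) \<in> rel_of E T"
    and g5: "\<And>D. D \<in> H \<Longrightarrow> (\<forall>p\<in>el P. \<exists>d\<in>el D. (d, p) \<in> rel_of E R) \<Longrightarrow>
        (\<exists>C\<in>H. el C \<subseteq> el I \<and> covers P C \<and>
          traps P R I T D C)"
    using T(2) unfolding guided_def by blast+
  have AX: "el A \<subseteq> el P \<inter> el X" if "A \<in> el I" "A \<in> el X" for A using enumf_subset g2 that by blast
  have cov: "\<exists>A\<in>el C. A \<in> el X \<and> a \<in> el A" if C: "C \<in> el X" "covers P C" and a: "a \<in> el P" "a \<in> el X" for C a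
  proof -
    have "dfh (\<lambda>s. s 0 \<in> el C \<and> a \<in> el (s 0))" by (intro dhI C a)
    moreover obtain A where "A \<in> el C" "a \<in> el A" using C(2) a(1) unfolding covers_def by blast
    ultimately show ?thesis using tv[of "\<lambda>A. A \<in> el C \<and> a \<in> el A" A] H_trans[OF X_H[OF C(1)]] by blast
  qed
  obtain s where s: "el s = el I \<inter> el X" using inter by blast
  have "s \<in> H" using H_subset[OF X_H[OF I(1)]] s by blast
  moreover have "el s \<noteq> {}" using cov[OF I(1) g1 p] s by blast
  ultimately have "covers P s \<or> (\<exists>B\<in>el I. (\<forall>a\<in>el B. \<exists>A\<in>el s. a \<in> el A) \<and> (\<forall>A\<in>el s. el A \<subseteq> el B))"
    using g3 s by blast
  moreover have "\<not> covers P s" using nP AX unfolding covers_def s by blast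
  ultimately obtain B where B: "B \<in> el I" "\<forall>a\<in>el B. \<exists>A\<in>el s. a \<in> el A" "\<forall>A\<in>el s. el A \<subseteq> el B" by blast
  have BX: "el B = el P \<inter> el X" using B(2,3) AX cov[OF I(1) g1] unfolding s by blast
  obtain q where q: "q \<in> el P" "(q, p) \<in> rel_of E R" "(B, q) \<in> rel_of E T" using g4[OF B(1)] BX p by blast
  have "\<exists>d\<in>el D. d \<in> el X \<and> (q, d) \<in> rel_of E R" if D: "D \<in> el X" "dense_in (el P) (rel_of E R) (el D)" for D
  proof -
    let ?P = "\<lambda>C. el C \<subseteq> el I \<and> covers P C \<and>
          traps P R I T D C"
    have "dfh (\<lambda>s. ?P (s 0))" unfolding covers_def traps_def by (intro dhI P R I D T)
    moreover have "\<exists>C\<in>H. ?P C" using g5[OF X_H[OF D(1)]] D(2) unfolding dense_in_def by blast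
    then obtain C0 where "C0 \<in> H" "?P C0" by (rule bexE)
    ultimately have "\<exists>C\<in>el X. ?P C" by (rule tv)
    then obtain C where C: "C \<in> el X" "?P C" by (rule bexE)
    have "\<exists>B'\<in>el C. el B' \<subseteq> el B \<and> a \<in> el B'" if "a \<in> el B" for a
    proof -
      have "covers P C" "el C \<subseteq> el I" by (rule C(2)[THEN conjunct2, THEN conjunct1], rule C(2)[THEN conjunct1])
      have "a \<in> el P" "a \<in> el X" using that BX by simp_all
      from cov[OF C(1) \<open>covers P C\<close> this] obtain A where A: "A \<in> el C" "A \<in> el X" "a \<in> el A" by blast
      then have "el A \<subseteq> el B" using AX[of A] \<open>el C \<subseteq> el I\<close> BX by (simp add: subset_iff)
      then show ?thesis using A(1,3) by (intro bexI conjI)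
    qed
    with C(2) B(1) have "\<forall>q\<in>el P. (B, q) \<in> rel_of E T \<longrightarrow> (\<exists>d\<in>el D. d \<in> el B \<and> (q, d) \<in> rel_of E R)" unfolding traps_def by blast
    then have "\<exists>d\<in>el D. d \<in> el B \<and> (q, d) \<in> rel_of E R" using q(1,3) by blast
    then show ?thesis using BX by blast
  qed
  then show ?thesis using q by blast
qed

end

section \<open>The families are proper\<close>

context zfc begin

section \<open>Stages of the chain and closure points\<close>

lemma Yc_le: "\<alpha> \<in> el w1 \<or> \<alpha> = w1 \<Longrightarrow> \<beta> = \<alpha> \<or> \<beta> \<in> el \<alpha> \<Longrightarrow> el (Yc \<beta>) \<subseteq> el (Yc \<alpha>)"
  using Yc_mono by blast

lemma Yc_suc: "\<alpha> \<in> el w1 \<or> \<alpha> = w1 \<Longrightarrow> N \<in> el (Yc \<alpha>) \<Longrightarrow> \<exists>\<beta>\<in>el \<alpha>. N \<in> el (Yc (suc \<beta>))"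
  unfolding el_Yc[of \<alpha>] el_Yc[of "suc _"] by auto

lemma Yc_w1E: "N \<in> el (Yc w1) \<Longrightarrow> \<exists>\<alpha>\<in>el w1. N \<in> el (Yc \<alpha>)"
  using Yc_suc[of w1 N] w1_suc by blast

lemma Yc_LC: "\<alpha> \<in> el w1 \<or> \<alpha> = w1 \<Longrightarrow> el (Yc \<alpha>) \<subseteq> el LC"
  using Yc_w1 Yc_w1E by blast

lemma Yc_L: "\<alpha> \<in> el w1 \<or> \<alpha> = w1 \<Longrightarrow> el (Yc \<alpha>) \<subseteq> el L"
  using Yc_LC by (auto simp: el_LC)

lemma lepoll_Yc: "lepoll_in E (Yc w1) w1"
proof (rule lepoll_w1[of Yc])
  show "tmu (\<lambda>s. Yc (s 0))" by (intro dfI)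
  show "el (Yc w1) \<subseteq> (\<Union>\<alpha>\<in>el w1. el (Yc \<alpha>))" using Yc_w1E by blast
  show "\<And>\<alpha>. \<alpha> \<in> el w1 \<Longrightarrow> cbl (Yc \<alpha>)" using Yc_w1 by (auto simp: el_LC)
qed

lemma w1_cases: "\<alpha> \<in> el w1 \<Longrightarrow> \<beta> \<in> el w1 \<Longrightarrow> \<alpha> \<in> el \<beta> \<or> \<alpha> = \<beta> \<or> \<beta> \<in> el \<alpha>"
  using ord_cmp[OF w1_ord w1_ord] .

lemma suc_le: "\<alpha> \<in> el w1 \<Longrightarrow> \<beta> \<in> el \<alpha> \<Longrightarrow> suc \<beta> = \<alpha> \<or> suc \<beta> \<in> el \<alpha>"
  using w1_cases[of "suc \<beta>" \<alpha>] w1_suc ord_trans[OF w1(1)] E_asym[of \<beta> \<alpha>] by auto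

text \<open>A countable closure of \<delta> under the operation is an initial segment of \<omega>_1,
  hence an ordinal \<gamma>. The term \<open>suc (suc u)\<close> makes it transitive and closed
  under successors, so each name in \<open>Yc \<gamma>\<close> already lies in
  \<open>Yc (suc \<beta>)\<close> for some \<open>suc \<beta>\<close> below \<gamma>.\<close>

lemma club:
  assumes S: "tmu (\<lambda>s. S (s 0))" "\<And>N. N \<in> el (Yc w1) \<Longrightarrow> cbl (S N) \<and> el (S N) \<subseteq> el w1" and d: "\<delta> \<in> el w1"
  obtains \<gamma> where "\<gamma> \<in> el w1" "\<delta> \<in> el \<gamma>" "\<And>N. N \<in> el (Yc \<gamma>) \<Longrightarrow> el (S N) \<subseteq> el \<gamma>"
proof -
  note [dfI] = tm_1[OF S(1)]
  let ?op = "\<lambda>u v. un (suc (suc u)) (bun (mk (S ` el (Yc u))))"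
  have op: "tmu (\<lambda>s. ?op (s 0) (s (Suc 0)))" by (intro dfI)
  have el_op: "el (?op u v) = el (suc (suc u)) \<union> (\<Union>N\<in>el (Yc u). el (S N))" for u v
    unfolding el_un el_bun_img[OF S(1)] ..
  have SY: "cbl (S N) \<and> el (S N) \<subseteq> el w1" if "u \<in> el w1" "N \<in> el (Yc u)" for u N
    using S(2) Yc_mono[of w1 u] that by blast
  have 1: "cbl (?op u v) \<and> el (?op u v) \<subseteq> el w1" if u: "u \<in> el w1" for u v
  proof
    have "cbl (Yc u)" using Yc_w1[OF u] by (simp add: el_LC)
    then have "cbl (bun (mk (S ` el (Yc u))))" by (rule cbl_UN'[OF S(1)]) (use SY[OF u] in blast)
    then show "cbl (?op u v)" using w1(3)[OF w1_suc[OF w1_suc[OF u]]] by (intro cbl_un)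
    have "el (suc (suc u)) \<subseteq> el w1" using w1_suc[OF u] u ord_trans[OF w1(1)] by auto
    then show "el (?op u v) \<subseteq> el w1" unfolding el_op using SY[OF u] by blast
  qed
  have x: "cbl (up \<delta> \<delta>)" "el (up \<delta> \<delta>) \<subseteq> el w1" using d by simp_all
  obtain C where C: "cbl C" "el (up \<delta> \<delta>) \<subseteq> el C" "el C \<subseteq> el w1"
    "\<And>u v. u \<in> el C \<Longrightarrow> v \<in> el C \<Longrightarrow> el (?op u v) \<subseteq> el C"
    by (rule cbl_closure[OF op 1 x]) (assumption, rule that)
  have C4: "el (suc (suc u)) \<subseteq> el C" "N \<in> el (Yc u) \<Longrightarrow> el (S N) \<subseteq> el C" if "u \<in> el C" for u N
    using C(4)[OF that that] unfolding el_op by blast+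
  have "el C = el w1 \<or> (\<exists>a\<in>el w1. el C = el a)"
    by (rule ord_initial[OF w1(1) C(3)]) (use C4(1) in auto)
  moreover have "el C \<noteq> el w1" using C(1) w1(2) cbl_subset[of C w1] by blast
  ultimately obtain \<gamma> where g: "\<gamma> \<in> el w1" "el C = el \<gamma>" by blast
  show thesis
  proof (rule that[OF g(1)])
    show "\<delta> \<in> el \<gamma>" using C(2) g(2) by simp
    fix N assume "N \<in> el (Yc \<gamma>)"
    then obtain \<beta> where b: "\<beta> \<in> el \<gamma>" "N \<in> el (Yc (suc \<beta>))" using Yc_suc g(1) by blast
    then have "suc \<beta> \<in> el C" using C4(1)[of \<beta>] g(2) by simp
    then show "el (S N) \<subseteq> el \<gamma>" using C4(2)[OF _ b(2)] g(2) by blast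
  qed
qed

end

context coh begin

lemma inf_iff: "infinite (rl H N) \<longleftrightarrow> (\<forall>k\<in>el om. \<exists>n\<in>el om. k \<in> el n \<and> mm H n N)"
  unfolding ball_om bex_om infinite_nat_iff_unbounded rl_def by simp

lemma almost_iff: "finite (rl H N - rl H M) \<longleftrightarrow> (\<exists>k\<in>el om. \<forall>n\<in>el om. k \<in> el n \<longrightarrow> mm H n N \<longrightarrow> mm H n M)"
proof -
  have "finite (rl H N - rl H M) \<longleftrightarrow> (\<exists>k. \<forall>n>k. \<not> n \<in> rl H N - rl H M)"
    using infinite_nat_iff_unbounded[of "rl H N - rl H M"] by blast
  then show ?thesis unfolding ball_om bex_om rl_def by simp
qed

lemma FG_inf [fgI]: "tmu t1 \<Longrightarrow> tmu t2 \<Longrightarrow> FG (\<lambda>s. infinite (rl (Gl (t1 s)) (t2 s)))"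
  unfolding inf_iff
  by (rule Frc_2[of "\<lambda>H l N. \<forall>k\<in>el om. \<exists>n\<in>el om. k \<in> el n \<and> mm (Gl l) n N"]) (intro fgI FG_mm Frc_df dfI)

lemma FG_almost [fgI]: "tmu t1 \<Longrightarrow> tmu t2 \<Longrightarrow> FG (\<lambda>s. finite (rl (Gl l) (t1 s) - rl (Gl l) (t2 s)))"
  unfolding almost_iff
  by (rule Frc_2[of "\<lambda>H N M. \<exists>k\<in>el om. \<forall>n\<in>el om. k \<in> el n \<longrightarrow> mm (Gl l) n N \<longrightarrow> mm (Gl l) n M"])
    (intro fgI FG_mm Frc_df dfI)

text \<open>Otherwise the Cohen real would be an infinite set computed without its own block, and
  \<open>splitting\<close> would make its difference with itself infinite.\<close>

lemma fresh:
  assumes l: "l \<in> el L" and a: "\<alpha> \<in> el w1" and l': "l' \<in> el L" and N: "l' \<noteq> l \<or> N \<in> el (Yc \<alpha>)"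
  shows "rl (Gl l') N \<noteq> cb l (Yc \<alpha>)"
proof
  assume eq: "rl (Gl l') N = cb l (Yc \<alpha>)"
  have Y: "Yc \<alpha> \<in> el L" using Yc_w1[OF a] by (simp add: el_LC)
  interpret J: forc E "dif L (K0 l (Yc \<alpha>))" "{GJ l (Yc \<alpha>)}" by (rule forc_J)
  have 1: "J.Frc (\<lambda>H s. mJ (GJ l (Yc \<alpha>)) l' (s 0) N)"
  proof (rule J.Frc_cong)
    show "J.Frc (\<lambda>H s. mJ H l' (s 0) N)" unfolding mJ_def by (intro J.frcI J.Frc_df dfI)
  qed simp
  have mj: "mJ (GJ l (Yc \<alpha>)) l' n N \<longleftrightarrow> mm (Gl l') n N" for n
    by (rule mJ[OF l']) (use N Yc_support[OF a] in blast)
  have r: "{n. mJ (GJ l (Yc \<alpha>)) l' (num n) N} = rl (Gl l') N" unfolding mj rl_def ..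
  have "J.Frc (\<lambda>H s. True)" by (intro J.Frc_df dfI)
  then have "infinite ({n. True} \<inter> cb l (Yc \<alpha>))" by (rule splitting(1)[OF l Y]) simp
  then have "infinite {n. mJ (GJ l (Yc \<alpha>)) l' (num n) N}" unfolding r eq by simp
  from splitting(2)[OF l Y 1 this] show False unfolding r eq by simp
qed

lemma cb_inf: "l \<in> el L \<Longrightarrow> Y \<in> el L \<Longrightarrow> infinite (cb l Y)"
proof -
  assume l: "l \<in> el L" "Y \<in> el L"
  interpret J: forc E "dif L (K0 l Y)" "{GJ l Y}" by (rule forc_J)
  have "J.Frc (\<lambda>H s. True)" by (intro J.Frc_df dfI)
  then have "infinite ({n. True} \<inter> cb l Y)" by (rule splitting(1)[OF l]) simp
  then show ?thesis by simp
qed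

text \<open>Code 9 is unary; the label is repeated as second argument so that both arguments lie in
  the closed set of names.\<close>

definition cn :: "'a \<Rightarrow> 'a" where "cn \<alpha> = og (pr (num 9) (pr (Yc \<alpha>) (Yc \<alpha>)))"

lemma tm_cn [dfI]: "tmu t \<Longrightarrow> tmu (\<lambda>s. cn (t s))"
  unfolding cn_def by (intro dfI)

lemma cn:
  assumes l: "l \<in> el L" and a: "\<alpha> \<in> el w1"
  shows "rl (Gl l) (cn \<alpha>) = cb l (Yc \<alpha>)" "infinite (rl (Gl l) (cn \<alpha>))"
    "\<beta> \<in> el w1 \<or> \<beta> = w1 \<Longrightarrow> \<alpha> \<in> el \<beta> \<Longrightarrow> cn \<alpha> \<in> el (Yc \<beta>)"
proof -
  have Y: "Yc \<alpha> \<in> el L" using Yc_w1[OF a] by (simp add: el_LC)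
  show r: "rl (Gl l) (cn \<alpha>) = cb l (Yc \<alpha>)" unfolding cn_def rl_ops(10)[OF gen_Gl[OF l] Y Y] cb_def ..
  show "infinite (rl (Gl l) (cn \<alpha>))" unfolding r using cb_inf[OF l Y] .
  assume b: "\<beta> \<in> el w1 \<or> \<beta> = w1" "\<alpha> \<in> el \<beta>"
  show "cn \<alpha> \<in> el (Yc \<beta>)" unfolding cn_def using Yc_mono[OF b] by (intro clp_op[OF Yc_clp[OF b(1)]]) auto
qed

lemma cn_inj:
  assumes l: "l \<in> el L" and ab: "\<alpha> \<in> el w1" "\<beta> \<in> el w1" and eq: "rl (Gl l) (cn \<alpha>) = rl (Gl l) (cn \<beta>)"
  shows "\<alpha> = \<beta>"
proof (rule ccontr)
  assume "\<alpha> \<noteq> \<beta>"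
  then have "\<alpha> \<in> el \<beta> \<or> \<beta> \<in> el \<alpha>" using w1_cases[OF ab] by blast
  then show False
    using fresh[OF l ab(2) l, of "cn \<alpha>"] fresh[OF l ab(1) l, of "cn \<beta>"] cn[OF l ab(1)] cn[OF l ab(2)] eq ab by blast
qed

definition qn :: "'a \<Rightarrow> 'a \<Rightarrow> 'a" where "qn \<alpha> N = og (pr (num 10) (pr (Yc \<alpha>) N))"

lemma tm_qn [dfI]: "tmu t \<Longrightarrow> tmu t' \<Longrightarrow> tmu (\<lambda>s. qn (t s) (t' s))"
  by (rule tm_2[of qn]) (unfold qn_def, intro dfI)

lemma qn:
  assumes l: "l \<in> el L" and a: "\<alpha> \<in> el w1" and N: "N \<in> el (Yc \<alpha>)" "infinite (rl (Gl l) N)"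
  shows "qn \<alpha> N \<in> el (Yc w1)" "infinite (rl (Gl l) (qn \<alpha> N))" "rl (Gl l) (qn \<alpha> N) \<subseteq> rl (Gl l) N"
proof -
  have m: "Yc \<alpha> \<in> el (Yc w1)" "N \<in> el (Yc w1)" using Yc_mono[of w1 \<alpha>] a N(1) by blast+
  then show "qn \<alpha> N \<in> el (Yc w1)" unfolding qn_def by (intro clp_op[OF Yc_clp]) auto
  have L: "Yc \<alpha> \<in> el L" "N \<in> el L" using m Yc_L[of w1] by blast+
  show "infinite (rl (Gl l) (qn \<alpha> N))" "rl (Gl l) (qn \<alpha> N) \<subseteq> rl (Gl l) N"
    unfolding qn_def q_basic[OF l L] using Qs_inf[OF N(2)] Qs_sub by blast+
qed

text \<open>S N collects two countable sets of ordinals: the stages whose labels occur in the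
  conditions deciding whether N is in D, and the stages at which the possible least refinements of N
  in D appear. If \<alpha> is closed under S, then D is dense on the reals named in
  \<open>Yc \<alpha>\<close> and is computed there without the block labelled
  \<open>Yc \<alpha>\<close>, so \<open>q_generic\<close> applies.\<close>

lemma trap:
  assumes l: "l \<in> el L"
    and dense: "\<And>N. N \<in> el (Yc w1) \<Longrightarrow> infinite (rl (Gl l) N) \<Longrightarrow> \<exists>N'\<in>el (Yc w1).
      infinite (rl (Gl l) N') \<and> val (nu l N') \<in> F.el D \<and> finite (rl (Gl l) N' - rl (Gl l) N)"
  obtains S where "tmu (\<lambda>s. S (s 0))" "\<And>N. N \<in> el (Yc w1) \<Longrightarrow> cbl (S N) \<and> el (S N) \<subseteq> el w1"
    "\<And>\<alpha> N. \<alpha> \<in> el w1 \<Longrightarrow> \<forall>M\<in>el (Yc \<alpha>). el (S M) \<subseteq> el \<alpha> \<Longrightarrow> N \<in> el (Yc \<alpha>) \<Longrightarrow> infinite (rl (Gl l) N) \<Longrightarrow>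
      \<exists>M\<in>el (Yc \<alpha>). infinite (rl (Gl l) M) \<and> val (nu l M) \<in> F.el D \<and> finite (rl (Gl l) (qn \<alpha> N) - rl (Gl l) M)"
proof -
  obtain t where t: "D = val t" by (rule valE)
  define XD where "XD N \<longleftrightarrow> infinite (rl (Gl l) N) \<and> val (nu l N) \<in> F.el (val t)" for N
  have FGX: "FG (\<lambda>s. XD (t s))" if "tmu t" for t
    by (rule Frc_1[of "\<lambda>H. XD", OF _ that]) (unfold XD_def, intro fgI dfI)
  have FGX0: "FG (\<lambda>s. XD (s 0))" by (intro FGX dfI)
  obtain f where f: "\<And>N. N \<in> el (Yc w1) \<Longrightarrow> cbl (app f N) \<and> el (app f N) \<subseteq> el (Fn L)"
    "\<And>H N. H \<in> {G} \<Longrightarrow> N \<in> el (Yc w1) \<Longrightarrow> XD N \<longleftrightarrow> (\<exists>p\<in>H. p \<in> el (app f N))"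
    by (rule Frc_ctbl[OF FGX0, of "Yc w1"]) (rule that)
  \<comment> \<open>For a literal \<open>pr (pr l (pr Y n)) i\<close> this is the label Y.\<close>
  define lab where "lab z = pfst (psnd (pfst z))" for z
  have tlab: "tmu (\<lambda>s. lab (s 0))" unfolding lab_def by (intro dfI)
  note [dfI] = tm_1[OF tlab]
  define Lb where "Lb N = mk {\<beta> \<in> el w1. \<exists>p\<in>el (app f N). \<exists>z\<in>el p. Yc \<beta> = lab z}" for N
  have Lb: "el (Lb N) = {\<beta> \<in> el w1. \<exists>p\<in>el (app f N). \<exists>z\<in>el p. Yc \<beta> = lab z}" for N
    unfolding Lb_def by (rule el_sep) (intro dfI)
  have cLb: "cbl (Lb N)" if N: "N \<in> el (Yc w1)" for N
  proof -
    have "cbl (bun (app f N))"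
      using f(1)[OF N] by (intro cbl_UN) (auto simp: el_Fn intro!: cbl_finite)
    then have c: "cbl (mk (lab ` el (bun (app f N))))" by (rule cbl_image[OF tlab])
    have tY: "tmu (\<lambda>s. Yc (s 0))" by (intro dfI)
    have "inj_on Yc (el (Lb N))"
    proof (rule inj_onI, rule ccontr)
      fix \<alpha> \<beta> assume a: "\<alpha> \<in> el (Lb N)" "\<beta> \<in> el (Lb N)" "Yc \<alpha> = Yc \<beta>" "\<alpha> \<noteq> \<beta>"
      then have w: "\<alpha> \<in> el w1" "\<beta> \<in> el w1" unfolding Lb by blast+
      then show False using w1_cases[OF w] a Yc_mono[of \<alpha> \<beta>] Yc_mono[of \<beta> \<alpha>] by auto
    qed
    moreover have "Yc ` el (Lb N) \<subseteq> el (mk (lab ` el (bun (app f N))))"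
      unfolding el_img[OF tlab] unfolding Lb el_bun by auto
    ultimately have "lepoll_in E (Lb N) (mk (lab ` el (bun (app f N))))" by (rule lepollI[OF tY])
    then show ?thesis using c lepoll_trans unfolding cbl_lepoll by blast
  qed
  obtain i where i: "inj_on (app i) (el (Yc w1))" "app i ` el (Yc w1) \<subseteq> el w1"
    using lepoll_Yc unfolding lepoll_iff by blast
  define good where "good N N' \<longleftrightarrow> XD N' \<and> finite (rl (Gl l) N' - rl (Gl l) N)" for N N'
  have FGg: "FG (\<lambda>s. good (t s) (t' s))" if "tmu t" "tmu t'" for t t'
    by (rule Frc_2[of "\<lambda>H. good", OF _ that]) (unfold good_def, intro fgI FGX dfI)
  \<comment> \<open>Taking the least refinement turns it into a partial function of N in the
    extension, so that \<open>covering\<close> gives countable sets of the ground model containing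
    its values.\<close>
  define lst where "lst N N' \<longleftrightarrow> good N N' \<and> (\<forall>M\<in>el (Yc w1). good N M \<longrightarrow> \<not> app i M \<in> el (app i N'))" for N N'
  have FGl: "FG (\<lambda>s. lst (s 0) (s (Suc 0)))" unfolding lst_def
    by (intro fgI FGg dfI; intro Frc_df dfI)
  have lst_un: "M = M'" if "M \<in> el (Yc w1)" "M' \<in> el (Yc w1)" "lst N M" "lst N M'" for N M M'
  proof -
    have "app i M \<in> el w1" "app i M' \<in> el w1" using i(2) that by blast+
    from w1_cases[OF this] have "app i M = app i M'" using that unfolding lst_def by blast
    then show ?thesis using i(1) that unfolding inj_on_def by blast
  qed
  have lst_ex: "\<exists>M\<in>el (Yc w1). lst N M" if N: "N \<in> el (Yc w1)" "infinite (rl (Gl l) N)" for N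
  proof -
    obtain M0 where M0: "M0 \<in> el (Yc w1)" "good N M0" using dense[OF N] unfolding good_def XD_def t by blast
    then have "app i M0 \<in> app i ` {M \<in> el (Yc w1). good N M}" by blast
    from E_min[OF this] obtain M where "M \<in> el (Yc w1)" "good N M"
      "\<forall>z\<in>el (app i M). z \<notin> app i ` {M \<in> el (Yc w1). good N M}" by blast
    then show ?thesis unfolding lst_def by blast
  qed
  obtain W where W: "tmu (\<lambda>s. W (s 0))" "\<And>N. N \<in> el (Yc w1) \<Longrightarrow> cbl (W N)"
    "\<And>N M. N \<in> el (Yc w1) \<Longrightarrow> M \<in> el (Yc w1) \<Longrightarrow> lst N M \<Longrightarrow> M \<in> el (W N)"
    by (rule covering[OF FGl, of "Yc w1" "Yc w1"]) (use lst_un in blast, rule that)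
  note [dfI] = tm_1[OF W(1)]
  have 1: "dfu (\<lambda>s. s 0 \<in> el (Yc (s (Suc 0))))" by (intro dfI)
  obtain ix where ix: "\<And>N. N \<in> el (Yc w1) \<Longrightarrow> app ix N \<in> el w1 \<and> N \<in> el (Yc (app ix N))"
    by (rule choice[OF 1 Yc_w1E]) (assumption, rule that)
  define W' where "W' N = mk {M \<in> el (W N). M \<in> el (Yc w1)}" for N
  have W': "el (W' N) = {M \<in> el (W N). M \<in> el (Yc w1)}" for N unfolding W'_def by (rule el_sep) (intro dfI)
  have tix: "tmu (\<lambda>s. app ix (s 0))" by (intro dfI)
  define S where "S N = un (Lb N) (mk (app ix ` el (W' N)))" for N
  have S: "el (S N) = el (Lb N) \<union> app ix ` el (W' N)" for N unfolding S_def el_un el_img[OF tix] ..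
  show thesis
  proof (rule that[of S])
    show "tmu (\<lambda>s. S (s 0))" unfolding S_def Lb_def W'_def by (intro dfI)
    fix N assume N: "N \<in> el (Yc w1)"
    have "cbl (W' N)" using W(2)[OF N] by (rule cbl_subset) (auto simp: W')
    then have "cbl (S N)" unfolding S_def by (intro cbl_un cLb[OF N] cbl_image[OF tix])
    moreover have "el (S N) \<subseteq> el w1" unfolding S using ix by (auto simp: W' Lb)
    ultimately show "cbl (S N) \<and> el (S N) \<subseteq> el w1" ..
  next
    fix \<alpha> N assume a: "\<alpha> \<in> el w1" and "\<forall>M\<in>el (Yc \<alpha>). el (S M) \<subseteq> el \<alpha>"
      and N: "N \<in> el (Yc \<alpha>)" "infinite (rl (Gl l) N)"
    then have c: "\<And>M. M \<in> el (Yc \<alpha>) \<Longrightarrow> el (S M) \<subseteq> el \<alpha>" by blast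
    have Yw: "el (Yc \<alpha>) \<subseteq> el (Yc w1)" using Yc_mono[of w1 \<alpha>] a by blast
    \<comment> \<open>As \<alpha> is closed under S, the conditions that decide about names in
      \<open>Yc \<alpha>\<close> avoid the block, and the smaller filter decides correctly.\<close>
    define X where "X M \<longleftrightarrow> (\<exists>p\<in>GJ l (Yc \<alpha>). p \<in> el (app f M))" for M
    have X: "X M \<longleftrightarrow> XD M" if M: "M \<in> el (Yc \<alpha>)" for M
    proof -
      have MY: "M \<in> el (Yc w1)" using M Yw by blast
      have "p \<in> el (Fn (dif L (K0 l (Yc \<alpha>))))" if p: "p \<in> el (app f M)" for p
      proof -
        have pF: "p \<in> el (Fn L)" using f(1)[OF MY] p by blast
        have "x \<notin> el (K0 l (Yc \<alpha>))" if z: "pr x k \<in> el p" for x k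
        proof
          assume "x \<in> el (K0 l (Yc \<alpha>))"
          then have "Yc \<alpha> = lab (pr x k)" unfolding el_K0 lab_def by auto
          then have "\<alpha> \<in> el (Lb M)" unfolding Lb using a p z by blast
          then show False using c[OF M] unfolding S by auto
        qed
        then show ?thesis using pF unfolding el_Fn by fastforce
      qed
      then show ?thesis unfolding f(2)[OF singletonI MY] X_def
        using pull_id[OF G, of "dif L (K0 l (Yc \<alpha>))"] by auto
    qed
    interpret J: forc E "dif L (K0 l (Yc \<alpha>))" "{GJ l (Yc \<alpha>)}" by (rule forc_J)
    have FX: "J.Frc (\<lambda>H s. X (s 0))"
    proof (rule J.Frc_cong)
      show "J.Frc (\<lambda>H s. \<exists>p\<in>H. p \<in> el (app f (s 0)))" by (intro J.frcI J.Frc_df dfI)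
    qed (simp add: X_def)
    have "\<exists>M\<in>el (Yc \<alpha>). X M \<and> finite (rl (Gl l) (og (pr (num 10) (pr (Yc \<alpha>) N))) - rl (Gl l) M)"
    proof (rule q_generic[OF l a N FX])
      fix N assume N: "N \<in> el (Yc \<alpha>)" "infinite (rl (Gl l) N)"
      then obtain M where M: "M \<in> el (Yc w1)" "lst N M" using lst_ex Yw by blast
      have "app ix M \<in> el (S N)" using W(3)[OF _ M] N(1) Yw M(1) unfolding S W' by blast
      then have "app ix M \<in> el \<alpha>" using c[OF N(1)] by blast
      then have "M \<in> el (Yc \<alpha>)" using ix[OF M(1)] Yc_mono[of \<alpha> "app ix M"] a by blast
      then show "\<exists>M\<in>el (Yc \<alpha>). X M \<and> infinite (rl (Gl l) M) \<and> finite (rl (Gl l) M - rl (Gl l) N)"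
        using M(2) X unfolding lst_def good_def XD_def by blast
    qed
    then show "\<exists>M\<in>el (Yc \<alpha>). infinite (rl (Gl l) M) \<and> val (nu l M) \<in> F.el D \<and> finite (rl (Gl l) (qn \<alpha> N) - rl (Gl l) M)"
      unfolding qn_def using X unfolding XD_def t by blast
  qed
qed

section \<open>The poset of a family and its stages in the extension\<close>

lemma F_inter: "\<exists>b. F.el b = F.el a \<inter> F.el c"
proof -
  obtain s t where st: "a = val s" "c = val t" by (metis valE)
  have 1: "FG (\<lambda>u. val (u 0) \<in> F.el (val s) \<and> val (u 0) \<in> F.el (val t))" by (intro fgI dfI)
  have 2: "tmu (\<lambda>u. u 0)" by (intro dfI)
  obtain b where "F.el (val b) = {val z | z. z \<in> el (bun (bun s)) \<and> val z \<in> F.el (val s) \<and> val z \<in> F.el (val t)}"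
    using Fcomp[OF 1 2] by blast
  moreover have "\<exists>z. x = val z \<and> z \<in> el (bun (bun s))" if "x \<in> F.el (val s)" for x
    using that act_dom unfolding elv by blast
  ultimately have "F.el (val b) = F.el (val s) \<inter> F.el (val t)"
    unfolding set_eq_iff Int_iff mem_Collect_eq by metis
  then show ?thesis unfolding st by (rule exI)
qed

lemma rel_mod:
  assumes "is_mod_Fin F Z P R"
  shows "(A, B) \<in> rel_of F R \<longleftrightarrow> A \<in> F.el P \<and> B \<in> F.el P \<and> finite (real_of F A - real_of F B)"
proof -
  obtain a b where ab: "A = val a" "B = val b" by (metis valE)
  have R: "F.el R = {z. \<exists>A\<in>F.el P. \<exists>B\<in>F.el P. finite (real_of F A - real_of F B) \<and> is_pair F A B z}"
    using assms unfolding is_mod_Fin_def by blast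
  show ?thesis
  proof
    assume "(A, B) \<in> rel_of F R"
    then obtain z where "z \<in> F.el R" "is_pair F A B z" unfolding rel_of_def by blast
    then obtain A' B' where *: "A' \<in> F.el P" "B' \<in> F.el P" "finite (real_of F A' - real_of F B')"
      "is_pair F A B z" "is_pair F A' B' z" unfolding R by blast
    obtain a' b' where "A' = val a'" "B' = val b'" by (metis valE)
    then have "A' = A" "B' = B" using *(4,5) fpr_eq unfolding ab by (auto simp: pair_F)
    then show "A \<in> F.el P \<and> B \<in> F.el P \<and> finite (real_of F A - real_of F B)" using * by blast
  next
    assume a: "A \<in> F.el P \<and> B \<in> F.el P \<and> finite (real_of F A - real_of F B)"
    have "is_pair F A B (val (fpr a b))" unfolding ab by (simp add: pair_F)
    moreover from this have "val (fpr a b) \<in> F.el R" unfolding R using a by blast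
    ultimately show "(A, B) \<in> rel_of F R" unfolding rel_of_def by blast
  qed
qed

lemma ex_An: "\<exists>h. tmu (\<lambda>s. h (s 0)) \<and> (\<forall>a. F.el (val (h a)) =
  {val (nu (pfst a) N) | N. N \<in> el (psnd a) \<and> N \<in> el (Yc w1) \<and> infinite (rl (Gl (pfst a)) N)})"
proof -
  have 1: "FG (\<lambda>s. s 0 \<in> el (Yc w1) \<and> infinite (rl (Gl (pfst (s (Suc 0)))) (s 0)))"
    by (rule FG_conj, rule Frc_df, intro dfI, intro fgI dfI)
  have 2: "tmu (\<lambda>s. nu (pfst (s (Suc 0))) (s 0))" "tmu (\<lambda>s. psnd (s 0))" by (intro dfI)+
  obtain h where "tmu (\<lambda>s. h (s 0))"
    "\<And>a. F.el (val (h a)) = {val (nu (pfst a) N) | N. N \<in> el (psnd a) \<and> N \<in> el (Yc w1) \<and> infinite (rl (Gl (pfst a)) N)}"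
    by (rule Fname[of "\<lambda>N a. N \<in> el (Yc w1) \<and> infinite (rl (Gl (pfst a)) N)" "\<lambda>N a. nu (pfst a) N" psnd, OF 1 2]) (rule that)
  then show ?thesis by blast
qed

text \<open>W is arbitrary because finite pieces of a stage are needed besides the stages
  themselves; cutting down to \<open>Yc w1\<close> keeps the values inside the family.\<close>

definition An :: "'a \<Rightarrow> 'a \<Rightarrow> 'a" where
  "An l W = (SOME h. tmu (\<lambda>s. h (s 0)) \<and> (\<forall>a. F.el (val (h a)) =
    {val (nu (pfst a) N) | N. N \<in> el (psnd a) \<and> N \<in> el (Yc w1) \<and> infinite (rl (Gl (pfst a)) N)})) (pr l W)"

lemma tm_An [dfI]: "tmu t \<Longrightarrow> tmu t' \<Longrightarrow> tmu (\<lambda>s. An (t s) (t' s))"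
  unfolding An_def by (rule tm_1[OF conjunct1[OF someI_ex[OF ex_An]]]) (intro dfI)

lemma el_An: "F.el (val (An l W)) = {val (nu l N) | N. N \<in> el W \<and> N \<in> el (Yc w1) \<and> infinite (rl (Gl l) N)}"
  using someI_ex[OF ex_An] unfolding An_def by simp

lemma ex_Zn: "\<exists>h. tmu (\<lambda>s. h (s 0)) \<and> (\<forall>l. F.el (val (h l)) = {val (nu l N) | N. N \<in> el (Yc w1)})"
proof -
  have 1: "FG (\<lambda>s. True)" by (intro Frc_df dfI)
  have 2: "tmu (\<lambda>s. nu (s (Suc 0)) (s 0))" "tmu (\<lambda>s. Yc w1)" by (intro dfI)+
  obtain h where "tmu (\<lambda>s. h (s 0))" "\<And>l. F.el (val (h l)) = {val (nu l N) | N. N \<in> el (Yc w1) \<and> True}"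
    by (rule Fname[of "\<lambda>N a. True" "\<lambda>N l. nu l N" "\<lambda>_. Yc w1", OF 1 2]) (rule that)
  then show ?thesis by auto
qed

definition Zn :: "'a \<Rightarrow> 'a" where
  "Zn = (SOME h. tmu (\<lambda>s. h (s 0)) \<and> (\<forall>l. F.el (val (h l)) = {val (nu l N) | N. N \<in> el (Yc w1)}))"

lemma tm_Zn [dfI]: "tmu t \<Longrightarrow> tmu (\<lambda>s. Zn (t s))"
  by (rule tm_1) (use someI_ex[OF ex_Zn] in \<open>simp_all add: Zn_def\<close>)

lemma el_Zn: "F.el (val (Zn l)) = {val (nu l N) | N. N \<in> el (Yc w1)}"
  using someI_ex[OF ex_Zn] unfolding Zn_def by blast

lemma mod_An: "is_mod_Fin F (val (Zn l)) P R \<Longrightarrow> P = val (An l (Yc w1))"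
proof -
  assume "is_mod_Fin F (val (Zn l)) P R"
  then have "F.el P = {A \<in> F.el (val (Zn l)). infinite (real_of F A)}" unfolding is_mod_Fin_def by blast
  then have "F.el P = F.el (val (An l (Yc w1)))" unfolding el_Zn el_An using real_nu by auto
  then show ?thesis using F.ext by blast
qed

lemma el_An_Yc:
  assumes "\<alpha> \<in> el w1 \<or> \<alpha> = w1"
  shows "F.el (val (An l (Yc \<alpha>))) = {val (nu l N) | N. N \<in> el (Yc \<alpha>) \<and> infinite (rl (Gl l) N)}"
  unfolding el_An using Yc_le[of w1 \<alpha>] assms by blast

lemma An_mono: "\<alpha> \<in> el w1 \<or> \<alpha> = w1 \<Longrightarrow> \<beta> = \<alpha> \<or> \<beta> \<in> el \<alpha> \<Longrightarrow> F.el (val (An l (Yc \<beta>))) \<subseteq> F.el (val (An l (Yc \<alpha>)))"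
  unfolding el_An using Yc_le by blast

text \<open>The Cohen reals mark the stages: that of \<alpha> enters immediately after stage
  \<alpha>. Hence \<alpha> can be recovered from the set of values of a stage, although different
  names may have equal values.\<close>

lemma cn_An:
  assumes l: "l \<in> el L" and ab: "\<alpha> \<in> el w1" "\<beta> \<in> el w1"
  shows "val (nu l (cn \<alpha>)) \<in> F.el (val (An l (Yc \<beta>))) \<longleftrightarrow> \<alpha> \<in> el \<beta>"
proof
  assume "\<alpha> \<in> el \<beta>"
  then show "val (nu l (cn \<alpha>)) \<in> F.el (val (An l (Yc \<beta>)))"
    using cn[OF l ab(1)] ab(2) unfolding el_An_Yc[OF disjI1[OF ab(2)]] by blast
next
  assume "val (nu l (cn \<alpha>)) \<in> F.el (val (An l (Yc \<beta>)))"
  then obtain N where N: "N \<in> el (Yc \<beta>)" "rl (Gl l) (cn \<alpha>) = rl (Gl l) N"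
    unfolding el_An_Yc[OF disjI1[OF ab(2)]] using nu_eq by blast
  show "\<alpha> \<in> el \<beta>"
  proof (rule ccontr)
    assume "\<alpha> \<notin> el \<beta>"
    then have "N \<in> el (Yc \<alpha>)" using w1_cases[OF ab] N(1) Yc_le[of \<alpha> \<beta>] ab by blast
    then show False using fresh[OF l ab(1) l] N(2) cn(1)[OF l ab(1)] by metis
  qed
qed

lemma An_sub:
  assumes l: "l \<in> el L" and ab: "\<alpha> \<in> el w1" "\<beta> \<in> el w1"
    and "F.el (val (An l (Yc \<beta>))) \<subseteq> F.el (val (An l (Yc \<alpha>)))"
  shows "\<beta> = \<alpha> \<or> \<beta> \<in> el \<alpha>"
proof (rule ccontr)
  assume "\<not> ?thesis"
  then have "\<alpha> \<in> el \<beta>" using w1_cases[OF ab] by blast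
  then have "val (nu l (cn \<alpha>)) \<in> F.el (val (An l (Yc \<alpha>)))" using cn_An[OF l ab] assms(4) by blast
  then show False using cn_An[OF l ab(1,1)] by simp
qed

lemma An_inj:
  assumes "l \<in> el L" "\<alpha> \<in> el w1" "\<beta> \<in> el w1" "val (An l (Yc \<beta>)) = val (An l (Yc \<alpha>))"
  shows "\<beta> = \<alpha>"
  using An_sub[OF assms(1-3)] An_sub[OF assms(1,3,2)] assms(4) E_asym by auto

(* The values of these names form a transitive set of size omega_1, and everything that has to be
   found in H(k) is a subset of it. *)
definition hn :: "'a \<Rightarrow> 'a \<Rightarrow> 'a" where
  "hn l z = (if pfst z = num 0 then (if pfst (psnd z) \<in> el om then ck (pfst (psnd z)) else ck emp)
    else if pfst z = num 1 then nu l (pfst (psnd z))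
    else if pfst z = num 2 then An l (pfst (psnd z))
    else if pfst z = num 3 then An l (mk (en (pfst (psnd z)) ` el (psnd (psnd z))))
    else if pfst z = num 4 then fup (An l (pfst (psnd z))) (An l (pfst (psnd z)))
    else if pfst z = num 5 then fup (An l (pfst (psnd z))) (nu l (psnd (psnd z)))
    else fpr (An l (pfst (psnd z))) (nu l (psnd (psnd z))))"

text \<open>The tags of \<open>hn\<close> cover numerals, reals, stages, their finite pieces, and
  ordered pairs together with the unordered pairs they consist of, which makes the set transitive.
  There are at most \<omega>_1 such names, by \<open>lepoll_w1\<close>.\<close>

lemma hull:
  obtains t where "transitive_in F t" "lepoll_in F t (val (ck w1))"
    "\<And>N. N \<in> el (Yc w1) \<Longrightarrow> val (nu l N) \<in> F.el t"
    "\<And>Y. Y \<in> el (Yc w1) \<Longrightarrow> val (An l Y) \<in> F.el t"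
    "\<And>Y n. Y \<in> el (Yc w1) \<Longrightarrow> n \<in> el om \<Longrightarrow> val (An l (mk (en Y ` el n))) \<in> F.el t"
    "\<And>Y N. Y \<in> el (Yc w1) \<Longrightarrow> N \<in> el (Yc w1) \<Longrightarrow> val (fpr (An l Y) (nu l N)) \<in> F.el t"
proof -
  define U where "U = un om (Yc w1)"
  define B where "B = tms om (tms U U)"
  have th: "tmu (\<lambda>s. hn l (s 0))" unfolding hn_def by (intro dfI)
  have "FG (\<lambda>s. True)" by (intro Frc_df dfI)
  from Fcomp[OF this th, of B] obtain t where t: "F.el (val t) = {val (hn l z) | z. z \<in> el B}" by auto
  have mem: "val (hn l (pr (num c) (pr u v))) \<in> F.el (val t)" if "u \<in> el U" "v \<in> el U" for c u v
    unfolding t B_def using that by auto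
  have d: "num 1 \<noteq> num 0" "num 2 \<noteq> num 0" "num 2 \<noteq> num 1" "num 3 \<noteq> num 0" "num 3 \<noteq> num 1" "num 3 \<noteq> num 2"
    "num 4 \<noteq> num 0" "num 4 \<noteq> num 1" "num 4 \<noteq> num 2" "num 4 \<noteq> num 3"
    "num 5 \<noteq> num 0" "num 5 \<noteq> num 1" "num 5 \<noteq> num 2" "num 5 \<noteq> num 3" "num 5 \<noteq> num 4"
    "num 6 \<noteq> num 0" "num 6 \<noteq> num 1" "num 6 \<noteq> num 2" "num 6 \<noteq> num 3" "num 6 \<noteq> num 4" "num 6 \<noteq> num 5"
    unfolding num_eq by simp_all
  have m0: "val (ck u) \<in> F.el (val t)" if "u \<in> el om" for u
    using mem[of u u 0] that unfolding hn_def U_def by (simp del: num.simps)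
  have m1: "val (nu l u) \<in> F.el (val t)" if "u \<in> el U" for u
    using mem[OF that that, of 1] unfolding hn_def pfst_pr psnd_pr by (simp only: d if_True if_False simp_thms)
  have m2: "val (An l u) \<in> F.el (val t)" if "u \<in> el U" for u
    using mem[OF that that, of 2] unfolding hn_def pfst_pr psnd_pr by (simp only: d if_True if_False simp_thms)
  have m3: "val (An l (mk (en u ` el v))) \<in> F.el (val t)" if "u \<in> el U" "v \<in> el U" for u v
    using mem[OF that, of 3] unfolding hn_def pfst_pr psnd_pr by (simp only: d if_True if_False simp_thms)
  have m4: "val (fup (An l u) (An l u)) \<in> F.el (val t)" if "u \<in> el U" for u
    using mem[OF that that, of 4] unfolding hn_def pfst_pr psnd_pr by (simp only: d if_True if_False simp_thms)
  have m5: "val (fup (An l u) (nu l v)) \<in> F.el (val t)" if "u \<in> el U" "v \<in> el U" for u v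
    using mem[OF that, of 5] unfolding hn_def pfst_pr psnd_pr by (simp only: d if_True if_False simp_thms)
  have m6: "val (fpr (An l u) (nu l v)) \<in> F.el (val t)" if "u \<in> el U" "v \<in> el U" for u v
    using mem[OF that, of 6] unfolding hn_def pfst_pr psnd_pr by (simp only: d if_True if_False simp_thms)
  have e0: "F.el (val (ck u)) \<subseteq> F.el (val t)" if u: "u \<in> el om" for u
  proof -
    obtain n where "u = num n" using u by (rule omE)
    then show ?thesis unfolding el_ck using m0 by (auto simp: el_num)
  qed
  have ee: "F.el (val (ck emp)) \<subseteq> F.el (val t)" by (simp add: el_ck)
  have e1: "F.el (val (nu l u)) \<subseteq> F.el (val t)" for u
    unfolding el_nu nF_def using m0 by auto
  have e2: "F.el (val (An l W)) \<subseteq> F.el (val t)" for W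
    unfolding el_An using m1 by (auto simp: U_def)
  have e4: "F.el (val (fup (An l u) (An l u))) \<subseteq> F.el (val t)" if "u \<in> el U" for u
    unfolding el_fup using m2[OF that] by simp
  have e5: "F.el (val (fup (An l u) (nu l v))) \<subseteq> F.el (val t)" if "u \<in> el U" "v \<in> el U" for u v
    unfolding el_fup using m2[OF that(1)] m1[OF that(2)] by simp
  have e6: "F.el (val (fpr (An l u) (nu l v))) \<subseteq> F.el (val t)" if "u \<in> el U" "v \<in> el U" for u v
    unfolding fpr_def el_fup using m4[OF that(1)] m5[OF that] by simp
  show thesis
  proof (rule that[of "val t"])
    show "transitive_in F (val t)" unfolding transitive_in_def
    proof
      fix x assume "x \<in> F.el (val t)"
      then obtain z where z: "z \<in> el B" "x = val (hn l z)" unfolding t by blast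
      then obtain c u v where cuv: "z = pr c (pr u v)" "u \<in> el U" "v \<in> el U" unfolding B_def by auto
      show "F.el x \<subseteq> F.el (val t)"
        unfolding z(2) cuv(1) hn_def pfst_pr psnd_pr
        by (auto split del: if_split split: if_splits dest: subsetD[OF e0] subsetD[OF ee] subsetD[OF e1] subsetD[OF e2]
            subsetD[OF e4[OF cuv(2)]] subsetD[OF e5[OF cuv(2,3)]] subsetD[OF e6[OF cuv(2,3)]])
    qed
    have "lepoll_in E B w1"
    proof (rule lepoll_w1)
      let ?h = "\<lambda>\<alpha>. tms om (tms (un om (Yc \<alpha>)) (un om (Yc \<alpha>)))"
      show "tmu (\<lambda>s. ?h (s 0))" by (intro dfI)
      show "el B \<subseteq> (\<Union>\<alpha>\<in>el w1. el (?h \<alpha>))"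
      proof
        fix z assume "z \<in> el B"
        then obtain c u v where cuv: "z = pr c (pr u v)" "c \<in> el om" "u \<in> el U" "v \<in> el U" unfolding B_def by auto
        have "\<exists>\<alpha>\<in>el w1. u \<in> el (un om (Yc \<alpha>))" if "u \<in> el U" for u
          using that Yc_w1E emp_w1 unfolding U_def by auto
        then obtain \<alpha> \<beta> where a: "\<alpha> \<in> el w1" "\<beta> \<in> el w1" "u \<in> el (un om (Yc \<alpha>))" "v \<in> el (un om (Yc \<beta>))"
          using cuv by meson
        obtain \<gamma> where g: "\<gamma> \<in> el w1" "\<alpha> = \<gamma> \<or> \<alpha> \<in> el \<gamma>" "\<beta> = \<gamma> \<or> \<beta> \<in> el \<gamma>" using w1_cases[OF a(1,2)] a(1,2) by blast
        then have "u \<in> el (un om (Yc \<gamma>))" "v \<in> el (un om (Yc \<gamma>))" using a(3,4) Yc_le[of \<gamma>] by auto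
        then show "z \<in> (\<Union>\<alpha>\<in>el w1. el (?h \<alpha>))" using g(1) cuv(1,2) by auto
      qed
      show "cbl (?h \<alpha>)" if "\<alpha> \<in> el w1" for \<alpha>
        using Yc_w1[OF that] by (intro cbl_tms cbl_un cbl_om) (auto simp: el_LC)
    qed
    then show "lepoll_in F (val t) (val (ck w1))" by (rule lepoll_w1_F[OF th t])
  qed (use m1 m2 m3 m6 in \<open>auto simp: U_def\<close>)
qed

lemma w1_An: assumes l: "l \<in> el L" shows "lepoll_in F (val (ck w1)) (val (An l (Yc w1)))"
proof (rule lepollI_F[of "\<lambda>_. True" ck "\<lambda>\<alpha>. nu l (cn \<alpha>)" _ w1])
  show "FG (\<lambda>s. True)" by (intro Frc_df dfI)
  show "tmu (\<lambda>s. ck (s 0))" "tmu (\<lambda>s. nu l (cn (s 0)))" by (intro dfI)+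
  show "F.el (val (ck w1)) = {val (ck x) |x. x \<in> el w1 \<and> True}" unfolding el_ck by auto
  show "val (nu l (cn x)) \<in> F.el (val (An l (Yc w1)))" if "x \<in> el w1" for x
    using cn(2,3)[OF l that] that unfolding el_An_Yc[OF disjI2[OF refl]] by blast
  show "val (ck x) = val (ck y) \<longleftrightarrow> val (nu l (cn x)) = val (nu l (cn y))" if "x \<in> el w1" "y \<in> el w1" for x y
    unfolding ck_inj nu_eq using cn_inj[OF l that] by blast
qed

lemma An_Pow:
  assumes "is_Pow F (val (An l (Yc w1))) pw" shows "lepoll_in F (val (An l (Yc w1))) pw"
proof (rule lepollI_F[of "\<lambda>N. infinite (rl (Gl l) N)" "nu l" "\<lambda>N. fup (nu l N) (nu l N)" _ "Yc w1"])
  show "FG (\<lambda>s. infinite (rl (Gl l) (s 0)))" by (intro fgI dfI)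
  show "tmu (\<lambda>s. nu l (s 0))" "tmu (\<lambda>s. fup (nu l (s 0)) (nu l (s 0)))" by (intro dfI)+
  show A: "F.el (val (An l (Yc w1))) = {val (nu l x) |x. x \<in> el (Yc w1) \<and> infinite (rl (Gl l) x)}"
    by (rule el_An_Yc) simp
  show "val (fup (nu l N) (nu l N)) \<in> F.el pw" if "N \<in> el (Yc w1)" "infinite (rl (Gl l) N)" for N
    using assms that unfolding is_Pow_def by (auto simp: el_fup A)
  show "val (nu l x) = val (nu l y) \<longleftrightarrow> val (fup (nu l x) (nu l x)) = val (fup (nu l y) (nu l y))" for x y
    using F.ext[of "val (fup (nu l x) (nu l x))" "val (fup (nu l y) (nu l y))"] by (auto simp: el_fup)
qed

text \<open>The pieces grow by at most one element at a time, and by none when a value is repeated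
  or finite. Only the set of pieces enters \<open>enumf\<close>, so such idle steps are
  harmless.\<close>

lemma enumf_An:
  assumes S: "submodel F X H" and a: "\<alpha> \<in> el w1"
    and f: "F.el f = {val (An l (mk (en (Yc \<alpha>) ` el n))) | n. n \<in> el om}"
  shows "submodel.enumf F H (val (An l (Yc \<alpha>))) f"
proof -
  interpret S: submodel F X H by (rule S)
  have ten: "tmu (\<lambda>s. en (Yc \<alpha>) (s 0))" by (intro dfI)
  define x where "x n = val (An l (mk (en (Yc \<alpha>) ` el (num n))))" for n
  have elx: "F.el (x n) = {val (nu l (en (Yc \<alpha>) (num i))) | i. i < n \<and> en (Yc \<alpha>) (num i) \<in> el (Yc w1) \<and>
      infinite (rl (Gl l) (en (Yc \<alpha>) (num i)))}" for n
    unfolding x_def el_An el_img[OF ten] by (auto simp: el_num)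
  have f: "F.el f = range x" unfolding f x_def by (auto simp: el_om)
  have x0: "F.el (x 0) = {}" unfolding elx by simp
  have mono: "m \<le> n \<Longrightarrow> F.el (x m) \<subseteq> F.el (x n)" for m n unfolding elx by auto
  let ?e = "\<lambda>n. val (nu l (en (Yc \<alpha>) (num n)))"
  have step: "F.el (x (Suc n)) \<subseteq> insert (?e n) (F.el (x n))" for n unfolding elx by (auto simp: less_Suc_eq)
  have next': "x (Suc n) = x n \<or> S.nxt (x n) (x (Suc n)) (?e n)" for n
  proof (cases "?e n \<in> F.el (x (Suc n)) - F.el (x n)")
    case True
    then show ?thesis using step[of n] mono[of n "Suc n"] unfolding S.nxt_iff by auto
  next
    case False
    moreover have "F.el (x n) \<subseteq> F.el (x (Suc n))" by (rule mono) simp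
    ultimately have "F.el (x (Suc n)) = F.el (x n)" using step[of n] by blast
    then show ?thesis by (intro disjI1) (simp only: F.ext)
  qed
  show ?thesis unfolding S.enumf_def
  proof (intro conjI ballI impI)
    show "\<exists>y\<in>F.el f. F.el y = {}" using x0 f by blast
    show "F.el u \<subseteq> F.el v \<or> F.el v \<subseteq> F.el u" if uv: "u \<in> F.el f" "v \<in> F.el f" for u v
    proof -
      obtain m n where "u = x m" "v = x n" using uv unfolding f by blast
      then show ?thesis using mono[of m n] mono[of n m] linear[of m n] by blast
    qed
  next
    fix a assume aA: "a \<in> F.el (val (An l (Yc \<alpha>)))"
    then obtain N where N: "N \<in> el (Yc \<alpha>)" "infinite (rl (Gl l) N)" "a = val (nu l N)"
      unfolding el_An_Yc[OF disjI1[OF a]] by blast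
    then have ne: "Yc \<alpha> \<noteq> emp" by (auto simp: emp_iff)
    obtain i where i: "en (Yc \<alpha>) (num i) = N" using en(2)[OF _ _ ne N(1), of 0] Yc_w1[OF a] by blast
    have "N \<in> el (Yc w1)" using N(1) Yc_le[of w1 \<alpha>] a by blast
    then have ex: "a \<in> F.el (x (Suc i))" unfolding elx using i N by blast
    define n where "n = (LEAST n. a \<in> F.el (x n))"
    have n: "a \<in> F.el (x n)" unfolding n_def by (rule LeastI[of _ "Suc i"]) (rule ex)
    have "n \<noteq> 0" using n x0 by (metis empty_iff)
    then obtain m where m: "n = Suc m" by (cases n) auto
    have nm: "a \<notin> F.el (x m)" using not_less_Least[of m "\<lambda>n. a \<in> F.el (x n)"] m unfolding n_def by simp
    have "S.nxt (x m) (x n) a" using next'[of m] n nm unfolding m S.nxt_iff by auto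
    then show "\<exists>u\<in>F.el f. \<exists>v\<in>F.el f. S.nxt u v a" unfolding f by blast
  next
    fix g assume g: "\<exists>y\<in>F.el g. F.el y = {}" "F.el g \<subseteq> F.el f"
      "\<forall>u\<in>F.el g. \<forall>v\<in>F.el f. (\<exists>a\<in>F.el v. S.nxt u v a) \<longrightarrow> v \<in> F.el g"
    have "x n \<in> F.el g" for n
    proof (induction n)
      case 0
      obtain y where "y \<in> F.el g" "F.el y = {}" using g(1) by blast
      then show ?case using x0 F.ext[of y "x 0"] by simp
    next
      case (Suc n)
      show ?case
      proof (cases "x (Suc n) = x n")
        case False
        then have nx: "S.nxt (x n) (x (Suc n)) (?e n)" using next'[of n] by blast
        then have "?e n \<in> F.el (x (Suc n))" unfolding S.nxt_def by blast
        then show ?thesis using g(3) Suc nx f by blast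
      qed (use Suc in simp)
    qed
    then show "F.el f \<subseteq> F.el g" unfolding f by blast
  qed
qed

text \<open>I is the chain of the stages A_\<alpha>, T attaches to A_\<alpha> the values of the
  names \<open>qn \<alpha> N\<close>, and for dense D the set C consists of the stages with \<alpha>
  closed under the function S from \<open>trap\<close>. All of them belong to H as subsets of t or
  of I.\<close>

lemma guided_An:
  assumes S: "submodel F X H" and l: "l \<in> el L" and P: "P = val (An l (Yc w1))"
    and R: "\<And>A B. (A, B) \<in> rel_of F R \<longleftrightarrow> A \<in> F.el P \<and> B \<in> F.el P \<and> finite (real_of F A - real_of F B)"
    and t: "\<And>x. F.el x \<subseteq> F.el t \<Longrightarrow> x \<in> H"
    and An_t: "\<And>Y. Y \<in> el (Yc w1) \<Longrightarrow> val (An l Y) \<in> F.el t"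
    and en_t: "\<And>Y n. Y \<in> el (Yc w1) \<Longrightarrow> n \<in> el om \<Longrightarrow> val (An l (mk (en Y ` el n))) \<in> F.el t"
    and pr_t: "\<And>Y N. Y \<in> el (Yc w1) \<Longrightarrow> N \<in> el (Yc w1) \<Longrightarrow> val (fpr (An l Y) (nu l N)) \<in> F.el t"
  shows "\<exists>I\<in>H. \<exists>T\<in>H. submodel.guided F H P R I T"
proof -
  interpret S: submodel F X H by (rule S)
  let ?r = "rl (Gl l)"
  define A where "A \<alpha> = val (An l (Yc \<alpha>))" for \<alpha>
  have elA: "F.el (A \<alpha>) = {val (nu l N) | N. N \<in> el (Yc \<alpha>) \<and> infinite (?r N)}" if "\<alpha> \<in> el w1" for \<alpha>
    unfolding A_def using that by (intro el_An_Yc) simp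
  have elP: "F.el P = {val (nu l N) | N. N \<in> el (Yc w1) \<and> infinite (?r N)}" unfolding P by (rule el_An_Yc) simp
  have Rnu: "(val (nu l M), val (nu l N)) \<in> rel_of F R \<longleftrightarrow> finite (?r M - ?r N)"
    if "M \<in> el (Yc w1)" "infinite (?r M)" "N \<in> el (Yc w1)" "infinite (?r N)" for M N
    unfolding R real_nu elP using that by blast
  have Yw: "el (Yc \<alpha>) \<subseteq> el (Yc w1)" "Yc \<alpha> \<in> el (Yc w1)" if "\<alpha> \<in> el w1" for \<alpha> using Yc_mono[of w1 \<alpha>] that by blast+
  have Amono: "F.el (A \<beta>) \<subseteq> F.el (A \<alpha>)" if "\<alpha> \<in> el w1" "\<beta> = \<alpha> \<or> \<beta> \<in> el \<alpha>" for \<alpha> \<beta>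
    unfolding A_def using that by (intro An_mono) simp_all
  have Asub: "\<beta> = \<alpha> \<or> \<beta> \<in> el \<alpha>" if "F.el (A \<beta>) \<subseteq> F.el (A \<alpha>)" "\<alpha> \<in> el w1" "\<beta> \<in> el w1" for \<alpha> \<beta>
    using An_sub[OF l that(2,3)] that(1) unfolding A_def .
  have AP: "F.el (A \<alpha>) \<subseteq> F.el P" if "\<alpha> \<in> el w1" for \<alpha> unfolding elA[OF that] elP using Yw(1)[OF that] by blast
  have FGT: "FG (\<lambda>s. True)" by (intro Frc_df dfI)
  have tA: "tmu (\<lambda>s. An l (Yc (s 0)))" by (intro dfI)
  obtain I where "F.el (val I) = {val (An l (Yc \<alpha>)) | \<alpha>. \<alpha> \<in> el w1 \<and> True}" using Fcomp[OF FGT tA, of w1] by blast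
  then have I: "F.el (val I) = A ` el w1" unfolding A_def by auto
  have FGz: "FG (\<lambda>s. psnd (s 0) \<in> el (Yc (pfst (s 0))) \<and> infinite (?r (psnd (s 0))))"
    by (rule FG_conj, rule Frc_df, intro dfI, intro fgI dfI)
  have tz: "tmu (\<lambda>s. fpr (An l (Yc (pfst (s 0)))) (nu l (qn (pfst (s 0)) (psnd (s 0)))))" by (intro dfI)
  obtain T where T: "F.el (val T) = {val (fpr (An l (Yc (pfst z))) (nu l (qn (pfst z) (psnd z)))) | z.
      z \<in> el (tms w1 (Yc w1)) \<and> psnd z \<in> el (Yc (pfst z)) \<and> infinite (?r (psnd z))}"
    using Fcomp[OF FGz tz, of "tms w1 (Yc w1)"] by blast
  have IH: "val I \<in> H" by (rule t) (use I An_t Yw(2) in \<open>auto simp: A_def\<close>)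
  have TH: "val T \<in> H"
    by (rule t) (use T pr_t Yw(2) qn(1)[OF l] in auto)
  have Tmem: "(A \<alpha>, q) \<in> rel_of F (val T) \<longleftrightarrow> (\<exists>N\<in>el (Yc \<alpha>). infinite (?r N) \<and> q = val (nu l (qn \<alpha> N)))"
    if a: "\<alpha> \<in> el w1" for \<alpha> q
  proof -
    obtain y where y: "q = val y" by (rule valE)
    show ?thesis
    proof
      assume "(A \<alpha>, q) \<in> rel_of F (val T)"
      then have "val (fpr (An l (Yc \<alpha>)) y) \<in> F.el (val T)" unfolding A_def y rel_F .
      then obtain \<beta> N where b: "\<beta> \<in> el w1" "N \<in> el (Yc \<beta>)" "infinite (?r N)"
        "val (fpr (An l (Yc \<alpha>)) y) = val (fpr (An l (Yc \<beta>)) (nu l (qn \<beta> N)))" unfolding T by auto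
      then have "val (An l (Yc \<alpha>)) = val (An l (Yc \<beta>))" "val y = val (nu l (qn \<beta> N))" unfolding fpr_eq by blast+
      then show "\<exists>N\<in>el (Yc \<alpha>). infinite (?r N) \<and> q = val (nu l (qn \<alpha> N))"
        using An_inj[OF l b(1) a] b(2,3) y by blast
    next
      assume "\<exists>N\<in>el (Yc \<alpha>). infinite (?r N) \<and> q = val (nu l (qn \<alpha> N))"
      then obtain N where N: "N \<in> el (Yc \<alpha>)" "infinite (?r N)" "q = val (nu l (qn \<alpha> N))" by blast
      have "val (fpr (An l (Yc \<alpha>)) (nu l (qn \<alpha> N))) \<in> F.el (val T)"
        unfolding T using N a Yw(1)[OF a] by (intro CollectI exI[of _ "pr \<alpha> N"]) auto
      then show "(A \<alpha>, q) \<in> rel_of F (val T)" unfolding A_def N(3) rel_F .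
    qed
  qed
  \<comment> \<open>Nothing new enters at limit stages; this is the continuity of the chain.\<close>
  have limit: "\<exists>\<beta>\<in>el \<alpha>. suc \<beta> \<in> el w1 \<and> a \<in> F.el (A (suc \<beta>))" if a: "\<alpha> \<in> el w1" "a \<in> F.el (A \<alpha>)" for \<alpha> a
  proof -
    obtain N where N: "N \<in> el (Yc \<alpha>)" "infinite (?r N)" "a = val (nu l N)" using a(2) unfolding elA[OF a(1)] by blast
    obtain \<beta> where b: "\<beta> \<in> el \<alpha>" "N \<in> el (Yc (suc \<beta>))" using Yc_suc N(1) a(1) by blast
    then have "suc \<beta> \<in> el w1" using w1_suc ord_trans[OF w1(1) a(1)] by blast
    then show ?thesis using b N elA by blast
  qed
  have "S.guided P R (val I) (val T)" unfolding S.guided_def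
  proof (intro conjI ballI impI)
    show "S.covers P (val I)" unfolding S.covers_def
    proof
      fix a assume "a \<in> F.el P"
      then obtain N where N: "N \<in> el (Yc w1)" "infinite (?r N)" "a = val (nu l N)" unfolding elP by blast
      then obtain \<alpha> where "\<alpha> \<in> el w1" "N \<in> el (Yc \<alpha>)" using Yc_w1E by blast
      then show "\<exists>A\<in>F.el (val I). a \<in> F.el A" unfolding I using elA N by blast
    qed
  next
    fix A' assume "A' \<in> F.el (val I)"
    then obtain \<alpha> where a: "\<alpha> \<in> el w1" "A' = A \<alpha>" unfolding I by blast
    show "F.el A' \<subseteq> F.el P" unfolding a(2) by (rule AP[OF a(1)])
    have tf: "tmu (\<lambda>s. An l (mk (en (Yc \<alpha>) ` el (s 0))))" by (intro dfI)
    obtain f where "F.el (val f) = {val (An l (mk (en (Yc \<alpha>) ` el n))) | n. n \<in> el om \<and> True}"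
      using Fcomp[OF FGT tf, of om] by blast
    then have f: "F.el (val f) = {val (An l (mk (en (Yc \<alpha>) ` el n))) | n. n \<in> el om}" by simp
    have "val f \<in> H" by (rule t) (use f en_t Yw(2)[OF a(1)] in auto)
    then show "\<exists>f\<in>H. S.enumf A' f" using enumf_An[OF S a(1) f] unfolding a(2) A_def by blast
  next
    fix s assume "s \<in> H" and s: "F.el s \<subseteq> F.el (val I) \<and> F.el s \<noteq> {}"
    show "S.covers P s \<or> (\<exists>B\<in>F.el (val I). (\<forall>a\<in>F.el B. \<exists>A\<in>F.el s. a \<in> F.el A) \<and> (\<forall>A\<in>F.el s. F.el A \<subseteq> F.el B))"
    proof (cases "S.covers P s")
      case False
      then obtain a where a: "a \<in> F.el P" "\<And>A. A \<in> F.el s \<Longrightarrow> a \<notin> F.el A" unfolding S.covers_def by blast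
      obtain N where N: "N \<in> el (Yc w1)" "infinite (?r N)" "a = val (nu l N)" using a(1) unfolding elP by blast
      obtain \<gamma> where g: "\<gamma> \<in> el w1" "N \<in> el (Yc \<gamma>)" using Yc_w1E N(1) by blast
      \<comment> \<open>A family of stages that misses some a is bounded by a stage containing a. By
        \<open>limit\<close> its least upper bound is the union of the family.\<close>
      define ub where "ub \<delta> \<longleftrightarrow> \<delta> \<in> el w1 \<and> (\<forall>\<alpha>\<in>el w1. A \<alpha> \<in> F.el s \<longrightarrow> F.el (A \<alpha>) \<subseteq> F.el (A \<delta>))" for \<delta>
      have "ub \<gamma>" unfolding ub_def
      proof (intro conjI g(1) ballI impI)
        fix \<alpha> assume \<alpha>: "\<alpha> \<in> el w1" "A \<alpha> \<in> F.el s"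
        have "a \<in> F.el (A \<gamma>)" unfolding elA[OF g(1)] using g(2) N by blast
        then have "\<not> (\<gamma> = \<alpha> \<or> \<gamma> \<in> el \<alpha>)" using Amono[OF \<alpha>(1)] a(2)[OF \<alpha>(2)] by blast
        then show "F.el (A \<alpha>) \<subseteq> F.el (A \<gamma>)" using w1_cases[OF \<alpha>(1) g(1)] Amono[OF g(1)] by blast
      qed
      then have "\<gamma> \<in> {\<delta>. ub \<delta>}" by simp
      from E_min[OF this] obtain \<delta> where \<delta>: "ub \<delta>" "\<And>\<beta>. \<beta> \<in> el \<delta> \<Longrightarrow> \<not> ub \<beta>" by blast
      have dw: "\<delta> \<in> el w1" using \<delta>(1) unfolding ub_def by blast
      have "\<exists>A\<in>F.el s. b \<in> F.el A" if b: "b \<in> F.el (A \<delta>)" for b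
      proof -
        obtain \<beta> where \<beta>: "\<beta> \<in> el \<delta>" "suc \<beta> \<in> el w1" "b \<in> F.el (A (suc \<beta>))" using limit[OF dw b] by blast
        have bw: "\<beta> \<in> el w1" using ord_trans[OF w1(1) dw \<beta>(1)] .
        then obtain \<alpha> where \<alpha>: "\<alpha> \<in> el w1" "A \<alpha> \<in> F.el s" "\<not> F.el (A \<alpha>) \<subseteq> F.el (A \<beta>)"
          using \<delta>(2)[OF \<beta>(1)] unfolding ub_def by blast
        then have "\<beta> \<in> el \<alpha>" using w1_cases[OF bw \<alpha>(1)] Amono[OF bw] by blast
        then have "F.el (A (suc \<beta>)) \<subseteq> F.el (A \<alpha>)" using suc_le[OF \<alpha>(1)] Amono[OF \<alpha>(1)] by blast
        then show ?thesis using \<alpha>(2) \<beta>(3) by blast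
      qed
      moreover have "\<forall>B\<in>F.el s. F.el B \<subseteq> F.el (A \<delta>)"
      proof
        fix B assume B: "B \<in> F.el s"
        then obtain \<alpha> where "\<alpha> \<in> el w1" "B = A \<alpha>" using s unfolding I by blast
        then show "F.el B \<subseteq> F.el (A \<delta>)" using \<delta>(1) B unfolding ub_def by blast
      qed
      ultimately show ?thesis using dw unfolding I by blast
    qed blast
  next
    fix A' p assume "A' \<in> F.el (val I)" and p: "p \<in> F.el A'"
    then obtain \<alpha> where a: "\<alpha> \<in> el w1" "A' = A \<alpha>" unfolding I by blast
    obtain N where N: "N \<in> el (Yc \<alpha>)" "infinite (?r N)" "p = val (nu l N)" using p unfolding a(2) elA[OF a(1)] by blast
    note q = qn[OF l a(1) N(1,2)]
    have "(val (nu l (qn \<alpha> N)), p) \<in> rel_of F R"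
      unfolding N(3) Rnu[OF q(1,2) subsetD[OF Yw(1)[OF a(1)] N(1)] N(2)] using q(3) by (simp add: Diff_eq_empty_iff[THEN iffD2])
    moreover have "(A', val (nu l (qn \<alpha> N))) \<in> rel_of F (val T)" unfolding a(2) Tmem[OF a(1)] using N by blast
    moreover have "val (nu l (qn \<alpha> N)) \<in> F.el P" unfolding elP using q(1,2) by blast
    ultimately show "\<exists>q\<in>F.el P. (q, p) \<in> rel_of F R \<and> (A', q) \<in> rel_of F (val T)" by blast
  next
    fix D assume D: "\<forall>p\<in>F.el P. \<exists>d\<in>F.el D. (d, p) \<in> rel_of F R"
    have dense: "\<exists>N'\<in>el (Yc w1). infinite (?r N') \<and> val (nu l N') \<in> F.el D \<and> finite (?r N' - ?r N)"
      if N: "N \<in> el (Yc w1)" "infinite (?r N)" for N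
    proof -
      have "val (nu l N) \<in> F.el P" unfolding elP using N by blast
      then obtain d where d: "d \<in> F.el D" "(d, val (nu l N)) \<in> rel_of F R" using D by blast
      then have "d \<in> F.el P" unfolding R by blast
      then obtain N' where N': "N' \<in> el (Yc w1)" "infinite (?r N')" "d = val (nu l N')" unfolding elP by blast
      then show ?thesis using d Rnu[OF N'(1,2) N] by blast
    qed
    obtain S where S: "tmu (\<lambda>s. S (s 0))" "\<And>N. N \<in> el (Yc w1) \<Longrightarrow> cbl (S N) \<and> el (S N) \<subseteq> el w1"
      "\<And>\<alpha> N. \<alpha> \<in> el w1 \<Longrightarrow> \<forall>M\<in>el (Yc \<alpha>). el (S M) \<subseteq> el \<alpha> \<Longrightarrow> N \<in> el (Yc \<alpha>) \<Longrightarrow> infinite (?r N) \<Longrightarrow>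
      \<exists>M\<in>el (Yc \<alpha>). infinite (?r M) \<and> val (nu l M) \<in> F.el D \<and> finite (?r (qn \<alpha> N) - ?r M)"
      by (rule trap[OF l dense]) (assumption, assumption, rule that)
    note [dfI] = tm_1[OF S(1)]
    define clo where "clo \<alpha> \<longleftrightarrow> (\<forall>M\<in>el (Yc \<alpha>). el (S M) \<subseteq> el \<alpha>)" for \<alpha>
    have FGc: "FG (\<lambda>s. clo (s 0))" unfolding clo_def by (intro Frc_df dfI)
    obtain C where "F.el (val C) = {val (An l (Yc \<alpha>)) | \<alpha>. \<alpha> \<in> el w1 \<and> clo \<alpha>}" using Fcomp[OF FGc tA, of w1] by blast
    then have C: "F.el (val C) = {A \<alpha> | \<alpha>. \<alpha> \<in> el w1 \<and> clo \<alpha>}" unfolding A_def .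
    have CI: "F.el (val C) \<subseteq> F.el (val I)" unfolding C I by blast
    have CH: "val C \<in> H" by (rule S.H_subset[OF IH CI])
    moreover have "S.covers P (val C)" unfolding S.covers_def
    proof
      fix a assume "a \<in> F.el P"
      then obtain N where N: "N \<in> el (Yc w1)" "infinite (?r N)" "a = val (nu l N)" unfolding elP by blast
      then obtain \<delta> where d: "\<delta> \<in> el w1" "N \<in> el (Yc \<delta>)" using Yc_w1E by blast
      obtain \<gamma> where g: "\<gamma> \<in> el w1" "\<delta> \<in> el \<gamma>" "\<And>M. M \<in> el (Yc \<gamma>) \<Longrightarrow> el (S M) \<subseteq> el \<gamma>"
        by (rule club[OF S(1,2) d(1)]) (assumption, rule that)
      have "a \<in> F.el (A \<gamma>)" unfolding elA[OF g(1)] using Yc_le[of \<gamma> \<delta>] g(1,2) d(2) N by blast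
      moreover have "A \<gamma> \<in> F.el (val C)" unfolding C clo_def using g(1,3) by blast
      ultimately show "\<exists>B\<in>F.el (val C). a \<in> F.el B" by blast
    qed
    moreover have "S.traps P R (val I) (val T) D (val C)" unfolding S.traps_def
    proof (intro ballI impI)
      fix A' q assume "A' \<in> F.el (val I)" and un: "\<forall>a\<in>F.el A'. \<exists>B\<in>F.el (val C). F.el B \<subseteq> F.el A' \<and> a \<in> F.el B"
        and q: "q \<in> F.el P" "(A', q) \<in> rel_of F (val T)"
      then obtain \<alpha> where a: "\<alpha> \<in> el w1" "A' = A \<alpha>" unfolding I by blast
      \<comment> \<open>The Cohen real of \<beta> lies in A_\<alpha>, hence in some A_\<gamma>
        inside A_\<alpha> with \<gamma> closed. Then \<beta> < \<gamma> \<le> \<alpha>, and closure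
        of \<gamma> settles M.\<close>
      have closed: "el (S M) \<subseteq> el \<alpha>" if M: "M \<in> el (Yc \<alpha>)" for M
      proof -
        obtain \<beta> where b: "\<beta> \<in> el \<alpha>" "M \<in> el (Yc (suc \<beta>))" using Yc_suc M a(1) by blast
        have bw: "\<beta> \<in> el w1" using ord_trans[OF w1(1) a(1) b(1)] .
        have "val (nu l (cn \<beta>)) \<in> F.el (A \<alpha>)" unfolding A_def cn_An[OF l bw a(1)] by (rule b(1))
        then obtain \<gamma> where g: "\<gamma> \<in> el w1" "clo \<gamma>" "F.el (A \<gamma>) \<subseteq> F.el (A \<alpha>)" "val (nu l (cn \<beta>)) \<in> F.el (A \<gamma>)"
          using un unfolding a(2) C by blast
        have "\<beta> \<in> el \<gamma>" using g(4) unfolding A_def cn_An[OF l bw g(1)] .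
        then have "el (Yc (suc \<beta>)) \<subseteq> el (Yc \<gamma>)" using suc_le[OF g(1)] Yc_le g(1) by blast
        then have "el (S M) \<subseteq> el \<gamma>" using g(2) b(2) unfolding clo_def by blast
        then show ?thesis using Asub[OF g(3) a(1) g(1)] ord_trans[OF w1_ord[OF a(1)]] by blast
      qed
      obtain N where N: "N \<in> el (Yc \<alpha>)" "infinite (?r N)" "q = val (nu l (qn \<alpha> N))"
        using q(2) unfolding a(2) Tmem[OF a(1)] by blast
      obtain M where M: "M \<in> el (Yc \<alpha>)" "infinite (?r M)" "val (nu l M) \<in> F.el D" "finite (?r (qn \<alpha> N) - ?r M)"
        using S(3)[OF a(1) _ N(1,2)] closed by blast
      have "(q, val (nu l M)) \<in> rel_of F R"
        unfolding N(3) Rnu[OF qn(1,2)[OF l a(1) N(1,2)] subsetD[OF Yw(1)[OF a(1)] M(1)] M(2)] by (rule M(4))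
      moreover have "val (nu l M) \<in> F.el A'" unfolding a(2) elA[OF a(1)] using M(1,2) by blast
      ultimately show "\<exists>d\<in>F.el D. d \<in> F.el A' \<and> (q, d) \<in> rel_of F R" using M(3) by blast
    qed
    ultimately show "\<exists>C\<in>H. F.el C \<subseteq> F.el (val I) \<and> S.covers P C \<and> S.traps P R (val I) (val T) D C" using CI by blast
  qed
  then show ?thesis using IH TH by blast
qed

lemma proper:
  assumes l: "l \<in> el L" and m: "is_mod_Fin F (val (Zn l)) P R"
  shows "proper_poset F P R"
proof -
  have P: "P = val (An l (Yc w1))" by (rule mod_An[OF m])
  note R = rel_mod[OF m]
  have main: "\<exists>q\<in>F.el P. (q, p) \<in> rel_of F R \<and>
      (\<forall>D\<in>F.el X. dense_in (F.el P) (rel_of F R) (F.el D) \<longrightarrow> (\<exists>d\<in>F.el D. d \<in> F.el X \<and> (q, d) \<in> rel_of F R))"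
    if pw: "is_Pow F P pw" "lesspoll_in F pw k" and X: "countable_in F X" "elementary_in F (F.el X) (H_of F k)"
      "P \<in> F.el X" "R \<in> F.el X" and p: "p \<in> F.el P" "p \<in> F.el X" for k pw X p
  proof -
    obtain t where t: "transitive_in F t" "lepoll_in F t (val (ck w1))"
      "\<And>Y. Y \<in> el (Yc w1) \<Longrightarrow> val (An l Y) \<in> F.el t"
      "\<And>Y n. Y \<in> el (Yc w1) \<Longrightarrow> n \<in> el om \<Longrightarrow> val (An l (mk (en Y ` el n))) \<in> F.el t"
      "\<And>Y N. Y \<in> el (Yc w1) \<Longrightarrow> N \<in> el (Yc w1) \<Longrightarrow> val (fpr (An l Y) (nu l N)) \<in> F.el t"
      by (rule hull[of l]) (rule that)
    have w1P: "lepoll_in F (val (ck w1)) P" unfolding P by (rule w1_An[OF l])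
    \<comment> \<open>The hull has size at most \<omega>_1, which is at most the size of P and so of
      its power set. As that is below k, all subsets of the hull are in H(k).\<close>
    have tpw: "lepoll_in F t pw" using An_Pow[of l pw] pw(1) w1P t(2) lepoll_trans_F unfolding P by blast
    have "lesspoll_in F t k"
      using pw(2) tpw lepoll_trans_F unfolding lesspoll_in_def by blast
    then have tH: "x \<in> H_of F k" if "F.el x \<subseteq> F.el t" for x using that t(1) unfolding H_of_def by blast
    interpret S: submodel F X "H_of F k"
    proof
      show "F.el x \<subseteq> H_of F k" if "x \<in> H_of F k" for x
        using that unfolding H_of_def transitive_in_def by blast
      show "y \<in> H_of F k" if "x \<in> H_of F k" "F.el y \<subseteq> F.el x" for x y
        using that unfolding H_of_def by blast
      show "elementary_in F (F.el X) (H_of F k)" by (rule X(2))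
      show "\<exists>b. F.el b = F.el a \<inter> F.el X" for a by (rule F_inter)
      show "F.el X \<noteq> {}" using X(3) by blast
    qed
    \<comment> \<open>P is uncountable and X countable. This excludes the case in which the stages
      in X cover P.\<close>
    have "\<not> F.el P \<subseteq> F.el X"
    proof
      assume sub: "F.el P \<subseteq> F.el X"
      have "lepoll_in F P X"
      proof (rule lepollI_F[of "\<lambda>N. infinite (rl (Gl l) N)" "nu l" "nu l" _ "Yc w1"])
        show "FG (\<lambda>s. infinite (rl (Gl l) (s 0)))" by (intro fgI dfI)
        show "tmu (\<lambda>s. nu l (s 0))" "tmu (\<lambda>s. nu l (s 0))" by (intro dfI)+
        show A: "F.el P = {val (nu l x) |x. x \<in> el (Yc w1) \<and> infinite (rl (Gl l) x)}"
          unfolding P by (rule el_An_Yc) simp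
        show "val (nu l x) \<in> F.el X" if "x \<in> el (Yc w1)" "infinite (rl (Gl l) x)" for x using that sub unfolding A by blast
      qed simp
      then have "countable_in F (val (ck w1))" using X(1) w1P lepoll_trans_F unfolding countable_F by blast
      then show False using omega1_F[of "val (ck w1)"] unfolding is_omega1_def by blast
    qed
    moreover obtain I T where "I \<in> H_of F k" "T \<in> H_of F k" "S.guided P R I T"
      using guided_An[OF S.submodel_axioms l P R tH t(3-5)] by blast
    ultimately show ?thesis using S.guided_generic[OF X(3,4) _ _ _ _ p] by blast
  qed
  show ?thesis unfolding proper_poset_def
  proof (intro allI impI ballI)
    fix k X p
    assume a: "uncountable_regular F k \<and> (\<exists>pw. is_Pow F P pw \<and> lesspoll_in F pw k) \<and>
        countable_in F X \<and> elementary_in F (elts F X) (H_of F k) \<and> F P X \<and> F R X"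
      and p: "p \<in> elts F P \<inter> elts F X"
    obtain pw where pw: "is_Pow F P pw" "lesspoll_in F pw k" using a by blast
    have X: "countable_in F X" "elementary_in F (F.el X) (H_of F k)" "P \<in> F.el X" "R \<in> F.el X"
      using a unfolding elts_def by blast+
    have "\<exists>q\<in>F.el P. (q, p) \<in> rel_of F R \<and>
      (\<forall>D\<in>F.el X. dense_in (F.el P) (rel_of F R) (F.el D) \<longrightarrow> (\<exists>d\<in>F.el D. d \<in> F.el X \<and> (q, d) \<in> rel_of F R))"
      by (rule main[OF pw X]) (use p in blast)+
    then obtain q where q: "q \<in> F.el P" "(q, p) \<in> rel_of F R"
      "\<And>D. D \<in> F.el X \<Longrightarrow> dense_in (F.el P) (rel_of F R) (F.el D) \<Longrightarrow> \<exists>d\<in>F.el D. d \<in> F.el X \<and> (q, d) \<in> rel_of F R"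
      by blast
    \<comment> \<open>q is below some d in D and X, so every z below q is itself a common extension
      of d and z.\<close>
    have "\<exists>d\<in>F.el D \<inter> F.el X. compatible (F.el P) (rel_of F R) d z"
      if D: "D \<in> F.el X" "dense_in (F.el P) (rel_of F R) (F.el D)" and z: "z \<in> F.el P" "(z, q) \<in> rel_of F R" for D z
    proof -
      obtain d where d: "d \<in> F.el D" "d \<in> F.el X" "(q, d) \<in> rel_of F R" using q(3)[OF D] by blast
      have "real_of F z - real_of F d \<subseteq> (real_of F z - real_of F q) \<union> (real_of F q - real_of F d)" by blast
      moreover have "finite (real_of F z - real_of F q)" "finite (real_of F q - real_of F d)" using z(2) d(3) unfolding R by blast+
      ultimately have "finite (real_of F z - real_of F d)" by (meson finite_UnI finite_subset)
      then have "(z, d) \<in> rel_of F R" "(z, z) \<in> rel_of F R" using z(1) d(3) unfolding R by simp_all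
      then show ?thesis using d z(1) unfolding compatible_def by blast
    qed
    then show "\<exists>q\<in>elts F P. (q, p) \<in> rel_of F R \<and> (\<forall>D\<in>elts F X. dense_in (elts F P) (rel_of F R) (elts F D) \<longrightarrow>
        (\<forall>z\<in>elts F P. (z, q) \<in> rel_of F R \<longrightarrow>
          (\<exists>d\<in>elts F D \<inter> elts F X. compatible (elts F P) (rel_of F R) d z)))" using q(1,2) by blast
  qed
qed

section \<open>Counting the families\<close>

lemma proper_Zn:
  assumes l: "l \<in> el L"
  shows "proper_family F (val (Zn l))" "size_omega1 F (val (Zn l))"
proof -
  have real: "real_of F ` F.el (val (Zn l)) = rl (Gl l) ` el (Yc w1)"
    unfolding el_Zn using real_nu by (auto simp: image_iff)
  have ne: "el (Yc w1) \<noteq> {}" using Yc_mono[of w1 emp] emp_w1 by blast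
  interpret ao: arith_ops "rl (Gl l) ` el (Yc w1)"
    by (rule arith_ops_rl[OF gen_Gl[OF l] Yc_clp Yc_L ne]) simp_all
  have "family_of_reals F (val (Zn l))"
    unfolding family_of_reals_def el_Zn is_numeral_F by (auto simp: el_nu)
  moreover have "arithmetically_closed F (val (Zn l))"
    unfolding arithmetically_closed_def real using ao.arith_closed by blast
  moreover have "\<exists>P R. is_mod_Fin F (val (Zn l)) P R"
  proof -
    let ?P = "\<lambda>z. infinite (rl (Gl l) (pfst z)) \<and> infinite (rl (Gl l) (psnd z)) \<and>
      finite (rl (Gl l) (pfst z) - rl (Gl l) (psnd z))"
    have 1: "FG (\<lambda>s. ?P (s 0))" by (intro fgI dfI)
    have 2: "tmu (\<lambda>s. fpr (nu l (pfst (s 0))) (nu l (psnd (s 0))))" by (intro dfI)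
    obtain R where R: "F.el (val R) = {val (fpr (nu l (pfst z)) (nu l (psnd z))) | z. z \<in> el (tms (Yc w1) (Yc w1)) \<and> ?P z}"
      using Fcomp[OF 1 2, of "tms (Yc w1) (Yc w1)"] by blast
    have A: "F.el (val (An l (Yc w1))) = {val (nu l N) | N. N \<in> el (Yc w1) \<and> infinite (rl (Gl l) N)}"
      by (rule el_An_Yc) simp
    have "F.el (val (An l (Yc w1))) = {A \<in> F.el (val (Zn l)). infinite (real_of F A)}"
      unfolding A el_Zn using real_nu by auto
    moreover have "F.el (val R) = {z. \<exists>A\<in>F.el (val (An l (Yc w1))). \<exists>B\<in>F.el (val (An l (Yc w1))).
        finite (real_of F A - real_of F B) \<and> is_pair F A B z}"
    proof (intro equalityI subsetI)
      fix z assume "z \<in> F.el (val R)"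
      then obtain M N where "M \<in> el (Yc w1)" "N \<in> el (Yc w1)" "?P (pr M N)" "z = val (fpr (nu l M) (nu l N))"
        unfolding R by auto
      then show "z \<in> {z. \<exists>A\<in>F.el (val (An l (Yc w1))). \<exists>B\<in>F.el (val (An l (Yc w1))).
        finite (real_of F A - real_of F B) \<and> is_pair F A B z}"
        unfolding A by (intro CollectI bexI[of _ "val (nu l M)"] bexI[of _ "val (nu l N)"]) (auto simp: real_nu pair_F)
    next
      fix z assume "z \<in> {z. \<exists>A\<in>F.el (val (An l (Yc w1))). \<exists>B\<in>F.el (val (An l (Yc w1))).
        finite (real_of F A - real_of F B) \<and> is_pair F A B z}"
      then obtain M N where "M \<in> el (Yc w1)" "N \<in> el (Yc w1)" "?P (pr M N)" "z = val (fpr (nu l M) (nu l N))"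
        unfolding A by (auto simp: real_nu pair_F)
      then show "z \<in> F.el (val R)" unfolding R by (intro CollectI exI[of _ "pr M N"]) auto
    qed
    ultimately show ?thesis unfolding is_mod_Fin_def by blast
  qed
  ultimately show "proper_family F (val (Zn l))" unfolding proper_family_def using proper[OF l] by blast
  have "eqpoll_in F (val (Zn l)) (val (ck w1))"
  proof (rule size_w1[OF _ el_Zn lepoll_Yc])
    show "tmu (\<lambda>s. nu l (s 0))" "tmu (\<lambda>s. cn (s 0))" by (intro dfI)+
    show "cn \<alpha> \<in> el (Yc w1)" if "\<alpha> \<in> el w1" for \<alpha> using cn(3)[OF l that] that by blast
    show "\<alpha> = \<beta>" if "\<alpha> \<in> el w1" "\<beta> \<in> el w1" "val (nu l (cn \<alpha>)) = val (nu l (cn \<beta>))" for \<alpha> \<beta>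
      using cn_inj[OF l that(1,2)] that(3) unfolding nu_eq .
  qed
  then show "size_omega1 F (val (Zn l))" unfolding size_omega1_def omega1_F by blast
qed

text \<open>The Cohen real with the first label identifies its block: by \<open>fresh\<close> no
  name evaluated at another block has the same value. This separates the families and injects
  \<open>L\<close> into the continuum.\<close>

lemma cn_emp_mem:
  assumes "l \<in> el L" "l' \<in> el L"
  shows "val (nu l (cn emp)) \<in> F.el (val (Zn l')) \<longleftrightarrow> l = l'"
proof
  assume "val (nu l (cn emp)) \<in> F.el (val (Zn l'))"
  then obtain N where "val (nu l (cn emp)) = val (nu l' N)" unfolding el_Zn by blast
  then have "rl (Gl l) (cn emp) = rl (Gl l') N" unfolding nu_eq .
  then show "l = l'" using fresh[OF assms(1) emp_w1 assms(2), of N] cn(1)[OF assms(1) emp_w1] by metis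
next
  assume "l = l'"
  moreover have "cn emp \<in> el (Yc w1)" using cn(3)[OF assms(1) emp_w1, of w1] emp_w1 by blast
  ultimately show "val (nu l (cn emp)) \<in> F.el (val (Zn l'))" unfolding el_Zn by blast
qed

lemma Zn_inj: "l \<in> el L \<Longrightarrow> l' \<in> el L \<Longrightarrow> val (Zn l) = val (Zn l') \<longleftrightarrow> l = l'"
  using cn_emp_mem by metis

text \<open>Cantor's diagonal argument with subsets of \<omega>_1 x {0}, all of which are subsets of
  \<open>B0\<close> and so elements of \<open>L\<close>.\<close>

lemma not_lepoll_L: "\<not> lepoll_in E L w1"
proof
  assume "lepoll_in E L w1"
  then obtain i where i: "inj_on (app i) (el L)" "app i ` el L \<subseteq> el w1" unfolding lepoll_iff by blast
  let ?D = "\<lambda>z. \<exists>x\<in>el L. z = pr (app i x) emp \<and> \<not> z \<in> el x"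
  define d where "d = mk {z \<in> el B0. ?D z}"
  have d: "el d = {z \<in> el B0. ?D z}" unfolding d_def by (rule el_sep) (intro dfI)
  have dL: "d \<in> el L" by (rule L_B0) (use d in blast)
  have "emp \<in> el om" using num_om[of 0] by simp
  then have z: "pr (app i d) emp \<in> el B0" unfolding B0_def using i(2) dL by auto
  have "x = d" if "x \<in> el L" "app i d = app i x" for x using i(1) that dL unfolding inj_on_def by metis
  then have "?D (pr (app i d) emp) \<longleftrightarrow> pr (app i d) emp \<notin> el d" using dL by auto
  then show False using d z by blast
qed

text \<open>A bijection between the continuum and \<omega>_1, restricted to one Cohen real per block
  and read backwards, is a partial function from \<omega>_1 to \<open>L\<close>.
  \<open>covering\<close> would make \<open>L\<close> a union of \<omega>_1 countable sets in the
  ground model, hence of size at most \<omega>_1 there.\<close>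

lemma not_CH: "\<not> CH F"
proof
  assume "CH F"
  then obtain c where c: "is_continuum F c" "size_omega1 F c" unfolding CH_def by blast
  then obtain f h where f: "is_fun F c f h" "bij_betw h (F.el c) (F.el (val (ck w1)))"
    unfolding size_omega1_def omega1_F eqpoll_in_def by blast
  obtain r where r: "f = val r" by (rule valE)
  have c: "val (nu l (cn emp)) \<in> F.el c" for l
    using c(1) unfolding is_continuum_def is_omega_F is_Pow_def by (auto simp: el_ck_om el_nu)
  note fn = is_fun_F[OF f(1)[unfolded r] c]
  have P: "FG (\<lambda>s. val (fpr (nu (s (Suc 0)) (cn emp)) (ck (s 0))) \<in> F.el (val r))" by (intro fgI dfI)
  have un: "l = l'" if "l \<in> el L" "l' \<in> el L" "val (fpr (nu l (cn emp)) (ck \<alpha>)) \<in> F.el (val r)"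
    "val (fpr (nu l' (cn emp)) (ck \<alpha>)) \<in> F.el (val r)" for l l' \<alpha>
  proof -
    have "h (val (nu l (cn emp))) = h (val (nu l' (cn emp)))" using that(3,4) fn by metis
    then have "val (nu l (cn emp)) = val (nu l' (cn emp))" using f(2) c unfolding bij_betw_def inj_on_def by blast
    then show ?thesis using cn_emp_mem[OF that(1,2)] cn_emp_mem[OF that(2,2)] by simp
  qed
  obtain W where W: "tmu (\<lambda>s. W (s 0))" "\<And>\<alpha>. \<alpha> \<in> el w1 \<Longrightarrow> cbl (W \<alpha>)"
    "\<And>\<alpha> l. \<alpha> \<in> el w1 \<Longrightarrow> l \<in> el L \<Longrightarrow> val (fpr (nu l (cn emp)) (ck \<alpha>)) \<in> F.el (val r) \<Longrightarrow> l \<in> el (W \<alpha>)"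
    by (rule covering[OF P, of w1 L]) (use un in blast, rule that)
  have "el L \<subseteq> (\<Union>\<alpha>\<in>el w1. el (W \<alpha>))"
  proof
    fix l assume l: "l \<in> el L"
    have "h (val (nu l (cn emp))) \<in> F.el (val (ck w1))" using f(2) c unfolding bij_betw_def by blast
    then obtain \<alpha> where "\<alpha> \<in> el w1" "h (val (nu l (cn emp))) = val (ck \<alpha>)" unfolding el_ck by blast
    then show "l \<in> (\<Union>\<alpha>\<in>el w1. el (W \<alpha>))" using W(3)[OF _ l] fn by blast
  qed
  then have "lepoll_in E L w1" using lepoll_w1[OF W(1) _ W(2)] by blast
  then show False using not_lepoll_L by blast
qed

lemma ex_nn: "\<exists>h. tmu (\<lambda>s. h (s 0)) \<and> (\<forall>N. F.el (val (h N)) = nF ` rl G N)"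
proof -
  have "FG (\<lambda>s. mm G (s 0) (s (Suc 0)))" unfolding mm_def by (intro fgI Frc_df dfI)
  moreover have "tmu (\<lambda>s. ck (s 0))" "tmu (\<lambda>s. om)" by (intro dfI)+
  ultimately obtain h where h: "tmu (\<lambda>s. h (s 0))"
    "\<And>N. F.el (val (h N)) = {val (ck n) | n. n \<in> el om \<and> mm G n N}"
    by (rule Fname[of "mm G" "\<lambda>n N. ck n" "\<lambda>_. om"]) (rule that)
  have "F.el (val (h N)) = nF ` rl G N" for N unfolding h(2) by (auto simp: el_om rl_def nF_def)
  then show ?thesis using h(1) by blast
qed

text \<open>The nice name is a countable set of pairs of numbers and conditions, which are countable
  elements of \<open>L\<close>; so it lies in \<open>LC\<close>. It is evaluated at G itself and not
  at a block.\<close>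

lemma real_name:
  assumes "F.el (val s) \<subseteq> range nF"
  shows "\<exists>N\<in>el LC. F.el (val s) = nF ` rl G N"
proof -
  have "FG (\<lambda>u. val (ck (u 0)) \<in> F.el (val (u (Suc 0))))" by (intro fgI dfI)
  then obtain g where g: "\<And>a. a \<in> el (up s s) \<Longrightarrow> cbl (g a) \<and> el (g a) \<subseteq> el (tms om (Fn L))"
    "\<And>H n a. H \<in> {G} \<Longrightarrow> a \<in> el (up s s) \<Longrightarrow> val (ck (num n)) \<in> F.el (val a) \<longleftrightarrow> (\<exists>p\<in>H. pr (num n) p \<in> el (g a))"
    by (rule Frc_ctbl_om[of "\<lambda>H n a. val (ck n) \<in> F.el (val a)" "up s s"]) (rule that)
  have gs: "cbl (g s)" "el (g s) \<subseteq> el (tms om (Fn L))" using g(1)[of s] by simp_all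
  have "el (g s) \<subseteq> el LC"
    using gs(2) L_Fn unfolding el_LC by (auto simp: el_om intro!: L_pr L_num)
  then have "g s \<in> el LC" using gs(1) by (rule LC_cbl)
  moreover have "nF n \<in> F.el (val s) \<longleftrightarrow> n \<in> rl G (g s)" for n
    using g(2)[of G s n] unfolding nF_def rl_def mm_def by simp
  then have "F.el (val s) = nF ` rl G (g s)" using assms by auto
  ultimately show ?thesis by blast
qed

text \<open>Reals are represented by their least nice names. Such a name is an element of
  \<open>L\<close> and thus itself the index of a family; different indices give different
  families.\<close>

lemma continuum_many:
  "\<exists>S c. is_continuum F c \<and> eqpoll_in F S c \<and> (\<forall>Z\<in>F.el S. proper_family F Z \<and> size_omega1 F Z)"
proof -
  obtain nn where nn: "tmu (\<lambda>s. nn (s 0))" "\<And>N. F.el (val (nn N)) = nF ` rl G N" using ex_nn by blast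
  have 1: "dfu (\<lambda>s. True)" by (intro dfI)
  have ex: "\<exists>y\<in>el w. True" if "el w \<subseteq> el LC" "el w \<noteq> {}" for w using that by blast
  obtain ch where ch: "\<And>w. el w \<subseteq> el LC \<Longrightarrow> el w \<noteq> {} \<Longrightarrow> app ch w \<in> el w \<and> True"
    by (rule choice_fn[OF 1 ex]) (assumption, assumption, rule that)
  then have ch: "\<And>w. el w \<subseteq> el LC \<Longrightarrow> el w \<noteq> {} \<Longrightarrow> app ch w \<in> el w" by simp
  obtain \<theta> H where H: "tmu (\<lambda>s. H (s 0))" "is_ordinal E \<theta>" "inj_on H (el \<theta>)" "H ` el \<theta> = el LC"
    by (rule numeration[of LC ch]; (rule ch | rule that); assumption)
  note [dfI] = tm_1[OF nn(1)] tm_1[OF H(1)]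
  have LCL: "el LC \<subseteq> el L" unfolding el_LC by blast
  \<comment> \<open>The least index among the nice names of the same real, in the well-order of
    \<open>LC\<close> given by H.\<close>
  define U where "U \<beta> \<longleftrightarrow> \<beta> \<in> el \<theta> \<and> (\<forall>\<gamma>\<in>el \<beta>. \<not> val (nn (H \<gamma>)) = val (nn (H \<beta>)))" for \<beta>
  have FGU: "FG (\<lambda>s. U (s 0))" unfolding U_def by (rule FG_conj, rule Frc_df, intro dfI, intro fgI dfI)
  have U_un: "\<beta> = \<gamma>" if "U \<beta>" "U \<gamma>" "val (nn (H \<beta>)) = val (nn (H \<gamma>))" for \<beta> \<gamma>
  proof -
    have "is_ordinal E \<beta>" "is_ordinal E \<gamma>" using that ord_mem[OF H(2)] unfolding U_def by blast+
    then show ?thesis using ord_cmp that unfolding U_def by metis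
  qed
  have tm: "tmu (\<lambda>s. Zn (H (s 0)))" "tmu (\<lambda>s. nn (H (s 0)))" by (intro dfI)+
  obtain S where S: "F.el (val S) = {val (Zn (H \<beta>)) | \<beta>. \<beta> \<in> el \<theta> \<and> U \<beta>}" using Fcomp[OF FGU tm(1)] by blast
  obtain c where c: "F.el (val c) = {val (nn (H \<beta>)) | \<beta>. \<beta> \<in> el \<theta> \<and> U \<beta>}" using Fcomp[OF FGU tm(2)] by blast
  have "F.el (val c) = {x. F.el x \<subseteq> F.el (val (ck om))}"
  proof (intro equalityI subsetI)
    fix x assume "x \<in> F.el (val c)"
    then show "x \<in> {x. F.el x \<subseteq> F.el (val (ck om))}" unfolding c el_ck_om using nn(2) by auto
  next
    fix x assume x: "x \<in> {x. F.el x \<subseteq> F.el (val (ck om))}"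
    obtain s where s: "x = val s" by (rule valE)
    then obtain N where N: "N \<in> el LC" "F.el x = nF ` rl G N" using real_name[of s] x unfolding el_ck_om by blast
    then obtain \<beta>0 where "\<beta>0 \<in> el \<theta>" "H \<beta>0 = N" using H(4) by (metis imageE)
    moreover have "val (nn N) = x" using nn(2) N(2) F.ext by metis
    ultimately have "\<beta>0 \<in> {\<beta> \<in> el \<theta>. val (nn (H \<beta>)) = x}" by blast
    from E_min[OF this] obtain \<beta> where b: "\<beta> \<in> el \<theta>" "val (nn (H \<beta>)) = x"
      "\<And>\<gamma>. \<gamma> \<in> el \<beta> \<Longrightarrow> \<gamma> \<notin> {\<beta> \<in> el \<theta>. val (nn (H \<beta>)) = x}" by blast
    have "U \<beta>" unfolding U_def using b ord_trans[OF H(2) b(1)] by blast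
    then show "x \<in> F.el (val c)" unfolding c using b by blast
  qed
  then have "is_continuum F (val c)" unfolding is_continuum_def is_Pow_def is_omega_F by blast
  moreover have "eqpoll_in F (val S) (val c)"
  proof (rule eqpollI_F[OF FGU tm S c])
    fix \<beta> \<gamma> assume b: "\<beta> \<in> el \<theta>" "U \<beta>" "\<gamma> \<in> el \<theta>" "U \<gamma>"
    have "H \<beta> \<in> el L" "H \<gamma> \<in> el L" using H(4) LCL b by blast+
    then have "val (Zn (H \<beta>)) = val (Zn (H \<gamma>)) \<longleftrightarrow> H \<beta> = H \<gamma>" by (rule Zn_inj)
    also have "\<dots> \<longleftrightarrow> \<beta> = \<gamma>" using H(3) b unfolding inj_on_def by blast
    also have "\<dots> \<longleftrightarrow> val (nn (H \<beta>)) = val (nn (H \<gamma>))" using U_un b by blast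
    finally show "val (Zn (H \<beta>)) = val (Zn (H \<gamma>)) \<longleftrightarrow> val (nn (H \<beta>)) = val (nn (H \<gamma>))" .
  qed
  moreover have "proper_family F Z \<and> size_omega1 F Z" if "Z \<in> F.el (val S)" for Z
    using that proper_Zn H(4) LCL unfolding S by blast
  ultimately show ?thesis by blast
qed

end

theorem theorem3p13:
  fixes E :: "'a \<Rightarrow> 'a \<Rightarrow> bool"
  assumes "wfp E" and "ZFC E"
  shows "\<exists>P R. is_poset E P R \<and> ccc E P R \<and>
           (\<forall>G F. generic_filter E P R G \<and> generic_extension E G F \<longrightarrow>
              \<not> CH F \<and>
              (\<exists>S c. is_continuum F c \<and> eqpoll_in F S c \<and>
                 (\<forall>Z\<in>elts F S. proper_family F Z \<and> size_omega1 F Z)))"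
proof -
  interpret zfc E
    using assms by unfold_locales (simp_all add: ZFC_def)
  define R where "R = mk {z \<in> el (tms (Fn L) (Fn L)). \<exists>p q. z = pr p q \<and> el q \<subseteq> el p}"
  have "el R = {z \<in> el (tms (Fn L) (Fn L)). \<exists>p q. z = pr p q \<and> el q \<subseteq> el p}"
    unfolding R_def by (rule el_sep) (intro dfI)
  then have R: "(p, q) \<in> rel_of E R \<longleftrightarrow> p \<in> el (Fn L) \<and> q \<in> el (Fn L) \<and> el q \<subseteq> el p" for p q
    unfolding rel_of_iff by auto
  have "is_poset E (Fn L) R" unfolding is_poset_def
  proof
    show "el (Fn L) \<noteq> {}" using emp_Fn by blast
    show "partial_order_on (el (Fn L)) (rel_of E R)"
      unfolding partial_order_on_def preorder_on_def
    proof (intro conjI)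
      show "refl_on (el (Fn L)) (rel_of E R)" unfolding refl_on_def using R by auto
      show "trans (rel_of E R)" unfolding trans_def R by blast
      show "antisym (rel_of E R)" unfolding antisym_def R using ext by blast
      show "rel_of E R \<subseteq> el (Fn L) \<times> el (Fn L)" using R by auto
    qed
  qed
  moreover have "ccc E (Fn L) R" unfolding ccc_def countable_iff
  proof (intro allI impI)
    fix A assume A: "el A \<subseteq> el (Fn L) \<and>
      (\<forall>p\<in>el A. \<forall>q\<in>el A. p \<noteq> q \<longrightarrow> \<not> compatible (el (Fn L)) (rel_of E R) p q)"
    show "cbl A"
    proof (rule ccc_Fn)
      show "el A \<subseteq> el (Fn L)" using A by blast
      fix p q assume pq: "p \<in> el A" "q \<in> el A" "p \<noteq> q"
      show "\<not> cons (el p \<union> el q)"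
      proof
        assume "cons (el p \<union> el q)"
        then have "un p q \<in> el (Fn L)" using A pq by (intro Fn_un) auto
        then have "compatible (el (Fn L)) (rel_of E R) p q"
          unfolding compatible_def R using A pq by (intro bexI[of _ "un p q"]) auto
        then show False using A pq by blast
      qed
    qed
  qed
  moreover have "\<not> CH F \<and> (\<exists>S c. is_continuum F c \<and> eqpoll_in F S c \<and>
      (\<forall>Z\<in>elts F S. proper_family F Z \<and> size_omega1 F Z))"
    if G: "generic_filter E (Fn L) R G" and F: "generic_extension E G F" for G F
  proof -
    note G' = G[unfolded generic_filter_def]
    have sub: "G \<subseteq> el (Fn L)" using G' by (elim conjE)
    have "gen L G" unfolding gen_def
    proof (intro conjI allI impI ballI)
      show "G \<subseteq> el (Fn L)" by (rule sub)
      show "G \<noteq> {}" by (rule G'[THEN conjunct2, THEN conjunct1])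
      fix p assume p: "p \<in> G"
      show "q \<in> G" if "q \<in> el (Fn L)" "el q \<subseteq> el p" for q
        using G'[THEN conjunct2, THEN conjunct2, THEN conjunct1] p that sub unfolding R by blast
      show "\<exists>r\<in>G. el p \<subseteq> el r \<and> el q \<subseteq> el r" if "q \<in> G" for q
        using G'[THEN conjunct2, THEN conjunct2, THEN conjunct2, THEN conjunct1] p that unfolding R by blast
    next
      fix D assume "el D \<subseteq> el (Fn L)" "\<forall>p\<in>el (Fn L). \<exists>d\<in>el D. el p \<subseteq> el d"
      then have "dense_in (el (Fn L)) (rel_of E R) (el D)" unfolding dense_in_def R by blast
      then show "\<exists>d\<in>el D. d \<in> G"
        using G'[THEN conjunct2, THEN conjunct2, THEN conjunct2, THEN conjunct2] by blast
    qed
    moreover obtain val where val: "surj val" "\<And>t. elts F (val t) = {val s | s. \<exists>p\<in>G. (s, p) \<in> rel_of E t}"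
      "extensional_rel F" using F unfolding generic_extension_def by blast
    ultimately interpret coh E G F val
      by unfold_locales (auto simp: rel_of_iff)
    show ?thesis using not_CH continuum_many by blast
  qed
  ultimately show ?thesis by blast
qed

end
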